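(* Let $p,q>1$, let $\Omega\subseteq\mathbb R^N$ be an open set, let $f,g:\Omega\times[0,\infty)\times[0,\infty)\to[0,\infty)$ be Carathéodory functions, and let $(u,v)$ be a weak solution of $$\begin{cases}-\mathrm{div}_L(|\nabla_L u|^{p-2}\nabla_L u)\ge f(x,u,v)&\text{on }\Omega,\\ -\mathrm{div}_L(|\nabla_L v|^{q-2}\nabla_L v)\ge g(x,u,v)&\text{on }\Omega,\\ u\ge0,\ v\ge0&\text{on }\Omega.\end{cases}$$ Write $u_\ell:=u+\ell$, $v_\ell:=v+\ell$, $p'=p/(p-1)$, $q'=q/(q-1)$. (1) For all test functions $\phi_1,\phi_2$ (nonnegative functions in $C^1_0(\Omega)$), every $\ell\ge0$ and every $\alpha,\beta<0$, $$\int_\Omega f(x,u,v)u_\ell^\alpha\phi_1+c_1\int_\Omega|\nabla_L u|^p u_\ell^{\alpha-1}\phi_1\le c_2\int_\Omega u_\ell^{\alpha-1+p}\frac{|\nabla_L\phi_1|^p}{\phi_1^{p-1}},$$ $$\int_\Omega g(x,u,v)v_\ell^\beta\phi_2+\tilde c_1\int_\Omega|\nabla_L v|^q v_\ell^{\beta-1}\phi_2\le\tilde c_2\int_\Omega v_\ell^{\beta-1+q}\frac{|\nabla_L\phi_2|^q}{\phi_2^{q-1}},$$ where $c_1:=|\alpha|-\eta^{p'}/p'$, $c_2:=\eta^{-p}/p$, $\eta>0$, $\tilde c_1:=|\beta|-\mu^{q'}/q'$, $\tilde c_2:=\mu^{-q}/q$, $\mu>0$. (2) If $\eta,\mu$ are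 so small that $c_1,\tilde c_1>0$, then for all $\alpha,\beta<0$ and $\ell\ge0$ (and all test functions $\phi_1,\phi_2$ as in (1)), $$\int_\Omega f(x,u,v)\phi_1\le c_3\Big(\int_\Omega u_\ell^{\alpha-1+p}\frac{|\nabla_L\phi_1|^p}{\phi_1^{p-1}}\Big)^{1/p'}\Big(\int_\Omega u_\ell^{(1-\alpha)(p-1)}\frac{|\nabla_L\phi_1|^p}{\phi_1^{p-1}}\Big)^{1/p},$$ $$\int_\Omega g(x,u,v)\phi_2\le\tilde c_3\Big(\int_\Omega v_\ell^{\beta-1+q}\frac{|\nabla_L\phi_2|^q}{\phi_2^{q-1}}\Big)^{1/q'}\Big(\int_\Omega v_\ell^{(1-\beta)(q-1)}\frac{|\nabla_L\phi_2|^q}{\phi_2^{q-1}}\Big)^{1/q},$$ where $c_3:=(c_2/c_1)^{1/p'}$ and $\tilde c_3:=(\tilde c_2/\tilde c_1)^{1/q'}$. (3) Let $R>0$ be such that $B_{2R}\Subset\Omega$. For all $\alpha,\beta<0$, if $u^{\alpha-1+p},u^{(1-\alpha)(p-1)}\in L^1_{loc}(A_R)$ and $v^{\beta-1+q},v^{(1-\beta)(q-1)}\in L^1_{loc}(A_R)$, then there exist $c_4,\tilde c_4>0$ for which $$\frac1{|B_R|}\int_{B_R}f(x,u,v)\le c_4R^{-p}\Big(\frac1{|A_R|}\int_{A_R}u^{\alpha-1+p}\Big)^{1/p'}\Big(\frac1{|A_R|}\int_{A_R}u^{(1-\alpha)(p-1)}\Big)^{1/p},$$ $$\frac1{|B_R|}\int_{B_R}g(x,u,v)\le\tilde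 c_4R^{-q}\Big(\frac1{|A_R|}\int_{A_R}v^{\beta-1+q}\Big)^{1/q'}\Big(\frac1{|A_R|}\int_{A_R}v^{(1-\beta)(q-1)}\Big)^{1/q}.$$ (4) If there exist $\sigma>p-1$, $\delta>q-1$ such that $u^\sigma,v^\delta\in L^1_{loc}(\Omega)$, then, with $R$ as in (3) and constants $c_4,\tilde c_4>0$, $$\frac1{|B_R|}\int_{B_R}f(x,u,v)\le c_4R^{-p}\Big(\frac1{|A_R|}\int_{A_R}u^\sigma\Big)^{(p-1)/\sigma},\qquad \frac1{|B_R|}\int_{B_R}g(x,u,v)\le\tilde c_4R^{-q}\Big(\frac1{|A_R|}\int_{A_R}v^\delta\Big)^{(q-1)/\delta}.$$ (5) In particular, if the weak Harnack inequality (WH) (see context) holds with exponent $\sigma$ for $u$ and with exponent $\delta$ for $v$ ($\sigma,\delta$ as in (4)), then the following inequalities hold for some appropriate constants $c_5,\tilde c_5>0$: $$\frac1{|B_R|}\int_{B_R}f(x,u,v)\le c_5R^{-p}\big(\operatorname{ess\,inf}_{B_R}u\big)^{p-1},\qquad \frac1{|B_R|}\int_{B_R}g(x,u,v)\le\tilde c_5R^{-q}\big(\operatorname{ess\,inf}_{B_R}v\big)^{q-1}.$$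
   Context: Setting: $\mathbb R^N$ carries the structure of a homogeneous Carnot group $(\mathbb R^N,\circ,\delta_R)$: $\mathbb R^N=\mathbb R^{n_1}\times\dots\times\mathbb R^{n_r}$, $\circ$ is a Lie group law, and for every $R>0$ the dilation $\delta_R(\xi^{(1)},\dots,\xi^{(r)})=(R\xi^{(1)},R^2\xi^{(2)},\dots,R^r\xi^{(r)})$ is a group automorphism. With $l=n_1$, for $i=1,\dots,l$ let $X_i$ be the left-invariant vector field that coincides with $\partial/\partial\xi^{(1)}_i$ at the origin; it is assumed that $X_1,\dots,X_l$ generate the whole Lie algebra of left-invariant vector fields. $\nabla_L=(X_1,\dots,X_l)^T$ is the horizontal gradient and $\mathrm{div}_L(h)=-\sum_{i=1}^lX_i^*h_i$, where $X_i^*$ is the formal adjoint of $X_i$. (The Euclidean case is $r=1$, $\nabla_L=\nabla$.) Integrals and $|E|$ refer to Lebesgue measure. A homogeneous norm $S:\mathbb R^N\to[0,\infty)$ is fixed: $S$ is continuous, $S(\xi^{-1})=S(\xi)$, $S(\xi)=0$ iff $\xi=0$, and $S(\delta_R\xi)=RS(\xi)$. For $R>0$, $B_R=\{x:S(x)<R\}$ and $A_R=B_{2R}\setminus\overline{B_R}$. $W^{1,p}_{L,loc}(\Omega)=\{u\in L^p_{loc}(\Omega):|\nabla_Lu|\in L^p_{loc}(\Omega)\}$. A Carathéodory function is measurable in $x$ and continuous in the remaining variables. $C^1_0(\Omega)$ denotes compactly supported $C^1$ functions on $\Omega$. Weak solution: a pair $(u,v)\in W^{1,p}_{L,loc}(\Omega)\times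 W^{1,q}_{L,loc}(\Omega)$ with $u,v\ge0$, $f(\cdot,u,v),g(\cdot,u,v)\in L^1_{loc}(\Omega)$, and $$\int_\Omega|\nabla_Lu|^{p-2}\nabla_Lu\cdot\nabla_L\phi_1\ge\int_\Omega f(x,u,v)\phi_1,\qquad\int_\Omega|\nabla_Lv|^{q-2}\nabla_Lv\cdot\nabla_L\phi_2\ge\int_\Omega g(x,u,v)\phi_2$$ for all nonnegative $\phi_1,\phi_2\in C^1_0(\Omega)$. (WH) with exponent $\sigma>0$ for a function $u\ge0$: there is a constant $c_H>0$ such that for all $R>0$ $$\left(\frac1{|B_R|}\int_{B_R}u^\sigma\right)^{1/\sigma}\le c_H\operatorname{ess\,inf}_{B_{R/2}}u.$$ *)

theory Defs
  imports "HOL-Analysis.Analysis" "HOL-Algebra.Group"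
begin

text \<open>Meant for open \<open>S\<close>. In finite dimension, \<open>C^(k+1)\<close> is the same as being differentiable with
  all directional derivatives of class \<open>C^k\<close>.\<close>

primrec Ck_on :: "nat \<Rightarrow> 'a::euclidean_space set \<Rightarrow> ('a \<Rightarrow> 'b::real_normed_vector) \<Rightarrow> bool" where
  "Ck_on 0 S f \<longleftrightarrow> continuous_on S f"
| "Ck_on (Suc k) S f \<longleftrightarrow> (\<forall>x\<in>S. f differentiable (at x)) \<and>
     (\<forall>d. Ck_on k S (\<lambda>x. frechet_derivative f (at x) d))"

definition smooth_on :: "'a::euclidean_space set \<Rightarrow> ('a \<Rightarrow> 'b::real_normed_vector) \<Rightarrow> bool" where
  "smooth_on S f \<longleftrightarrow> (\<forall>k. Ck_on k S f)"

text \<open>The dilations fix the identity of the group, so the identity is necessarily the origin.\<close>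

definition group_of :: "(real^'n \<Rightarrow> real^'n \<Rightarrow> real^'n) \<Rightarrow> (real^'n) monoid" where
  "group_of mul = \<lparr>carrier = UNIV, monoid.mult = mul, monoid.one = 0\<rparr>"

definition lie_group_law :: "(real^'n \<Rightarrow> real^'n \<Rightarrow> real^'n) \<Rightarrow> bool" where
  "lie_group_law mul \<longleftrightarrow> group (group_of mul) \<and>
     smooth_on UNIV (\<lambda>z. mul (fst z) (snd z)) \<and>
     smooth_on UNIV (\<lambda>x. m_inv (group_of mul) x)"

text \<open>\<open>layer i = j\<close> says that the \<open>i\<close>-th coordinate belongs to the factor \<open>\<real>^(n_j)\<close>.\<close>

definition dilation :: "('n \<Rightarrow> nat) \<Rightarrow> real \<Rightarrow> real^'n \<Rightarrow> real^'n" where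
  "dilation layer R x = (\<chi> i. R ^ layer i * x $ i)"

text \<open>A vector field is represented by its coefficient function.\<close>

definition left_invariant :: "(real^'n \<Rightarrow> real^'n \<Rightarrow> real^'n) \<Rightarrow> (real^'n \<Rightarrow> real^'n) \<Rightarrow> bool" where
  "left_invariant mul Y \<longleftrightarrow> smooth_on UNIV Y \<and>
     (\<forall>a x. frechet_derivative (mul a) (at x) (Y x) = Y (mul a x))"

definition lie_bracket :: "(real^'n \<Rightarrow> real^'n) \<Rightarrow> (real^'n \<Rightarrow> real^'n) \<Rightarrow> real^'n \<Rightarrow> real^'n" where
  "lie_bracket Y Z x = frechet_derivative Z (at x) (Y x) - frechet_derivative Y (at x) (Z x)"

inductive_set lie_generated :: "(real^'n \<Rightarrow> real^'n) set \<Rightarrow> (real^'n \<Rightarrow> real^'n) set"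
  for F where
  base: "Y \<in> F \<Longrightarrow> Y \<in> lie_generated F"
| zero: "(\<lambda>x. 0) \<in> lie_generated F"
| add: "Y \<in> lie_generated F \<Longrightarrow> Z \<in> lie_generated F \<Longrightarrow> (\<lambda>x. Y x + Z x) \<in> lie_generated F"
| scale: "Y \<in> lie_generated F \<Longrightarrow> (\<lambda>x. c *\<^sub>R Y x) \<in> lie_generated F"
| bracket: "Y \<in> lie_generated F \<Longrightarrow> Z \<in> lie_generated F \<Longrightarrow> lie_bracket Y Z \<in> lie_generated F"

text \<open>The family \<open>X\<close> is indexed by all coordinates; outside the first layer it is padded with zero
  fields. Horizontal vectors, elements of \<open>\<real>^l\<close> with \<open>l = n_1\<close>, are thereby embedded
  isometrically in \<open>\<real>^N\<close>.\<close>

definition horizontal_frame ::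
  "(real^'n \<Rightarrow> real^'n \<Rightarrow> real^'n) \<Rightarrow> ('n \<Rightarrow> nat) \<Rightarrow> ('n \<Rightarrow> real^'n \<Rightarrow> real^'n) \<Rightarrow> bool" where
  "horizontal_frame mul layer X \<longleftrightarrow>
     (\<forall>i. if layer i = 1 then left_invariant mul (X i) \<and> X i 0 = axis i 1
          else X i = (\<lambda>x. 0))"

definition homogeneous_carnot_group ::
  "nat \<Rightarrow> ('n \<Rightarrow> nat) \<Rightarrow> (real^'n \<Rightarrow> real^'n \<Rightarrow> real^'n) \<Rightarrow> ('n \<Rightarrow> real^'n \<Rightarrow> real^'n) \<Rightarrow> bool" where
  "homogeneous_carnot_group r layer mul X \<longleftrightarrow>
     range layer = {1..r} \<and>
     lie_group_law mul \<and>
     (\<forall>R>0. dilation layer R \<in> iso (group_of mul) (group_of mul)) \<and>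
     horizontal_frame mul layer X \<and>
     lie_generated (X ` {i. layer i = 1}) = {Y. left_invariant mul Y}"

definition homogeneous_norm ::
  "('n \<Rightarrow> nat) \<Rightarrow> (real^'n \<Rightarrow> real^'n \<Rightarrow> real^'n) \<Rightarrow> (real^'n \<Rightarrow> real) \<Rightarrow> bool" where
  "homogeneous_norm layer mul S \<longleftrightarrow>
     continuous_on UNIV S \<and>
     (\<forall>x. 0 \<le> S x) \<and>
     (\<forall>x. S (m_inv (group_of mul) x) = S x) \<and>
     (\<forall>x. S x = 0 \<longleftrightarrow> x = 0) \<and>
     (\<forall>R>0. \<forall>x. S (dilation layer R x) = R * S x)"

definition hball :: "(real^'n \<Rightarrow> real) \<Rightarrow> real \<Rightarrow> (real^'n) set" where
  "hball S R = {x. S x < R}"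

definition annulus :: "(real^'n \<Rightarrow> real) \<Rightarrow> real \<Rightarrow> (real^'n) set" where
  "annulus S R = hball S (2 * R) - closure (hball S R)"

definition compactly_inside :: "(real^'n) set \<Rightarrow> (real^'n) set \<Rightarrow> bool" where
  "compactly_inside A \<Omega> \<longleftrightarrow> compact (closure A) \<and> closure A \<subseteq> \<Omega>"

text \<open>Real powers on \<open>[0,\<infinity>]\<close> with \<open>0 powr s = \<infinity>\<close> and \<open>\<infinity> powr s = 0\<close> for \<open>s < 0\<close>, and exponent 0
  giving 1. The library's real \<open>powr\<close> has \<open>0 powr s = 0\<close> for every \<open>s\<close>, which is not the intended
  value of \<open>u^\<alpha>\<close> at zeros of \<open>u\<close> when \<open>\<alpha> \<le> 0\<close>.\<close>

definition epowr :: "ennreal \<Rightarrow> real \<Rightarrow> ennreal" (infixr \<open>epowr\<close> 80) where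
  "a epowr s =
     (if s = 0 then 1
      else if a = 0 then (if s > 0 then 0 else \<infinity>)
      else if a = \<infinity> then (if s > 0 then \<infinity> else 0)
      else ennreal (enn2real a powr s))"

definition avg :: "(real^'n) set \<Rightarrow> (real^'n \<Rightarrow> ennreal) \<Rightarrow> ennreal" where
  "avg E h = (\<integral>\<^sup>+x\<in>E. h x \<partial>lebesgue) / emeasure lebesgue E"

definition ess_inf :: "(real^'n) set \<Rightarrow> (real^'n \<Rightarrow> ennreal) \<Rightarrow> ennreal" where
  "ess_inf E h = Sup {c. AE x in lebesgue. x \<in> E \<longrightarrow> c \<le> h x}"

definition Lp_loc :: "real \<Rightarrow> (real^'n) set \<Rightarrow> (real^'n \<Rightarrow> 'b::real_normed_vector) \<Rightarrow> bool" where
  "Lp_loc p \<Omega> w \<longleftrightarrow> w \<in> borel_measurable (lebesgue_on \<Omega>) \<and>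
     (\<forall>K. compact K \<and> K \<subseteq> \<Omega> \<longrightarrow> (\<integral>\<^sup>+x\<in>K. ennreal (norm (w x) powr p) \<partial>lebesgue) < \<infinity>)"

definition nn_L1_loc :: "(real^'n) set \<Rightarrow> (real^'n \<Rightarrow> ennreal) \<Rightarrow> bool" where
  "nn_L1_loc \<Omega> h \<longleftrightarrow> h \<in> borel_measurable (lebesgue_on \<Omega>) \<and>
     (\<forall>K. compact K \<and> K \<subseteq> \<Omega> \<longrightarrow> (\<integral>\<^sup>+x\<in>K. h x \<partial>lebesgue) < \<infinity>)"

definition C1_0 :: "(real^'n) set \<Rightarrow> (real^'n \<Rightarrow> real) set" where
  "C1_0 \<Omega> = {\<phi>. Ck_on 1 \<Omega> \<phi> \<and> (\<exists>K. compact K \<and> K \<subseteq> \<Omega> \<and> (\<forall>x. x \<notin> K \<longrightarrow> \<phi> x = 0))}"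

text \<open>The gradient of a nonnegative test function vanishes at its zeros, so with \<open>x / 0 = 0\<close> the
  quotient \<open>|\<nabla>\<phi>|^p / \<phi>^(p-1)\<close> is \<open>0\<close> there.\<close>

definition nonneg_tests :: "(real^'n) set \<Rightarrow> (real^'n \<Rightarrow> real) set" where
  "nonneg_tests \<Omega> = {\<phi> \<in> C1_0 \<Omega>. \<forall>x. 0 \<le> \<phi> x}"

definition hgrad :: "('n \<Rightarrow> real^'n \<Rightarrow> real^'n) \<Rightarrow> (real^'n \<Rightarrow> real) \<Rightarrow> real^'n \<Rightarrow> real^'n" where
  "hgrad X \<phi> x = (\<chi> i. frechet_derivative \<phi> (at x) (X i x))"

text \<open>The formal adjoint of \<open>Y = \<Sum>j. Y_j \<partial>_j\<close> with respect to Lebesgue measure is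
  \<open>Y^* \<phi> = - \<Sum>j. \<partial>_j (Y_j \<phi>)\<close>.\<close>

definition formal_adjoint :: "(real^'n \<Rightarrow> real^'n) \<Rightarrow> (real^'n \<Rightarrow> real) \<Rightarrow> real^'n \<Rightarrow> real" where
  "formal_adjoint Y \<phi> x =
     - (\<Sum>j\<in>UNIV. frechet_derivative (\<lambda>y. Y y $ j * \<phi> y) (at x) (axis j 1))"

definition is_weak_hgrad ::
  "('n \<Rightarrow> real^'n \<Rightarrow> real^'n) \<Rightarrow> (real^'n) set \<Rightarrow> (real^'n \<Rightarrow> real) \<Rightarrow> (real^'n \<Rightarrow> real^'n) \<Rightarrow> bool" where
  "is_weak_hgrad X \<Omega> u w \<longleftrightarrow> Lp_loc 1 \<Omega> w \<and>
     (\<forall>i. \<forall>\<phi>\<in>C1_0 \<Omega>. (LINT x:\<Omega>|lebesgue. u x * formal_adjoint (X i) \<phi> x) =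
                      (LINT x:\<Omega>|lebesgue. w x $ i * \<phi> x))"

text \<open>Any two weak gradients on \<open>\<Omega>\<close> agree almost everywhere in \<open>\<Omega>\<close>.\<close>

definition weak_hgrad ::
  "('n \<Rightarrow> real^'n \<Rightarrow> real^'n) \<Rightarrow> (real^'n) set \<Rightarrow> (real^'n \<Rightarrow> real) \<Rightarrow> real^'n \<Rightarrow> real^'n" where
  "weak_hgrad X \<Omega> u = (SOME w. is_weak_hgrad X \<Omega> u w)"

definition W1p_loc ::
  "('n \<Rightarrow> real^'n \<Rightarrow> real^'n) \<Rightarrow> real \<Rightarrow> (real^'n) set \<Rightarrow> (real^'n \<Rightarrow> real) set" where
  "W1p_loc X p \<Omega> =
     {u. Lp_loc p \<Omega> u \<and> (\<exists>w. is_weak_hgrad X \<Omega> u w) \<and> Lp_loc p \<Omega> (weak_hgrad X \<Omega> u)}"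

definition caratheodory :: "(real^'n) set \<Rightarrow> (real^'n \<Rightarrow> real \<Rightarrow> real \<Rightarrow> real) \<Rightarrow> bool" where
  "caratheodory \<Omega> f \<longleftrightarrow>
     (\<forall>s\<ge>0. \<forall>t\<ge>0. (\<lambda>x. f x s t) \<in> borel_measurable (lebesgue_on \<Omega>)) \<and>
     (\<forall>x\<in>\<Omega>. continuous_on ({0..} \<times> {0..}) (\<lambda>(s, t). f x s t))"

text \<open>For \<open>p < 2\<close> the vector \<open>|\<xi>|^(p-2) \<xi>\<close> is \<open>0\<close> at \<open>\<xi> = 0\<close>, as usual.\<close>

definition weak_supersolution ::
  "('n \<Rightarrow> real^'n \<Rightarrow> real^'n) \<Rightarrow> (real^'n) set \<Rightarrow> real \<Rightarrow> (real^'n \<Rightarrow> real) \<Rightarrow> (real^'n \<Rightarrow> real) \<Rightarrow> bool" where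
  "weak_supersolution X \<Omega> p h u \<longleftrightarrow>
     (\<forall>\<phi>\<in>nonneg_tests \<Omega>.
        (LINT x:\<Omega>|lebesgue. norm (weak_hgrad X \<Omega> u x) powr (p - 2) * (weak_hgrad X \<Omega> u x \<bullet> hgrad X \<phi> x))
        \<ge> (LINT x:\<Omega>|lebesgue. h x * \<phi> x))"

definition weak_solution ::
  "('n \<Rightarrow> real^'n \<Rightarrow> real^'n) \<Rightarrow> (real^'n) set \<Rightarrow> real \<Rightarrow> real \<Rightarrow>
   (real^'n \<Rightarrow> real \<Rightarrow> real \<Rightarrow> real) \<Rightarrow> (real^'n \<Rightarrow> real \<Rightarrow> real \<Rightarrow> real) \<Rightarrow>
   (real^'n \<Rightarrow> real) \<Rightarrow> (real^'n \<Rightarrow> real) \<Rightarrow> bool" where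
  "weak_solution X \<Omega> p q f g u v \<longleftrightarrow>
     u \<in> W1p_loc X p \<Omega> \<and> v \<in> W1p_loc X q \<Omega> \<and>
     (AE x in lebesgue. x \<in> \<Omega> \<longrightarrow> 0 \<le> u x \<and> 0 \<le> v x) \<and>
     Lp_loc 1 \<Omega> (\<lambda>x. f x (u x) (v x)) \<and> Lp_loc 1 \<Omega> (\<lambda>x. g x (u x) (v x)) \<and>
     weak_supersolution X \<Omega> p (\<lambda>x. f x (u x) (v x)) u \<and>
     weak_supersolution X \<Omega> q (\<lambda>x. g x (u x) (v x)) v"

text \<open>For \<open>\<Omega> = \<real>^N\<close> the condition runs over all \<open>R > 0\<close>; for smaller \<open>\<Omega>\<close> only balls inside the
  domain of \<open>u\<close> make sense.\<close>

definition weak_harnack ::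
  "(real^'n \<Rightarrow> real) \<Rightarrow> (real^'n) set \<Rightarrow> real \<Rightarrow> (real^'n \<Rightarrow> real) \<Rightarrow> bool" where
  "weak_harnack S \<Omega> \<sigma> u \<longleftrightarrow>
     (\<exists>c>0. \<forall>R>0. compactly_inside (hball S R) \<Omega> \<longrightarrow>
        avg (hball S R) (\<lambda>x. ennreal (u x) epowr \<sigma>) epowr (1 / \<sigma>)
        \<le> ennreal c * ess_inf (hball S (R / 2)) (\<lambda>x. ennreal (u x)))"

end

theory Submission
  imports Defs
begin

text \<open>
  By homogeneity the fields \<open>X\<^sub>i\<close> are divergence free, so Lebesgue measure is bi-invariant, and the
  convolution of \<open>u\<close> with the kernel \<open>\<rho> (x \<circ> y\<^sup>-\<^sup>1)\<close> commutes with every \<open>X\<^sub>i\<close>. Hence \<open>u\<close> is a limit of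
  nonnegative \<open>C\<^sup>1\<close> functions \<open>u\<^sub>n\<close> whose horizontal gradients converge in \<open>L\<^sup>p\<close>. Testing the
  inequation with \<open>\<phi> (u\<^sub>n + l)\<^sup>\<alpha>\<close> and letting \<open>n \<rightarrow> \<infinity>\<close> bounds
  \<open>\<integral> f u\<^sub>l\<^sup>\<alpha> \<phi> + |\<alpha>| \<integral> |\<nabla>u|\<^sup>p u\<^sub>l\<^sup>\<alpha>\<^sup>-\<^sup>1 \<phi>\<close> by \<open>\<integral> |\<nabla>u|\<^sup>p\<^sup>-\<^sup>1 u\<^sub>l\<^sup>\<alpha> |\<nabla>\<phi>|\<close>, and Young's
  inequality gives (1) for \<open>l > 0\<close>. Testing with \<open>\<phi>\<close> itself and applying Hoelder's inequality to
  \<open>\<integral> |\<nabla>u|\<^sup>p\<^sup>-\<^sup>1 |\<nabla>\<phi>|\<close> gives (2). Cutoffs equal to 1 on \<open>B\<^sub>R\<close>, obtained by dilating a fixed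
  one, turn (2) into (3); (4) follows by comparing power means on \<open>A\<^sub>R\<close>, and (5) from (4) on \<open>B\<^sub>2\<^sub>R\<close>.
\<close>

section \<open>Real powers on \<open>[0,\<infinity>]\<close>\<close>

text \<open>The natural test function \<phi> (u + l)^\<alpha> is not C^1, and Euclidean
  mollification does not commute with the fields. The kernel \<rho> (x \<circ> y^-1) is unchanged
  when x and y are multiplied on the right by the same element, so a left-invariant derivative in x
  is minus the one in y and falls on a C^1 function. The kernel must have integral 1 in each
  variable: in y to be an average, in x to contract L^p. This is what bi-invariance provides. The
  shift l > 0 keeps negative powers bounded. For l = 0 the left side passes to the limit by monotone
  convergence, but a positive power of u + l decreases with l, and |\<nabla>\<phi>|^p / \<phi>^(p-1)
  need not be bounded. Replacing \<phi>^(1/p) by its part above a threshold makes the quotient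
  bounded and never increases it. In (1) the constant c1 may be negative and terms may be infinite,
  so inequalities stay free of subtraction in [0,\<infinity>] until the end. In (4) \<alpha> is
  taken so close to 0 that both exponents of (3) lie in (0, \<sigma>].\<close>

lemma epowr_ennreal: "0 < a \<Longrightarrow> ennreal a epowr s = ennreal (a powr s)"
  by (auto simp: epowr_def)

lemma epowr_ennreal_nonneg: "0 \<le> a \<Longrightarrow> 0 < s \<Longrightarrow> ennreal a epowr s = ennreal (a powr s)"
  by (auto simp: epowr_def)

lemma epowr_top: "0 < s \<Longrightarrow> top_class.top epowr s = top_class.top"
  by (auto simp: epowr_def)

lemma zero_epowr: "0 < s \<Longrightarrow> 0 epowr s = 0"
  by (auto simp: epowr_def)

lemma epowr_eq_0_iff: "0 < s \<Longrightarrow> a epowr s = 0 \<longleftrightarrow> a = 0"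
  by (cases a rule: ennreal_cases) (auto simp: epowr_def ennreal_eq_0_iff enn2real_eq_0_iff)

lemma epowr_mono: "0 \<le> s \<Longrightarrow> a \<le> b \<Longrightarrow> a epowr s \<le> b epowr s"
  by (cases a rule: ennreal_cases; cases b rule: ennreal_cases)
     (auto simp: epowr_def top_unique ennreal_le_iff powr_mono2)

lemma epowr_antimono: "s \<le> 0 \<Longrightarrow> a \<le> b \<Longrightarrow> b epowr s \<le> a epowr s"
  by (cases a rule: ennreal_cases; cases b rule: ennreal_cases)
     (auto simp: epowr_def top_unique ennreal_le_iff powr_mono2')

lemma epowr_add: "0 < s \<Longrightarrow> 0 < t \<Longrightarrow> a epowr (s + t) = a epowr s * a epowr t"
  by (cases a rule: ennreal_cases)
     (auto simp: epowr_def ennreal_mult_top ennreal_top_mult powr_add ennreal_mult'')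

lemma epowr_epowr: "0 < s \<Longrightarrow> 0 < t \<Longrightarrow> (a epowr s) epowr t = a epowr (s * t)"
  by (cases a rule: ennreal_cases)
     (auto simp: epowr_def powr_powr ennreal_eq_0_iff)

lemma epowr_mult: "0 < s \<Longrightarrow> (a * b) epowr s = a epowr s * b epowr s"
  by (cases a rule: ennreal_cases; cases b rule: ennreal_cases)
     (auto simp: epowr_def ennreal_mult_top ennreal_top_mult powr_mult ennreal_mult[symmetric] ennreal_eq_0_iff mult_le_0_iff)

lemma epowr_1 [simp]: "a epowr 1 = a"
  by (cases a rule: ennreal_cases) (auto simp: epowr_def)

lemma measurable_epowr [measurable]: "(\<lambda>x. x epowr s) \<in> borel_measurable borel"
  unfolding epowr_def by measurable

section \<open>Young's and Hoelder's inequalities for values in [0,\<infinity>]\<close>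

lemma epowr_young:
  assumes p: "1 < p" and q: "q = p / (p - 1)"
  shows "a * b \<le> ennreal (1 / p) * a epowr p + ennreal (1 / q) * b epowr q"
proof -
  have q1: "q > 1" "1 / p + 1 / q = 1" using p by (auto simp: q field_simps)
  have ne: "ennreal (1/p) \<noteq> 0" "ennreal (1/q) \<noteq> 0" using p q1 by auto
  show ?thesis
  proof (cases "a = \<infinity> \<or> b = \<infinity>")
    case True
    then show ?thesis using p q1 ne by (auto simp: epowr_top ennreal_mult_top ennreal_mult_eq_top_iff)
  next
    case False
    then obtain x y where xy: "a = ennreal x" "b = ennreal y" "x \<ge> 0" "y \<ge> 0"
      by (metis ennreal_cases infinity_ennreal_def)
    have "x * y \<le> x powr p / p + y powr q / q"
      using Youngs_inequality[OF p q1(1,2) xy(3,4)] .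
    then show ?thesis using xy p q1
      by (simp add: epowr_ennreal_nonneg ennreal_mult'[symmetric] ennreal_plus[symmetric] ennreal_le_iff del: ennreal_plus)
  qed
qed

text \<open>Homogeneity reduces finite positive norms to norm one, where the pointwise Young
  inequality integrates to 1/p + 1/q = 1. Degenerate norms are treated apart, because 0 times
  \<infinity> is 0 here.\<close>

lemma nn_integral_Hoelder:
  assumes p: "1 < p" and q: "q = p / (p - 1)"
    and [measurable]: "f \<in> borel_measurable M" "g \<in> borel_measurable M"
  shows "(\<integral>\<^sup>+x. f x * g x \<partial>M) \<le> (\<integral>\<^sup>+x. f x epowr p \<partial>M) epowr (1 / p) * (\<integral>\<^sup>+x. g x epowr q \<partial>M) epowr (1 / q)"
proof -
  have q1: "q > 1" "1 / p + 1 / q = 1" using p by (auto simp: q field_simps)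
  define A where "A = (\<integral>\<^sup>+x. f x epowr p \<partial>M)"
  define B where "B = (\<integral>\<^sup>+x. g x epowr q \<partial>M)"
  consider "A = 0 \<or> B = 0" | "A \<noteq> 0" "B \<noteq> 0" "A = \<infinity> \<or> B = \<infinity>" | "A \<noteq> 0" "B \<noteq> 0" "A \<noteq> \<infinity>" "B \<noteq> \<infinity>"
    by auto
  then have "(\<integral>\<^sup>+x. f x * g x \<partial>M) \<le> A epowr (1 / p) * B epowr (1 / q)"
  proof cases
    case 1
    \<comment> \<open>A vanishing norm makes one factor zero almost everywhere, and then the product
      is zero even where the other factor is infinite.\<close>
    have "AE x in M. f x * g x = 0"
      using 1
    proof (elim disjE)
      assume "A = 0"
      then have "AE x in M. f x epowr p = 0" unfolding A_def by (subst (asm) nn_integral_0_iff_AE) auto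
      then show ?thesis by eventually_elim (use p in \<open>simp add: epowr_eq_0_iff\<close>)
    next
      assume "B = 0"
      then have "AE x in M. g x epowr q = 0" unfolding B_def by (subst (asm) nn_integral_0_iff_AE) auto
      then show ?thesis by eventually_elim (use q1 in \<open>simp add: epowr_eq_0_iff\<close>)
    qed
    then have "(\<integral>\<^sup>+x. f x * g x \<partial>M) = 0" by (subst nn_integral_0_iff_AE) auto
    then show ?thesis by simp
  next
    case 2
    then show ?thesis using p q1
      by (auto simp: epowr_top ennreal_mult_top ennreal_top_mult epowr_eq_0_iff)
  next
    case 3
    then obtain a b where ab: "A = ennreal a" "B = ennreal b" "a > 0" "b > 0"
      by (metis ennreal_cases infinity_ennreal_def less_eq_real_def ennreal_0)
    \<comment> \<open>Normalising factors: s^p A = 1 and t^q B = 1, so 1 / (s t) is the product of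
      the two norms.\<close>
    define s where "s = a powr (- 1 / p)"
    define t where "t = b powr (- 1 / q)"
    have st: "s > 0" "t > 0" using ab by (auto simp: s_def t_def)
    have sp: "s powr p * a = 1" "t powr q * b = 1"
      unfolding s_def t_def powr_powr using ab p q1 by (auto simp: powr_minus_divide)
    have "ennreal (s * t) * (\<integral>\<^sup>+x. f x * g x \<partial>M) = (\<integral>\<^sup>+x. (ennreal s * f x) * (ennreal t * g x) \<partial>M)"
      using st by (subst nn_integral_cmult[symmetric]) (auto simp: ennreal_mult mult_ac)
    also have "\<dots> \<le> (\<integral>\<^sup>+x. ennreal (1 / p) * (ennreal s * f x) epowr p + ennreal (1 / q) * (ennreal t * g x) epowr q \<partial>M)"
      by (intro nn_integral_mono epowr_young p q)
    also have "\<dots> = (\<integral>\<^sup>+x. ennreal (1 / p) * ennreal (s powr p) * (f x epowr p) + ennreal (1 / q) * ennreal (t powr q) * (g x epowr q) \<partial>M)"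
      using p q1 st by (simp add: epowr_mult epowr_ennreal mult.assoc)
    also have "\<dots> = ennreal (1 / p) * ennreal (s powr p) * A + ennreal (1 / q) * ennreal (t powr q) * B"
      unfolding A_def B_def by (subst nn_integral_add) (auto simp: nn_integral_cmult)
    also have "\<dots> = ennreal (1 / p * (s powr p * a)) + ennreal (1 / q * (t powr q * b))"
      using ab p q1 by (simp add: ennreal_mult[symmetric] mult.assoc)
    also have "\<dots> = 1" unfolding sp using q1 p by (simp add: ennreal_plus[symmetric] del: ennreal_plus)
    finally have *: "ennreal (s * t) * (\<integral>\<^sup>+x. f x * g x \<partial>M) \<le> 1" .
    have "(\<integral>\<^sup>+x. f x * g x \<partial>M) = ennreal (1 / (s * t)) * (ennreal (s * t) * (\<integral>\<^sup>+x. f x * g x \<partial>M))"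
      using st by (simp add: mult.assoc[symmetric] ennreal_mult[symmetric])
    also have "\<dots> \<le> ennreal (1 / (s * t)) * 1" by (intro mult_left_mono *) auto
    also have "1 / (s * t) = a powr (1/p) * b powr (1/q)" using ab
      by (simp add: s_def t_def powr_minus field_simps)
    also have "ennreal (a powr (1/p) * b powr (1/q)) * 1 = A epowr (1 / p) * B epowr (1 / q)"
      using ab by (simp add: epowr_ennreal ennreal_mult)
    finally show ?thesis .
  qed
  then show ?thesis by (simp add: A_def B_def)
qed

section \<open>\<open>C\<^sup>1\<close> functions and parameter integrals\<close>

text \<open>The derivative is carried as a continuous map into the bounded linear maps, so that the
  chain and product rules yield it explicitly. For functions on the whole space this is the class
  \<open>Ck_on 1\<close>.\<close>

definition C1_deriv :: "('a::euclidean_space \<Rightarrow> 'b::real_normed_vector) \<Rightarrow> ('a \<Rightarrow> 'a \<Rightarrow>\<^sub>L 'b) \<Rightarrow> bool" where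
  "C1_deriv f f' \<longleftrightarrow> (\<forall>x. (f has_derivative blinfun_apply (f' x)) (at x)) \<and> continuous_on UNIV f'"

lemma C1_derivD: "C1_deriv f f' \<Longrightarrow> (f has_derivative blinfun_apply (f' x)) (at x)"
  and C1_deriv_cont: "C1_deriv f f' \<Longrightarrow> continuous_on UNIV f'"
  by (auto simp: C1_deriv_def)

lemma C1_deriv_imp_continuous: "C1_deriv f f' \<Longrightarrow> continuous_on UNIV f"
  by (meson C1_derivD continuous_at_imp_continuous_on has_derivative_continuous)

lemma C1_deriv_compose:
  assumes f: "C1_deriv f f'" and g: "C1_deriv g g'"
  shows "C1_deriv (\<lambda>x. f (g x)) (\<lambda>x. f' (g x) o\<^sub>L g' x)"
  unfolding C1_deriv_def
proof (intro conjI allI)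
  fix x
  show "((\<lambda>x. f (g x)) has_derivative blinfun_apply (f' (g x) o\<^sub>L g' x)) (at x)"
    using has_derivative_compose[OF C1_derivD[OF g, of x] C1_derivD[OF f]] by (simp add: blinfun_compose.rep_eq comp_def)
  have "continuous_on UNIV (\<lambda>x. f' (g x))"
    using continuous_on_compose2[OF C1_deriv_cont[OF f] C1_deriv_imp_continuous[OF g]] by auto
  then show "continuous_on UNIV (\<lambda>x. f' (g x) o\<^sub>L g' x)"
    using C1_deriv_cont[OF g] by (intro continuous_intros)
qed

lemma C1_deriv_apply_cont: "C1_deriv f f' \<Longrightarrow> continuous_on UNIV (\<lambda>x. blinfun_apply (f' x) h)"
  using C1_deriv_cont by (intro continuous_intros)

lemma C1_deriv_frechet: "C1_deriv f f' \<Longrightarrow> frechet_derivative f (at x) = blinfun_apply (f' x)"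
  using C1_derivD frechet_derivative_at by metis

text \<open>In finite dimension a map into bounded linear maps is continuous as soon as its value on
  every fixed vector is, so continuity of the directional derivatives suffices.\<close>

lemma C1_deriv_of_continuous:
  fixes f :: "'a::euclidean_space \<Rightarrow> 'b::real_normed_vector"
  assumes d: "\<And>x. (f has_derivative D x) (at x)" and c: "\<And>h. continuous_on UNIV (\<lambda>x. D x h)"
  shows "C1_deriv f (\<lambda>x. Blinfun (D x))" "blinfun_apply (Blinfun (D x)) = D x"
proof -
  have eq: "blinfun_apply (Blinfun (D x)) = D x" for x
    using d has_derivative_bounded_linear bounded_linear_Blinfun_apply by blast
  then show "blinfun_apply (Blinfun (D x)) = D x" .
  show "C1_deriv f (\<lambda>x. Blinfun (D x))"
    unfolding C1_deriv_def using d c by (auto simp: eq intro!: continuous_on_blinfun_componentwise)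
qed

lemma Ck_on_1_UNIV_iff: "Ck_on 1 UNIV f \<longleftrightarrow> (\<exists>f'. C1_deriv f f')"
proof
  assume *: "Ck_on 1 UNIV f"
  have "C1_deriv f (\<lambda>x. Blinfun (frechet_derivative f (at x)))"
    by (rule C1_deriv_of_continuous) (use * in \<open>auto simp: frechet_derivative_works\<close>)
  then show "\<exists>f'. C1_deriv f f'" by blast
next
  assume "\<exists>f'. C1_deriv f f'"
  then obtain f' where f': "C1_deriv f f'" ..
  then show "Ck_on 1 UNIV f"
    by (auto simp: C1_deriv_frechet differentiable_def intro: C1_derivD C1_deriv_apply_cont)
qed

text \<open>The support \<open>K\<close> lies in the open set \<open>\<Omega>\<close>, so
  \<open>\<Omega>\<close> and the complement of \<open>K\<close> are open sets covering the space;
  the function is C^1 on the first and vanishes on the second.\<close>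

lemma C1_0_imp_C1_deriv:
  assumes "\<phi> \<in> C1_0 \<Omega>" "open \<Omega>"
  obtains \<phi>' where "C1_deriv \<phi> \<phi>'"
proof -
  from assms obtain K where K: "compact K" "K \<subseteq> \<Omega>" "\<And>x. x \<notin> K \<Longrightarrow> \<phi> x = 0"
    and d: "\<And>x. x \<in> \<Omega> \<Longrightarrow> \<phi> differentiable (at x)"
    and c: "\<And>h. continuous_on \<Omega> (\<lambda>x. frechet_derivative \<phi> (at x) h)"
    unfolding C1_0_def by auto
  have op: "open (- K)" using K(1) by (simp add: compact_imp_closed open_Compl)
  have z: "(\<phi> has_derivative (\<lambda>h. 0)) (at x)" if "x \<in> - K" for x
    by (rule has_derivative_transform_within_open[OF _ op that]) (use K in auto)
  then have z': "frechet_derivative \<phi> (at x) h = 0" if "x \<in> - K" for x h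
    using that frechet_derivative_at by metis
  have D: "(\<phi> has_derivative frechet_derivative \<phi> (at x)) (at x)" for x
    using z d K(2) by (metis ComplI differentiable_def frechet_derivative_works subsetD)
  have "continuous_on (- K) (\<lambda>x. frechet_derivative \<phi> (at x) h)" for h
    using z' by (metis (no_types, lifting) continuous_on_cong continuous_on_const)
  then have "continuous_on (\<Omega> \<union> - K) (\<lambda>x. frechet_derivative \<phi> (at x) h)" for h
    using c op assms(2) by (intro continuous_on_open_Un) auto
  moreover have "\<Omega> \<union> - K = UNIV" using K by auto
  ultimately have "C1_deriv \<phi> (\<lambda>x. Blinfun (frechet_derivative \<phi> (at x)))"
    using D by (intro C1_deriv_of_continuous) auto
  then show ?thesis using that by blast
qed

lemma C1_deriv_imp_C1_0:
  assumes "C1_deriv \<phi> \<phi>'" "compact K" "K \<subseteq> \<Omega>" "\<And>x. x \<notin> K \<Longrightarrow> \<phi> x = 0"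
  shows "\<phi> \<in> C1_0 \<Omega>"
proof -
  have "Ck_on 1 UNIV \<phi>" using assms(1) Ck_on_1_UNIV_iff by blast
  then have "Ck_on 1 \<Omega> \<phi>" using continuous_on_subset[OF _ subset_UNIV] by (simp; blast)
  then show ?thesis using assms unfolding C1_0_def by blast
qed

lemma C1_deriv_zero_off_compact:
  assumes "C1_deriv \<phi> \<phi>'" "compact K" "\<And>x. x \<notin> K \<Longrightarrow> \<phi> x = 0" "x \<notin> K"
  shows "\<phi>' x = 0"
proof -
  have op: "open (- K)" using assms by (simp add: compact_imp_closed open_Compl)
  have "(\<phi> has_derivative (\<lambda>h. 0)) (at x)"
    by (rule has_derivative_transform_within_open[OF _ op]) (use assms in auto)
  then have "blinfun_apply (\<phi>' x) = (\<lambda>h. 0)"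
    using C1_derivD[OF assms(1)] has_derivative_unique by blast
  then show ?thesis by (intro blinfun_eqI) simp
qed

text \<open>A zero of a nonnegative function is a minimum. This makes |\<nabla>\<phi>|^p /
  \<phi>^(p-1) harmless at the zeros of \<phi>, where division returns 0.\<close>

lemma C1_deriv_zero_at_min:
  fixes \<phi> :: "'a::euclidean_space \<Rightarrow> real"
  assumes "C1_deriv \<phi> \<phi>'" "\<And>x. 0 \<le> \<phi> x" "\<phi> x = 0"
  shows "\<phi>' x = 0"
proof -
  have "blinfun_apply (\<phi>' x) = (\<lambda>h. 0)"
    by (rule differential_zero_maxmin[of x UNIV \<phi>]) (use assms in \<open>auto intro: C1_derivD\<close>)
  then show ?thesis by (intro blinfun_eqI) simp
qed

section \<open>Parameter integrals and differentiation under the integral sign\<close>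

lemma integrable_mult_continuous:
  fixes c :: "'b::euclidean_space \<Rightarrow> real"
  assumes c: "continuous_on UNIV c" and C: "compact C" and u: "integrable lborel u" "\<And>y. y \<notin> C \<Longrightarrow> u y = 0"
  shows "integrable lborel (\<lambda>y. c y * u y)"
proof -
  have "bounded (c ` C)"
    using c C by (meson compact_continuous_image compact_imp_bounded continuous_on_subset subset_UNIV)
  then obtain B where B: "\<And>y. y \<in> C \<Longrightarrow> \<bar>c y\<bar> \<le> B" by (auto simp: bounded_iff)
  have [measurable]: "c \<in> borel_measurable borel" "u \<in> borel_measurable borel"
    using c u by (auto intro: borel_measurable_continuous_onI)
  have "norm (c y * u y) \<le> norm (B * \<bar>u y\<bar>)" for y
  proof (cases "y \<in> C")
    case True
    then have "\<bar>c y\<bar> * \<bar>u y\<bar> \<le> \<bar>B\<bar> * \<bar>u y\<bar>" using B[OF True] by (intro mult_right_mono) auto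
    then show ?thesis by (simp add: abs_mult)
  qed (use u in auto)
  then have "AE y in lborel. norm (c y * u y) \<le> norm (B * \<bar>u y\<bar>)" by blast
  then show ?thesis
  proof (rule Bochner_Integration.integrable_bound[rotated 2])
    show "integrable lborel (\<lambda>y. B * \<bar>u y\<bar>)" using u(1) by simp
  qed measurable
qed

lemma param_integral_le:
  fixes c d :: "'b::euclidean_space \<Rightarrow> real"
  assumes C: "compact C" and u: "integrable lborel u" "\<And>y. y \<notin> C \<Longrightarrow> u y = 0"
    and c: "continuous_on UNIV c" "\<And>y. y \<in> C \<Longrightarrow> \<bar>c y\<bar> \<le> e" 
  shows "\<bar>\<integral>y. c y * u y \<partial>lborel\<bar> \<le> e * (\<integral>y. \<bar>u y\<bar> \<partial>lborel)"
proof -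
  have "\<bar>\<integral>y. c y * u y \<partial>lborel\<bar> \<le> (\<integral>y. \<bar>c y * u y\<bar> \<partial>lborel)"
    by (rule integral_abs_bound)
  also have "\<dots> \<le> (\<integral>y. e * \<bar>u y\<bar> \<partial>lborel)"
  proof (rule integral_mono)
    show "integrable lborel (\<lambda>y. \<bar>c y * u y\<bar>)"
      using integrable_mult_continuous[OF c(1) C u] by (rule integrable_abs)
    show "integrable lborel (\<lambda>y. e * \<bar>u y\<bar>)" using u by auto
    fix y show "\<bar>c y * u y\<bar> \<le> e * \<bar>u y\<bar>"
      using c(2) u(2) by (cases "y \<in> C") (auto simp: abs_mult intro: mult_right_mono)
  qed
  finally show ?thesis by simp
qed

text \<open>The tube lemma in the compact variable: one radius \<open>d\<close> serves all y in
  \<open>C\<close>. It takes the place of a domination hypothesis in limits of parameter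
  integrals.\<close>

lemma uniform_near_on_compact:
  fixes c :: "'a::metric_space \<Rightarrow> 'b::metric_space \<Rightarrow> 'c::metric_space"
  assumes c: "continuous_on UNIV (\<lambda>(x, y). c x y)" and C: "compact C" and e: "e > 0"
  obtains d where "d > 0" "\<And>x' y. dist x' x < d \<Longrightarrow> y \<in> C \<Longrightarrow> dist (c x' y) (c x y) \<le> e"
proof -
  have "continuous_on (UNIV \<times> C) (\<lambda>(x, y). c x y)" using c continuous_on_subset by blast
  from continuous_on_prod_compactE[OF this C UNIV_I e, of x]
  obtain X where X: "x \<in> X" "open X" "\<forall>x'\<in>X \<inter> UNIV. \<forall>y\<in>C. dist (c x' y) (c x y) \<le> e"
    by auto
  then obtain d where "d > 0" "ball x d \<subseteq> X" using openE by blast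
  with X show ?thesis by (intro that[of d]) (auto simp: dist_commute subset_iff)
qed

lemma param_integral_continuous:
  fixes c :: "'a::metric_space \<Rightarrow> 'b::euclidean_space \<Rightarrow> real"
  assumes c: "continuous_on UNIV (\<lambda>(x, y). c x y)" and C: "compact C"
    and u: "integrable lborel u" "\<And>y. y \<notin> C \<Longrightarrow> u y = 0"
  shows "continuous_on UNIV (\<lambda>x. \<integral>y. c x y * u y \<partial>lborel)"
  unfolding continuous_on_iff
proof (intro ballI allI impI)
  fix x and e :: real assume e: "e > 0"
  define I where "I = (\<integral>y. \<bar>u y\<bar> \<partial>lborel)"
  have I: "I \<ge> 0" by (simp add: I_def)
  have cc: "continuous_on UNIV (c x)" for x
    using continuous_on_compose2[OF c, of UNIV "\<lambda>y. (x, y)"] by (simp add: continuous_on_Pair)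
  obtain d where d: "d > 0" "\<And>x' y. dist x' x < d \<Longrightarrow> y \<in> C \<Longrightarrow> dist (c x' y) (c x y) \<le> e / (I + 1)"
    using uniform_near_on_compact[OF c C, of "e / (I + 1)" x] e I by (metis add_nonneg_pos divide_pos_pos zero_less_one)
  have "dist (\<integral>y. c x' y * u y \<partial>lborel) (\<integral>y. c x y * u y \<partial>lborel) < e" if "dist x' x < d" for x'
  proof -
    have "(\<integral>y. c x' y * u y \<partial>lborel) - (\<integral>y. c x y * u y \<partial>lborel) = (\<integral>y. (c x' y - c x y) * u y \<partial>lborel)"
      using integrable_mult_continuous[OF cc C u] by (simp add: left_diff_distrib)
    moreover have "\<bar>\<dots>\<bar> \<le> e / (I + 1) * I" unfolding I_def
      by (rule param_integral_le[OF C u]) (use d(2)[OF that] in \<open>auto intro!: continuous_intros cc simp: dist_real_def I_def\<close>)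
    moreover have "e / (I + 1) * I < e" using e I by (simp add: field_simps)
    ultimately show ?thesis by (simp add: dist_real_def)
  qed
  then show "\<exists>d>0. \<forall>x'\<in>UNIV. dist x' x < d \<longrightarrow> dist (\<integral>y. c x' y * u y \<partial>lborel) (\<integral>y. c x y * u y \<partial>lborel) < e"
    using d(1) by blast
qed

text \<open>The density \<open>u\<close> is merely integrable; all regularity sits in
  \<open>k\<close>. The mean value inequality bounds the linearisation error of \<open>k\<close>,
  uniformly for y in \<open>C\<close>, by the oscillation of \<open>k'\<close> near x, and
  integrating against |u| keeps the error of smaller order than |x' - x|.\<close>

lemma C1_deriv_param_integral:
  fixes k :: "'a::euclidean_space \<Rightarrow> 'b::euclidean_space \<Rightarrow> real"
  assumes k: "continuous_on UNIV (\<lambda>(x, y). k x y)"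
    and d: "\<And>x y. ((\<lambda>x. k x y) has_derivative blinfun_apply (k' x y)) (at x)"
    and k': "continuous_on UNIV (\<lambda>(x, y). k' x y)"
    and C: "compact C" and u: "integrable lborel u" "\<And>y. y \<notin> C \<Longrightarrow> u y = 0"
  obtains D where "C1_deriv (\<lambda>x. \<integral>y. k x y * u y \<partial>lborel) D"
    "\<And>x h. blinfun_apply (D x) h = (\<integral>y. blinfun_apply (k' x y) h * u y \<partial>lborel)"
proof -
  define I where "I = (\<integral>y. \<bar>u y\<bar> \<partial>lborel)"
  have I: "I \<ge> 0" by (simp add: I_def)
  have kc: "continuous_on UNIV (k x)" for x
    using continuous_on_compose2[OF k, of UNIV "\<lambda>y. (x, y)"] by (simp add: continuous_on_Pair)
  have k'c2: "continuous_on UNIV (k' x)" for x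
    using continuous_on_compose2[OF k', of UNIV "\<lambda>y. (x, y)"] by (simp add: continuous_on_Pair)
  have k'c: "continuous_on UNIV (\<lambda>y. k' x y h)" for x h
    using k'c2 by (intro continuous_intros)
  have k'h: "continuous_on UNIV (\<lambda>(x, y). k' x y h)" for h
    using k' unfolding case_prod_unfold by (intro continuous_intros)
  have int: "integrable lborel (\<lambda>y. k' x y h * u y)" for x h
    by (rule integrable_mult_continuous[OF k'c C u])
  define D where "D x h = (\<integral>y. k' x y h * u y \<partial>lborel)" for x h
  have der: "((\<lambda>x. \<integral>y. k x y * u y \<partial>lborel) has_derivative D x) (at x)" for x
    unfolding has_derivative_within_alt
  proof (intro conjI allI impI)
    have "linear (D x)"
      by (rule linearI) (auto simp: D_def blinfun.add_right blinfun.scaleR_right distrib_right int mult.assoc)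
    then show "bounded_linear (D x)" by (simp add: linear_conv_bounded_linear)
    fix e :: real assume e: "e > 0"
    \<comment> \<open>The denominator \<open>I + 1\<close>, rather than the L^1 norm
      \<open>I\<close> of u, also covers \<open>I = 0\<close>.\<close>
    obtain r where r: "r > 0" "\<And>x' y. dist x' x < r \<Longrightarrow> y \<in> C \<Longrightarrow> dist (k' x' y) (k' x y) \<le> e / (I + 1)"
      using uniform_near_on_compact[OF k' C, of "e / (I + 1)" x] e I by (metis add_nonneg_pos divide_pos_pos zero_less_one)
    have "norm ((\<integral>y. k x' y * u y \<partial>lborel) - (\<integral>y. k x y * u y \<partial>lborel) - D x (x' - x)) \<le> e * norm (x' - x)"
      if x': "norm (x' - x) < r" for x'
    proof -
      have bd: "\<bar>k x' y - k x y - k' x y (x' - x)\<bar> \<le> norm (x' - x) * (e / (I + 1))" if y: "y \<in> C" for y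
      proof -
        have "norm (k x' y - k x y - k' x y (x' - x)) \<le> norm (x' - x) * (e / (I + 1))"
        proof (rule differentiable_bound_linearization[where S="ball x r" and f="\<lambda>x. k x y" and f'="\<lambda>x. blinfun_apply (k' x y)"])
          show "x + t *\<^sub>R (x' - x) \<in> ball x r" if "t \<in> {0..1}" for t
          proof -
            have "\<bar>t\<bar> * norm (x' - x) \<le> 1 * norm (x' - x)" using that by (intro mult_right_mono) auto
            then show ?thesis using x' by (simp add: dist_norm)
          qed
          show "((\<lambda>x. k x y) has_derivative k' z y) (at z within ball x r)" if "z \<in> ball x r" for z
            using d has_derivative_at_withinI by blast
          show "onorm (blinfun_apply (k' z y) - blinfun_apply (k' x y)) \<le> e / (I + 1)" if "z \<in> ball x r" for z
          proof -
            have "blinfun_apply (k' z y) - blinfun_apply (k' x y) = blinfun_apply (k' z y - k' x y)"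
              by (simp add: fun_eq_iff blinfun.diff_left)
            then show ?thesis using r(2)[of z y] that y by (simp add: norm_blinfun.rep_eq[symmetric] dist_norm norm_minus_commute)
          qed
          show "x \<in> ball x r" using r by simp
        qed
        then show ?thesis by simp
      qed
      have "(\<integral>y. k x' y * u y \<partial>lborel) - (\<integral>y. k x y * u y \<partial>lborel) - D x (x' - x)
           = (\<integral>y. (k x' y - k x y - k' x y (x' - x)) * u y \<partial>lborel)"
        using integrable_mult_continuous[OF kc C u] int by (simp add: left_diff_distrib D_def)
      also have "norm \<dots> \<le> norm (x' - x) * (e / (I + 1)) * I"
        unfolding real_norm_def I_def
        by (rule param_integral_le[OF C u]) (use bd in \<open>auto intro!: continuous_intros kc k'c simp: I_def\<close>)
      also have "\<dots> = norm (x' - x) * (e / (I + 1) * I)" by simp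
      also have "\<dots> \<le> norm (x' - x) * e" using e I by (intro mult_left_mono) (auto simp: field_simps)
      finally show ?thesis by (simp add: mult.commute)
    qed
    then show "\<exists>d>0. \<forall>y\<in>UNIV. norm (y - x) < d \<longrightarrow> norm ((\<integral>z. k y z * u z \<partial>lborel) - (\<integral>y. k x y * u y \<partial>lborel) - D x (y - x)) \<le> e * norm (y - x)"
      using r(1) by blast
  qed
  have c: "continuous_on UNIV (\<lambda>x. D x h)" for h
    unfolding D_def by (rule param_integral_continuous[OF k'h C u])
  show ?thesis
  proof (rule that)
    show "C1_deriv (\<lambda>x. \<integral>y. k x y * u y \<partial>lborel) (\<lambda>x. Blinfun (D x))"
      by (rule C1_deriv_of_continuous(1)[OF der c])
    show "blinfun_apply (Blinfun (D x)) h = (\<integral>y. blinfun_apply (k' x y) h * u y \<partial>lborel)" for x h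
      unfolding C1_deriv_of_continuous(2)[OF der c] D_def ..
  qed
qed

section \<open>Compactly supported functions and integrals of their derivatives\<close>

lemma integrable_indicator_compact:
  "compact (C::'a::euclidean_space set) \<Longrightarrow> integrable lborel (indicator C :: 'a \<Rightarrow> real)"
  using emeasure_compact_finite[of C] by (intro integrable_real_indicator) (auto simp: compact_imp_closed borel_compact less_top)

lemma integrable_C0:
  fixes g :: "'a::euclidean_space \<Rightarrow> real"
  assumes "continuous_on UNIV g" "compact C" "\<And>x. x \<notin> C \<Longrightarrow> g x = 0"
  shows "integrable lborel g"
proof -
  have "integrable lborel (\<lambda>x. g x * indicator C x)"
    using assms by (intro integrable_mult_continuous integrable_indicator_compact) auto
  moreover have "(\<lambda>x. g x * indicator C x) = g" using assms(3) by (intro ext) (auto simp: indicator_def)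
  ultimately show ?thesis by simp
qed

text \<open>By translation invariance of Lebesgue measure the integral of g (y + t e) over y is
  constant for small t; its derivative at t = 0, computed under the integral sign, is the integral
  of the directional derivative.\<close>

lemma integral_deriv_eq_0:
  fixes g :: "'a::euclidean_space \<Rightarrow> real"
  assumes g: "C1_deriv g g'" and C: "compact C" and z: "\<And>x. x \<notin> C \<Longrightarrow> g x = 0"
  shows "(\<integral>x. blinfun_apply (g' x) e \<partial>lborel) = 0"
proof -
  \<comment> \<open>All points from which a shift by t e with |t| \<le> 1 reaches \<open>C\<close>.
    The indicator of this set is the integrable weight of the parameter integral and cuts nothing
    off for these t.\<close>
  define C1 where "C1 = (\<lambda>(c, s). c - s *\<^sub>R e) ` (C \<times> {-1..1::real})"
  have "continuous_on (C \<times> {-1..1::real}) (\<lambda>(c, s). c - s *\<^sub>R e)"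
    unfolding case_prod_unfold by (intro continuous_intros)
  then have C1: "compact C1" unfolding C1_def using C by (intro compact_continuous_image compact_Times) auto
  have z1: "g (y + t *\<^sub>R e) = 0" if "y \<notin> C1" "\<bar>t\<bar> \<le> 1" for y t
  proof (rule z, rule notI)
    assume "y + t *\<^sub>R e \<in> C"
    then have "y \<in> C1" unfolding C1_def using that(2) by (intro image_eqI[of _ _ "(y + t *\<^sub>R e, t)"]) auto
    then show False using that by simp
  qed
  have gc: "continuous_on UNIV g" and g'c: "continuous_on UNIV g'"
    using g C1_deriv_imp_continuous C1_deriv_cont by auto
  obtain D where D: "C1_deriv (\<lambda>t. \<integral>y. g (y + t *\<^sub>R e) * indicator C1 y \<partial>lborel) D"
    "\<And>t h. blinfun_apply (D t) h = (\<integral>y. blinfun_apply (g' (y + t *\<^sub>R e) o\<^sub>L blinfun_scaleR_left e) h * indicator C1 y \<partial>lborel)"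
  proof (rule C1_deriv_param_integral[of "\<lambda>t y. g (y + t *\<^sub>R e)" "\<lambda>t y. g' (y + t *\<^sub>R e) o\<^sub>L blinfun_scaleR_left e" C1 "indicator C1"])
    show "continuous_on UNIV (\<lambda>(t, y). g (y + t *\<^sub>R e))" unfolding case_prod_unfold
      by (rule continuous_on_compose2[OF gc]) (auto intro!: continuous_intros)
    show "continuous_on UNIV (\<lambda>(t, y). g' (y + t *\<^sub>R e) o\<^sub>L blinfun_scaleR_left e)" unfolding case_prod_unfold
      by (intro continuous_intros continuous_on_compose2[OF g'c]) auto
    show "((\<lambda>t. g (y + t *\<^sub>R e)) has_derivative blinfun_apply (g' (y + t *\<^sub>R e) o\<^sub>L blinfun_scaleR_left e)) (at t)" for t y
    proof -
      have "((\<lambda>t. y + t *\<^sub>R e) has_derivative (\<lambda>h. h *\<^sub>R e)) (at t)" by (auto intro!: derivative_eq_intros)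
      from has_derivative_compose[OF this C1_derivD[OF g]] show ?thesis by (simp add: blinfun_compose.rep_eq comp_def)
    qed
    show "integrable lborel (indicator C1 :: 'a \<Rightarrow> real)" using C1 by (rule integrable_indicator_compact)
    show "compact C1" by (rule C1)
    show "indicator C1 y = (0::real)" if "y \<notin> C1" for y using that by simp
  qed (rule that)
  have [measurable]: "g \<in> borel_measurable borel" using gc by (rule borel_measurable_continuous_onI)
  have const: "(\<integral>y. g (y + t *\<^sub>R e) * indicator C1 y \<partial>lborel) = (\<integral>y. g y \<partial>lborel)" if "\<bar>t\<bar> \<le> 1" for t
  proof -
    have "(\<integral>y. g (y + t *\<^sub>R e) * indicator C1 y \<partial>lborel) = (\<integral>y. g (t *\<^sub>R e + y) \<partial>lborel)"
      by (intro Bochner_Integration.integral_cong) (use z1[OF _ that] in \<open>auto simp: indicator_def add.commute\<close>)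
    also have "\<dots> = (\<integral>y. g y \<partial>distr lborel borel ((+) (t *\<^sub>R e)))"
      by (subst integral_distr) auto
    also have "\<dots> = (\<integral>y. g y \<partial>lborel)" by (simp add: lborel_distr_plus)
    finally show ?thesis .
  qed
  have "((\<lambda>t. \<integral>y. g (y + t *\<^sub>R e) * indicator C1 y \<partial>lborel) has_derivative (\<lambda>h. 0)) (at (0::real))"
    by (rule has_derivative_transform_within[where d=1, OF has_derivative_const[of "\<integral>y. g y \<partial>lborel"]])
       (use const in \<open>auto simp: dist_real_def\<close>)
  then have "blinfun_apply (D 0) = (\<lambda>h. 0)" using C1_derivD[OF D(1)] has_derivative_unique by blast
  then have "0 = (\<integral>y. blinfun_apply (g' y) e * indicator C1 y \<partial>lborel)"
    using D(2)[of 0 1] by simp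
  also have "\<dots> = (\<integral>y. blinfun_apply (g' y) e \<partial>lborel)"
  proof (intro Bochner_Integration.integral_cong refl)
    fix y
    have "g' y = 0" if "y \<notin> C1"
    proof -
      have "y \<notin> C" using that by (force simp: C1_def image_iff)
      then show ?thesis using C1_deriv_zero_off_compact[OF g C z] by auto
    qed
    then show "blinfun_apply (g' y) e * indicator C1 y = blinfun_apply (g' y) e" by (auto simp: indicator_def)
  qed
  finally show ?thesis by simp
qed

section \<open>Calculus rules for C^1 maps\<close>

lemma C1_deriv_real_compose:
  fixes g :: "'a::euclidean_space \<Rightarrow> real"
  assumes g: "C1_deriv g g'" and F: "\<And>x. (F has_real_derivative F' (g x)) (at (g x))"
    and c: "continuous_on UNIV (\<lambda>x. F' (g x))"
  shows "C1_deriv (\<lambda>x. F (g x)) (\<lambda>x. F' (g x) *\<^sub>R g' x)"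
  unfolding C1_deriv_def
proof (intro conjI allI)
  fix x
  show "((\<lambda>x. F (g x)) has_derivative blinfun_apply (F' (g x) *\<^sub>R g' x)) (at x)"
    using has_derivative_compose[OF C1_derivD[OF g, of x] F[of x, unfolded has_field_derivative_def]]
    by (simp add: scaleR_blinfun.rep_eq)
  show "continuous_on UNIV (\<lambda>x. F' (g x) *\<^sub>R g' x)"
    using c C1_deriv_cont[OF g] by (intro continuous_intros)
qed

lemma C1_deriv_mult:
  fixes f g :: "'a::euclidean_space \<Rightarrow> real"
  assumes f: "C1_deriv f f'" and g: "C1_deriv g g'"
  shows "C1_deriv (\<lambda>x. f x * g x) (\<lambda>x. f x *\<^sub>R g' x + g x *\<^sub>R f' x)"
  unfolding C1_deriv_def
proof (intro conjI allI)
  fix x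
  show "((\<lambda>x. f x * g x) has_derivative blinfun_apply (f x *\<^sub>R g' x + g x *\<^sub>R f' x)) (at x)"
    using has_derivative_mult[OF C1_derivD[OF f, of x] C1_derivD[OF g, of x]]
    by (simp add: plus_blinfun.rep_eq scaleR_blinfun.rep_eq mult.commute)
  show "continuous_on UNIV (\<lambda>x. f x *\<^sub>R g' x + g x *\<^sub>R f' x)"
    using C1_deriv_cont[OF g] C1_deriv_cont[OF f] C1_deriv_imp_continuous[OF f] C1_deriv_imp_continuous[OF g]
    by (intro continuous_intros)
qed

lemma C1_deriv_add:
  assumes f: "C1_deriv f f'" and g: "C1_deriv g g'"
  shows "C1_deriv (\<lambda>x. f x + g x) (\<lambda>x. f' x + g' x)"
  unfolding C1_deriv_def
proof (intro conjI allI)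
  fix x
  show "((\<lambda>x. f x + g x) has_derivative blinfun_apply (f' x + g' x)) (at x)"
    using has_derivative_add[OF C1_derivD[OF f, of x] C1_derivD[OF g, of x]]
    by (simp add: plus_blinfun.rep_eq)
  show "continuous_on UNIV (\<lambda>x. f' x + g' x)"
    using C1_deriv_cont[OF g] C1_deriv_cont[OF f] by (intro continuous_intros)
qed

lemma C1_deriv_blinfun:
  fixes L :: "'b::real_normed_vector \<Rightarrow>\<^sub>L 'c::real_normed_vector"
  assumes f: "C1_deriv f f'"
  shows "C1_deriv (\<lambda>x. L (f x)) (\<lambda>x. L o\<^sub>L f' x)"
  unfolding C1_deriv_def
proof (intro conjI allI)
  fix x
  show "((\<lambda>x. L (f x)) has_derivative blinfun_apply (L o\<^sub>L f' x)) (at x)"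
    using bounded_linear.has_derivative[OF blinfun.bounded_linear_right C1_derivD[OF f, of x]]
    by (simp add: blinfun_compose.rep_eq comp_def)
  show "continuous_on UNIV (\<lambda>x. L o\<^sub>L f' x)"
    using C1_deriv_cont[OF f] by (intro continuous_intros)
qed

lemma C1_deriv_linear:
  fixes L :: "'a::euclidean_space \<Rightarrow> 'b::real_normed_vector"
  assumes "bounded_linear L"
  shows "C1_deriv L (\<lambda>x. Blinfun L)"
  unfolding C1_deriv_def using assms
  by (auto simp: bounded_linear_Blinfun_apply intro: bounded_linear_imp_has_derivative)

lemma C1_deriv_Pair:
  fixes f :: "'a::euclidean_space \<Rightarrow> 'b::euclidean_space" and g :: "'a \<Rightarrow> 'c::euclidean_space"
  assumes f: "C1_deriv f f'" and g: "C1_deriv g g'"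
  obtains P where "C1_deriv (\<lambda>x. (f x, g x)) P" "\<And>x h. blinfun_apply (P x) h = (f' x h, g' x h)"
proof -
  have 1: "((\<lambda>x. (f x, g x)) has_derivative (\<lambda>h. (f' x h, g' x h))) (at x)" for x
    using has_derivative_Pair[OF C1_derivD[OF f] C1_derivD[OF g]] .
  have 2: "continuous_on UNIV (\<lambda>x. (f' x h, g' x h))" for h
    using C1_deriv_cont[OF g] C1_deriv_cont[OF f] by (intro continuous_intros)
  show ?thesis
    by (rule that[OF C1_deriv_of_continuous(1)[OF 1 2]]) (simp add: C1_deriv_of_continuous(2)[OF 1 2])
qed

text \<open>Only t = 0 needs an argument: there the difference quotient is at most |h|^(p-1), which
  tends to 0 since p > 1. Powers of positive parts produce the bump, the cutoffs and the
  truncations.\<close>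

lemma has_real_derivative_pos_part_powr:
  fixes p :: real
  assumes p: "1 < p"
  shows "((\<lambda>t. max 0 t powr p) has_real_derivative p * max 0 t powr (p - 1)) (at t)"
proof -
  consider "t > 0" | "t < 0" | "t = 0" by linarith
  then show ?thesis
  proof cases
    case 1
    have "((\<lambda>t. t powr p) has_real_derivative p * t powr (p - 1)) (at t)"
      using 1 by (auto intro!: derivative_eq_intros)
    then have "((\<lambda>t. t powr p) has_real_derivative p * max 0 t powr (p - 1)) (at t)"
      using 1 by (simp add: max_def)
    then show ?thesis
      by (rule has_field_derivative_transform_within_open[where S="{0<..}"]) (use 1 in auto)
  next
    case 2
    have "((\<lambda>t. 0) has_real_derivative p * max 0 t powr (p - 1)) (at t)"
      using 2 by (simp add: max_def)
    then show ?thesis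
      by (rule has_field_derivative_transform_within_open[where S="{..<0}"]) (use 2 in auto)
  next
    case 3
    have "((\<lambda>h. (max 0 (0 + h) powr p - max 0 0 powr p) / h) \<longlongrightarrow> 0) (at 0)"
    proof (rule Lim_null_comparison)
      show "\<forall>\<^sub>F h in at 0. norm ((max 0 (0 + h) powr p - max 0 0 powr p) / h) \<le> \<bar>h\<bar> powr (p - 1)"
        unfolding eventually_at_filter
      proof (intro always_eventually allI impI)
        fix h :: real assume "h \<noteq> 0"
        then consider "h > 0" | "h < 0" by linarith
        then show "norm ((max 0 (0 + h) powr p - max 0 0 powr p) / h) \<le> \<bar>h\<bar> powr (p - 1)"
        proof cases
          case 1 then show ?thesis by (simp add: powr_diff)
        qed simp
      qed
      have "((\<lambda>h::real. \<bar>h\<bar> powr (p - 1)) \<longlongrightarrow> \<bar>0\<bar> powr (p - 1)) (at 0)"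
        using p by (intro tendsto_powr' tendsto_intros) auto
      then show "((\<lambda>h::real. \<bar>h\<bar> powr (p - 1)) \<longlongrightarrow> 0) (at 0)" by simp
    qed
    then show ?thesis using 3 by (simp add: DERIV_def)
  qed
qed

lemma continuous_pos_part_powr:
  "0 < s \<Longrightarrow> continuous_on UNIV f \<Longrightarrow> continuous_on UNIV (\<lambda>x. max 0 (f x) powr s)" for f :: "'a::topological_space \<Rightarrow> real"
  by (intro continuous_on_powr' continuous_intros) auto

lemma C1_deriv_pos_part_powr:
  fixes g :: "'a::euclidean_space \<Rightarrow> real"
  assumes p: "1 < p" and g: "C1_deriv g g'"
  shows "C1_deriv (\<lambda>x. max 0 (g x) powr p) (\<lambda>x. (p * max 0 (g x) powr (p - 1)) *\<^sub>R g' x)"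
proof (rule C1_deriv_real_compose[where F="\<lambda>t. max 0 t powr p" and F'="\<lambda>t. p * max 0 t powr (p - 1)", OF g])
  show "((\<lambda>t. max 0 t powr p) has_real_derivative p * max 0 (g x) powr (p - 1)) (at (g x))" for x
    by (rule has_real_derivative_pos_part_powr[OF p])
  show "continuous_on UNIV (\<lambda>x. p * max 0 (g x) powr (p - 1))"
    using p by (intro continuous_on_mult_left continuous_pos_part_powr C1_deriv_imp_continuous[OF g]) simp
qed

lemma C1_deriv_param_integral_pair:
  fixes k :: "'a::euclidean_space \<times> 'b::euclidean_space \<Rightarrow> real"
  assumes k: "C1_deriv k k'" and C: "compact C" and u: "integrable lborel u" "\<And>y. y \<notin> C \<Longrightarrow> u y = 0"
  obtains D where "C1_deriv (\<lambda>x. \<integral>y. k (x, y) * u y \<partial>lborel) D"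
    "\<And>x h. blinfun_apply (D x) h = (\<integral>y. blinfun_apply (k' (x, y)) (h, 0) * u y \<partial>lborel)"
proof -
  define i :: "'a \<Rightarrow>\<^sub>L ('a \<times> 'b)" where "i = Blinfun (\<lambda>h. (h, 0))"
  have i: "blinfun_apply i h = (h, 0)" for h
    unfolding i_def by (subst bounded_linear_Blinfun_apply) (auto intro: bounded_linear_Pair bounded_linear_ident bounded_linear_zero)
  have 1: "continuous_on UNIV (\<lambda>(x, y). k (x, y))" using C1_deriv_imp_continuous[OF k] by simp
  have 2: "((\<lambda>x. k (x, y)) has_derivative blinfun_apply (k' (x, y) o\<^sub>L i)) (at x)" for x y
  proof -
    have "((\<lambda>x. (x, y)) has_derivative (\<lambda>h. (h, 0))) (at x)" by (auto intro!: derivative_eq_intros)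
    from has_derivative_compose[OF this C1_derivD[OF k]] show ?thesis
      by (simp add: blinfun_compose.rep_eq comp_def i)
  qed
  have 3: "continuous_on UNIV (\<lambda>(x, y). k' (x, y) o\<^sub>L i)"
    using C1_deriv_cont[OF k] by (simp add: case_prod_unfold) (intro continuous_intros)
  obtain D where D: "C1_deriv (\<lambda>x. \<integral>y. k (x, y) * u y \<partial>lborel) D"
      "\<And>x h. blinfun_apply (D x) h = (\<integral>y. blinfun_apply (k' (x, y) o\<^sub>L i) h * u y \<partial>lborel)"
    by (rule C1_deriv_param_integral[of "\<lambda>x y. k (x, y)" "\<lambda>x y. k' (x, y) o\<^sub>L i", OF 1 2 3 C u]) (assumption, rule that)
  show ?thesis by (rule that[OF D(1)]) (simp add: D(2) i)
qed

text \<open>While x ranges over a unit ball the support in y stays in one compact set, whose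
  indicator may be inserted as an integrable weight without changing the integral. Differentiation
  under the integral sign then gives derivative 0 everywhere.\<close>

lemma param_integral_const:
  fixes k :: "'a::euclidean_space \<times> 'b::euclidean_space \<Rightarrow> real"
    and k' :: "'a \<times> 'b \<Rightarrow> ('a \<times> 'b) \<Rightarrow>\<^sub>L real"
  assumes k: "C1_deriv k k'"
    and loc: "\<And>x0. \<exists>C. compact C \<and> (\<forall>x\<in>ball x0 1. \<forall>y. y \<notin> C \<longrightarrow> k (x, y) = 0)"
    and z: "\<And>x h. (\<integral>y. blinfun_apply (k' (x, y)) (h, 0) \<partial>lborel) = 0"
  shows "(\<integral>y. k (x, y) \<partial>lborel) = (\<integral>y. k (0, y) \<partial>lborel)"
proof -
  have "((\<lambda>x. \<integral>y. k (x, y) \<partial>lborel) has_derivative (\<lambda>h. 0)) (at x0)" for x0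
  proof -
    obtain C where C: "compact C" "\<And>x y. x \<in> ball x0 1 \<Longrightarrow> y \<notin> C \<Longrightarrow> k (x, y) = 0" using loc[of x0] by metis
    have "integrable lborel (indicator C :: 'b \<Rightarrow> real)" using C by (intro integrable_indicator_compact)
    then obtain D where D: "C1_deriv (\<lambda>x. \<integral>y. k (x, y) * indicator C y \<partial>lborel) D"
      "\<And>x h. blinfun_apply (D x) h = (\<integral>y. blinfun_apply (k' (x, y)) (h, 0) * indicator C y \<partial>lborel)"
      by (rule C1_deriv_param_integral_pair[OF k C(1)]) (simp, rule that)
    have "((\<lambda>x. \<integral>y. k (x, y) \<partial>lborel) has_derivative D x0) (at x0)"
    proof (rule has_derivative_transform_within_open[OF C1_derivD[OF D(1)], of "ball x0 1"])
      show "(\<integral>y. k (x, y) * indicator C y \<partial>lborel) = (\<integral>y. k (x, y) \<partial>lborel)" if "x \<in> ball x0 1" for x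
        by (intro Bochner_Integration.integral_cong) (use C(2)[OF that] in \<open>auto simp: indicator_def\<close>)
    qed auto
    moreover have "blinfun_apply (D x0) = (\<lambda>h. 0)"
    proof (rule ext)
      fix h
      have "blinfun_apply (D x0) h = (\<integral>y. blinfun_apply (k' (x0, y)) (h, 0) \<partial>lborel)"
        unfolding D(2)
      proof (intro Bochner_Integration.integral_cong refl)
        fix y
        show "blinfun_apply (k' (x0, y)) (h, 0) * indicator C y = blinfun_apply (k' (x0, y)) (h, 0)"
        proof (cases "y \<in> C")
          case False
          \<comment> \<open>For y outside \<open>C\<close> the function x \<mapsto> k (x, y) is
            identically 0 near x0, hence its partial derivative there is 0.\<close>
          have "((\<lambda>x. 0) has_derivative (\<lambda>h. blinfun_apply (k' (x0, y)) (h, 0))) (at x0)"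
          proof (rule has_derivative_transform_within_open[where s="ball x0 1"])
            have "((\<lambda>x. (x, y)) has_derivative (\<lambda>h. (h, 0))) (at x0)" by (auto intro!: derivative_eq_intros)
            from has_derivative_compose[OF this C1_derivD[OF k]]
            show "((\<lambda>x. k (x, y)) has_derivative (\<lambda>h. blinfun_apply (k' (x0, y)) (h, 0))) (at x0)" .
          qed (use C(2) False in auto)
          then have "(\<lambda>h. blinfun_apply (k' (x0, y)) (h, 0)) = (\<lambda>h. 0)" using has_derivative_const has_derivative_unique by blast
          with False show ?thesis by (simp add: fun_eq_iff)
        qed simp
      qed
      then show "blinfun_apply (D x0) h = 0" using z by simp
    qed
    ultimately show ?thesis by simp
  qed
  then obtain c where "\<And>x. (\<integral>y. k (x, y) \<partial>lborel) = c"
    using has_derivative_zero_constant[of UNIV "\<lambda>x. \<integral>y. k (x, y) \<partial>lborel"] by auto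
  then show ?thesis by simp
qed

section \<open>Invariant vector fields on a homogeneous group\<close>

lemma bounded_linear_dilation: "bounded_linear (dilation layer R)"
  by (rule linear_conv_bounded_linear[THEN iffD1], rule linearI)
     (auto simp: dilation_def vec_eq_iff algebra_simps)

lemma dilation_nth: "dilation layer R x $ i = R ^ layer i * x $ i"
  by (simp add: dilation_def)

lemma dilation_axis: "dilation layer R (axis j c) = axis j (R ^ layer j * c)"
  by (auto simp: dilation_def vec_eq_iff axis_def)

text \<open>\<open>mul''\<close> is the second-order part of the smoothness of the group law: it
  makes the left-invariant fields C^1, so that their divergence exists. \<open>layer_pos\<close>
  gives every coordinate a positive homogeneous degree.\<close>

locale homogeneous_lie_group =
  fixes mul :: "real^'n \<Rightarrow> real^'n \<Rightarrow> real^'n" and iv :: "real^'n \<Rightarrow> real^'n"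
    and layer :: "'n \<Rightarrow> nat"
    and mul' :: "(real^'n) \<times> (real^'n) \<Rightarrow> ((real^'n) \<times> (real^'n)) \<Rightarrow>\<^sub>L (real^'n)"
    and iv' :: "real^'n \<Rightarrow> (real^'n) \<Rightarrow>\<^sub>L (real^'n)"
  assumes assoc: "mul (mul x y) z = mul x (mul y z)"
    and mul_0_left [simp]: "mul 0 x = x" and mul_0_right [simp]: "mul x 0 = x"
    and iv_left [simp]: "mul (iv x) x = 0" and iv_right [simp]: "mul x (iv x) = 0"
    and layer_pos: "layer i \<ge> 1"
    and dilation_mul: "R > 0 \<Longrightarrow> dilation layer R (mul x y) = mul (dilation layer R x) (dilation layer R y)"
    and mul': "C1_deriv (\<lambda>z. mul (fst z) (snd z)) mul'"
    and iv': "C1_deriv iv iv'"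
    and mul'': "\<exists>D. C1_deriv (\<lambda>a. blinfun_apply (mul' (a, 0)) (0, v)) D"
begin

text \<open>The left-invariant field with value v at the origin: the derivative of s \<mapsto> a
  \<circ> s at s = 0 in direction v.\<close>

definition Y :: "real^'n \<Rightarrow> real^'n \<Rightarrow> real^'n" where
  "Y v a = blinfun_apply (mul' (a, 0)) (0, v)"

text \<open>The right-invariant field with value v at the origin: the derivative of s \<mapsto> s
  \<circ> z at s = 0 in direction v.\<close>

definition V :: "real^'n \<Rightarrow> real^'n \<Rightarrow> real^'n" where
  "V v z = blinfun_apply (mul' (0, z)) (v, 0)"

lemma iv_0 [simp]: "iv 0 = 0"
  by (metis iv_right mul_0_left)

lemma mul_iv_cancel: "mul x (mul (iv x) y) = y" "mul (iv x) (mul x y) = y" "mul (mul y x) (iv x) = y" "mul (mul y (iv x)) x = y"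
  by (simp_all add: assoc[symmetric]) (simp_all add: assoc)

lemma iv_unique: "mul x y = 0 \<Longrightarrow> iv x = y"
  by (metis mul_iv_cancel(2) mul_0_right)

lemma iv_iv [simp]: "iv (iv x) = x"
  by (rule iv_unique) simp

lemma iv_mul: "iv (mul x y) = mul (iv y) (iv x)"
  by (rule iv_unique) (metis assoc iv_right mul_iv_cancel(3))

lemma mul_compose_deriv:
  assumes "(f has_derivative f') (at x within T)" "(g has_derivative g') (at x within T)"
  shows "((\<lambda>x. mul (f x) (g x)) has_derivative (\<lambda>h. mul' (f x, g x) (f' h, g' h))) (at x within T)"
  using has_derivative_compose[OF has_derivative_Pair[OF assms] C1_derivD[OF mul', of "(f x, g x)"]] by simp

lemma mul_left_deriv: "(mul a has_derivative (\<lambda>h. mul' (a, b) (0, h))) (at b)"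
  using mul_compose_deriv[OF has_derivative_const has_derivative_ident] by simp

lemma mul_right_deriv: "((\<lambda>x. mul x b) has_derivative (\<lambda>h. mul' (a, b) (h, 0))) (at a)"
  using mul_compose_deriv[OF has_derivative_ident has_derivative_const] by simp

lemma mul_left_deriv_0: "(mul a has_derivative (\<lambda>v. Y v a)) (at 0)"
  unfolding Y_def by (rule mul_left_deriv)

lemma mul_right_deriv_0: "((\<lambda>x. mul x b) has_derivative (\<lambda>v. V v b)) (at 0)"
  unfolding V_def by (rule mul_right_deriv)

lemma Y_left_invariant: "mul' (a, x) (0, Y v x) = Y v (mul a x)"
proof -
  have "((\<lambda>y. mul a (mul x y)) has_derivative (\<lambda>v. mul' (a, x) (0, Y v x))) (at 0)"
    using has_derivative_compose[OF mul_left_deriv_0, of "mul a"] mul_left_deriv[of a x] by simp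
  moreover have "((\<lambda>y. mul a (mul x y)) has_derivative (\<lambda>v. Y v (mul a x))) (at 0)"
    using mul_left_deriv_0[of "mul a x"] unfolding assoc[symmetric] .
  ultimately show ?thesis by (metis has_derivative_unique)
qed

lemma Y_0 [simp]: "Y v 0 = v"
proof -
  have "(mul 0 has_derivative (\<lambda>v. v)) (at 0)"
    using has_derivative_ident[of "at 0"] by (metis (no_types, lifting) ext mul_0_left)
  then show ?thesis using mul_left_deriv_0[of 0] by (metis has_derivative_unique)
qed

lemma V_0 [simp]: "V v 0 = v"
proof -
  have "((\<lambda>x. mul x 0) has_derivative (\<lambda>v. v)) (at 0)" by simp
  then show ?thesis using mul_right_deriv_0[of 0] by (metis has_derivative_unique)
qed

lemma V_right_invariant: "mul' (z, b) (V v z, 0) = V v (mul z b)"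
proof -
  have "((\<lambda>y. mul (mul y z) b) has_derivative (\<lambda>v. mul' (z, b) (V v z, 0))) (at 0)"
    using has_derivative_compose[OF mul_right_deriv_0, of "\<lambda>x. mul x b"] mul_right_deriv[of b z] by simp
  moreover have "((\<lambda>y. mul (mul y z) b) has_derivative (\<lambda>v. V v (mul z b))) (at 0)"
    using mul_right_deriv_0[of "mul z b"] by (simp add: assoc)
  ultimately show ?thesis by (metis has_derivative_unique)
qed

text \<open>Differentiate (x \<circ> s) \<circ> z = x \<circ> (s \<circ> z) in s at the origin:
  moving x along a left-invariant field changes the product in the same way as moving z along the
  corresponding right-invariant field.\<close>

lemma mul'_Y_V: "mul' (x, z) (Y v x, 0) = mul' (x, z) (0, V v z)"
proof -
  have "((\<lambda>s. mul (mul x s) z) has_derivative (\<lambda>v. mul' (x, z) (Y v x, 0))) (at 0)"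
    using has_derivative_compose[OF mul_left_deriv_0, of "\<lambda>x. mul x z"] mul_right_deriv[of z x] by simp
  moreover have "((\<lambda>s. mul x (mul s z)) has_derivative (\<lambda>v. mul' (x, z) (0, V v z))) (at 0)"
    using has_derivative_compose[OF mul_right_deriv_0, of "mul x"] mul_left_deriv[of x z] by simp
  ultimately show ?thesis by (metis (no_types, lifting) assoc ext has_derivative_unique)
qed

lemma iv'_0: "iv' 0 v = - v"
proof -
  have "((\<lambda>x. mul x (iv x)) has_derivative (\<lambda>h. mul' (0, iv 0) (h, iv' 0 h))) (at 0)"
    by (rule mul_compose_deriv[OF has_derivative_ident C1_derivD[OF iv']])
  moreover have "((\<lambda>x. mul x (iv x)) has_derivative (\<lambda>h. 0)) (at 0)" by simp
  ultimately have "(\<lambda>h. mul' (0, iv 0) (h, iv' 0 h)) = (\<lambda>h. 0)" by (rule has_derivative_unique)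
  then have "mul' (0, 0) (v, iv' 0 v) = 0" by (metis iv_0)
  moreover have "mul' (0, 0) (v, iv' 0 v) = V v 0 + Y (iv' 0 v) 0"
    unfolding V_def Y_def by (simp add: blinfun.add_right[symmetric])
  ultimately show ?thesis by (simp add: eq_neg_iff_add_eq_0 add.commute)
qed

text \<open>From (y \<circ> s)^-1 = s^-1 \<circ> y^-1 and the derivative -1 of inversion at the
  origin: inversion turns left-invariant fields into right-invariant ones and changes the
  sign.\<close>

lemma iv'_Y: "iv' y (Y v y) = - V v (iv y)"
proof -
  have "((\<lambda>s. iv (mul y s)) has_derivative (\<lambda>v. iv' y (Y v y))) (at 0)"
    using has_derivative_compose[OF mul_left_deriv_0[of y] C1_derivD[OF iv', of "mul y 0"]] by simp
  moreover have "((\<lambda>s. mul (iv s) (iv y)) has_derivative (\<lambda>v. V (iv' 0 v) (iv y))) (at 0)"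
    using has_derivative_compose[OF C1_derivD[OF iv', of 0], of "\<lambda>x. mul x (iv y)"] mul_right_deriv_0[of "iv y"] by simp
  ultimately have "(\<lambda>v. iv' y (Y v y)) = (\<lambda>v. V (iv' 0 v) (iv y))"
    unfolding iv_mul by (rule has_derivative_unique)
  then have "iv' y (Y v y) = V (- v) (iv y)" unfolding iv'_0 by metis
  also have "\<dots> = mul' (0, iv y) (- (v, 0))" by (simp add: V_def)
  also have "\<dots> = - V v (iv y)" unfolding V_def blinfun.minus_right ..
  finally show ?thesis .
qed

lemma linear_Y: "linear (\<lambda>v. Y v a)" and linear_V: "linear (\<lambda>v. V v a)"
  by (rule has_derivative_linear[OF mul_left_deriv_0], rule has_derivative_linear[OF mul_right_deriv_0])

text \<open>Translating a back to the origin, where \<open>Y v 0 = v\<close>, gives injectivity, and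
  equal dimensions do the rest. Thus every direction at a point is the value of some left-invariant
  field.\<close>

lemma surj_Y: "surj (\<lambda>v. Y v a)"
proof -
  have "inj (\<lambda>v. Y v a)"
  proof (rule injI)
    fix v w assume "Y v a = Y w a"
    then have "Y v (mul (iv a) a) = Y w (mul (iv a) a)" unfolding Y_left_invariant[symmetric] by simp
    then show "v = w" by simp
  qed
  then show ?thesis by (rule linear_injective_imp_surjective[OF linear_Y]) auto
qed

lemma surj_V: "surj (\<lambda>v. V v a)"
proof -
  have "inj (\<lambda>v. V v a)"
  proof (rule injI)
    fix v w assume "V v a = V w a"
    then have "V v (mul a (iv a)) = V w (mul a (iv a))" unfolding V_right_invariant[symmetric] by simp
    then show "v = w" by simp
  qed
  then show ?thesis by (rule linear_injective_imp_surjective[OF linear_V]) auto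
qed

lemma Y_dilation: assumes "R > 0" shows "Y (dilation layer R v) (dilation layer R a) = dilation layer R (Y v a)"
proof -
  have d: "(dilation layer R has_derivative dilation layer R) (at x)" for x
    using bounded_linear_dilation by (rule bounded_linear_imp_has_derivative)
  have "dilation layer R 0 = 0" by (simp add: dilation_def vec_eq_iff)
  then have "((\<lambda>y. mul (dilation layer R a) (dilation layer R y)) has_derivative (\<lambda>v. Y (dilation layer R v) (dilation layer R a))) (at 0)"
    using has_derivative_compose[OF d[of 0], of "mul (dilation layer R a)" "\<lambda>v. Y v (dilation layer R a)"] mul_left_deriv_0[of "dilation layer R a"] by simp
  moreover have "((\<lambda>y. dilation layer R (mul a y)) has_derivative (\<lambda>v. dilation layer R (Y v a))) (at 0)"
    using has_derivative_compose[OF mul_left_deriv_0[of a] d] by simp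
  ultimately show ?thesis using dilation_mul[OF assms] by (metis (no_types, lifting) ext has_derivative_unique)
qed

lemma Y_axis_dilation:
  assumes "R > 0"
  shows "R ^ layer j *\<^sub>R Y (axis j 1) (dilation layer R a) = dilation layer R (Y (axis j 1) a)"
proof -
  have "axis j (R ^ layer j * 1) = R ^ layer j *\<^sub>R (axis j 1 :: real^'n)" by (simp add: vec_eq_iff axis_def)
  then show ?thesis
    using Y_dilation[OF assms, of "axis j 1" a] linear_scale[OF linear_Y] by (simp add: dilation_axis)
qed

lemma tendsto_dilation_0: "((\<lambda>R. dilation layer R a) \<longlongrightarrow> 0) (at_right 0)"
proof (rule vec_tendstoI)
  fix i
  have "((\<lambda>R::real. R ^ layer i * a $ i) \<longlongrightarrow> 0 ^ layer i * a $ i) (at_right 0)"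
    by (intro tendsto_intros)
  then show "((\<lambda>R. dilation layer R a $ i) \<longlongrightarrow> 0 $ i) (at_right 0)"
    using layer_pos[of i] by (simp add: dilation_def power_0_left)
qed

text \<open>The derivative is continuous at the origin and homogeneous of the negative degree \<open>- layer j\<close>
  under the dilations. Consequently left-invariant fields are divergence free.\<close>

lemma Y_axis_partial_0:
  assumes D: "C1_deriv (Y (axis j 1)) D"
  shows "blinfun_apply (D a) (axis i 1) $ i = 0"
proof -
  \<comment> \<open>Obtained by differentiating \<open>Y_axis_dilation\<close> and reading off the
    i-th component along the i-th axis. The factor R^(layer i) then occurs on both sides and
    cancels, which is special to the diagonal partial derivatives.\<close>
  have eq: "D a (axis i 1) $ i = R ^ layer j * D (dilation layer R a) (axis i 1) $ i" if R: "R > 0" for R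
  proof -
    have bl: "(dilation layer R has_derivative dilation layer R) (at x)" for x
      using bounded_linear_dilation by (rule bounded_linear_imp_has_derivative)
    have "((\<lambda>a. R ^ layer j *\<^sub>R Y (axis j 1) (dilation layer R a)) has_derivative
        (\<lambda>h. R ^ layer j *\<^sub>R D (dilation layer R a) (dilation layer R h))) (at a)"
      using has_derivative_scaleR_right[OF has_derivative_compose[OF bl C1_derivD[OF D]]] .
    moreover have "((\<lambda>a. dilation layer R (Y (axis j 1) a)) has_derivative (\<lambda>h. dilation layer R (D a h))) (at a)"
      using has_derivative_compose[OF C1_derivD[OF D] bl] .
    ultimately have "R ^ layer j *\<^sub>R D (dilation layer R a) (dilation layer R h) = dilation layer R (D a h)" for h
      unfolding Y_axis_dilation[OF R] by (metis has_derivative_unique)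
    from arg_cong[OF this[of "axis i 1"], of "\<lambda>x. x $ i"]
    have "R ^ layer j * (D (dilation layer R a) (axis i (R ^ layer i)) $ i) = R ^ layer i * D a (axis i 1) $ i"
      by (simp add: dilation_axis dilation_nth)
    moreover have "axis i (R ^ layer i) = R ^ layer i *\<^sub>R (axis i 1 :: real^'n)" by (simp add: vec_eq_iff axis_def)
    ultimately have "R ^ layer i * (R ^ layer j * (D (dilation layer R a) (axis i 1) $ i)) = R ^ layer i * (D a (axis i 1) $ i)"
      by (simp add: blinfun.scaleR_right mult_ac)
    then show ?thesis using R by simp
  qed
  have "continuous_on UNIV (\<lambda>x. D x (axis i 1) $ i)"
    using C1_deriv_cont[OF D] by (intro continuous_intros)
  then have "isCont (\<lambda>x. D x (axis i 1) $ i) 0" by (simp add: continuous_on_eq_continuous_at)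
  then have lim: "((\<lambda>R. D (dilation layer R a) (axis i 1) $ i) \<longlongrightarrow> D 0 (axis i 1) $ i) (at_right 0)"
    using isCont_tendsto_compose[OF _ tendsto_dilation_0] by blast
  have "((\<lambda>R::real. R ^ layer j * (D (dilation layer R a) (axis i 1) $ i)) \<longlongrightarrow> 0 ^ layer j * (D 0 (axis i 1) $ i)) (at_right 0)"
    by (rule tendsto_mult[OF _ lim]) (intro tendsto_intros)
  moreover have "\<forall>\<^sub>F R in at_right 0. R ^ layer j * (D (dilation layer R a) (axis i 1) $ i) = D a (axis i 1) $ i"
    using eq by (auto simp: eventually_at_right_field intro!: exI[of _ 1])
  \<comment> \<open>The function under the limit is constant in R, so it equals the limit, which is
    0 because \<open>layer j \<ge> 1\<close>.\<close>
  ultimately have "((\<lambda>R::real. D a (axis i 1) $ i) \<longlongrightarrow> 0 ^ layer j * (D 0 (axis i 1) $ i)) (at_right 0)"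
    using tendsto_cong by fastforce
  then show ?thesis using layer_pos[of j] by (simp add: tendsto_const_iff power_0_left)
qed

lemma Y_C1: obtains D where "C1_deriv (Y v) D"
  using mul''[of v] unfolding Y_def[abs_def] by blast

lemma bounded_linear_vec_nth_blinfun: "blinfun_apply (Blinfun (\<lambda>x::real^'n. x $ i)) = (\<lambda>x. x $ i)"
  by (rule bounded_linear_Blinfun_apply) (rule bounded_linear_vec_nth)

lemma Y_component_mult:
  assumes D: "C1_deriv (Y (axis j 1)) D" and \<phi>: "C1_deriv \<phi> \<phi>'"
  obtains G where "C1_deriv (\<lambda>y. Y (axis j 1) y $ i * \<phi> y) G"
    "\<And>y. blinfun_apply (G y) (axis i 1) = Y (axis j 1) y $ i * \<phi>' y (axis i 1)"
proof -
  note c = C1_deriv_blinfun[OF D, of "Blinfun (\<lambda>x::real^'n. x $ i)", unfolded bounded_linear_vec_nth_blinfun]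
  show ?thesis
    by (rule that[OF C1_deriv_mult[OF c \<phi>]])
       (simp add: plus_blinfun.rep_eq scaleR_blinfun.rep_eq blinfun_compose.rep_eq bounded_linear_vec_nth_blinfun Y_axis_partial_0[OF D])
qed

lemma vec_sum_axis: "(\<Sum>i\<in>UNIV. x $ i *\<^sub>R axis i 1) = (x :: real^'n)"
  using basis_expansion[of x] by (simp add: scalar_mult_eq_scaleR)

lemma blinfun_sum_axis: "(\<Sum>i\<in>UNIV. x $ i * blinfun_apply L (axis i 1)) = blinfun_apply L (x :: real^'n)"
  for L :: "(real^'n) \<Rightarrow>\<^sub>L real"
  by (subst (2) vec_sum_axis[symmetric]) (simp add: blinfun.sum_right blinfun.scaleR_right)

text \<open>The product rule would leave a zero-order term, the divergence of the field, but every
  diagonal partial derivative of its coefficients vanishes. The field is therefore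
  skew-adjoint.\<close>

lemma formal_adjoint_Y:
  assumes \<phi>: "C1_deriv \<phi> \<phi>'"
  shows "formal_adjoint (Y (axis j 1)) \<phi> x = - \<phi>' x (Y (axis j 1) x)"
proof -
  obtain D where D: "C1_deriv (Y (axis j 1)) D" using Y_C1 .
  have "frechet_derivative (\<lambda>y. Y (axis j 1) y $ i * \<phi> y) (at x) (axis i 1) = Y (axis j 1) x $ i * \<phi>' x (axis i 1)" for i
  proof -
    obtain G where "C1_deriv (\<lambda>y. Y (axis j 1) y $ i * \<phi> y) G"
      "\<And>y. blinfun_apply (G y) (axis i 1) = Y (axis j 1) y $ i * \<phi>' y (axis i 1)"
      using Y_component_mult[OF D \<phi>] by blast
    then show ?thesis by (simp add: C1_deriv_frechet)
  qed
  then show ?thesis unfolding formal_adjoint_def by (simp add: blinfun_sum_axis)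
qed

text \<open>The divergence theorem for a divergence-free field: each Y_i \<partial>_i \<phi> equals
  the full derivative \<partial>_i (Y_i \<phi>), whose integral vanishes. General v follow from the
  axes by linearity.\<close>

lemma integral_Y_eq_0:
  fixes \<phi> :: "real^'n \<Rightarrow> real"
  assumes \<phi>: "C1_deriv \<phi> \<phi>'" and C: "compact C" and z: "\<And>x. x \<notin> C \<Longrightarrow> \<phi> x = 0"
  shows "(\<integral>x. \<phi>' x (Y v x) \<partial>lborel) = 0"
proof -
  have z': "\<phi>' x = 0" if "x \<notin> C" for x using C1_deriv_zero_off_compact[OF \<phi> C z that] .
  have Yc: "continuous_on UNIV (Y v)" for v using Y_C1 C1_deriv_imp_continuous by metis
  have *: "(\<integral>x. \<phi>' x (Y (axis j 1) x) \<partial>lborel) = 0" for j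
  proof -
    obtain D where D: "C1_deriv (Y (axis j 1)) D" using Y_C1 .
    have 0: "(\<integral>x. Y (axis j 1) x $ i * \<phi>' x (axis i 1) \<partial>lborel) = 0" for i
    proof -
      obtain G where G: "C1_deriv (\<lambda>y. Y (axis j 1) y $ i * \<phi> y) G"
        "\<And>y. blinfun_apply (G y) (axis i 1) = Y (axis j 1) y $ i * \<phi>' y (axis i 1)"
        using Y_component_mult[OF D \<phi>] by blast
      show ?thesis using integral_deriv_eq_0[OF G(1) C, where e="axis i 1"] z by (simp add: G(2))
    qed
    have "integrable lborel (\<lambda>x. Y (axis j 1) x $ i * \<phi>' x (axis i 1))" for i
      by (rule integrable_C0[OF _ C]) (use z' Yc C1_deriv_cont[OF \<phi>] in \<open>auto intro!: continuous_intros\<close>)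
    then have "(\<integral>x. (\<Sum>i\<in>UNIV. Y (axis j 1) x $ i * \<phi>' x (axis i 1)) \<partial>lborel) = (\<Sum>i\<in>UNIV. \<integral>x. Y (axis j 1) x $ i * \<phi>' x (axis i 1) \<partial>lborel)"
      by (intro Bochner_Integration.integral_sum) auto
    then show ?thesis by (simp add: 0 blinfun_sum_axis)
  qed
  have int: "integrable lborel (\<lambda>x. \<phi>' x (Y v x))" for v
    by (rule integrable_C0[OF _ C]) (use z' Yc C1_deriv_cont[OF \<phi>] in \<open>auto intro!: continuous_intros\<close>)
  have "\<phi>' x (Y v x) = (\<Sum>j\<in>UNIV. v $ j * \<phi>' x (Y (axis j 1) x))" for x
  proof -
    have "Y v x = Y (\<Sum>j\<in>UNIV. v $ j *\<^sub>R axis j 1) x" by (simp add: vec_sum_axis)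
    also have "\<dots> = (\<Sum>j\<in>UNIV. v $ j *\<^sub>R Y (axis j 1) x)"
      using linear_sum[OF linear_Y, of "\<lambda>j. v $ j *\<^sub>R axis j 1" UNIV x] linear_scale[OF linear_Y] by simp
    finally show ?thesis by (simp add: blinfun.sum_right blinfun.scaleR_right)
  qed
  then show ?thesis by (simp add: int *)
qed

end

lemma C1_deriv_section_fst:
  assumes f: "C1_deriv f f'"
  obtains D where "C1_deriv (\<lambda>x. f (x, y)) D" "\<And>x h. blinfun_apply (D x) h = blinfun_apply (f' (x, y)) (h, 0)"
proof -
  have 1: "((\<lambda>x. f (x, y)) has_derivative (\<lambda>h. blinfun_apply (f' (x, y)) (h, 0))) (at x)" for x
    by (rule has_derivative_compose[OF _ C1_derivD[OF f]]) (auto intro!: derivative_eq_intros)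
  have 2: "continuous_on UNIV (\<lambda>x. blinfun_apply (f' (x, y)) (h, 0))" for h
    by (rule continuous_on_compose2[OF C1_deriv_apply_cont[OF f, of "(h, 0)"]]) (auto intro!: continuous_intros)
  show ?thesis by (rule that[OF C1_deriv_of_continuous(1)[OF 1 2]]) (simp add: C1_deriv_of_continuous(2)[OF 1 2])
qed

lemma C1_deriv_section_snd:
  assumes f: "C1_deriv f f'"
  obtains D where "C1_deriv (\<lambda>y. f (x, y)) D" "\<And>y h. blinfun_apply (D y) h = blinfun_apply (f' (x, y)) (0, h)"
proof -
  have 1: "((\<lambda>y. f (x, y)) has_derivative (\<lambda>h. blinfun_apply (f' (x, y)) (0, h))) (at y)" for y
    by (rule has_derivative_compose[OF _ C1_derivD[OF f]]) (auto intro!: derivative_eq_intros)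
  have 2: "continuous_on UNIV (\<lambda>y. blinfun_apply (f' (x, y)) (0, h))" for h
    by (rule continuous_on_compose2[OF C1_deriv_apply_cont[OF f, of "(0, h)"]]) (auto intro!: continuous_intros)
  show ?thesis by (rule that[OF C1_deriv_of_continuous(1)[OF 1 2]]) (simp add: C1_deriv_of_continuous(2)[OF 1 2])
qed

section \<open>Invariant kernels, bi-invariance of Lebesgue measure and mollifiers\<close>

context homogeneous_lie_group
begin

lemma mul_continuous [continuous_intros]:
  "continuous_on T f \<Longrightarrow> continuous_on T g \<Longrightarrow> continuous_on T (\<lambda>x. mul (f x) (g x))"
  using continuous_on_compose2[OF C1_deriv_imp_continuous[OF mul'], of T "\<lambda>x. (f x, g x)"]
  by (auto intro: continuous_on_Pair)

lemma iv_continuous [continuous_intros]: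
  "continuous_on T f \<Longrightarrow> continuous_on T (\<lambda>x. iv (f x))"
  using continuous_on_compose2[OF C1_deriv_imp_continuous[OF iv'], of T f] by auto

text \<open>Since (x \<circ> s) \<circ> (y \<circ> s)^-1 = x \<circ> y^-1, the kernel does not
  change when x and y move together along the same left-invariant field; so its derivatives along
  that field in x and in y cancel.\<close>

lemma kernel_deriv:
  fixes \<rho> :: "real^'n \<Rightarrow> real"
  assumes \<rho>: "C1_deriv \<rho> \<rho>'"
  obtains k' where "C1_deriv (\<lambda>z. \<rho> (mul (fst z) (iv (snd z)))) k'"
    "\<And>x y v. blinfun_apply (k' (x, y)) (Y v x, 0) = - blinfun_apply (k' (x, y)) (0, Y v y)"
proof -
  obtain P where P: "C1_deriv (\<lambda>z::(real^'n)\<times>(real^'n). (fst z, iv (snd z))) P"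
    "\<And>z h. blinfun_apply (P z) h = (blinfun_apply (Blinfun fst) h, blinfun_apply (iv' (snd z) o\<^sub>L Blinfun snd) h)"
    by (rule C1_deriv_Pair[OF C1_deriv_linear[OF bounded_linear_fst] C1_deriv_compose[OF iv' C1_deriv_linear[OF bounded_linear_snd]]]) (rule that)
  note k = C1_deriv_compose[OF \<rho> C1_deriv_compose[OF mul' P(1)], simplified]
  show ?thesis
  proof (rule that[OF k])
    fix x y v
    have "P (x, y) (Y v x, 0) = (Y v x, 0)" "P (x, y) (0, Y v y) = (0, - V v (iv y))"
      by (simp_all add: P(2) bounded_linear_Blinfun_apply[OF bounded_linear_fst] bounded_linear_Blinfun_apply[OF bounded_linear_snd]
          blinfun_compose.rep_eq iv'_Y)
    moreover have "mul' (x, iv y) (0, - V v (iv y)) = - mul' (x, iv y) (Y v x, 0)"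
    proof -
      have "mul' (x, iv y) (- (0, V v (iv y))) = - mul' (x, iv y) (0, V v (iv y))" by (rule blinfun.minus_right)
      then show ?thesis by (simp add: mul'_Y_V)
    qed
    ultimately show "blinfun_apply (\<rho>' (mul (fst (x, y)) (iv (snd (x, y)))) o\<^sub>L (mul' (fst (x, y), iv (snd (x, y))) o\<^sub>L P (x, y))) (Y v x, 0) =
       - blinfun_apply (\<rho>' (mul (fst (x, y)) (iv (snd (x, y)))) o\<^sub>L (mul' (fst (x, y), iv (snd (x, y))) o\<^sub>L P (x, y))) (0, Y v y)"
      by (simp add: blinfun_compose.rep_eq blinfun.minus_right)
  qed
qed

text \<open>The derivative in x along \<open>Y v x\<close> is minus the derivative in y along
  \<open>Y v y\<close>, whose integral vanishes. As every direction has the form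
  \<open>Y v x\<close>, the integral does not depend on x, and x = 0 gives the right side.\<close>

lemma integral_kernel_snd:
  fixes \<rho> :: "real^'n \<Rightarrow> real"
  assumes \<rho>: "C1_deriv \<rho> \<rho>'" and P: "compact P" "\<And>a. a \<notin> P \<Longrightarrow> \<rho> a = 0"
  shows "(\<integral>y. \<rho> (mul x (iv y)) \<partial>lborel) = (\<integral>y. \<rho> (iv y) \<partial>lborel)"
proof -
  obtain k' where k': "C1_deriv (\<lambda>z. \<rho> (mul (fst z) (iv (snd z)))) k'"
    "\<And>x y v. blinfun_apply (k' (x, y)) (Y v x, 0) = - blinfun_apply (k' (x, y)) (0, Y v y)"
    by (rule kernel_deriv[OF \<rho>]) (rule that)
  have loc: "\<exists>C. compact C \<and> (\<forall>x\<in>ball x0 1. \<forall>y. y \<notin> C \<longrightarrow> \<rho> (mul x (iv y)) = 0)" for x0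
  proof (intro exI conjI ballI allI impI)
    \<comment> \<open>If x \<circ> y^-1 = p lies in \<open>P\<close>, then y = p^-1 \<circ> x; for x
      in the ball the support in y therefore lies in this compact image.\<close>
    let ?C = "(\<lambda>(x, p). mul (iv p) x) ` (cball x0 1 \<times> P)"
    show "compact ?C"
      using P by (intro compact_continuous_image compact_Times) (auto simp: case_prod_unfold intro!: continuous_intros)
    fix x y assume x: "x \<in> ball x0 1" and y: "y \<notin> ?C"
    show "\<rho> (mul x (iv y)) = 0"
    proof (rule P(2), rule notI)
      assume "mul x (iv y) \<in> P"
      moreover have "y = mul (iv (mul x (iv y))) x" by (simp add: iv_mul assoc)
      ultimately show False using x y by (force simp: image_iff)
    qed
  qed
  have "(\<integral>y. blinfun_apply (k' (x, y)) (h, 0) \<partial>lborel) = 0" for x h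
  proof -
    obtain v where v: "h = Y v x" using surj_Y[of x] by (metis surjD)
    obtain C where C: "compact C" "\<forall>y. y \<notin> C \<longrightarrow> \<rho> (mul x (iv y)) = 0" using loc[of x] by auto
    obtain D where D: "C1_deriv (\<lambda>y. \<rho> (mul (fst (x, y)) (iv (snd (x, y))))) D"
      "\<And>y h. blinfun_apply (D y) h = blinfun_apply (k' (x, y)) (0, h)"
      by (rule C1_deriv_section_snd[OF k'(1), of x]) (rule that)
    have "(\<integral>y. blinfun_apply (D y) (Y v y) \<partial>lborel) = 0"
      by (rule integral_Y_eq_0[OF D(1) C(1)]) (use C(2) in simp)
    then show ?thesis
      by (simp add: v k'(2) D(2))
  qed
  from param_integral_const[OF k'(1) _ this, of x] loc show ?thesis by simp
qed

text \<open>Moving z along a right-invariant field acts on x \<circ> z like moving x along the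
  left-invariant one, and the latter derivative integrates to 0. So the integral does not depend on
  z.\<close>

lemma integral_right_translate:
  fixes \<rho> :: "real^'n \<Rightarrow> real"
  assumes \<rho>: "C1_deriv \<rho> \<rho>'" and P: "compact P" "\<And>a. a \<notin> P \<Longrightarrow> \<rho> a = 0"
  shows "(\<integral>x. \<rho> (mul x z) \<partial>lborel) = (\<integral>x. \<rho> x \<partial>lborel)"
proof -
  \<comment> \<open>The swap puts the translation parameter z into the first component, the one that
    \<open>param_integral_const\<close> varies.\<close>
  obtain S where S: "C1_deriv (\<lambda>z::(real^'n)\<times>(real^'n). (snd z, fst z)) S"
    "\<And>z h. blinfun_apply (S z) h = (blinfun_apply (Blinfun snd) h, blinfun_apply (Blinfun fst) h)"
    by (rule C1_deriv_Pair[OF C1_deriv_linear[OF bounded_linear_snd] C1_deriv_linear[OF bounded_linear_fst]]) (rule that)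
  note k = C1_deriv_compose[OF \<rho> C1_deriv_compose[OF mul' S(1)], simplified]
  define k' where "k' = (\<lambda>x. \<rho>' (mul (snd x) (fst x)) o\<^sub>L (mul' (snd x, fst x) o\<^sub>L S x))"
  have k'eq: "blinfun_apply (k' (z, x)) (V v z, 0) = blinfun_apply (k' (z, x)) (0, Y v x)" for z x v
    unfolding k'_def
    by (simp add: blinfun_compose.rep_eq S(2) bounded_linear_Blinfun_apply[OF bounded_linear_fst] bounded_linear_Blinfun_apply[OF bounded_linear_snd]
        mul'_Y_V)
  have loc: "\<exists>C. compact C \<and> (\<forall>z\<in>ball z0 1. \<forall>x. x \<notin> C \<longrightarrow> \<rho> (mul x z) = 0)" for z0
  proof (intro exI conjI ballI allI impI)
    let ?C = "(\<lambda>(z, p). mul p (iv z)) ` (cball z0 1 \<times> P)"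
    show "compact ?C"
      using P by (intro compact_continuous_image compact_Times) (auto simp: case_prod_unfold intro!: continuous_intros)
    fix z x assume z: "z \<in> ball z0 1" and x: "x \<notin> ?C"
    show "\<rho> (mul x z) = 0"
    proof (rule P(2), rule notI)
      assume "mul x z \<in> P"
      moreover have "x = mul (mul x z) (iv z)" by (simp add: assoc)
      ultimately show False using x z by (force simp: image_iff)
    qed
  qed
  have "(\<integral>x. blinfun_apply (k' (z, x)) (h, 0) \<partial>lborel) = 0" for z h
  proof -
    obtain v where v: "h = V v z" using surj_V[of z] by (metis surjD)
    obtain C where C: "compact C" "\<forall>x. x \<notin> C \<longrightarrow> \<rho> (mul x z) = 0" using loc[of z] by auto
    obtain D where D: "C1_deriv (\<lambda>x. \<rho> (mul (snd (z, x)) (fst (z, x)))) D"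
      "\<And>x h. blinfun_apply (D x) h = blinfun_apply (k' (z, x)) (0, h)"
      by (rule C1_deriv_section_snd[OF k[folded k'_def], of z]) (rule that)
    have "(\<integral>x. blinfun_apply (D x) (Y v x) \<partial>lborel) = 0"
      by (rule integral_Y_eq_0[OF D(1) C(1)]) (use C(2) in simp)
    then show ?thesis
      by (simp add: v k'eq D(2))
  qed
  from param_integral_const[OF k[folded k'_def] _ this, of z] loc show ?thesis by simp
qed

text \<open>The two normalisations have different roles: integral 1 in y makes \<open>moll\<close>
  an average of u, and integral 1 in x yields the L^p bound after exchanging integrals.\<close>

definition mollifier :: "real \<Rightarrow> (real^'n \<Rightarrow> real) \<Rightarrow> bool" where
  "mollifier e \<rho> \<longleftrightarrow> (\<exists>\<rho>'. C1_deriv \<rho> \<rho>') \<and> (\<forall>a. 0 \<le> \<rho> a) \<and> (\<forall>a. \<rho> a \<noteq> 0 \<longrightarrow> norm a < e) \<and>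
    (\<forall>x. (\<integral>y. \<rho> (mul x (iv y)) \<partial>lborel) = 1) \<and> (\<forall>y. (\<integral>x. \<rho> (mul x (iv y)) \<partial>lborel) = 1)"

lemma C1_deriv_bump:
  fixes s :: real
  obtains b' where "C1_deriv (\<lambda>a::'a::euclidean_space. max 0 (s - a \<bullet> a) powr 2) b'"
proof -
  have 1: "((\<lambda>a::'a. s - a \<bullet> a) has_derivative (\<lambda>h. - 2 * (a \<bullet> h))) (at a)" for a
    by (auto intro!: derivative_eq_intros simp: inner_commute)
  have 2: "continuous_on UNIV (\<lambda>a::'a. - 2 * (a \<bullet> h))" for h by (intro continuous_intros)
  show ?thesis
    by (rule that[OF C1_deriv_pos_part_powr[OF _ C1_deriv_of_continuous(1)[OF 1 2]]]) simp
qed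

text \<open>A bump symmetrized under inversion: both one-sided integrals of the kernel then agree.\<close>

lemma mollifier_exists:
  assumes e: "e > 0"
  obtains \<rho> where "mollifier e \<rho>"
proof -
  have "isCont iv 0" using C1_deriv_imp_continuous[OF iv'] by (simp add: continuous_on_eq_continuous_at)
  \<comment> \<open>Applied to \<open>iv a\<close> in place of \<open>a\<close>: where
    \<open>b (iv a)\<close> is nonzero, \<open>iv a\<close> is small, and inverting once more
    confines \<open>a\<close> to the ball of radius e.\<close>
  then obtain d where d: "d > 0" "\<And>a. norm a < d \<Longrightarrow> norm (iv a) < e"
    using e unfolding continuous_at_eps_delta by (metis diff_zero dist_norm iv_0)
  define s where "s = min d e"
  have s: "s > 0" "s \<le> d" "s \<le> e" using d e by (auto simp: s_def)
  define b where "b = (\<lambda>a::real^'n. max 0 (s\<^sup>2 - a \<bullet> a) powr 2)"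
  obtain b' where b': "C1_deriv b b'" unfolding b_def using C1_deriv_bump .
  have bs: "norm a < s" if "b a \<noteq> 0" for a
  proof -
    have "a \<bullet> a < s\<^sup>2" using that unfolding b_def by (auto simp: max_def split: if_splits)
    then show ?thesis using s by (simp add: power2_norm_eq_inner[symmetric] power_less_imp_less_base)
  qed
  define r where "r a = b a + b (iv a)" for a
  obtain r' where r': "C1_deriv r r'" unfolding r_def[abs_def]
    using C1_deriv_add[OF b' C1_deriv_compose[OF b' iv']] by blast
  have r0: "r a \<ge> 0" for a by (simp add: r_def b_def)
  have rs: "norm a < e" if "r a \<noteq> 0" for a
  proof -
    have "b a \<noteq> 0 \<or> b (iv a) \<noteq> 0" using that by (auto simp: r_def)
    then show ?thesis using bs[of a] bs[of "iv a"] d(2)[of "iv a"] s by force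
  qed
  have rz: "r a = 0" if "a \<notin> cball 0 e" for a using rs[of a] that by force
  have rc: "continuous_on UNIV r" using C1_deriv_imp_continuous[OF r'] .
  have ri: "integrable lborel r" by (rule integrable_C0[OF rc compact_cball rz])
  define I where "I = (\<integral>a. r a \<partial>lborel)"
  have "I > 0"
  proof -
    have "I \<ge> 0" using r0 by (simp add: I_def)
    \<comment> \<open>r is continuous and positive at the origin, so it is nonzero on a nonempty
      open set and cannot vanish almost everywhere. This justifies dividing by
      \<open>I\<close>.\<close>
    moreover have "I \<noteq> 0"
    proof
      assume "I = 0"
      then have "AE a in lborel. r a = 0" using integral_nonneg_eq_0_iff_AE[OF ri] r0 by (simp add: I_def)
      moreover have o: "open {a. r a \<noteq> 0}" by (intro open_Collect_neq rc continuous_intros)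
      then have "{a. r a \<noteq> 0} \<in> sets lborel" by simp
      ultimately have "{a. r a \<noteq> 0} \<in> null_sets lborel"
        using AE_iff_null[of lborel "\<lambda>a. r a = 0"] by simp
      then have "negligible {a. r a \<noteq> 0}"
        unfolding negligible_iff_null_sets by (rule null_sets_completionI)
      moreover have "(0::real^'n) \<in> {a. r a \<noteq> 0}" using s by (simp add: r_def b_def)
      ultimately show False using open_not_negligible[OF o] by blast
    qed
    ultimately show ?thesis by simp
  qed
  define \<rho> where "\<rho> a = r a / I" for a
  have "C1_deriv (\<lambda>a. (\<lambda>t. t / I) (r a)) (\<lambda>a. (1 / I) *\<^sub>R r' a)"
    by (rule C1_deriv_real_compose[OF r', where F'="\<lambda>_. 1 / I"]) (use \<open>I > 0\<close> in \<open>auto intro!: derivative_eq_intros continuous_intros\<close>)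
  then have "\<exists>\<rho>'. C1_deriv \<rho> \<rho>'" unfolding \<rho>_def[abs_def] by blast
  moreover have "(\<integral>y. r (mul x (iv y)) \<partial>lborel) = I" for x
  proof -
    have "(\<integral>y. r (mul x (iv y)) \<partial>lborel) = (\<integral>y. r (iv y) \<partial>lborel)"
      by (rule integral_kernel_snd[OF r' compact_cball rz])
    also have "(\<lambda>y. r (iv y)) = r" by (simp add: r_def fun_eq_iff add.commute)
    finally show ?thesis by (simp add: I_def)
  qed
  moreover have "(\<integral>x. r (mul x (iv y)) \<partial>lborel) = I" for y
    unfolding I_def by (rule integral_right_translate[OF r' compact_cball rz])
  ultimately have "mollifier e \<rho>"
    unfolding mollifier_def using \<open>I > 0\<close> r0 rs by (auto simp: \<rho>_def)
  then show ?thesis by (rule that)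
qed

end

section \<open>Mollification along the group\<close>

lemma powr_add_le:
  fixes a b p :: real
  assumes "0 \<le> a" "0 \<le> b" "0 \<le> p"
  shows "(a + b) powr p \<le> 2 powr p * (a powr p + b powr p)"
proof -
  have "(a + b) powr p \<le> (2 * max a b) powr p" using assms by (intro powr_mono2) auto
  also have "\<dots> = 2 powr p * max a b powr p" using assms by (simp add: powr_mult)
  also have "max a b powr p \<le> a powr p + b powr p" by (auto simp: max_def)
  finally show ?thesis by simp
qed

lemma ennreal_powr_add_le:
  fixes a b p :: real
  assumes "0 \<le> p"
  shows "ennreal (\<bar>a + b\<bar> powr p) \<le> ennreal (2 powr p) * (ennreal (\<bar>a\<bar> powr p) + ennreal (\<bar>b\<bar> powr p))"
proof -
  have "\<bar>a + b\<bar> powr p \<le> (\<bar>a\<bar> + \<bar>b\<bar>) powr p" using assms by (intro powr_mono2) auto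
  also have "\<dots> \<le> 2 powr p * (\<bar>a\<bar> powr p + \<bar>b\<bar> powr p)" using assms by (intro powr_add_le) auto
  finally show ?thesis by (simp add: ennreal_plus[symmetric] ennreal_mult[symmetric] ennreal_le_iff del: ennreal_plus)
qed

text \<open>On the compact set carrying w one has |w| \<le> 1 + |w|^p.\<close>

lemma integrable_of_Lp:
  fixes w :: "'a::euclidean_space \<Rightarrow> real"
  assumes [measurable]: "w \<in> borel_measurable borel" and C: "compact C" "\<And>x. x \<notin> C \<Longrightarrow> w x = 0"
    and p: "1 \<le> p" and fin: "(\<integral>\<^sup>+x. ennreal (\<bar>w x\<bar> powr p) \<partial>lborel) < \<infinity>"
  shows "integrable lborel w"
proof (rule integrableI_bounded)
  have [measurable]: "C \<in> sets borel" using C by (simp add: borel_compact)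
  have "ennreal (norm (w x)) \<le> indicator C x + ennreal (\<bar>w x\<bar> powr p)" for x
  proof (cases "x \<in> C \<and> \<bar>w x\<bar> \<ge> 1")
    case True
    then have "\<bar>w x\<bar> powr 1 \<le> \<bar>w x\<bar> powr p" using p by (intro powr_mono) auto
    then have "ennreal (norm (w x)) \<le> ennreal (\<bar>w x\<bar> powr p)" using True by (simp add: ennreal_le_iff)
    also have "\<dots> \<le> indicator C x + ennreal (\<bar>w x\<bar> powr p)" by simp
    finally show ?thesis .
  next
    case False
    then have "ennreal (norm (w x)) \<le> indicator C x" using C(2)[of x] by (auto simp: indicator_def)
    also have "\<dots> \<le> indicator C x + ennreal (\<bar>w x\<bar> powr p)" by simp
    finally show ?thesis .
  qed
  then have "(\<integral>\<^sup>+x. ennreal (norm (w x)) \<partial>lborel) \<le> (\<integral>\<^sup>+x. indicator C x + ennreal (\<bar>w x\<bar> powr p) \<partial>lborel)"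
    by (rule nn_integral_mono)
  also have "\<dots> = emeasure lborel C + (\<integral>\<^sup>+x. ennreal (\<bar>w x\<bar> powr p) \<partial>lborel)"
    by (subst nn_integral_add) auto
  also have "\<dots> < \<infinity>" using fin emeasure_compact_finite[OF C(1)] by (simp add: less_top)
  finally show "(\<integral>\<^sup>+x. ennreal (norm (w x)) \<partial>lborel) < \<infinity>" .
qed simp

lemma compact_cutoff:
  fixes C :: "'a::euclidean_space set"
  assumes "compact C"
  obtains \<theta> :: "'a \<Rightarrow> real" and C' where "continuous_on UNIV \<theta>" "compact C'" "\<And>x. 0 \<le> \<theta> x" "\<And>x. \<theta> x \<le> 1"
    "\<And>x. x \<in> C \<Longrightarrow> \<theta> x = 1" "\<And>x. x \<notin> C' \<Longrightarrow> \<theta> x = 0"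
proof (cases "C = {}")
  case True then show ?thesis by (intro that[of "\<lambda>_. 0" "{}"]) auto
next
  case False
  show ?thesis
  proof (rule that[of "\<lambda>x. max 0 (1 - infdist x C)" "{x. infdist x C \<le> 1}"])
    show "continuous_on UNIV (\<lambda>x. max 0 (1 - infdist x C))" by (intro continuous_intros)
    show "compact {x. infdist x C \<le> 1}" using False assms by (intro compact_infdist_le) auto
  qed (auto simp: infdist_nonneg)
qed

text \<open>Two dominated limits. Clipping w at height M costs an L^p error that tends to 0 with
  growing M; the clipped function is an almost everywhere limit of continuous functions, clipped at
  the same height and cut off, so that a multiple of the indicator of \<open>C'\<close>
  dominates.\<close>

lemma Lp_dense_continuous:
  fixes w :: "'a::euclidean_space \<Rightarrow> real"
  assumes w[measurable]: "w \<in> borel_measurable borel" and C: "compact C" "\<And>x. x \<notin> C \<Longrightarrow> w x = 0"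
    and p: "0 < p" and fin: "(\<integral>\<^sup>+x. ennreal (\<bar>w x\<bar> powr p) \<partial>lborel) < \<infinity>" and e: "0 < (e::real)"
  obtains g C' where "continuous_on UNIV g" "compact C'" "\<And>x. x \<notin> C' \<Longrightarrow> g x = 0"
    "(\<integral>\<^sup>+x. ennreal (\<bar>w x - g x\<bar> powr p) \<partial>lborel) < ennreal e"
proof -
  define cl where "cl M t = max (- M) (min M (t::real))" for M t
  have clc: "continuous_on UNIV (cl M)" for M unfolding cl_def by (intro continuous_intros)
  have [measurable]: "cl M \<in> borel_measurable borel" for M using clc by (rule borel_measurable_continuous_onI)
  define c where "c = ennreal (2 powr p)"
  have c0: "c \<noteq> 0" "c \<noteq> top_class.top" by (auto simp: c_def)
  have pw0: "((\<lambda>n. ennreal (\<bar>f n\<bar> powr p)) \<longlonglongrightarrow> 0)" if "f \<longlonglongrightarrow> 0" for f :: "nat \<Rightarrow> real"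
  proof -
    have "(\<lambda>n. \<bar>f n\<bar> powr p) \<longlonglongrightarrow> \<bar>0\<bar> powr p" using p by (intro tendsto_powr' tendsto_intros that) auto
    then have "(\<lambda>n. ennreal (\<bar>f n\<bar> powr p)) \<longlonglongrightarrow> ennreal 0" using p by (intro tendsto_ennrealI) simp
    then show ?thesis by simp
  qed
  have "(\<lambda>M::nat. \<integral>\<^sup>+x. ennreal (\<bar>w x - cl (real M) (w x)\<bar> powr p) \<partial>lborel) \<longlonglongrightarrow> (\<integral>\<^sup>+x. 0 \<partial>(lborel::'a measure))"
  proof (rule nn_integral_dominated_convergence[where w="\<lambda>x. ennreal (\<bar>w x\<bar> powr p)"])
    show "AE x in lborel. ennreal (\<bar>w x - cl (real j) (w x)\<bar> powr p) \<le> ennreal (\<bar>w x\<bar> powr p)" for j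
      using p by (intro AE_I2 ennreal_leI powr_mono2) (auto simp: cl_def max_def min_def)
    show "AE x in lborel. (\<lambda>M. ennreal (\<bar>w x - cl (real M) (w x)\<bar> powr p)) \<longlonglongrightarrow> 0"
    proof (intro AE_I2 pw0)
      fix x
      have "\<forall>\<^sub>F M in sequentially. w x - cl (real M) (w x) = 0"
        using eventually_ge_at_top[of "nat \<lceil>\<bar>w x\<bar>\<rceil>"]
      proof eventually_elim
        case (elim M)
        then have "\<bar>w x\<bar> \<le> real M" by linarith
        then show ?case by (auto simp: cl_def max_def min_def)
      qed
      then show "(\<lambda>M. w x - cl (real M) (w x)) \<longlonglongrightarrow> 0" by (rule tendsto_eventually)
    qed
  qed (use fin in measurable)
  then have "(\<lambda>M::nat. c * (\<integral>\<^sup>+x. ennreal (\<bar>w x - cl (real M) (w x)\<bar> powr p) \<partial>lborel)) \<longlonglongrightarrow> c * 0"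
    using c0 by (intro ennreal_tendsto_cmult) (auto simp: less_top)
  moreover have e2: "ennreal (e / 2) > 0" using e by simp
  ultimately have "\<forall>\<^sub>F M in sequentially. c * (\<integral>\<^sup>+x. ennreal (\<bar>w x - cl (real M) (w x)\<bar> powr p) \<partial>lborel) < ennreal (e / 2)"
    by (auto intro: order_tendstoD)
  then obtain M :: nat where M: "c * (\<integral>\<^sup>+x. ennreal (\<bar>w x - cl (real M) (w x)\<bar> powr p) \<partial>lborel) < ennreal (e / 2)"
    by (auto simp: eventually_sequentially)
  obtain \<theta> :: "'a \<Rightarrow> real" and C' where \<theta>: "continuous_on UNIV \<theta>" "compact C'" "\<And>x. 0 \<le> \<theta> x" "\<And>x. \<theta> x \<le> 1"
    "\<And>x. x \<in> C \<Longrightarrow> \<theta> x = 1" "\<And>x. x \<notin> C' \<Longrightarrow> \<theta> x = 0" using compact_cutoff[OF C(1)] by blast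
  have [measurable]: "\<theta> \<in> borel_measurable borel" "C' \<in> sets borel"
    using \<theta> by (auto intro: borel_measurable_continuous_onI borel_compact)
  have "w \<in> borel_measurable (lebesgue_on UNIV)"
    using measurable_completion[of w lborel borel] by (simp add: lebesgue_on_UNIV_eq)
  \<comment> \<open>This notion supplies continuous functions converging to w off a negligible set.
    They come without any bound, hence the clipping and the cutoff in \<open>h\<close>.\<close>
  then have "w measurable_on UNIV" by (subst measurable_on_iff_borel_measurable) auto
  then obtain N g where N: "negligible N" and g: "\<And>n. continuous_on UNIV (g n)"
    and lim: "\<And>x. x \<notin> N \<Longrightarrow> (\<lambda>n. g n x) \<longlonglongrightarrow> w x"
    unfolding measurable_on_def by auto
  have [measurable]: "g n \<in> borel_measurable borel" for n using g by (rule borel_measurable_continuous_onI)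
  define h where "h n x = \<theta> x * cl (real M) (g n x)" for n x
  have hc: "continuous_on UNIV (h n)" for n
    unfolding h_def using \<theta>(1) continuous_on_compose2[OF clc g] by (intro continuous_intros) auto
  have [measurable]: "h n \<in> borel_measurable borel" for n using hc by (rule borel_measurable_continuous_onI)
  have "(\<lambda>n. \<integral>\<^sup>+x. ennreal (\<bar>cl (real M) (w x) - h n x\<bar> powr p) \<partial>lborel) \<longlonglongrightarrow> (\<integral>\<^sup>+x. 0 \<partial>(lborel::'a measure))"
  proof (rule nn_integral_dominated_convergence[where w="\<lambda>x. ennreal ((2 * real M) powr p) * indicator C' x"])
    show "AE x in lborel. ennreal (\<bar>cl (real M) (w x) - h j x\<bar> powr p) \<le> ennreal ((2 * real M) powr p) * indicator C' x" for j
    proof (rule AE_I2)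
      fix x
      show "ennreal (\<bar>cl (real M) (w x) - h j x\<bar> powr p) \<le> ennreal ((2 * real M) powr p) * indicator C' x"
      proof (cases "x \<in> C'")
        case True
        have 1: "\<bar>cl (real M) t\<bar> \<le> real M" for t by (auto simp: cl_def max_def min_def)
        have "\<bar>h j x\<bar> \<le> 1 * real M" unfolding h_def abs_mult using 1 \<theta>(3,4) by (intro mult_mono) auto
        then have "\<bar>cl (real M) (w x) - h j x\<bar> \<le> 2 * real M" using 1[of "w x"] by linarith
        then have "\<bar>cl (real M) (w x) - h j x\<bar> powr p \<le> (2 * real M) powr p" using p by (intro powr_mono2) auto
        then show ?thesis using True by (simp add: ennreal_le_iff)
      next
        case False
        then have "x \<notin> C" using \<theta>(5,6)[of x] by auto
        then show ?thesis using False \<theta>(6) C(2) p by (simp add: h_def cl_def)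
      qed
    qed
    show "(\<integral>\<^sup>+x. ennreal ((2 * real M) powr p) * indicator C' x \<partial>lborel) < \<infinity>"
      using emeasure_compact_finite[OF \<theta>(2)] by (simp add: nn_integral_cmult ennreal_mult_less_top)
    have "AE x in lborel. x \<notin> N"
    proof -
      have "N \<in> null_sets lebesgue" using N negligible_iff_null_sets by blast
      then show ?thesis using AE_not_in[of N lebesgue] by (simp add: AE_completion_iff)
    qed
    then show "AE x in lborel. (\<lambda>n. ennreal (\<bar>cl (real M) (w x) - h n x\<bar> powr p)) \<longlonglongrightarrow> 0"
    proof eventually_elim
      case (elim x)
      have "isCont (cl (real M)) (w x)" using clc by (simp add: continuous_on_eq_continuous_at)
      from isCont_tendsto_compose[OF this lim[OF elim]]
      have "(\<lambda>n. cl (real M) (w x) - h n x) \<longlonglongrightarrow> cl (real M) (w x) - \<theta> x * cl (real M) (w x)"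
        unfolding h_def by (intro tendsto_intros)
      moreover have "cl (real M) (w x) - \<theta> x * cl (real M) (w x) = 0"
        using \<theta>(5)[of x] C(2)[of x] by (cases "x \<in> C") (auto simp: cl_def)
      ultimately show ?case by (intro pw0) simp
    qed
  qed measurable
  then have "(\<lambda>n. c * (\<integral>\<^sup>+x. ennreal (\<bar>cl (real M) (w x) - h n x\<bar> powr p) \<partial>lborel)) \<longlonglongrightarrow> c * 0"
    using c0 by (intro ennreal_tendsto_cmult) (auto simp: less_top)
  then have "\<forall>\<^sub>F n in sequentially. c * (\<integral>\<^sup>+x. ennreal (\<bar>cl (real M) (w x) - h n x\<bar> powr p) \<partial>lborel) < ennreal (e / 2)"
    using e2 by (auto intro: order_tendstoD)
  then obtain n where n: "c * (\<integral>\<^sup>+x. ennreal (\<bar>cl (real M) (w x) - h n x\<bar> powr p) \<partial>lborel) < ennreal (e / 2)"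
    by (auto simp: eventually_sequentially)
  have "(\<integral>\<^sup>+x. ennreal (\<bar>w x - h n x\<bar> powr p) \<partial>lborel) \<le>
    (\<integral>\<^sup>+x. c * (ennreal (\<bar>w x - cl (real M) (w x)\<bar> powr p) + ennreal (\<bar>cl (real M) (w x) - h n x\<bar> powr p)) \<partial>lborel)"
    unfolding c_def
  proof (rule nn_integral_mono)
    fix x
    show "ennreal (\<bar>w x - h n x\<bar> powr p) \<le> ennreal (2 powr p) * (ennreal (\<bar>w x - cl (real M) (w x)\<bar> powr p) + ennreal (\<bar>cl (real M) (w x) - h n x\<bar> powr p))"
      using ennreal_powr_add_le[of p "w x - cl (real M) (w x)" "cl (real M) (w x) - h n x"] p by simp
  qed
  also have "\<dots> = c * (\<integral>\<^sup>+x. ennreal (\<bar>w x - cl (real M) (w x)\<bar> powr p) \<partial>lborel) + c * (\<integral>\<^sup>+x. ennreal (\<bar>cl (real M) (w x) - h n x\<bar> powr p) \<partial>lborel)"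
    by (subst nn_integral_cmult, measurable) (subst nn_integral_add, auto simp: distrib_left)
  also have "\<dots> < ennreal (e / 2) + ennreal (e / 2)" by (rule add_strict_mono[OF M n])
  also have "ennreal (e / 2) + ennreal (e / 2) = ennreal e" using e by (simp add: ennreal_plus[symmetric] del: ennreal_plus)
  finally show ?thesis
    by (intro that[OF hc \<theta>(2)]) (auto simp: h_def \<theta>(6))
qed

lemma tendsto_0_ennrealI:
  fixes f :: "'a \<Rightarrow> ennreal"
  assumes "\<And>r. r > 0 \<Longrightarrow> \<forall>\<^sub>F n in F. f n \<le> ennreal r"
  shows "(f \<longlongrightarrow> 0) F"
proof (rule order_tendstoI)
  fix a :: ennreal assume "0 < a"
  then obtain b where b: "0 < b" "b < a" using dense by blast
  obtain r where r: "b = ennreal r" "r > 0"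
    using b by (cases b rule: ennreal_cases) auto
  from assms[OF r(2)] show "\<forall>\<^sub>F n in F. f n < a" by eventually_elim (use b r in auto)
qed auto

section \<open>The mollification operator and its convergence in L^p\<close>

context homogeneous_lie_group
begin

definition moll :: "(real^'n \<Rightarrow> real) \<Rightarrow> (real^'n \<Rightarrow> real) \<Rightarrow> real^'n \<Rightarrow> real" where
  "moll \<rho> u x = (\<integral>y. \<rho> (mul x (iv y)) * u y \<partial>lborel)"

lemma mollifierD:
  assumes "mollifier e \<rho>"
  shows "0 \<le> \<rho> a" "\<rho> a \<noteq> 0 \<Longrightarrow> norm a < e" "(\<integral>y. \<rho> (mul x (iv y)) \<partial>lborel) = 1" "(\<integral>x. \<rho> (mul x (iv y)) \<partial>lborel) = 1"
  using assms unfolding mollifier_def by auto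

lemma mollifier_C1: assumes "mollifier e \<rho>" obtains \<rho>' where "C1_deriv \<rho> \<rho>'"
  using assms unfolding mollifier_def by auto

lemma mollifier_cont: "mollifier e \<rho> \<Longrightarrow> continuous_on T f \<Longrightarrow> continuous_on T (\<lambda>x. \<rho> (f x))"
  using continuous_on_compose2[of UNIV \<rho> T f] mollifier_C1 C1_deriv_imp_continuous by (metis subset_UNIV)

text \<open>A left-invariant derivative in x becomes a formal adjoint acting on the kernel in y. In
  this form the weak definition of the gradient applies with the kernel as test function.\<close>

lemma moll_C1:
  assumes \<rho>: "mollifier e \<rho>" and C: "compact C" and u: "integrable lborel u" "\<And>y. y \<notin> C \<Longrightarrow> u y = 0"
  obtains D where "C1_deriv (moll \<rho> u) D"
    "\<And>x j. blinfun_apply (D x) (Y (axis j 1) x) = (\<integral>y. formal_adjoint (Y (axis j 1)) (\<lambda>y. \<rho> (mul x (iv y))) y * u y \<partial>lborel)"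
proof -
  obtain \<rho>' where \<rho>': "C1_deriv \<rho> \<rho>'" using mollifier_C1[OF \<rho>] .
  obtain k' where k': "C1_deriv (\<lambda>z. \<rho> (mul (fst z) (iv (snd z)))) k'"
    "\<And>x y v. blinfun_apply (k' (x, y)) (Y v x, 0) = - blinfun_apply (k' (x, y)) (0, Y v y)"
    by (rule kernel_deriv[OF \<rho>']) (rule that)
  obtain D where D: "C1_deriv (\<lambda>x. \<integral>y. \<rho> (mul (fst (x, y)) (iv (snd (x, y)))) * u y \<partial>lborel) D"
    "\<And>x h. blinfun_apply (D x) h = (\<integral>y. blinfun_apply (k' (x, y)) (h, 0) * u y \<partial>lborel)"
    by (rule C1_deriv_param_integral_pair[OF k'(1) C u]) (assumption, rule that)
  have "C1_deriv (moll \<rho> u) D" using D(1) by (simp add: moll_def[abs_def])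
  then show ?thesis
  proof (rule that)
    fix x j
    obtain E where E: "C1_deriv (\<lambda>y. \<rho> (mul (fst (x, y)) (iv (snd (x, y))))) E"
      "\<And>y h. blinfun_apply (E y) h = blinfun_apply (k' (x, y)) (0, h)"
      by (rule C1_deriv_section_snd[OF k'(1), of x]) (rule that)
    have "formal_adjoint (Y (axis j 1)) (\<lambda>y. \<rho> (mul x (iv y))) y = blinfun_apply (k' (x, y)) (Y (axis j 1) x, 0)" for y
      using formal_adjoint_Y[OF E(1), of j y] by (simp add: E(2) k'(2))
    then show "blinfun_apply (D x) (Y (axis j 1) x) = (\<integral>y. formal_adjoint (Y (axis j 1)) (\<lambda>y. \<rho> (mul x (iv y))) y * u y \<partial>lborel)"
      by (simp add: D(2))
  qed
qed

text \<open>The Bochner integral of a non-integrable function is 0, so the value 1 already contains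
  integrability.\<close>

lemma kernel_integrable:
  assumes "mollifier e \<rho>"
  shows "integrable lborel (\<lambda>y. \<rho> (mul x (iv y)))" "integrable lborel (\<lambda>x. \<rho> (mul x (iv y)))"
  using mollifierD(3,4)[OF assms] not_integrable_integral_eq zero_neq_one by metis+

lemma kernel_nn_integral:
  assumes "mollifier e \<rho>"
  shows "(\<integral>\<^sup>+y. ennreal (\<rho> (mul x (iv y))) \<partial>lborel) = 1" "(\<integral>\<^sup>+x. ennreal (\<rho> (mul x (iv y))) \<partial>lborel) = 1"
  using mollifierD[OF assms] kernel_integrable[OF assms] by (auto simp: nn_integral_eq_integral)

lemma kernel_measurable:
  assumes "mollifier e \<rho>"
  shows "(\<lambda>y. \<rho> (mul x (iv y))) \<in> borel_measurable borel" "(\<lambda>x. \<rho> (mul x (iv y))) \<in> borel_measurable borel"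
    "(\<lambda>z. \<rho> (mul (fst z) (iv (snd z)))) \<in> borel_measurable (borel \<Otimes>\<^sub>M borel)"
  unfolding borel_prod
  by (intro borel_measurable_continuous_onI mollifier_cont[OF assms] continuous_intros)+

lemma moll_integrable:
  assumes "mollifier e \<rho>" "compact C" "integrable lborel u" "\<And>y. y \<notin> C \<Longrightarrow> u y = 0"
  shows "integrable lborel (\<lambda>y. \<rho> (mul x (iv y)) * u y)"
  by (rule integrable_mult_continuous[OF _ assms(2-4)]) (intro mollifier_cont[OF assms(1)] continuous_intros)

text \<open>Jensen's inequality for the probability density y \<mapsto> \<rho> (x \<circ> y^-1),
  obtained from Hoelder by splitting the kernel as k^(1/p) k^(1/q); the factor made of k alone
  integrates to 1.\<close>

lemma moll_powr_le:
  assumes \<rho>: "mollifier e \<rho>" and C: "compact C" and u: "integrable lborel u" "\<And>y. y \<notin> C \<Longrightarrow> u y = 0" and p: "1 < p"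
  shows "ennreal (\<bar>moll \<rho> u x\<bar> powr p) \<le> (\<integral>\<^sup>+y. ennreal (\<rho> (mul x (iv y))) * ennreal (\<bar>u y\<bar> powr p) \<partial>lborel)"
proof -
  define q where "q = p / (p - 1)"
  have q: "q > 1" "1 / p + 1 / q = 1" using p by (auto simp: q_def field_simps)
  have [measurable]: "u \<in> borel_measurable borel" using u by auto
  note [measurable] = kernel_measurable(1)[OF \<rho>]
  let ?k = "\<lambda>y. ennreal (\<rho> (mul x (iv y)))"
  have "ennreal \<bar>moll \<rho> u x\<bar> \<le> (\<integral>\<^sup>+y. ennreal (norm (\<rho> (mul x (iv y)) * u y)) \<partial>lborel)"
    unfolding moll_def using integral_norm_bound_ennreal[OF moll_integrable[OF \<rho> C u]] by simp
  also have "\<dots> = (\<integral>\<^sup>+y. (?k y epowr (1 / p) * ennreal \<bar>u y\<bar>) * (?k y epowr (1 / q)) \<partial>lborel)"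
  proof (intro nn_integral_cong)
    fix y
    have "?k y = ?k y epowr (1 / p) * ?k y epowr (1 / q)"
      using p q epowr_add[of "1 / p" "1 / q" "?k y"] by simp
    then show "ennreal (norm (\<rho> (mul x (iv y)) * u y)) = (?k y epowr (1 / p) * ennreal \<bar>u y\<bar>) * (?k y epowr (1 / q))"
      using mollifierD(1)[OF \<rho>] by (simp add: abs_mult ennreal_mult mult_ac)
  qed
  also have "\<dots> \<le> (\<integral>\<^sup>+y. (?k y epowr (1 / p) * ennreal \<bar>u y\<bar>) epowr p \<partial>lborel) epowr (1 / p) * (\<integral>\<^sup>+y. (?k y epowr (1 / q)) epowr q \<partial>lborel) epowr (1 / q)"
    by (rule nn_integral_Hoelder[OF p q_def]) measurable
  also have "(\<integral>\<^sup>+y. (?k y epowr (1 / q)) epowr q \<partial>lborel) = 1"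
    using q kernel_nn_integral(1)[OF \<rho>] by (simp add: epowr_epowr)
  also have "(\<lambda>y. (?k y epowr (1 / p) * ennreal \<bar>u y\<bar>) epowr p) = (\<lambda>y. ?k y * ennreal (\<bar>u y\<bar> powr p))"
    using p by (simp add: epowr_mult epowr_epowr epowr_ennreal_nonneg fun_eq_iff)
  finally have "ennreal \<bar>moll \<rho> u x\<bar> epowr p \<le> (((\<integral>\<^sup>+y. ?k y * ennreal (\<bar>u y\<bar> powr p) \<partial>lborel) epowr (1 / p)) * 1 epowr (1 / q)) epowr p"
    using p by (intro epowr_mono) auto
  moreover have "1 epowr s = 1" for s using epowr_ennreal[of 1 s] by simp
  ultimately show ?thesis using p by (simp add: epowr_epowr epowr_ennreal_nonneg)
qed

text \<open>Integrate the pointwise bound and exchange the integrals: the kernel has integral 1 in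
  x. The contraction is thus uniform in the mollifier.\<close>

lemma moll_Lp_le:
  assumes \<rho>: "mollifier e \<rho>" and C: "compact C" and u: "integrable lborel u" "\<And>y. y \<notin> C \<Longrightarrow> u y = 0" and p: "1 < p"
  shows "(\<integral>\<^sup>+x. ennreal (\<bar>moll \<rho> u x\<bar> powr p) \<partial>lborel) \<le> (\<integral>\<^sup>+y. ennreal (\<bar>u y\<bar> powr p) \<partial>lborel)"
proof -
  have [measurable]: "u \<in> borel_measurable borel" using u by auto
  note [measurable] = kernel_measurable[OF \<rho>]
  have "(\<integral>\<^sup>+x. ennreal (\<bar>moll \<rho> u x\<bar> powr p) \<partial>lborel) \<le> (\<integral>\<^sup>+x. (\<integral>\<^sup>+y. ennreal (\<rho> (mul x (iv y))) * ennreal (\<bar>u y\<bar> powr p) \<partial>lborel) \<partial>lborel)"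
    by (intro nn_integral_mono moll_powr_le[OF \<rho> C u p])
  also have "\<dots> = (\<integral>\<^sup>+y. (\<integral>\<^sup>+x. ennreal (\<rho> (mul x (iv y))) * ennreal (\<bar>u y\<bar> powr p) \<partial>lborel) \<partial>lborel)"
    using lborel_pair.Fubini'[of "\<lambda>x y. ennreal (\<rho> (mul x (iv y))) * ennreal (\<bar>u y\<bar> powr p)"]
    by (simp add: case_prod_unfold)
  also have "\<dots> = (\<integral>\<^sup>+y. ennreal (\<bar>u y\<bar> powr p) \<partial>lborel)"
    by (simp add: nn_integral_multc kernel_nn_integral(2)[OF \<rho>])
  finally show ?thesis .
qed

text \<open>With a = x \<circ> y^-1 one has y = a^-1 \<circ> x, and a is small on the support of the
  kernel. So g y is close to g x, uniformly for x in \<open>K\<close>, and the same holds for the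
  average.\<close>

lemma moll_near_continuous:
  assumes g: "continuous_on UNIV g" and K: "compact K" and s: "s > 0"
  obtains d where "d > 0" "\<And>e \<rho> x. mollifier e \<rho> \<Longrightarrow> e \<le> d \<Longrightarrow> x \<in> K \<Longrightarrow> integrable lborel (\<lambda>y. \<rho> (mul x (iv y)) * g y) \<Longrightarrow> \<bar>moll \<rho> g x - g x\<bar> \<le> s"
proof -
  have "continuous_on UNIV (\<lambda>(a, x). g (mul (iv a) x))" unfolding case_prod_unfold
    by (intro continuous_on_compose2[OF g] continuous_intros) auto
  then obtain d where d: "d > 0" "\<And>a x. dist a 0 < d \<Longrightarrow> x \<in> K \<Longrightarrow> dist (g (mul (iv a) x)) (g (mul (iv 0) x)) \<le> s"
    using uniform_near_on_compact[OF _ K s] by blast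
  show ?thesis
  proof (rule that[OF d(1)])
    fix e \<rho> x assume \<rho>: "mollifier e \<rho>" and e: "e \<le> d" and x: "x \<in> K"
      and int: "integrable lborel (\<lambda>y. \<rho> (mul x (iv y)) * g y)"
    note ki = kernel_integrable(1)[OF \<rho>, of x]
    have "moll \<rho> g x - g x = (\<integral>y. \<rho> (mul x (iv y)) * g y \<partial>lborel) - (\<integral>y. \<rho> (mul x (iv y)) * g x \<partial>lborel)"
      using ki by (simp add: moll_def mollifierD(3)[OF \<rho>])
    also have "\<dots> = (\<integral>y. \<rho> (mul x (iv y)) * (g y - g x) \<partial>lborel)"
      using int ki by (simp add: right_diff_distrib)
    also have "\<bar>\<dots>\<bar> \<le> (\<integral>y. \<bar>\<rho> (mul x (iv y)) * (g y - g x)\<bar> \<partial>lborel)" by (rule integral_abs_bound)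
    also have "\<dots> \<le> (\<integral>y. \<rho> (mul x (iv y)) * s \<partial>lborel)"
    proof (rule integral_mono)
      show "integrable lborel (\<lambda>y. \<bar>\<rho> (mul x (iv y)) * (g y - g x)\<bar>)" using int ki by (simp add: right_diff_distrib)
      show "integrable lborel (\<lambda>y. \<rho> (mul x (iv y)) * s)" using ki by simp
      fix y
      show "\<bar>\<rho> (mul x (iv y)) * (g y - g x)\<bar> \<le> \<rho> (mul x (iv y)) * s"
      proof (cases "\<rho> (mul x (iv y)) = 0")
        case False
        define a where "a = mul x (iv y)"
        have "mul (iv a) x = y" by (simp add: a_def iv_mul assoc)
        moreover have "norm a < d" using mollifierD(2)[OF \<rho>] False e by (force simp: a_def)
        ultimately have "\<bar>g y - g x\<bar> \<le> s" using d(2)[of a x] x by (simp add: dist_real_def)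
        then show ?thesis using mollifierD(1)[OF \<rho>] by (simp add: abs_mult mult_left_mono)
      qed simp
    qed
    also have "\<dots> = s" by (simp add: mollifierD(3)[OF \<rho>])
    finally show "\<bar>moll \<rho> g x - g x\<bar> \<le> s" .
  qed
qed

text \<open>Split w = g + h with g continuous of compact support and h small in L^p: mollification
  contracts h, and the mollified g converges uniformly on \<open>K\<close>.\<close>

lemma moll_tendsto:
  assumes w[measurable]: "w \<in> borel_measurable borel" and C: "compact C" "\<And>x. x \<notin> C \<Longrightarrow> w x = 0"
    and p: "1 < p" and fin: "(\<integral>\<^sup>+x. ennreal (\<bar>w x\<bar> powr p) \<partial>lborel) < \<infinity>" and K: "compact K"
    and \<rho>: "\<And>n. mollifier (e n) (\<rho> n)" and e: "e \<longlonglongrightarrow> 0"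
  shows "(\<lambda>n. \<integral>\<^sup>+x. ennreal (\<bar>moll (\<rho> n) w x - w x\<bar> powr p) * indicator K x \<partial>lborel) \<longlonglongrightarrow> 0"
proof (rule tendsto_0_ennrealI)
  fix r :: real assume r: "r > 0"
  have wi: "integrable lborel w" using integrable_of_Lp[OF w C _ fin] p by simp
  define c where "c = 2 powr p"
  have c: "c > 0" by (simp add: c_def)
  define m where "m = measure lborel K"
  have m: "m \<ge> 0" "emeasure lborel K = ennreal m"
    using emeasure_compact_finite[OF K] by (auto simp: m_def emeasure_eq_ennreal_measure less_top)
  \<comment> \<open>The constants come from using |a + b|^p \<le> c (|a|^p + |b|^p), c = 2^p, twice:
    h contributes (c + c^2) r1 = r/2 and g at most c^2 t m \<le> r/2, with m the measure of
    \<open>K\<close>. The term \<open>m + 1\<close> allows m = 0.\<close>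
  define r1 where "r1 = r / (2 * (c + c * c))"
  define t where "t = r / (2 * (c * c) * (m + 1))"
  define s where "s = t powr (1 / p)"
  have r1: "r1 > 0" "(c + c * c) * r1 = r / 2" using r c
  proof -
    have "c + c * c > 0" using c by (simp add: add_pos_pos)
    then show "r1 > 0" "(c + c * c) * r1 = r / 2" using r by (auto simp: r1_def field_simps)
  qed
  have t: "t > 0" using r c m by (simp add: t_def)
  have s: "s > 0" "s powr p = t" using t p by (auto simp: s_def powr_powr)
  have tm: "c * c * (t * m) \<le> r / 2" using r c m 
  proof -
    have "c * c * (t * m) = r / 2 * (m / (m + 1))" using c m by (simp add: t_def)
    also have "\<dots> \<le> r / 2 * 1" using r m by (intro mult_left_mono) auto
    finally show ?thesis by simp
  qed
  obtain g C' where g: "continuous_on UNIV g" "compact C'" "\<And>x. x \<notin> C' \<Longrightarrow> g x = 0"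
    "(\<integral>\<^sup>+x. ennreal (\<bar>w x - g x\<bar> powr p) \<partial>lborel) < ennreal r1"
    using Lp_dense_continuous[OF w C _ fin r1(1)] p by auto
  have [measurable]: "g \<in> borel_measurable borel" "K \<in> sets borel"
    using g K by (auto intro: borel_measurable_continuous_onI borel_compact)
  have gi: "integrable lborel g" by (rule integrable_C0[OF g(1-3)])
  obtain d where d: "d > 0" "\<And>e \<rho> x. mollifier e \<rho> \<Longrightarrow> e \<le> d \<Longrightarrow> x \<in> K \<Longrightarrow> integrable lborel (\<lambda>y. \<rho> (mul x (iv y)) * g y) \<Longrightarrow> \<bar>moll \<rho> g x - g x\<bar> \<le> s"
    by (rule moll_near_continuous[OF g(1) K s(1)]) (rule that)
  have "\<forall>\<^sub>F n in sequentially. e n < d" using e d(1) by (rule order_tendstoD)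
  then show "\<forall>\<^sub>F n in sequentially. (\<integral>\<^sup>+x. ennreal (\<bar>moll (\<rho> n) w x - w x\<bar> powr p) * indicator K x \<partial>lborel) \<le> ennreal r"
  proof eventually_elim
    case (elim n)
    have CC: "compact (C \<union> C')" using C g by auto
    define h where "h x = w x - g x" for x
    have h[measurable]: "h \<in> borel_measurable borel" unfolding h_def by measurable
    have hi: "integrable lborel h" unfolding h_def using wi gi by auto
    have hz: "\<And>x. x \<notin> C \<union> C' \<Longrightarrow> h x = 0" using C g by (auto simp: h_def)
    have Tc: "moll (\<rho> n) f \<in> borel_measurable borel" if "integrable lborel f" "\<And>y. y \<notin> C \<union> C' \<Longrightarrow> f y = 0" for f
      using moll_C1[OF \<rho> CC that] C1_deriv_imp_continuous borel_measurable_continuous_onI by metis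
    have [measurable]: "moll (\<rho> n) h \<in> borel_measurable borel" by (rule Tc[OF hi hz])
    have [measurable]: "moll (\<rho> n) g \<in> borel_measurable borel" by (rule Tc[OF gi]) (use g in auto)
    have "ennreal (\<bar>moll (\<rho> n) w x - w x\<bar> powr p) * indicator K x \<le>
       ennreal c * ennreal (\<bar>moll (\<rho> n) h x\<bar> powr p) + (ennreal (c * c) * (ennreal t * indicator K x) + ennreal (c * c) * ennreal (\<bar>h x\<bar> powr p))" for x
    proof (cases "x \<in> K")
      case True
      have lin: "moll (\<rho> n) w x = moll (\<rho> n) h x + moll (\<rho> n) g x"
      proof -
        have "moll (\<rho> n) h x + moll (\<rho> n) g x = (\<integral>y. \<rho> n (mul x (iv y)) * h y + \<rho> n (mul x (iv y)) * g y \<partial>lborel)"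
          unfolding moll_def
          using moll_integrable[OF \<rho> CC hi hz] moll_integrable[OF \<rho> g(2) gi g(3)]
          by (rule Bochner_Integration.integral_add[symmetric])
        also have "\<dots> = moll (\<rho> n) w x" unfolding moll_def by (simp add: h_def right_diff_distrib)
        finally show ?thesis by simp
      qed
      have Ts: "\<bar>moll (\<rho> n) g x - g x\<bar> \<le> s"
        using d(2)[OF \<rho> _ True moll_integrable[OF \<rho> g(2) gi g(3)]] elim by simp
      then have "\<bar>moll (\<rho> n) g x - g x\<bar> powr p \<le> s powr p" using p by (intro powr_mono2) auto
      then have Ts': "ennreal (\<bar>moll (\<rho> n) g x - g x\<bar> powr p) \<le> ennreal t" using s by (simp add: ennreal_leI)
      have "ennreal (\<bar>moll (\<rho> n) w x - w x\<bar> powr p) = ennreal (\<bar>moll (\<rho> n) h x + ((moll (\<rho> n) g x - g x) + (- h x))\<bar> powr p)"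
        by (simp add: lin h_def add_diff_eq)
      also have "\<dots> \<le> ennreal c * (ennreal (\<bar>moll (\<rho> n) h x\<bar> powr p) + ennreal (\<bar>(moll (\<rho> n) g x - g x) + (- h x)\<bar> powr p))"
        unfolding c_def using p by (intro ennreal_powr_add_le) auto
      also have "\<dots> \<le> ennreal c * (ennreal (\<bar>moll (\<rho> n) h x\<bar> powr p) + ennreal c * (ennreal (\<bar>moll (\<rho> n) g x - g x\<bar> powr p) + ennreal (\<bar>- h x\<bar> powr p)))"
        unfolding c_def using p by (intro mult_left_mono add_left_mono ennreal_powr_add_le) auto
      also have "\<dots> \<le> ennreal c * (ennreal (\<bar>moll (\<rho> n) h x\<bar> powr p) + ennreal c * (ennreal t + ennreal (\<bar>- h x\<bar> powr p)))"
        by (intro mult_left_mono add_left_mono add_right_mono Ts') auto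
      also have "\<dots> = ennreal c * ennreal (\<bar>moll (\<rho> n) h x\<bar> powr p) + (ennreal (c * c) * ennreal t + ennreal (c * c) * ennreal (\<bar>h x\<bar> powr p))"
        using c by (simp add: distrib_left ennreal_mult mult.assoc)
      finally show ?thesis using True by simp
    qed simp
    then have "(\<integral>\<^sup>+x. ennreal (\<bar>moll (\<rho> n) w x - w x\<bar> powr p) * indicator K x \<partial>lborel) \<le>
      (\<integral>\<^sup>+x. ennreal c * ennreal (\<bar>moll (\<rho> n) h x\<bar> powr p) + (ennreal (c * c) * (ennreal t * indicator K x) + ennreal (c * c) * ennreal (\<bar>h x\<bar> powr p)) \<partial>lborel)"
      by (rule nn_integral_mono)
    also have "\<dots> = ennreal c * (\<integral>\<^sup>+x. ennreal (\<bar>moll (\<rho> n) h x\<bar> powr p) \<partial>lborel) +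
       (ennreal (c * c) * (ennreal t * ennreal m) + ennreal (c * c) * (\<integral>\<^sup>+x. ennreal (\<bar>h x\<bar> powr p) \<partial>lborel))"
      by (subst nn_integral_add, measurable, subst nn_integral_add, measurable) (simp add: nn_integral_cmult m)
    also have "\<dots> \<le> ennreal c * ennreal r1 + (ennreal (c * c) * (ennreal t * ennreal m) + ennreal (c * c) * ennreal r1)"
    proof -
      have "(\<integral>\<^sup>+x. ennreal (\<bar>h x\<bar> powr p) \<partial>lborel) \<le> ennreal r1" using g(4) by (simp add: h_def less_imp_le)
      moreover have "(\<integral>\<^sup>+x. ennreal (\<bar>moll (\<rho> n) h x\<bar> powr p) \<partial>lborel) \<le> (\<integral>\<^sup>+x. ennreal (\<bar>h x\<bar> powr p) \<partial>lborel)"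
        by (rule moll_Lp_le[OF \<rho> CC hi hz p])
      ultimately show ?thesis by (intro add_mono mult_left_mono order_refl) (auto intro: order_trans)
    qed
    also have "\<dots> = ennreal (c * r1 + (c * c * (t * m) + c * c * r1))"
      using c r1 t m by (simp add: ennreal_mult[symmetric] ennreal_plus[symmetric] del: ennreal_plus)
    also have "\<dots> \<le> ennreal r" using r1 tm by (intro ennreal_leI) (simp add: distrib_right)
    finally show ?case .
  qed
qed

end

lemma hgrad_nth_C1: "C1_deriv \<phi> \<phi>' \<Longrightarrow> hgrad X \<phi> x $ i = blinfun_apply (\<phi>' x) (X i x)"
  by (simp add: hgrad_def C1_deriv_frechet)

lemma formal_adjoint_zero: "formal_adjoint (\<lambda>x. 0) \<phi> x = 0"
  by (simp add: formal_adjoint_def)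

section \<open>C^1 approximation of functions with a weak horizontal gradient\<close>

context homogeneous_lie_group
begin

text \<open>Continuity of (a, x) \<mapsto> a^-1 \<circ> x at a = 0, uniform on \<open>K\<close>. For
  x in \<open>K\<close> a narrow kernel y \<mapsto> \<rho> (x \<circ> y^-1) is then supported in
  \<open>\<Omega>\<close> and is an admissible test function.\<close>

lemma left_translate_compact_in_open:
  assumes K: "compact K" "K \<subseteq> \<Omega>" and \<Omega>: "open \<Omega>"
  obtains \<delta> where "\<delta> > 0" "\<And>a x. norm a \<le> \<delta> \<Longrightarrow> x \<in> K \<Longrightarrow> mul (iv a) x \<in> \<Omega>"
proof -
  obtain e where e: "e > 0" "(\<Union>x\<in>K. cball x e) \<subseteq> \<Omega>"
    using compact_subset_open_imp_cball_epsilon_subset[OF K(1) \<Omega> K(2)] by blast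
  have "continuous_on UNIV (\<lambda>(a :: real^'n, x :: real^'n). mul (iv a) x)" unfolding case_prod_unfold
    by (intro continuous_intros)
  then obtain d where d: "d > 0" "\<And>a x. dist a 0 < d \<Longrightarrow> x \<in> K \<Longrightarrow> dist (mul (iv a) x) (mul (iv 0) x) \<le> e"
    using uniform_near_on_compact[OF _ K(1) e(1)] by blast
  show ?thesis
  proof (rule that[of "d / 2"])
    fix a x :: "real^'n" assume "norm a \<le> d / 2" "x \<in> K"
    then have "mul (iv a) x \<in> cball x e" using d(2)[of a x] d(1) by (simp add: dist_commute)
    then show "mul (iv a) x \<in> \<Omega>" using e(2) \<open>x \<in> K\<close> by blast
  qed (use d in simp)
qed

text \<open>On \<open>K\<close> the horizontal gradient of the mollified u is the mollified w: the
  derivative falls on the kernel, and the weak identity tested with the kernel replaces u by w.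
  Hence the gradients converge in L^p; almost everywhere convergence is reached along a
  subsequence.\<close>

lemma C1_approximation:
  fixes w :: "real^'n \<Rightarrow> real^'n"
  assumes \<Omega>: "open \<Omega>" and K: "compact K" "K \<subseteq> \<Omega>" and p: "1 < p"
    and u[measurable]: "u \<in> borel_measurable borel" and u0: "\<And>x. 0 \<le> u x"
    and w[measurable]: "w \<in> borel_measurable borel"
    and uL: "\<And>K. compact K \<Longrightarrow> K \<subseteq> \<Omega> \<Longrightarrow> (\<integral>\<^sup>+x. ennreal (\<bar>u x\<bar> powr p) * indicator K x \<partial>lborel) < \<infinity>"
    and wL: "\<And>K. compact K \<Longrightarrow> K \<subseteq> \<Omega> \<Longrightarrow> (\<integral>\<^sup>+x. ennreal (norm (w x) powr p) * indicator K x \<partial>lborel) < \<infinity>"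
    and X: "\<And>i. X i = Y (axis i 1) \<or> X i = (\<lambda>x. 0)"
    and weak: "\<And>i \<phi>. \<phi> \<in> C1_0 \<Omega> \<Longrightarrow> (\<integral>x. indicator \<Omega> x * (u x * formal_adjoint (X i) \<phi> x) \<partial>lborel) =
       (\<integral>x. indicator \<Omega> x * (w x $ i * \<phi> x) \<partial>lborel)"
  obtains U where "\<And>n. \<exists>D. C1_deriv (U n) D" "\<And>n x. 0 \<le> U n x"
    "AE x in lborel. x \<in> K \<longrightarrow> (\<lambda>n. U n x) \<longlonglongrightarrow> u x"
    "\<And>i. (\<lambda>n::nat. \<integral>\<^sup>+x. ennreal (\<bar>hgrad X (U n) x $ i - w x $ i\<bar> powr p) * indicator K x \<partial>lborel) \<longlonglongrightarrow> 0"
proof -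
  obtain \<delta> where \<delta>: "\<delta> > 0" "\<And>a x. norm a \<le> \<delta> \<Longrightarrow> x \<in> K \<Longrightarrow> mul (iv a) x \<in> \<Omega>"
    by (rule left_translate_compact_in_open[OF K \<Omega>]) (rule that)
  \<comment> \<open>All points a^-1 \<circ> x with |a| \<le> \<delta> and x in \<open>K\<close>.
    Mollification on \<open>K\<close> sees u and w only there, so both may be cut off by the
    indicator of \<open>C\<close>, which makes them integrable on the whole space.\<close>
  define C where "C = (\<lambda>(a, x). mul (iv a) x) ` (cball 0 \<delta> \<times> K)"
  have C: "compact C" unfolding C_def using K
    by (intro compact_continuous_image compact_Times) (auto simp: case_prod_unfold intro!: continuous_intros)
  have C\<Omega>: "C \<subseteq> \<Omega>" using \<delta> by (auto simp: C_def)
  have KC: "K \<subseteq> C"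
  proof
    fix x assume "x \<in> K"
    then show "x \<in> C" unfolding C_def using \<delta>(1) by (intro image_eqI[of _ _ "(0, x)"]) auto
  qed
  have [measurable]: "C \<in> sets borel" "K \<in> sets borel" using C K by (auto intro: borel_compact)
  define e where "e n = \<delta> * inverse (real (Suc n))" for n
  have e: "e n > 0" "e n \<le> \<delta>" for n using \<delta>(1) by (auto simp: e_def field_simps)
  have elim: "e \<longlonglongrightarrow> 0" unfolding e_def using tendsto_mult_left[OF LIMSEQ_inverse_real_of_nat, of \<delta>] by simp
  have "\<exists>\<rho>. mollifier (e n) \<rho>" for n using mollifier_exists[OF e(1)] by metis
  then obtain \<rho> where \<rho>: "\<And>n. mollifier (e n) (\<rho> n)" by metis
  define uC where "uC x = u x * indicator C x" for x
  define wC where "wC i x = w x $ i * indicator C x" for i x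
  have [measurable]: "(\<lambda>x. w x $ i) \<in> borel_measurable borel" for i
    using borel_measurable_continuous_onI[OF continuous_on_component[of UNIV "\<lambda>x::real^'n. x" i]] by measurable
  have [measurable]: "uC \<in> borel_measurable borel" "wC i \<in> borel_measurable borel" for i
    unfolding uC_def wC_def by measurable
  have uCz: "\<And>x. x \<notin> C \<Longrightarrow> uC x = 0" and wCz: "\<And>i x. x \<notin> C \<Longrightarrow> wC i x = 0" by (auto simp: uC_def wC_def)
  have uCf: "(\<integral>\<^sup>+x. ennreal (\<bar>uC x\<bar> powr p) \<partial>lborel) < \<infinity>"
  proof -
    have "(\<lambda>x. ennreal (\<bar>uC x\<bar> powr p)) = (\<lambda>x. ennreal (\<bar>u x\<bar> powr p) * indicator C x)"
      using p by (auto simp: uC_def fun_eq_iff indicator_def)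
    then show ?thesis using uL[OF C C\<Omega>] by simp
  qed
  have wCf: "(\<integral>\<^sup>+x. ennreal (\<bar>wC i x\<bar> powr p) \<partial>lborel) < \<infinity>" for i
  proof -
    have "(\<integral>\<^sup>+x. ennreal (\<bar>wC i x\<bar> powr p) \<partial>lborel) \<le> (\<integral>\<^sup>+x. ennreal (norm (w x) powr p) * indicator C x \<partial>lborel)"
      using p component_le_norm_cart[of "w _" i] by (intro nn_integral_mono) (auto simp: wC_def indicator_def intro!: ennreal_leI powr_mono2)
    then show ?thesis using wL[OF C C\<Omega>] by (rule le_less_trans)
  qed
  have uCi: "integrable lborel uC" by (rule integrable_of_Lp[OF _ C uCz _ uCf]) (use p in auto)
  have wCi: "integrable lborel (wC i)" for i by (rule integrable_of_Lp[OF _ C wCz _ wCf]) (use p in auto)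
  define U0 where "U0 n = moll (\<rho> n) uC" for n
  have grad: "hgrad X (U0 n) x $ i = moll (\<rho> n) (wC i) x" if x: "x \<in> K" for n x i
  proof -
    obtain D where D: "C1_deriv (moll (\<rho> n) uC) D"
      "\<And>x j. blinfun_apply (D x) (Y (axis j 1) x) = (\<integral>y. formal_adjoint (Y (axis j 1)) (\<lambda>y. \<rho> n (mul x (iv y))) y * uC y \<partial>lborel)"
      by (rule moll_C1[OF \<rho> C uCi uCz]) (assumption, rule that)
    note D = D[folded U0_def]
    let ?\<phi> = "\<lambda>y. \<rho> n (mul x (iv y))"
    obtain \<rho>' where \<rho>': "C1_deriv (\<rho> n) \<rho>'" using mollifier_C1[OF \<rho>] by metis
    obtain k' where k': "C1_deriv (\<lambda>z. \<rho> n (mul (fst z) (iv (snd z)))) k'" 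
      by (rule kernel_deriv[OF \<rho>']) (rule that)
    obtain E where "C1_deriv (\<lambda>y. \<rho> n (mul (fst (x, y)) (iv (snd (x, y))))) E"
      by (rule C1_deriv_section_snd[OF k', of x]) (rule that)
    then have E: "C1_deriv ?\<phi> E" by simp
    have \<phi>z: "?\<phi> y = 0" if "y \<notin> C" for y
    proof (rule ccontr)
      assume *: "?\<phi> y \<noteq> 0"
      have "norm (mul x (iv y)) \<le> \<delta>" using mollifierD(2)[OF \<rho> *] e(2)[of n] by simp
      moreover have "y = mul (iv (mul x (iv y))) x" by (simp add: iv_mul assoc)
      ultimately have "y \<in> C" unfolding C_def using x by (intro image_eqI[of _ _ "(mul x (iv y), x)"]) auto
      then show False using that by simp
    qed
    have \<phi>: "?\<phi> \<in> C1_0 \<Omega>" by (rule C1_deriv_imp_C1_0[OF E C C\<Omega> \<phi>z])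
    have "hgrad X (U0 n) x $ i = (\<integral>y. formal_adjoint (X i) ?\<phi> y * uC y \<partial>lborel)"
      using X[of i] by (auto simp: hgrad_nth_C1[OF D(1)] D(2) formal_adjoint_zero)
    also have "\<dots> = (\<integral>y. indicator \<Omega> y * (u y * formal_adjoint (X i) ?\<phi> y) \<partial>lborel)"
    proof (intro Bochner_Integration.integral_cong refl)
      fix y
      have "formal_adjoint (X i) ?\<phi> y = 0" if "y \<notin> C"
        using X[of i] formal_adjoint_Y[OF E] C1_deriv_zero_off_compact[OF E C \<phi>z that] by (auto simp: formal_adjoint_zero)
      then show "formal_adjoint (X i) ?\<phi> y * uC y = indicator \<Omega> y * (u y * formal_adjoint (X i) ?\<phi> y)"
        using C\<Omega> by (cases "y \<in> C") (auto simp: uC_def)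
    qed
    also have "\<dots> = (\<integral>y. indicator \<Omega> y * (w y $ i * ?\<phi> y) \<partial>lborel)" by (rule weak[OF \<phi>])
    also have "\<dots> = moll (\<rho> n) (wC i) x" unfolding moll_def
    proof (intro Bochner_Integration.integral_cong refl)
      fix y show "indicator \<Omega> y * (w y $ i * ?\<phi> y) = ?\<phi> y * wC i y"
        using C\<Omega> \<phi>z[of y] by (cases "y \<in> C") (auto simp: wC_def)
    qed
    finally show ?thesis .
  qed
  have gradlim: "(\<lambda>n. \<integral>\<^sup>+x. ennreal (\<bar>hgrad X (U0 n) x $ i - w x $ i\<bar> powr p) * indicator K x \<partial>lborel) \<longlonglongrightarrow> 0" for i
  proof -
    have "(\<integral>\<^sup>+x. ennreal (\<bar>hgrad X (U0 n) x $ i - w x $ i\<bar> powr p) * indicator K x \<partial>lborel)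
      = (\<integral>\<^sup>+x. ennreal (\<bar>moll (\<rho> n) (wC i) x - wC i x\<bar> powr p) * indicator K x \<partial>lborel)" for n
      using KC by (intro nn_integral_cong) (auto simp: indicator_def grad wC_def)
    then show ?thesis using moll_tendsto[OF _ C wCz p wCf K(1) \<rho> elim] by simp
  qed
  define f where "f n x = \<bar>U0 n x - uC x\<bar> powr p * indicator K x" for n x
  have U0c: "\<exists>D. C1_deriv (U0 n) D" for n
    unfolding U0_def using moll_C1[OF \<rho> C uCi uCz] by metis
  have [measurable]: "U0 n \<in> borel_measurable borel" for n
    using U0c[of n] C1_deriv_imp_continuous borel_measurable_continuous_onI by metis
  have [measurable]: "f n \<in> borel_measurable borel" for n unfolding f_def by measurable
  have fe: "ennreal (norm (f n x)) = ennreal (\<bar>moll (\<rho> n) uC x - uC x\<bar> powr p) * indicator K x" for n x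
    by (auto simp: f_def U0_def indicator_def)
  have flim: "(\<lambda>n. \<integral>\<^sup>+x. ennreal (norm (f n x)) \<partial>lborel) \<longlonglongrightarrow> 0"
    unfolding fe by (rule moll_tendsto[OF _ C uCz p uCf K(1) \<rho> elim]) auto
  then have "\<forall>\<^sub>F n in sequentially. (\<integral>\<^sup>+x. ennreal (norm (f n x)) \<partial>lborel) < 1"
    by (rule order_tendstoD) simp
  then obtain N where N: "\<And>n. n \<ge> N \<Longrightarrow> (\<integral>\<^sup>+x. ennreal (norm (f n x)) \<partial>lborel) < 1"
    by (auto simp: eventually_sequentially)
  \<comment> \<open>The L^1 norms are known to be finite only from the index \<open>N\<close> on, so
    the sequence is shifted before a subsequence converging almost everywhere is extracted.\<close>
  have fi: "integrable lborel (f (n + N))" for n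
    by (rule integrableI_bounded) (use N[of "n + N"] in \<open>auto intro: less_trans[OF _ ennreal_one_less_top]\<close>)
  have "(\<lambda>n. ennreal (\<integral>x. norm (f (n + N) x) \<partial>lborel)) \<longlonglongrightarrow> ennreal 0"
    using LIMSEQ_ignore_initial_segment[OF flim, of N] fi by (simp add: nn_integral_eq_integral)
  then have "(\<lambda>n. \<integral>x. norm (f (n + N) x) \<partial>lborel) \<longlonglongrightarrow> 0"
    by (subst (asm) tendsto_ennreal_iff) auto
  from tendsto_L1_AE_subseq[OF fi this]
  obtain r where r: "strict_mono r" "AE x in lborel. (\<lambda>n. f (r n + N) x) \<longlonglongrightarrow> 0" by blast
  have sm: "strict_mono (\<lambda>n. r n + N)" using r(1) by (simp add: strict_mono_def)
  show ?thesis
  proof (rule that[of "\<lambda>n. U0 (r n + N)"])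
    show "\<exists>D. C1_deriv (U0 (r n + N)) D" for n by (rule U0c)
    show "0 \<le> U0 (r n + N) x" for n x
      unfolding U0_def moll_def using mollifierD(1)[OF \<rho>] u0 by (intro Bochner_Integration.integral_nonneg) (auto simp: uC_def)
    show "AE x in lborel. x \<in> K \<longrightarrow> (\<lambda>n. U0 (r n + N) x) \<longlonglongrightarrow> u x"
      using r(2)
    proof eventually_elim
      case (elim x)
      show ?case
      proof
        assume x: "x \<in> K"
        have "(\<lambda>n. \<bar>U0 (r n + N) x - u x\<bar> powr p) \<longlonglongrightarrow> 0"
          using elim x KC by (auto simp: f_def uC_def)
        then have "(\<lambda>n. (\<bar>U0 (r n + N) x - u x\<bar> powr p) powr (1 / p)) \<longlonglongrightarrow> 0 powr (1 / p)"
          using p by (intro tendsto_powr') auto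
        then have "(\<lambda>n. \<bar>U0 (r n + N) x - u x\<bar>) \<longlonglongrightarrow> 0" using p by (simp add: powr_powr)
        then show "(\<lambda>n. U0 (r n + N) x) \<longlonglongrightarrow> u x"
          by (simp add: tendsto_rabs_zero_iff LIM_zero_iff)
      qed
    qed
    show "(\<lambda>n. \<integral>\<^sup>+x. ennreal (\<bar>hgrad X (U0 (r n + N)) x $ i - w x $ i\<bar> powr p) * indicator K x \<partial>lborel) \<longlonglongrightarrow> 0" for i
      using LIMSEQ_subseq_LIMSEQ[OF gradlim sm] by (simp add: comp_def)
  qed
qed

end

section \<open>Energy estimates\<close>

lemma tendsto_epowr_0:
  assumes f: "(f \<longlongrightarrow> 0) F" and s: "0 < s"
  shows "((\<lambda>n. f n epowr s) \<longlongrightarrow> 0) F"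
proof (rule tendsto_0_ennrealI)
  fix r :: real assume r: "r > 0"
  have "\<forall>\<^sub>F n in F. f n < ennreal (r powr (1 / s))" using f by (rule order_tendstoD) (use r in auto)
  then show "\<forall>\<^sub>F n in F. f n epowr s \<le> ennreal r"
  proof eventually_elim
    case (elim n)
    then have "f n epowr s \<le> ennreal (r powr (1 / s)) epowr s" using s by (intro epowr_mono) auto
    also have "\<dots> = ennreal r" using r s by (simp add: epowr_ennreal powr_powr)
    finally show ?case .
  qed
qed

lemma continuous_hgrad:
  assumes X: "\<And>i. continuous_on UNIV (X i)" and \<phi>: "C1_deriv \<phi> \<phi>'"
  shows "continuous_on UNIV (hgrad X \<phi>)"
proof -
  have "hgrad X \<phi> = (\<lambda>x. \<chi> i. blinfun_apply (\<phi>' x) (X i x))"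
    by (simp add: hgrad_def C1_deriv_frechet[OF \<phi>] fun_eq_iff)
  then show ?thesis using C1_deriv_cont[OF \<phi>] X by (auto intro!: continuous_intros)
qed

text \<open>Borel representatives on the whole space, with u and h nonnegative everywhere; w stands
  for the weak horizontal gradient. Apart from continuity of the fields,
  \<open>approximation\<close> is what the energy estimates take from the group structure.\<close>

locale supersolution =
  fixes X :: "'n::finite \<Rightarrow> real^'n \<Rightarrow> real^'n" and \<Omega> :: "(real^'n) set" and p :: real
    and u h :: "real^'n \<Rightarrow> real" and w :: "real^'n \<Rightarrow> real^'n"
  assumes open_domain: "open \<Omega>" and p: "1 < p"
    and X_cont: "\<And>i. continuous_on UNIV (X i)"
    and u_meas [measurable]: "u \<in> borel_measurable borel" and u_nonneg: "\<And>x. 0 \<le> u x"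
    and h_meas [measurable]: "h \<in> borel_measurable borel" and h_nonneg: "\<And>x. 0 \<le> h x"
    and w_meas [measurable]: "w \<in> borel_measurable borel"
    and u_Lp: "\<And>K. compact K \<Longrightarrow> K \<subseteq> \<Omega> \<Longrightarrow> (\<integral>\<^sup>+x. ennreal (\<bar>u x\<bar> powr p) * indicator K x \<partial>lborel) < \<infinity>"
    and w_Lp: "\<And>K. compact K \<Longrightarrow> K \<subseteq> \<Omega> \<Longrightarrow> (\<integral>\<^sup>+x. ennreal (norm (w x) powr p) * indicator K x \<partial>lborel) < \<infinity>"
    and h_L1: "\<And>K. compact K \<Longrightarrow> K \<subseteq> \<Omega> \<Longrightarrow> (\<integral>\<^sup>+x. ennreal (h x) * indicator K x \<partial>lborel) < \<infinity>"
    and weak: "\<And>\<phi>. \<phi> \<in> nonneg_tests \<Omega> \<Longrightarrow>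
      (\<integral>x. indicator \<Omega> x * (h x * \<phi> x) \<partial>lborel) \<le>
      (\<integral>x. indicator \<Omega> x * (norm (w x) powr (p - 2) * (w x \<bullet> hgrad X \<phi> x)) \<partial>lborel)"
    and approximation: "\<And>K. compact K \<Longrightarrow> K \<subseteq> \<Omega> \<Longrightarrow> \<exists>U. (\<forall>n. \<exists>D. C1_deriv (U n) D) \<and> (\<forall>n x. 0 \<le> U n x) \<and>
      (AE x in lborel. x \<in> K \<longrightarrow> (\<lambda>n. U n x) \<longlonglongrightarrow> u x) \<and>
      (\<forall>i. (\<lambda>n::nat. \<integral>\<^sup>+x. ennreal (\<bar>hgrad X (U n) x $ i - w x $ i\<bar> powr p) * indicator K x \<partial>lborel) \<longlonglongrightarrow> 0)"
begin

lemma hgrad_cont: "C1_deriv \<phi> \<phi>' \<Longrightarrow> continuous_on UNIV (hgrad X \<phi>)"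
  by (rule continuous_hgrad) (rule X_cont)

lemma test_facts:
  assumes "\<phi> \<in> nonneg_tests \<Omega>"
  obtains \<phi>' K B where "C1_deriv \<phi> \<phi>'" "compact K" "K \<subseteq> \<Omega>" "\<And>x. x \<notin> K \<Longrightarrow> \<phi> x = 0" "\<And>x. 0 \<le> \<phi> x" "\<And>x. \<phi> x \<le> B"
    "\<And>x. norm (hgrad X \<phi> x) \<le> B" "\<And>x. \<phi> x = 0 \<Longrightarrow> hgrad X \<phi> x = 0" "0 \<le> B"
proof -
  from assms have C1: "\<phi> \<in> C1_0 \<Omega>" and pos: "\<And>x. 0 \<le> \<phi> x" by (auto simp: nonneg_tests_def)
  obtain \<phi>' where \<phi>': "C1_deriv \<phi> \<phi>'" using C1_0_imp_C1_deriv[OF C1 open_domain] .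
  from C1 obtain K where K: "compact K" "K \<subseteq> \<Omega>" "\<And>x. x \<notin> K \<Longrightarrow> \<phi> x = 0" by (auto simp: C1_0_def)
  have g0: "hgrad X \<phi> x = 0" if "\<phi> x = 0" for x
    using C1_deriv_zero_at_min[OF \<phi>' pos that] by (simp add: vec_eq_iff hgrad_nth_C1[OF \<phi>'])
  have "bounded (\<phi> ` K)" "bounded (hgrad X \<phi> ` K)"
    using K(1) C1_deriv_imp_continuous[OF \<phi>'] hgrad_cont[OF \<phi>']
    by (meson compact_continuous_image compact_imp_bounded continuous_on_subset subset_UNIV)+
  then obtain B1 B2 where B: "\<And>x. x \<in> K \<Longrightarrow> \<bar>\<phi> x\<bar> \<le> B1" "\<And>x. x \<in> K \<Longrightarrow> norm (hgrad X \<phi> x) \<le> B2"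
    by (auto simp: bounded_iff)
  define B where "B = max 0 (max B1 B2)"
  have BK: "\<bar>\<phi> x\<bar> \<le> B" "norm (hgrad X \<phi> x) \<le> B" for x
  proof -
    have "\<bar>\<phi> x\<bar> \<le> B \<and> norm (hgrad X \<phi> x) \<le> B"
    proof (cases "x \<in> K")
      case True then show ?thesis using B[OF True] by (auto simp: B_def)
    next
      case False then show ?thesis using K(3)[OF False] g0[OF K(3)[OF False]] by (simp add: B_def)
    qed
    then show "\<bar>\<phi> x\<bar> \<le> B" "norm (hgrad X \<phi> x) \<le> B" by auto
  qed
  show ?thesis
  proof (rule that[OF \<phi>' K pos])
    show "\<phi> x \<le> B" for x using BK(1)[of x] by linarith
  qed (use BK g0 in \<open>auto simp: B_def\<close>)
qed

lemma hgrad_meas: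
  assumes "C1_deriv \<phi> \<phi>'"
  shows "hgrad X \<phi> \<in> borel_measurable borel" "\<phi> \<in> borel_measurable borel"
  using hgrad_cont[OF assms] C1_deriv_imp_continuous[OF assms] borel_measurable_continuous_onI by auto

lemma w_nth_meas [measurable]: "(\<lambda>x. w x $ i) \<in> borel_measurable borel"
  using borel_measurable_continuous_onI[OF continuous_on_component[of UNIV "\<lambda>x::real^'n. x" i]] by measurable

lemma integrable_on_compact:
  assumes K: "compact K" "K \<subseteq> \<Omega>"
  shows "integrable lborel (\<lambda>x. norm (w x) powr p * indicator K x)"
    "integrable lborel (\<lambda>x. norm (w x) powr (p - 1) * indicator K x)"
    "integrable lborel (\<lambda>x. h x * indicator K x)"
proof -
  have [measurable]: "K \<in> sets borel" using K by (simp add: borel_compact)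
  have 1: "ennreal (norm (f x * indicator K x)) = ennreal (f x) * indicator K x" if "\<And>x. 0 \<le> f x" for f :: "real^'n \<Rightarrow> real" and x
    using that[of x] by (auto simp: indicator_def)
  show i1: "integrable lborel (\<lambda>x. norm (w x) powr p * indicator K x)"
  proof (rule integrableI_bounded)
    show "(\<integral>\<^sup>+x. ennreal (norm (norm (w x) powr p * indicator K x)) \<partial>lborel) < \<infinity>"
      unfolding 1[of "\<lambda>x. norm (w x) powr p", OF powr_ge_zero] by (rule w_Lp[OF K])
  qed measurable
  show "integrable lborel (\<lambda>x. h x * indicator K x)"
  proof (rule integrableI_bounded)
    show "(\<integral>\<^sup>+x. ennreal (norm (h x * indicator K x)) \<partial>lborel) < \<infinity>"
      unfolding 1[of h, OF h_nonneg] by (rule h_L1[OF K])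
  qed measurable
  have "integrable lborel (\<lambda>x. indicator K x + norm (w x) powr p * indicator K x)"
    using i1 integrable_indicator_compact[OF K(1)] by (intro Bochner_Integration.integrable_add)
  then show "integrable lborel (\<lambda>x. norm (w x) powr (p - 1) * indicator K x)"
  proof (rule Bochner_Integration.integrable_bound)
    have "norm (w x) powr (p - 1) \<le> 1 + norm (w x) powr p" for x
    proof (cases "norm (w x) \<le> 1")
      case True
      then have "norm (w x) powr (p - 1) \<le> 1 powr (p - 1)" using p by (intro powr_mono2) auto
      then show ?thesis by (simp add: add_increasing2)
    next
      case False
      then have "norm (w x) powr (p - 1) \<le> norm (w x) powr p" by (intro powr_mono) auto
      then show ?thesis by simp
    qed
    then show "AE x in lborel. norm (norm (w x) powr (p - 1) * indicator K x) \<le> norm (indicator K x + norm (w x) powr p * indicator K x)"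
      by (auto simp: indicator_def intro!: AE_I2)
  qed measurable
qed

lemma powr_shift_le:
  fixes l t \<alpha> :: real
  assumes "l > 0" "0 \<le> t" "\<alpha> < 0"
  shows "(t + l) powr \<alpha> \<le> l powr \<alpha>"
  using assms by (intro powr_mono2') auto

lemma flux_inner: "norm (w x) powr (p - 2) * (w x \<bullet> w x) = norm (w x) powr p"
proof (cases "w x = 0")
  case False
  have "norm (w x) powr p = norm (w x) powr (p - 2) * norm (w x) powr 2"
    using powr_add[of "norm (w x)" "p - 2" 2] by simp
  then show ?thesis using False by (simp add: power2_norm_eq_inner)
qed simp

lemma flux_bound: "\<bar>norm (w x) powr (p - 2) * (w x \<bullet> v)\<bar> \<le> norm (w x) powr (p - 1) * norm v"
proof (cases "w x = 0")
  case False
  have "\<bar>norm (w x) powr (p - 2) * (w x \<bullet> v)\<bar> \<le> norm (w x) powr (p - 2) * (norm (w x) * norm v)"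
    unfolding abs_mult using Cauchy_Schwarz_ineq2[of "w x" v] by (simp add: mult_left_mono)
  also have "\<dots> = norm (w x) powr (p - 1) * norm v"
  proof -
    have "norm (w x) powr (p - 1) = norm (w x) powr (p - 2) * norm (w x)"
      using powr_add[of "norm (w x)" "p - 2" 1] by simp
    then show ?thesis by (simp add: mult.assoc)
  qed
  finally show ?thesis .
qed simp

text \<open>Hoelder for |w|^(p-1), which lies in L^q on \<open>K\<close> because (p - 1) q = p,
  against each component of the gradient error, which tends to 0 in L^p.\<close>

lemma error_term_tendsto:
  assumes K: "compact K" "K \<subseteq> \<Omega>" and U: "\<And>n. \<exists>D. C1_deriv (U n) D"
    and lim: "\<And>i. (\<lambda>n::nat. \<integral>\<^sup>+x. ennreal (\<bar>hgrad X (U n) x $ i - w x $ i\<bar> powr p) * indicator K x \<partial>lborel) \<longlonglongrightarrow> 0"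
  shows "(\<lambda>n. \<integral>\<^sup>+x. ennreal (norm (w x) powr (p - 1) * norm (hgrad X (U n) x - w x)) * indicator K x \<partial>lborel) \<longlonglongrightarrow> 0"
proof -
  define q where "q = p / (p - 1)"
  have q: "q > 1" "(p - 1) * q = p" using p by (auto simp: q_def)
  have [measurable]: "K \<in> sets borel" using K by (simp add: borel_compact)
  have [measurable]: "hgrad X (U n) \<in> borel_measurable borel" for n using U[of n] hgrad_meas by blast
  have [measurable]: "(\<lambda>x. hgrad X (U n) x $ i) \<in> borel_measurable borel" for i n
    using borel_measurable_continuous_onI[OF continuous_on_component[of UNIV "\<lambda>x::real^'n. x" i]] by measurable
  define W where "W = (\<integral>\<^sup>+x. ennreal (norm (w x) powr p) * indicator K x \<partial>lborel)"
  define E where "E i n = (\<integral>\<^sup>+x. ennreal (\<bar>hgrad X (U n) x $ i - w x $ i\<bar> powr p) * indicator K x \<partial>lborel)" for i n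
  have "W epowr (1 / q) < \<infinity>" using w_Lp[OF K] q unfolding W_def[symmetric]
    by (cases W rule: ennreal_cases) (auto simp: epowr_ennreal_nonneg)
  then have t: "(\<lambda>n. \<Sum>i\<in>UNIV. W epowr (1 / q) * E i n epowr (1 / p)) \<longlonglongrightarrow> (\<Sum>i\<in>(UNIV::'n set). W epowr (1 / q) * 0)"
    using lim p unfolding E_def[symmetric]
    by (intro tendsto_sum ennreal_tendsto_cmult tendsto_epowr_0) auto
  have "(\<integral>\<^sup>+x. ennreal (norm (w x) powr (p - 1) * norm (hgrad X (U n) x - w x)) * indicator K x \<partial>lborel)
      \<le> (\<Sum>i\<in>UNIV. W epowr (1 / q) * E i n epowr (1 / p))" for n
  proof -
    let ?d = "\<lambda>i x. \<bar>hgrad X (U n) x $ i - w x $ i\<bar>"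
    have "(\<integral>\<^sup>+x. ennreal (norm (w x) powr (p - 1) * norm (hgrad X (U n) x - w x)) * indicator K x \<partial>lborel)
      \<le> (\<integral>\<^sup>+x. (\<Sum>i\<in>UNIV. (ennreal (norm (w x) powr (p - 1)) * indicator K x) * (ennreal (?d i x) * indicator K x)) \<partial>lborel)"
    proof (rule nn_integral_mono)
      fix x
      have "norm (hgrad X (U n) x - w x) \<le> (\<Sum>i\<in>UNIV. ?d i x)"
        using norm_le_l1_cart[of "hgrad X (U n) x - w x"] by simp
      then have "norm (w x) powr (p - 1) * norm (hgrad X (U n) x - w x) \<le> (\<Sum>i\<in>UNIV. norm (w x) powr (p - 1) * ?d i x)"
        unfolding sum_distrib_left[symmetric] by (intro mult_left_mono) auto
      then have "ennreal (norm (w x) powr (p - 1) * norm (hgrad X (U n) x - w x)) \<le> (\<Sum>i\<in>UNIV. ennreal (norm (w x) powr (p - 1)) * ennreal (?d i x))"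
        by (simp add: ennreal_mult[symmetric] sum_ennreal ennreal_leI)
      then show "ennreal (norm (w x) powr (p - 1) * norm (hgrad X (U n) x - w x)) * indicator K x \<le>
        (\<Sum>i\<in>UNIV. (ennreal (norm (w x) powr (p - 1)) * indicator K x) * (ennreal (?d i x) * indicator K x))"
        by (auto simp: indicator_def)
    qed
    also have "\<dots> = (\<Sum>i\<in>UNIV. \<integral>\<^sup>+x. (ennreal (norm (w x) powr (p - 1)) * indicator K x) * (ennreal (?d i x) * indicator K x) \<partial>lborel)"
      by (rule nn_integral_sum) measurable
    also have "\<dots> \<le> (\<Sum>i\<in>UNIV. W epowr (1 / q) * E i n epowr (1 / p))"
    proof (rule sum_mono)
      fix i
      have pq: "p = q / (q - 1)" using p q by (auto simp: q_def field_simps)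
      have "(\<integral>\<^sup>+x. (ennreal (norm (w x) powr (p - 1)) * indicator K x) * (ennreal (?d i x) * indicator K x) \<partial>lborel)
        \<le> (\<integral>\<^sup>+x. (ennreal (norm (w x) powr (p - 1)) * indicator K x) epowr q \<partial>lborel) epowr (1 / q) *
          (\<integral>\<^sup>+x. (ennreal (?d i x) * indicator K x) epowr p \<partial>lborel) epowr (1 / p)"
        by (rule nn_integral_Hoelder[OF q(1) pq]) measurable
      also have "(\<integral>\<^sup>+x. (ennreal (norm (w x) powr (p - 1)) * indicator K x) epowr q \<partial>lborel) = W"
        unfolding W_def using q p by (intro nn_integral_cong) (auto simp: indicator_def zero_epowr epowr_ennreal_nonneg powr_powr)
      also have "(\<integral>\<^sup>+x. (ennreal (?d i x) * indicator K x) epowr p \<partial>lborel) = E i n"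
        unfolding E_def using p by (intro nn_integral_cong) (auto simp: indicator_def zero_epowr epowr_ennreal_nonneg)
      finally show "(\<integral>\<^sup>+x. (ennreal (norm (w x) powr (p - 1)) * indicator K x) * (ennreal (?d i x) * indicator K x) \<partial>lborel)
        \<le> W epowr (1 / q) * E i n epowr (1 / p)" .
    qed
    finally show ?thesis .
  qed
  then show ?thesis
    by (intro tendsto_sandwich[OF _ _ tendsto_const t[simplified]] always_eventually allI) auto
qed

lemma hgrad_product:
  assumes \<phi>: "C1_deriv \<phi> \<phi>'" and U: "C1_deriv U U'" and U0: "\<And>x. 0 \<le> U x" and l: "l > 0"
  shows "\<exists>D. C1_deriv (\<lambda>x. \<phi> x * (U x + l) powr \<alpha>) D"
    "hgrad X (\<lambda>x. \<phi> x * (U x + l) powr \<alpha>) x =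
       (U x + l) powr \<alpha> *\<^sub>R hgrad X \<phi> x + (\<phi> x * (\<alpha> * (U x + l) powr (\<alpha> - 1))) *\<^sub>R hgrad X U x"
proof -
  have pos: "U x + l > 0" for x using U0[of x] l by simp
  have P: "C1_deriv (\<lambda>x. (U x + l) powr \<alpha>) (\<lambda>x. (\<alpha> * (U x + l) powr (\<alpha> - 1)) *\<^sub>R U' x)"
  proof (rule C1_deriv_real_compose[OF U, where F="\<lambda>t. (t + l) powr \<alpha>" and F'="\<lambda>t. \<alpha> * (t + l) powr (\<alpha> - 1)"])
    show "((\<lambda>t. (t + l) powr \<alpha>) has_real_derivative \<alpha> * (U x + l) powr (\<alpha> - 1)) (at (U x))" for x
      using pos[of x] by (auto intro!: derivative_eq_intros)
    have "U x + l \<noteq> 0" for x using pos[of x] by simp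
    then show "continuous_on UNIV (\<lambda>x. \<alpha> * (U x + l) powr (\<alpha> - 1))"
      using C1_deriv_imp_continuous[OF U] by (intro continuous_intros) auto
  qed
  note M = C1_deriv_mult[OF \<phi> P]
  then show "\<exists>D. C1_deriv (\<lambda>x. \<phi> x * (U x + l) powr \<alpha>) D" by blast
  show "hgrad X (\<lambda>x. \<phi> x * (U x + l) powr \<alpha>) x =
       (U x + l) powr \<alpha> *\<^sub>R hgrad X \<phi> x + (\<phi> x * (\<alpha> * (U x + l) powr (\<alpha> - 1))) *\<^sub>R hgrad X U x"
    by (simp add: vec_eq_iff hgrad_nth_C1[OF M] hgrad_nth_C1[OF \<phi>] hgrad_nth_C1[OF U] plus_blinfun.rep_eq scaleR_blinfun.rep_eq)
qed

text \<open>Testing with \<phi> (U_n + l)^\<alpha> splits the flux into three parts: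
  \<open>A\<close> with the gradient of \<phi>, \<open>D\<close> with w in place of the gradient of
  U_n, and \<open>R\<close>, the error of that replacement. As \<alpha> < 0 and U_n + l \<ge> l, the
  powers are bounded by powers of l, so \<open>A\<close>, \<open>D\<close> and the source term
  \<open>H\<close> converge by dominated convergence, while \<open>R\<close> tends to 0. The limit
  of \<open>D\<close> carries the factor \<alpha> and changes side.\<close>

lemma energy_shifted:
  assumes \<phi>: "\<phi> \<in> nonneg_tests \<Omega>" and l: "l > 0" and \<alpha>: "\<alpha> < 0"
  shows "(\<integral>\<^sup>+x. ennreal (h x * (u x + l) powr \<alpha> * \<phi> x) \<partial>lborel)
      + ennreal (- \<alpha>) * (\<integral>\<^sup>+x. ennreal (norm (w x) powr p * (u x + l) powr (\<alpha> - 1) * \<phi> x) \<partial>lborel)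
      \<le> (\<integral>\<^sup>+x. ennreal (norm (w x) powr (p - 1) * (u x + l) powr \<alpha> * norm (hgrad X \<phi> x)) \<partial>lborel)"
    and "(\<integral>\<^sup>+x. ennreal (norm (w x) powr p * (u x + l) powr (\<alpha> - 1) * \<phi> x) \<partial>lborel) < \<infinity>"
proof -
  obtain \<phi>' K B where \<phi>': "C1_deriv \<phi> \<phi>'" and K: "compact K" "K \<subseteq> \<Omega>" and z: "\<And>x. x \<notin> K \<Longrightarrow> \<phi> x = 0"
    and pos: "\<And>x. 0 \<le> \<phi> x" and B: "\<And>x. \<phi> x \<le> B" "\<And>x. norm (hgrad X \<phi> x) \<le> B"
    and g0: "\<And>x. \<phi> x = 0 \<Longrightarrow> hgrad X \<phi> x = 0" and B0: "0 \<le> B"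
    by (rule test_facts[OF \<phi>]) (rule that)
  have [measurable]: "K \<in> sets borel" using K by (simp add: borel_compact)
  note [measurable] = hgrad_meas[OF \<phi>']
  obtain U where U: "\<And>n. \<exists>D. C1_deriv (U n) D" and U0: "\<And>n x. 0 \<le> U n x"
    and Ulim: "AE x in lborel. x \<in> K \<longrightarrow> (\<lambda>n. U n x) \<longlonglongrightarrow> u x"
    and Ug: "\<And>i. (\<lambda>n::nat. \<integral>\<^sup>+x. ennreal (\<bar>hgrad X (U n) x $ i - w x $ i\<bar> powr p) * indicator K x \<partial>lborel) \<longlonglongrightarrow> 0"
    using approximation[OF K] by blast
  have [measurable]: "hgrad X (U n) \<in> borel_measurable borel" "U n \<in> borel_measurable borel" for n
    using U[of n] hgrad_meas by blast+
  define F where "F v x = norm (w x) powr (p - 2) * (w x \<bullet> v x)" for v x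
  have F: "\<bar>F v x\<bar> \<le> norm (w x) powr (p - 1) * norm (v x)" for v x unfolding F_def by (rule flux_bound)
  \<comment> \<open>Bounds independent of n: \<open>c0\<close> for the power with exponent \<alpha>,
    \<open>c1\<close> for \<phi> times the derivative of that power.\<close>
  define c0 where "c0 = l powr \<alpha>"
  define c1 where "c1 = - \<alpha> * (l powr (\<alpha> - 1)) * B"
  have c: "c0 \<ge> 0" "c1 \<ge> 0" using \<alpha> B0 by (auto simp: c0_def c1_def intro!: mult_nonpos_nonneg)
  have Pn: "(t + l) powr \<alpha> \<le> c0" "(t + l) powr (\<alpha> - 1) \<le> l powr (\<alpha> - 1)" if "0 \<le> t" for t
    unfolding c0_def using powr_shift_le[OF l that] \<alpha> by auto
  have coef: "\<bar>\<phi> x * (\<alpha> * (t + l) powr (\<alpha> - 1))\<bar> \<le> c1" if "0 \<le> t" for x t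
  proof -
    have "\<bar>\<phi> x * (\<alpha> * (t + l) powr (\<alpha> - 1))\<bar> = \<phi> x * (- \<alpha> * (t + l) powr (\<alpha> - 1))"
      using pos[of x] \<alpha> by (simp add: abs_mult)
    also have "\<dots> \<le> B * (- \<alpha> * l powr (\<alpha> - 1))"
      using pos[of x] B(1)[of x] \<alpha> Pn(2)[OF that] B0 by (intro mult_mono mult_nonneg_nonneg) auto
    finally show ?thesis by (simp add: c1_def mult_ac)
  qed
  define A where "A n x = (U n x + l) powr \<alpha> * F (hgrad X \<phi>) x" for n x
  define A' where "A' x = (u x + l) powr \<alpha> * F (hgrad X \<phi>) x" for x
  define D where "D n x = \<phi> x * (\<alpha> * (U n x + l) powr (\<alpha> - 1)) * F w x" for n x
  define D' where "D' x = \<phi> x * (\<alpha> * (u x + l) powr (\<alpha> - 1)) * F w x" for x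
  define R where "R n x = \<phi> x * (\<alpha> * (U n x + l) powr (\<alpha> - 1)) * F (\<lambda>x. hgrad X (U n) x - w x) x" for n x
  define H where "H n x = h x * \<phi> x * (U n x + l) powr \<alpha>" for n x
  define H' where "H' x = h x * \<phi> x * (u x + l) powr \<alpha>" for x
  have [measurable]: "F (hgrad X \<phi>) \<in> borel_measurable borel" "F w \<in> borel_measurable borel"
    "F (\<lambda>x. hgrad X (U n) x - w x) \<in> borel_measurable borel" for n
    unfolding F_def by measurable
  have [measurable]: "A n \<in> borel_measurable borel" "A' \<in> borel_measurable borel" "D n \<in> borel_measurable borel"
    "D' \<in> borel_measurable borel" "R n \<in> borel_measurable borel" "H n \<in> borel_measurable borel" "H' \<in> borel_measurable borel" for n
    unfolding A_def A'_def D_def D'_def R_def H_def H'_def by measurable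
  note ik = integrable_on_compact[OF K]
  have powlim: "AE x in lborel. x \<in> K \<longrightarrow> (\<lambda>n. (U n x + l) powr s) \<longlonglongrightarrow> (u x + l) powr s" for s
    using Ulim
  proof eventually_elim
    case (elim x)
    have "u x + l \<noteq> 0" using u_nonneg[of x] l by simp
    then show ?case using elim by (auto intro!: tendsto_intros)
  qed
  have LA: "integrable lborel A'" "\<And>n. integrable lborel (A n)" "(\<lambda>n. \<integral>x. A n x \<partial>lborel) \<longlonglongrightarrow> (\<integral>x. A' x \<partial>lborel)"
  proof -
    have 1: "AE x in lborel. (\<lambda>n. A n x) \<longlonglongrightarrow> A' x"
      using powlim[of \<alpha>]
    proof eventually_elim
      case (elim x)
      show ?case
      proof (cases "x \<in> K")
        case True then show ?thesis using elim unfolding A_def A'_def by (intro tendsto_mult_left tendsto_mult_right) auto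
      qed (simp add: A_def A'_def F_def g0[OF z])
    qed
    have 2: "AE x in lborel. norm (A n x) \<le> c0 * B * (norm (w x) powr (p - 1) * indicator K x)" for n
    proof (rule AE_I2)
      fix x
      show "norm (A n x) \<le> c0 * B * (norm (w x) powr (p - 1) * indicator K x)"
      proof (cases "x \<in> K")
        case True
        have "norm (A n x) = (U n x + l) powr \<alpha> * \<bar>F (hgrad X \<phi>) x\<bar>" by (simp add: A_def abs_mult)
        also have "\<dots> \<le> c0 * (norm (w x) powr (p - 1) * norm (hgrad X \<phi> x))"
          using Pn(1)[OF U0[of n x]] F c by (intro mult_mono) auto
        also have "\<dots> \<le> c0 * (norm (w x) powr (p - 1) * B)"
          using B(2) c by (intro mult_left_mono) auto
        finally show ?thesis using True by (simp add: mult_ac)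
      qed (simp add: A_def F_def g0[OF z])
    qed
    have 3: "integrable lborel (\<lambda>x. c0 * B * (norm (w x) powr (p - 1) * indicator K x))"
      using ik(2) by (rule integrable_mult_right)
    show "integrable lborel A'" "\<And>n. integrable lborel (A n)" "(\<lambda>n. \<integral>x. A n x \<partial>lborel) \<longlonglongrightarrow> (\<integral>x. A' x \<partial>lborel)"
      by (rule integrable_dominated_convergence[OF _ _ 3 1 2] integrable_dominated_convergence2[OF _ _ 3 1 2] integral_dominated_convergence[OF _ _ 3 1 2]; measurable)+
  qed
  have Fw: "F w x = norm (w x) powr p" for x unfolding F_def by (rule flux_inner)
  have LD: "integrable lborel D'" "\<And>n. integrable lborel (D n)" "(\<lambda>n. \<integral>x. D n x \<partial>lborel) \<longlonglongrightarrow> (\<integral>x. D' x \<partial>lborel)"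
  proof -
    have 1: "AE x in lborel. (\<lambda>n. D n x) \<longlonglongrightarrow> D' x"
      using powlim[of "\<alpha> - 1"]
    proof eventually_elim
      case (elim x)
      show ?case
      proof (cases "x \<in> K")
        case True then show ?thesis using elim unfolding D_def D'_def by (intro tendsto_mult_left tendsto_mult_right) auto
      qed (simp add: D_def D'_def z)
    qed
    have 2: "AE x in lborel. norm (D n x) \<le> c1 * (norm (w x) powr p * indicator K x)" for n
    proof (rule AE_I2)
      fix x
      show "norm (D n x) \<le> c1 * (norm (w x) powr p * indicator K x)"
        using coef[OF U0[of n x], of x] by (cases "x \<in> K") (auto simp: D_def z Fw abs_mult mult_right_mono)
    qed
    have 3: "integrable lborel (\<lambda>x. c1 * (norm (w x) powr p * indicator K x))"
      using ik(1) by (rule integrable_mult_right)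
    show "integrable lborel D'" "\<And>n. integrable lborel (D n)" "(\<lambda>n. \<integral>x. D n x \<partial>lborel) \<longlonglongrightarrow> (\<integral>x. D' x \<partial>lborel)"
      by (rule integrable_dominated_convergence[OF _ _ 3 1 2] integrable_dominated_convergence2[OF _ _ 3 1 2] integral_dominated_convergence[OF _ _ 3 1 2]; measurable)+
  qed
  have LH: "integrable lborel H'" "\<And>n. integrable lborel (H n)" "(\<lambda>n. \<integral>x. H n x \<partial>lborel) \<longlonglongrightarrow> (\<integral>x. H' x \<partial>lborel)"
  proof -
    have 1: "AE x in lborel. (\<lambda>n. H n x) \<longlonglongrightarrow> H' x"
      using powlim[of \<alpha>]
    proof eventually_elim
      case (elim x)
      show ?case
      proof (cases "x \<in> K")
        case True then show ?thesis using elim unfolding H_def H'_def by (intro tendsto_mult_left tendsto_mult_right) auto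
      qed (simp add: H_def H'_def z)
    qed
    have 2: "AE x in lborel. norm (H n x) \<le> B * c0 * (h x * indicator K x)" for n
    proof (rule AE_I2)
      fix x
      show "norm (H n x) \<le> B * c0 * (h x * indicator K x)"
      proof (cases "x \<in> K")
        case True
        have "norm (H n x) = h x * (\<phi> x * (U n x + l) powr \<alpha>)" using h_nonneg[of x] pos[of x] by (simp add: H_def abs_mult)
        also have "\<dots> \<le> h x * (B * c0)"
          using Pn(1)[OF U0[of n x]] B(1)[of x] B0 h_nonneg[of x] by (intro mult_left_mono mult_mono) auto
        finally show ?thesis using True by (simp add: mult_ac)
      qed (simp add: H_def z)
    qed
    have 3: "integrable lborel (\<lambda>x. B * c0 * (h x * indicator K x))"
      using ik(3) by (rule integrable_mult_right)
    show "integrable lborel H'" "\<And>n. integrable lborel (H n)" "(\<lambda>n. \<integral>x. H n x \<partial>lborel) \<longlonglongrightarrow> (\<integral>x. H' x \<partial>lborel)"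
      by (rule integrable_dominated_convergence[OF _ _ 3 1 2] integrable_dominated_convergence2[OF _ _ 3 1 2] integral_dominated_convergence[OF _ _ 3 1 2]; measurable)+
  qed
  have Rb: "\<bar>R n x\<bar> \<le> c1 * (norm (w x) powr (p - 1) * norm (hgrad X (U n) x - w x) * indicator K x)" for n x
  proof (cases "x \<in> K")
    case True
    have "\<bar>R n x\<bar> \<le> c1 * (norm (w x) powr (p - 1) * norm (hgrad X (U n) x - w x))"
      unfolding R_def abs_mult[of _ "F _ _"] using coef[OF U0[of n x], of x] F c by (intro mult_mono) auto
    then show ?thesis using True by simp
  qed (simp add: R_def z)
  \<comment> \<open>Needed to split the integral of the flux into three. The gradient of
    \<open>U n\<close> is bounded on \<open>K\<close>, with a bound that may depend on n.\<close>
  have Ri: "integrable lborel (R n)" for n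
  proof -
    obtain U' where U': "C1_deriv (U n) U'" using U by blast
    have "bounded (hgrad X (U n) ` K)" 
      using K(1) hgrad_cont[OF U'] by (meson compact_continuous_image compact_imp_bounded continuous_on_subset subset_UNIV)
    then obtain b where b: "\<And>x. x \<in> K \<Longrightarrow> norm (hgrad X (U n) x) \<le> b" by (auto simp: bounded_iff)
    have "integrable lborel (\<lambda>x. c1 * (b * (norm (w x) powr (p - 1) * indicator K x) + norm (w x) powr p * indicator K x))"
      using ik by (intro integrable_mult_right Bochner_Integration.integrable_add) auto
    then show ?thesis
    proof (rule Bochner_Integration.integrable_bound)
      show "AE x in lborel. norm (R n x) \<le> norm (c1 * (b * (norm (w x) powr (p - 1) * indicator K x) + norm (w x) powr p * indicator K x))"
      proof (rule AE_I2)
        fix x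
        show "norm (R n x) \<le> norm (c1 * (b * (norm (w x) powr (p - 1) * indicator K x) + norm (w x) powr p * indicator K x))"
        proof (cases "x \<in> K")
          case True
          have wp: "norm (w x) powr (p - 1) * norm (w x) = norm (w x) powr p"
            using powr_add[of "norm (w x)" "p - 1" 1] by simp
          have "norm (hgrad X (U n) x - w x) \<le> b + norm (w x)" using b[OF True] norm_triangle_ineq4[of "hgrad X (U n) x" "w x"] by linarith
          then have "norm (w x) powr (p - 1) * norm (hgrad X (U n) x - w x) \<le> norm (w x) powr (p - 1) * (b + norm (w x))"
            by (intro mult_left_mono) auto
          also have "\<dots> = b * norm (w x) powr (p - 1) + norm (w x) powr p" using wp by (simp add: algebra_simps)
          finally have "c1 * (norm (w x) powr (p - 1) * norm (hgrad X (U n) x - w x)) \<le> c1 * (b * norm (w x) powr (p - 1) + norm (w x) powr p)"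
            using c by (intro mult_left_mono) auto
          with Rb[of n x] True show ?thesis by simp
        qed (simp add: R_def z)
      qed
    qed measurable
  qed
  have LR: "(\<lambda>n. \<integral>x. R n x \<partial>lborel) \<longlonglongrightarrow> 0"
  proof -
    define E where "E n = (\<integral>\<^sup>+x. ennreal (norm (w x) powr (p - 1) * norm (hgrad X (U n) x - w x)) * indicator K x \<partial>lborel)" for n
    have E0: "E \<longlonglongrightarrow> 0" unfolding E_def by (rule error_term_tendsto[OF K U Ug])
    have le: "ennreal \<bar>\<integral>x. R n x \<partial>lborel\<bar> \<le> ennreal c1 * E n" for n
    proof -
      have "ennreal \<bar>\<integral>x. R n x \<partial>lborel\<bar> \<le> (\<integral>\<^sup>+x. ennreal (norm (R n x)) \<partial>lborel)"
        using integral_norm_bound_ennreal[OF Ri] by simp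
      also have "\<dots> \<le> (\<integral>\<^sup>+x. ennreal c1 * (ennreal (norm (w x) powr (p - 1) * norm (hgrad X (U n) x - w x)) * indicator K x) \<partial>lborel)"
      proof (rule nn_integral_mono)
        fix x
        have "ennreal (norm (R n x)) \<le> ennreal (c1 * (norm (w x) powr (p - 1) * norm (hgrad X (U n) x - w x) * indicator K x))"
          using Rb[of n x] by (intro ennreal_leI) simp
        also have "\<dots> = ennreal c1 * (ennreal (norm (w x) powr (p - 1) * norm (hgrad X (U n) x - w x)) * indicator K x)"
          using c by (auto simp: indicator_def ennreal_mult)
        finally show "ennreal (norm (R n x)) \<le> ennreal c1 * (ennreal (norm (w x) powr (p - 1) * norm (hgrad X (U n) x - w x)) * indicator K x)" .
      qed
      also have "\<dots> = ennreal c1 * E n" unfolding E_def by (rule nn_integral_cmult) measurable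
      finally show ?thesis .
    qed
    have "(\<lambda>n. ennreal c1 * E n) \<longlonglongrightarrow> ennreal c1 * 0" by (rule ennreal_tendsto_cmult[OF _ E0]) simp
    then have lim0: "(\<lambda>n. ennreal c1 * E n) \<longlonglongrightarrow> 0" by simp
    have "(\<lambda>n. ennreal \<bar>\<integral>x. R n x \<partial>lborel\<bar>) \<longlonglongrightarrow> 0"
    proof (rule tendsto_sandwich[OF _ _ tendsto_const lim0])
      show "\<forall>\<^sub>F n in sequentially. 0 \<le> ennreal \<bar>\<integral>x. R n x \<partial>lborel\<bar>" by simp
      show "\<forall>\<^sub>F n in sequentially. ennreal \<bar>\<integral>x. R n x \<partial>lborel\<bar> \<le> ennreal c1 * E n"
        by (rule always_eventually) (rule allI, rule le)
    qed
    then have "(\<lambda>n. ennreal \<bar>\<integral>x. R n x \<partial>lborel\<bar>) \<longlonglongrightarrow> ennreal 0" by simp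
    then have "(\<lambda>n. \<bar>\<integral>x. R n x \<partial>lborel\<bar>) \<longlonglongrightarrow> 0" by (subst (asm) tendsto_ennreal_iff) auto
    then show ?thesis by (simp add: tendsto_rabs_zero_iff)
  qed
  have ineq: "(\<integral>x. H n x \<partial>lborel) \<le> (\<integral>x. A n x \<partial>lborel) + (\<integral>x. D n x \<partial>lborel) + (\<integral>x. R n x \<partial>lborel)" for n
  proof -
    obtain U' where U': "C1_deriv (U n) U'" using U by blast
    let ?\<Phi> = "\<lambda>x. \<phi> x * (U n x + l) powr \<alpha>"
    obtain \<Phi>' where \<Phi>': "C1_deriv ?\<Phi> \<Phi>'" using hgrad_product(1)[OF \<phi>' U' U0 l] by blast
    have "?\<Phi> \<in> C1_0 \<Omega>" by (rule C1_deriv_imp_C1_0[OF \<Phi>' K]) (simp add: z)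
    then have "?\<Phi> \<in> nonneg_tests \<Omega>" using pos by (simp add: nonneg_tests_def)
    from weak[OF this]
    have "(\<integral>x. indicator \<Omega> x * (h x * ?\<Phi> x) \<partial>lborel) \<le> (\<integral>x. indicator \<Omega> x * (norm (w x) powr (p - 2) * (w x \<bullet> hgrad X ?\<Phi> x)) \<partial>lborel)" .
    also have "(\<lambda>x. indicator \<Omega> x * (h x * ?\<Phi> x)) = H n"
      using z K(2) by (auto simp: fun_eq_iff H_def indicator_def)
    also have "(\<lambda>x. indicator \<Omega> x * (norm (w x) powr (p - 2) * (w x \<bullet> hgrad X ?\<Phi> x))) = (\<lambda>x. A n x + D n x + R n x)"
    proof (rule ext)
      fix x
      show "indicator \<Omega> x * (norm (w x) powr (p - 2) * (w x \<bullet> hgrad X ?\<Phi> x)) = A n x + D n x + R n x"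
      proof (cases "x \<in> K")
        case True
        then have "x \<in> \<Omega>" using K by blast
        then show ?thesis
          unfolding hgrad_product(2)[OF \<phi>' U' U0 l] A_def D_def R_def F_def
          by (simp add: inner_add_right inner_diff_right algebra_simps)
      next
        case False
        have "hgrad X ?\<Phi> x = 0" by (simp add: hgrad_product(2)[OF \<phi>' U' U0 l] z[OF False] g0[OF z[OF False]])
        then show ?thesis by (simp add: A_def D_def R_def F_def z[OF False] g0[OF z[OF False]])
      qed
    qed
    also have "(\<integral>x. A n x + D n x + R n x \<partial>lborel) = (\<integral>x. A n x \<partial>lborel) + (\<integral>x. D n x \<partial>lborel) + (\<integral>x. R n x \<partial>lborel)"
      using LA(2) LD(2) Ri by simp
    finally show ?thesis .
  qed
  have "(\<integral>x. H' x \<partial>lborel) \<le> (\<integral>x. A' x \<partial>lborel) + (\<integral>x. D' x \<partial>lborel) + 0"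
    by (rule LIMSEQ_le[OF LH(3) tendsto_add[OF tendsto_add[OF LA(3) LD(3)] LR]]) (use ineq in auto)
  define d where "d x = norm (w x) powr p * (u x + l) powr (\<alpha> - 1) * \<phi> x" for x
  define M where "M x = norm (w x) powr (p - 1) * (u x + l) powr \<alpha> * norm (hgrad X \<phi> x)" for x
  have [measurable]: "d \<in> borel_measurable borel" "M \<in> borel_measurable borel" unfolding d_def M_def by measurable
  have Dd: "D' x = \<alpha> * d x" for x by (simp add: D'_def d_def Fw mult_ac)
  have di: "integrable lborel d"
  proof -
    have "integrable lborel (\<lambda>x. (1 / \<alpha>) * D' x)" using LD(1) by (rule integrable_mult_right)
    then show ?thesis using \<alpha> by (simp add: Dd)
  qed
  have dn: "0 \<le> d x" "0 \<le> M x" "0 \<le> H' x" for x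
    using pos[of x] h_nonneg[of x] by (auto simp: d_def M_def H'_def)
  have AM: "A' x \<le> M x" for x
  proof -
    have "A' x \<le> (u x + l) powr \<alpha> * (norm (w x) powr (p - 1) * norm (hgrad X \<phi> x))"
      unfolding A'_def using F[of "hgrad X \<phi>" x] by (intro mult_left_mono) auto
    then show ?thesis by (simp add: M_def mult_ac)
  qed
  have H'e: "(\<integral>\<^sup>+x. ennreal (h x * (u x + l) powr \<alpha> * \<phi> x) \<partial>lborel) = ennreal (\<integral>x. H' x \<partial>lborel)"
    using LH(1) dn by (subst nn_integral_eq_integral[symmetric]) (auto simp: H'_def mult_ac)
  have de: "(\<integral>\<^sup>+x. ennreal (d x) \<partial>lborel) = ennreal (\<integral>x. d x \<partial>lborel)"
    using di dn by (subst nn_integral_eq_integral) auto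
  show "(\<integral>\<^sup>+x. ennreal (norm (w x) powr p * (u x + l) powr (\<alpha> - 1) * \<phi> x) \<partial>lborel) < \<infinity>"
    using de unfolding d_def by simp
  have "(\<integral>\<^sup>+x. ennreal (h x * (u x + l) powr \<alpha> * \<phi> x) \<partial>lborel) + ennreal (- \<alpha>) * (\<integral>\<^sup>+x. ennreal (d x) \<partial>lborel)
      = ennreal ((\<integral>x. H' x \<partial>lborel) + (- \<alpha>) * (\<integral>x. d x \<partial>lborel))"
  proof -
    have "0 \<le> (\<integral>x. d x \<partial>lborel)" "0 \<le> (\<integral>x. H' x \<partial>lborel)" using dn by auto
    then show ?thesis
      unfolding H'e de using \<alpha> ennreal_mult[of "- \<alpha>" "\<integral>x. d x \<partial>lborel"]
        ennreal_plus[of "\<integral>x. H' x \<partial>lborel" "- \<alpha> * (\<integral>x. d x \<partial>lborel)"] by (simp add: mult_nonpos_nonneg)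
  qed
  also have "\<dots> \<le> ennreal (\<integral>x. A' x \<partial>lborel)"
    using \<open>(\<integral>x. H' x \<partial>lborel) \<le> (\<integral>x. A' x \<partial>lborel) + (\<integral>x. D' x \<partial>lborel) + 0\<close> by (intro ennreal_leI) (simp add: Dd)
  also have "\<dots> \<le> (\<integral>\<^sup>+x. ennreal (M x) \<partial>lborel)"
  proof -
    \<comment> \<open>\<open>A'\<close> has no sign; its positive part is still below
      \<open>M\<close> and has an integral in [0,\<infinity>].\<close>
    have "ennreal (\<integral>x. A' x \<partial>lborel) \<le> ennreal (\<integral>x. max 0 (A' x) \<partial>lborel)"
      using LA(1) by (intro ennreal_leI integral_mono) auto
    also have "\<dots> = (\<integral>\<^sup>+x. ennreal (max 0 (A' x)) \<partial>lborel)"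
      using LA(1) by (subst nn_integral_eq_integral) auto
    also have "\<dots> \<le> (\<integral>\<^sup>+x. ennreal (M x) \<partial>lborel)"
      using AM dn by (intro nn_integral_mono ennreal_leI) auto
    finally show ?thesis .
  qed
  finally show "(\<integral>\<^sup>+x. ennreal (h x * (u x + l) powr \<alpha> * \<phi> x) \<partial>lborel)
      + ennreal (- \<alpha>) * (\<integral>\<^sup>+x. ennreal (norm (w x) powr p * (u x + l) powr (\<alpha> - 1) * \<phi> x) \<partial>lborel)
      \<le> (\<integral>\<^sup>+x. ennreal (norm (w x) powr (p - 1) * (u x + l) powr \<alpha> * norm (hgrad X \<phi> x)) \<partial>lborel)"
    unfolding d_def M_def .
qed

end

section \<open>Weighted Young inequality and limits of negative powers\<close>

lemma small_parameter:
  fixes q \<alpha> :: real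
  assumes "q > 0" "\<alpha> < 0"
  obtains \<eta> where "\<eta> > 0" "\<eta> powr q / q < - \<alpha>"
proof -
  \<comment> \<open>With \<eta> = a^(1/q) the quantity \<eta>^q / q equals |\<alpha>| / 2.\<close>
  define a where "a = q * (- \<alpha> / 2)"
  have a: "a > 0" unfolding a_def using assms by (intro mult_pos_pos) auto
  show ?thesis
  proof (rule that)
    show "a powr (1 / q) > 0" using a by simp
    have "(a powr (1 / q)) powr q = a" using a assms by (simp add: powr_powr)
    then show "(a powr (1 / q)) powr q / q < - \<alpha>" using assms by (simp add: a_def)
  qed
qed

text \<open>Young's inequality for x y, where t^\<alpha> = t^((\<alpha>-1)/q) t^((\<alpha>-1)/p + 1)
  and 1 = f^(1/q) f^(-1/q) are distributed so that x^q is a multiple of the gradient term. The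
  parameter enters as \<eta> in x and 1 / \<eta> in y, which is the origin of \<eta>^q / q and
  \<eta>^(-p) / p.\<close>

lemma young_powr:
  fixes p q a b t f \<alpha> \<eta> :: real
  assumes p: "1 < p" and q: "q = p / (p - 1)" and t: "0 < t" and f: "0 < f" and a: "0 \<le> a" and b: "0 \<le> b" and \<eta>: "0 < \<eta>"
  shows "a powr (p - 1) * t powr \<alpha> * b \<le> \<eta> powr q / q * (a powr p * t powr (\<alpha> - 1) * f)
     + \<eta> powr (- p) / p * (t powr (\<alpha> - 1 + p) * (b powr p / f powr (p - 1)))"
proof -
  have q1: "q > 1" "1 / q + 1 / p = 1" "(p - 1) * q = p" "p / q = p - 1" "1 / q = 1 - 1 / p" using p by (auto simp: q field_simps)
  define x where "x = \<eta> * a powr (p - 1) * t powr ((\<alpha> - 1) / q) * f powr (1 / q)"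
  define y where "y = (1 / \<eta>) * t powr ((\<alpha> - 1) / p + 1) * b * f powr (- (1 / q))"
  have xy: "x \<ge> 0" "y \<ge> 0" using \<eta> b by (auto simp: x_def y_def)
  have e1: "(\<alpha> - 1) / q + ((\<alpha> - 1) / p + 1) = \<alpha>"
  proof -
    have "(\<alpha> - 1) / q + ((\<alpha> - 1) / p + 1) = (\<alpha> - 1) * (1 / q + 1 / p) + 1" by (simp add: distrib_left)
    then show ?thesis using q1(2) by simp
  qed
  have "x * y = a powr (p - 1) * b * (t powr ((\<alpha> - 1) / q) * t powr ((\<alpha> - 1) / p + 1)) * (f powr (1 / q) * f powr (- (1 / q)))"
    using \<eta> by (simp add: x_def y_def)
  also have "\<dots> = a powr (p - 1) * b * t powr \<alpha>"
    using f by (simp only: powr_add[symmetric] e1) simp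
  finally have 1: "x * y = a powr (p - 1) * t powr \<alpha> * b" by simp
  have 2: "x powr q = \<eta> powr q * (a powr p * t powr (\<alpha> - 1) * f)"
    using \<eta> a t f q1(1,3) unfolding x_def by (simp add: powr_mult powr_powr)
  have "((\<alpha> - 1) / p + 1) * p = \<alpha> - 1 + p" "- (1 / q) * p = - (p - 1)" using p q1 by (auto simp: field_simps)
  then have 3: "y powr p = \<eta> powr (- p) * (t powr (\<alpha> - 1 + p) * (b powr p / f powr (p - 1)))"
    using \<eta> b t f unfolding y_def
    by (simp only: powr_mult powr_powr) (simp add: powr_divide powr_minus_divide powr_diff)
  show ?thesis using Youngs_inequality[OF q1(1) p q1(2) xy] unfolding 1 2 3 by (simp add: mult_ac)
qed

text \<open>Multiplication by c = \<infinity> is not continuous at 0, but it commutes with suprema,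
  so increasing sequences are safe for every c.\<close>

lemma incseq_ennreal_tendsto_cmult:
  fixes f :: "nat \<Rightarrow> ennreal"
  assumes "incseq f" "f \<longlonglongrightarrow> L"
  shows "(\<lambda>n. c * f n) \<longlonglongrightarrow> c * L" "incseq (\<lambda>n. c * f n)"
proof -
  have L: "L = (SUP n. f n)" using LIMSEQ_SUP[OF assms(1)] assms(2) LIMSEQ_unique by blast
  show i: "incseq (\<lambda>n. c * f n)" using assms(1) by (auto simp: incseq_def mult_left_mono)
  have "c * L = (SUP n. c * f n)" unfolding L by (rule SUP_mult_left_ennreal)
  then show "(\<lambda>n. c * f n) \<longlonglongrightarrow> c * L" using LIMSEQ_SUP[OF i] by simp
qed

text \<open>A negative power increases as the shift decreases. At t = 0 it blows up, in agreement
  with the value \<infinity> of \<open>0 epowr s\<close>.\<close>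

lemma epowr_shift_tendsto:
  assumes t: "0 \<le> t" and s: "s < 0"
  shows "(\<lambda>n. ennreal (t + inverse (real (Suc n))) epowr s) \<longlonglongrightarrow> ennreal t epowr s"
    and "incseq (\<lambda>n. ennreal (t + inverse (real (Suc n))) epowr s)"
proof -
  have eq: "ennreal (t + inverse (real (Suc n))) epowr s = ennreal ((t + inverse (real (Suc n))) powr s)" for n
    using t by (intro epowr_ennreal) (simp add: add_nonneg_pos)
  show "incseq (\<lambda>n. ennreal (t + inverse (real (Suc n))) epowr s)"
    using s by (auto simp: incseq_Suc_iff intro!: epowr_antimono ennreal_leI)
  show "(\<lambda>n. ennreal (t + inverse (real (Suc n))) epowr s) \<longlonglongrightarrow> ennreal t epowr s"
  proof (cases "t = 0")
    case False
    have "(\<lambda>n. (t + inverse (real (Suc n))) powr s) \<longlonglongrightarrow> (t + 0) powr s"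
      using False by (intro tendsto_powr tendsto_add tendsto_const LIMSEQ_inverse_real_of_nat) auto
    then have "(\<lambda>n. ennreal ((t + inverse (real (Suc n))) powr s)) \<longlonglongrightarrow> ennreal (t powr s)"
      by (intro tendsto_ennrealI) simp
    then show ?thesis unfolding eq using False t by (subst epowr_ennreal) auto
  next
    case True
    have "filterlim (\<lambda>n. real (Suc n) powr (- s)) at_top sequentially"
      using s by (intro filterlim_compose[OF real_powr_at_top]  filterlim_compose[OF filterlim_real_sequentially filterlim_Suc]) simp
    moreover have "real (Suc n) powr (- s) = inverse (real (Suc n)) powr s" for n
      by (simp add: powr_minus_divide inverse_eq_divide powr_divide)
    ultimately have "(\<lambda>n. ennreal (inverse (real (Suc n)) powr s)) \<longlonglongrightarrow> \<infinity>"
      by (simp add: ennreal_tendsto_top_eq_at_top)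
    then show ?thesis unfolding eq using True s by (simp add: epowr_def)
  qed
qed

section \<open>Energy estimates for all shifts, including zero\<close>

context supersolution
begin

definition source_int :: "real \<Rightarrow> real \<Rightarrow> (real^'n \<Rightarrow> real) \<Rightarrow> ennreal" where
  "source_int l \<alpha> \<phi> = (\<integral>\<^sup>+x. ennreal (h x) * ennreal (u x + l) epowr \<alpha> * ennreal (\<phi> x) \<partial>lborel)"

definition gradient_int :: "real \<Rightarrow> real \<Rightarrow> (real^'n \<Rightarrow> real) \<Rightarrow> ennreal" where
  "gradient_int l \<alpha> \<phi> = (\<integral>\<^sup>+x. ennreal (norm (w x) powr p) * ennreal (u x + l) epowr (\<alpha> - 1) * ennreal (\<phi> x) \<partial>lborel)"

definition cutoff_quotient :: "(real^'n \<Rightarrow> real) \<Rightarrow> real^'n \<Rightarrow> real" where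
  "cutoff_quotient \<phi> x = norm (hgrad X \<phi> x) powr p / \<phi> x powr (p - 1)"

definition weighted_int :: "real \<Rightarrow> real \<Rightarrow> (real^'n \<Rightarrow> real) \<Rightarrow> ennreal" where
  "weighted_int l s \<phi> = (\<integral>\<^sup>+x. ennreal (u x + l) epowr s * ennreal (cutoff_quotient \<phi> x) \<partial>lborel)"

lemma test_meas:
  assumes "\<phi> \<in> nonneg_tests \<Omega>"
  shows "\<phi> \<in> borel_measurable borel" "hgrad X \<phi> \<in> borel_measurable borel" "cutoff_quotient \<phi> \<in> borel_measurable borel"
proof -
  obtain \<phi>' where "C1_deriv \<phi> \<phi>'" using test_facts[OF assms] by metis
  note [measurable] = hgrad_meas[OF this]
  show "\<phi> \<in> borel_measurable borel" "hgrad X \<phi> \<in> borel_measurable borel" by measurable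
  show "cutoff_quotient \<phi> \<in> borel_measurable borel" unfolding cutoff_quotient_def by measurable
qed

text \<open>The gradient integral is kept on both sides, because |\<alpha>| - \<eta>^q / q may have
  either sign and nothing can be subtracted in [0,\<infinity>]. Its finiteness is recorded since it
  later permits absorption.\<close>

lemma energy_young:
  assumes \<phi>: "\<phi> \<in> nonneg_tests \<Omega>" and l: "l > 0" and \<alpha>: "\<alpha> < 0" and \<eta>: "0 < \<eta>" and q: "q = p / (p - 1)"
  shows "source_int l \<alpha> \<phi> + ennreal (- \<alpha>) * gradient_int l \<alpha> \<phi> \<le> ennreal (\<eta> powr q / q) * gradient_int l \<alpha> \<phi> + ennreal (\<eta> powr (- p) / p) * weighted_int l (\<alpha> - 1 + p) \<phi>"
    and "gradient_int l \<alpha> \<phi> < \<infinity>"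
proof -
  note [measurable] = test_meas[OF \<phi>]
  have pos: "\<And>x. 0 \<le> \<phi> x" and g0: "\<And>x. \<phi> x = 0 \<Longrightarrow> hgrad X \<phi> x = 0" using test_facts[OF \<phi>] by metis+
  have q0: "q > 0" using p by (simp add: q)
  have ul: "0 < u x + l" for x using u_nonneg[of x] l by simp
  have F: "source_int l \<alpha> \<phi> = (\<integral>\<^sup>+x. ennreal (h x * (u x + l) powr \<alpha> * \<phi> x) \<partial>lborel)"
    unfolding source_int_def using h_nonneg pos by (intro nn_integral_cong) (simp add: epowr_ennreal[OF ul] ennreal_mult)
  have D: "gradient_int l \<alpha> \<phi> = (\<integral>\<^sup>+x. ennreal (norm (w x) powr p * (u x + l) powr (\<alpha> - 1) * \<phi> x) \<partial>lborel)"
    unfolding gradient_int_def using pos by (intro nn_integral_cong) (simp add: epowr_ennreal[OF ul] ennreal_mult)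
  have Q0: "0 \<le> cutoff_quotient \<phi> x" for x using pos by (simp add: cutoff_quotient_def)
  have G: "weighted_int l (\<alpha> - 1 + p) \<phi> = (\<integral>\<^sup>+x. ennreal ((u x + l) powr (\<alpha> - 1 + p) * cutoff_quotient \<phi> x) \<partial>lborel)"
    unfolding weighted_int_def using Q0 by (intro nn_integral_cong) (simp add: epowr_ennreal[OF ul] ennreal_mult)
  show "gradient_int l \<alpha> \<phi> < \<infinity>" unfolding D by (rule energy_shifted(2)[OF \<phi> l \<alpha>])
  have "source_int l \<alpha> \<phi> + ennreal (- \<alpha>) * gradient_int l \<alpha> \<phi> \<le> (\<integral>\<^sup>+x. ennreal (norm (w x) powr (p - 1) * (u x + l) powr \<alpha> * norm (hgrad X \<phi> x)) \<partial>lborel)"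
    unfolding F D by (rule energy_shifted(1)[OF \<phi> l \<alpha>])
  also have "\<dots> \<le> (\<integral>\<^sup>+x. ennreal (\<eta> powr q / q) * ennreal (norm (w x) powr p * (u x + l) powr (\<alpha> - 1) * \<phi> x)
      + ennreal (\<eta> powr (- p) / p) * ennreal ((u x + l) powr (\<alpha> - 1 + p) * cutoff_quotient \<phi> x) \<partial>lborel)"
  proof (rule nn_integral_mono)
    fix x
    have "norm (w x) powr (p - 1) * (u x + l) powr \<alpha> * norm (hgrad X \<phi> x) \<le>
      \<eta> powr q / q * (norm (w x) powr p * (u x + l) powr (\<alpha> - 1) * \<phi> x) + \<eta> powr (- p) / p * ((u x + l) powr (\<alpha> - 1 + p) * cutoff_quotient \<phi> x)"
    proof (cases "\<phi> x = 0")
      case True then show ?thesis by (simp add: g0 cutoff_quotient_def)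
    next
      case False
      then show ?thesis unfolding cutoff_quotient_def using pos[of x] \<eta> by (intro young_powr[OF p q ul]) auto
    qed
    then have "ennreal (norm (w x) powr (p - 1) * (u x + l) powr \<alpha> * norm (hgrad X \<phi> x)) \<le>
      ennreal (\<eta> powr q / q * (norm (w x) powr p * (u x + l) powr (\<alpha> - 1) * \<phi> x) + \<eta> powr (- p) / p * ((u x + l) powr (\<alpha> - 1 + p) * cutoff_quotient \<phi> x))"
      by (rule ennreal_leI)
    also have "\<dots> = ennreal (\<eta> powr q / q) * ennreal (norm (w x) powr p * (u x + l) powr (\<alpha> - 1) * \<phi> x)
      + ennreal (\<eta> powr (- p) / p) * ennreal ((u x + l) powr (\<alpha> - 1 + p) * cutoff_quotient \<phi> x)"
      using pos[of x] q0 p Q0[of x] by (subst ennreal_plus) (auto simp: ennreal_mult[symmetric])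
    finally show "ennreal (norm (w x) powr (p - 1) * (u x + l) powr \<alpha> * norm (hgrad X \<phi> x)) \<le> \<dots>" .
  qed
  also have "\<dots> = ennreal (\<eta> powr q / q) * gradient_int l \<alpha> \<phi> + ennreal (\<eta> powr (- p) / p) * weighted_int l (\<alpha> - 1 + p) \<phi>"
    unfolding D G by (subst nn_integral_add) (auto simp: nn_integral_cmult)
  finally show "source_int l \<alpha> \<phi> + ennreal (- \<alpha>) * gradient_int l \<alpha> \<phi> \<le> ennreal (\<eta> powr q / q) * gradient_int l \<alpha> \<phi> + ennreal (\<eta> powr (- p) / p) * weighted_int l (\<alpha> - 1 + p) \<phi>" .
qed

text \<open>For \<open>\<psi> = trunc \<epsilon> \<phi>\<close> the quotient \<open>|\<nabla>\<psi>|^p / \<psi>^(p-1)\<close> equals \<open>|\<nabla>\<phi>|^p / \<phi>^(p-1)\<close> where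
  \<open>\<phi> > \<epsilon>^p\<close> and vanishes elsewhere. Unlike the quotient of \<open>\<phi>\<close> it is bounded, which allows \<open>l\<close> to tend to 0.\<close>

definition trunc :: "real \<Rightarrow> (real^'n \<Rightarrow> real) \<Rightarrow> real^'n \<Rightarrow> real" where
  "trunc \<epsilon> \<phi> x = max 0 (max 0 (\<phi> x) powr (1 / p) - \<epsilon>) powr p"

text \<open>The profile vanishes below \<epsilon>^p, which keeps it away from the singularity of
  t^(1/p) at 0, and for t > 0 the chain rule applies. The two open ranges overlap and cover the
  line.\<close>

lemma trunc_profile:
  fixes \<epsilon> :: real
  assumes \<epsilon>: "\<epsilon> > 0"
  defines "H' \<equiv> \<lambda>t. max 0 (max 0 t powr (1 / p) - \<epsilon>) powr (p - 1) * max 0 t powr (1 / p - 1)"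
  shows "((\<lambda>t. max 0 (max 0 t powr (1 / p) - \<epsilon>) powr p) has_real_derivative H' t) (at t)"
    and "continuous_on UNIV H'"
proof -
  have small: "max 0 t powr (1 / p) - \<epsilon> < 0" if "t < \<epsilon> powr p" for t
  proof -
    have "max 0 t powr (1 / p) < (\<epsilon> powr p) powr (1 / p)" using that p \<epsilon> by (intro powr_less_mono2) auto
    then show ?thesis using p \<epsilon> by (simp add: powr_powr)
  qed
  have ep: "\<epsilon> powr p > 0" using \<epsilon> by simp
  show "((\<lambda>t. max 0 (max 0 t powr (1 / p) - \<epsilon>) powr p) has_real_derivative H' t) (at t)"
  proof (cases "t < \<epsilon> powr p")
    case True
    have "((\<lambda>t. 0) has_real_derivative H' t) (at t)"
      using small[OF True] p by (simp add: H'_def max_absorb1)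
    then show ?thesis
    proof (rule has_field_derivative_transform_within_open[where S="{..<\<epsilon> powr p}"])
      show "0 = max 0 (max 0 t powr (1 / p) - \<epsilon>) powr p" if "t \<in> {..<\<epsilon> powr p}" for t
        using small[of t] that p by (simp add: max_absorb1)
    qed (use True in auto)
  next
    case False
    then have t: "t > 0" using ep by linarith
    have "((\<lambda>t. t powr (1 / p) - \<epsilon>) has_real_derivative (1 / p) * t powr (1 / p - 1)) (at t)"
      using t by (auto intro!: derivative_eq_intros)
    from DERIV_chain2[OF has_real_derivative_pos_part_powr[OF p] this]
    have "((\<lambda>t. max 0 (t powr (1 / p) - \<epsilon>) powr p) has_real_derivative H' t) (at t)"
      using t p by (simp add: H'_def max_absorb2)
    then show ?thesis
      by (rule has_field_derivative_transform_within_open[where S="{0<..}"]) (use t in auto)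
  qed
  have "continuous_on {..<\<epsilon> powr p} H'"
  proof (rule continuous_on_eq[OF continuous_on_const[of _ 0]])
    show "0 = H' t" if "t \<in> {..<\<epsilon> powr p}" for t using small[of t] that p by (simp add: H'_def max_absorb1)
  qed
  moreover have "continuous_on {0<..} H'"
    unfolding H'_def using p by (intro continuous_intros continuous_on_powr') auto
  ultimately have "continuous_on ({..<\<epsilon> powr p} \<union> {0<..}) H'" by (intro continuous_on_open_Un) auto
  moreover have "{..<\<epsilon> powr p} \<union> {0<..} = UNIV" using ep by (auto simp: not_less intro: le_less_trans)
  ultimately show "continuous_on UNIV H'" by simp
qed

lemma trunc_le: assumes "0 \<le> \<phi> x" "\<epsilon> > 0" shows "trunc \<epsilon> \<phi> x \<le> \<phi> x"
proof -
  have "trunc \<epsilon> \<phi> x \<le> (\<phi> x powr (1 / p)) powr p"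
    unfolding trunc_def using assms p by (intro powr_mono2) (auto simp: max_def)
  then show ?thesis using assms p by (simp add: powr_powr)
qed

text \<open>Where \<phi> > 0 the quotient |\<nabla>\<phi>|^p / \<phi>^(p-1) is p^p times
  |\<nabla>(\<phi>^(1/p))|^p, and truncation only subtracts the constant \<epsilon> from
  \<phi>^(1/p). In the computation the powers of k = \<phi>^(1/p) - \<epsilon> cancel.\<close>

lemma trunc_test:
  assumes \<phi>: "\<phi> \<in> nonneg_tests \<Omega>" and \<epsilon>: "\<epsilon> > 0"
  shows "trunc \<epsilon> \<phi> \<in> nonneg_tests \<Omega>"
    and "cutoff_quotient (trunc \<epsilon> \<phi>) x = (if \<phi> x > \<epsilon> powr p then cutoff_quotient \<phi> x else 0)"
proof -
  obtain \<phi>' K where \<phi>': "C1_deriv \<phi> \<phi>'" and K: "compact K" "K \<subseteq> \<Omega>" and z: "\<And>x. x \<notin> K \<Longrightarrow> \<phi> x = 0"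
    and pos: "\<And>x. 0 \<le> \<phi> x"
    using test_facts[OF \<phi>] by metis
  define H' where "H' = (\<lambda>t. max 0 (max 0 t powr (1 / p) - \<epsilon>) powr (p - 1) * max 0 t powr (1 / p - 1))"
  have T: "C1_deriv (trunc \<epsilon> \<phi>) (\<lambda>x. H' (\<phi> x) *\<^sub>R \<phi>' x)"
    unfolding trunc_def[abs_def]
  proof (rule C1_deriv_real_compose[OF \<phi>', where F="\<lambda>t. max 0 (max 0 t powr (1 / p) - \<epsilon>) powr p" and F'=H'])
    show "((\<lambda>t. max 0 (max 0 t powr (1 / p) - \<epsilon>) powr p) has_real_derivative H' (\<phi> x)) (at (\<phi> x))" for x
      unfolding H'_def by (rule trunc_profile(1)[OF \<epsilon>])
    show "continuous_on UNIV (\<lambda>x. H' (\<phi> x))"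
      using continuous_on_compose2[OF trunc_profile(2)[OF \<epsilon>] C1_deriv_imp_continuous[OF \<phi>']] by (simp add: H'_def)
  qed
  have tz: "trunc \<epsilon> \<phi> x = 0" if "x \<notin> K" for x using z[OF that] \<epsilon> p by (simp add: trunc_def max_absorb1)
  have "trunc \<epsilon> \<phi> \<in> C1_0 \<Omega>" by (rule C1_deriv_imp_C1_0[OF T K tz])
  then show "trunc \<epsilon> \<phi> \<in> nonneg_tests \<Omega>" by (simp add: nonneg_tests_def trunc_def)
  have g: "hgrad X (trunc \<epsilon> \<phi>) x = H' (\<phi> x) *\<^sub>R hgrad X \<phi> x"
    by (simp add: vec_eq_iff hgrad_nth_C1[OF T] hgrad_nth_C1[OF \<phi>'] scaleR_blinfun.rep_eq)
  show "cutoff_quotient (trunc \<epsilon> \<phi>) x = (if \<phi> x > \<epsilon> powr p then cutoff_quotient \<phi> x else 0)"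
  proof (cases "\<phi> x > \<epsilon> powr p")
    case True
    moreover have "\<epsilon> powr p > 0" using \<epsilon> by simp
    ultimately have f: "\<phi> x > 0" by linarith
    define k where "k = \<phi> x powr (1 / p) - \<epsilon>"
    have "(\<epsilon> powr p) powr (1 / p) < \<phi> x powr (1 / p)" using True p by (intro powr_less_mono2) auto
    then have k: "k > 0" using \<epsilon> p by (simp add: k_def powr_powr)
    have Hk: "H' (\<phi> x) = k powr (p - 1) * \<phi> x powr (1 / p - 1)" "trunc \<epsilon> \<phi> x = k powr p"
      using f k by (auto simp: H'_def trunc_def k_def max_absorb2)
    have "cutoff_quotient (trunc \<epsilon> \<phi>) x = (k powr (p - 1) * \<phi> x powr (1 / p - 1) * norm (hgrad X \<phi> x)) powr p / (k powr p) powr (p - 1)"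
      unfolding cutoff_quotient_def g Hk using k by (simp add: abs_mult)
    also have "\<dots> = (k powr (p * (p - 1)) / k powr (p * (p - 1))) * (\<phi> x powr ((1 / p - 1) * p) * norm (hgrad X \<phi> x) powr p)"
      by (simp add: powr_mult powr_powr mult.commute)
    also have "\<dots> = \<phi> x powr (- (p - 1)) * norm (hgrad X \<phi> x) powr p"
    proof -
      have "(1 / p - 1) * p = - (p - 1)" using p by (simp add: field_simps)
      then show ?thesis using k by simp
    qed
    also have "\<dots> = cutoff_quotient \<phi> x" unfolding cutoff_quotient_def using f by (simp only: powr_minus_divide) simp
    finally show ?thesis using True by simp
  next
    case False
    have "\<phi> x powr (1 / p) \<le> (\<epsilon> powr p) powr (1 / p)" using False pos[of x] p by (intro powr_mono2) auto
    then have "trunc \<epsilon> \<phi> x = 0" using \<epsilon> p pos[of x] by (simp add: trunc_def powr_powr max_absorb1 max_absorb2)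
    then show ?thesis using False by (simp add: cutoff_quotient_def)
  qed
qed

lemma trunc_tendsto:
  assumes "0 \<le> \<phi> x"
  shows "(\<lambda>n. ennreal (trunc (inverse (real (Suc n))) \<phi> x)) \<longlonglongrightarrow> ennreal (\<phi> x)"
    and "incseq (\<lambda>n. ennreal (trunc (inverse (real (Suc n))) \<phi> x))"
proof -
  have "(\<lambda>n. max 0 (\<phi> x powr (1 / p) - inverse (real (Suc n))) powr p) \<longlonglongrightarrow> max 0 (\<phi> x powr (1 / p) - 0) powr p"
    using p by (intro tendsto_powr' tendsto_max tendsto_diff tendsto_const LIMSEQ_inverse_real_of_nat) auto
  moreover have "max 0 (\<phi> x powr (1 / p) - 0) powr p = \<phi> x" using assms p by (simp add: powr_powr max_absorb2)
  ultimately show "(\<lambda>n. ennreal (trunc (inverse (real (Suc n))) \<phi> x)) \<longlonglongrightarrow> ennreal (\<phi> x)"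
    unfolding trunc_def using assms by (intro tendsto_ennrealI) (simp add: max_absorb2)
  show "incseq (\<lambda>n. ennreal (trunc (inverse (real (Suc n))) \<phi> x))"
    unfolding trunc_def incseq_Suc_iff using p
    by (intro allI ennreal_leI powr_mono2 max.mono diff_mono) (auto simp: field_simps)
qed

abbreviation (input) sh :: "nat \<Rightarrow> real" where "sh n \<equiv> inverse (real (Suc n))"

lemma test_nonneg: "\<phi> \<in> nonneg_tests \<Omega> \<Longrightarrow> 0 \<le> \<phi> x"
  by (simp add: nonneg_tests_def)

lemma test_hgrad_zero:
  assumes \<phi>: "\<phi> \<in> nonneg_tests \<Omega>" and z: "\<phi> x = 0"
  shows "hgrad X \<phi> x = 0"
proof -
  obtain B :: real where "\<And>x. \<phi> x = 0 \<Longrightarrow> hgrad X \<phi> x = 0" by (rule test_facts[OF \<phi>]) (rule that)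
  then show ?thesis using z .
qed

text \<open>Negative powers of u + l increase as l decreases to 0, so monotone convergence applies
  even when the limit is infinite.\<close>

lemma weighted_tendsto_shift:
  assumes [measurable]: "a \<in> borel_measurable borel" "b \<in> borel_measurable borel" and s: "s < 0"
  shows "(\<lambda>n. \<integral>\<^sup>+x. ennreal (a x) * ennreal (u x + sh n) epowr s * ennreal (b x) \<partial>lborel)
     \<longlonglongrightarrow> (\<integral>\<^sup>+x. ennreal (a x) * ennreal (u x + 0) epowr s * ennreal (b x) \<partial>lborel)"
proof (rule nn_integral_LIMSEQ)
  have *: "incseq (\<lambda>n. ennreal (a x) * ennreal (u x + sh n) epowr s * ennreal (b x))"
    "(\<lambda>n. ennreal (a x) * ennreal (u x + sh n) epowr s * ennreal (b x)) \<longlonglongrightarrow> ennreal (a x) * ennreal (u x + 0) epowr s * ennreal (b x)" for x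
    using incseq_ennreal_tendsto_cmult[OF epowr_shift_tendsto(2)[OF u_nonneg s] epowr_shift_tendsto(1)[OF u_nonneg s], of "ennreal (a x) * ennreal (b x)" x]
    by (simp_all add: mult_ac)
  show "incseq (\<lambda>n x. ennreal (a x) * ennreal (u x + sh n) epowr s * ennreal (b x))"
    unfolding incseq_def le_fun_def by (intro allI impI incseqD[OF *(1)])
  show "(\<lambda>n. ennreal (a x) * ennreal (u x + sh n) epowr s * ennreal (b x)) \<longlonglongrightarrow> ennreal (a x) * ennreal (u x + 0) epowr s * ennreal (b x)" for x
    by (rule *(2))
qed measurable

lemma weighted_tendsto_trunc:
  assumes \<phi>: "\<phi> \<in> nonneg_tests \<Omega>" and [measurable]: "a \<in> borel_measurable borel"
  shows "(\<lambda>n. \<integral>\<^sup>+x. a x * ennreal (trunc (sh n) \<phi> x) \<partial>lborel) \<longlonglongrightarrow> (\<integral>\<^sup>+x. a x * ennreal (\<phi> x) \<partial>lborel)"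
proof (rule nn_integral_LIMSEQ)
  note pos = test_nonneg[OF \<phi>]
  note * = incseq_ennreal_tendsto_cmult[OF trunc_tendsto(2)[OF pos] trunc_tendsto(1)[OF pos]]
  show "incseq (\<lambda>n x. a x * ennreal (trunc (sh n) \<phi> x))"
    unfolding incseq_def le_fun_def by (intro allI impI incseqD[OF *(2)])
  show "(\<lambda>n. a x * ennreal (trunc (sh n) \<phi> x)) \<longlonglongrightarrow> a x * ennreal (\<phi> x)" for x by (rule *(1))
  have [measurable]: "trunc (sh n) \<phi> \<in> borel_measurable borel" for n
    by (rule test_meas(1)[OF trunc_test(1)[OF \<phi>]]) simp
  show "(\<lambda>x. a x * ennreal (trunc (sh n) \<phi> x)) \<in> borel_measurable lborel" for n by measurable
qed

lemma source_gradient_mono: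
  assumes "\<And>x. \<psi> x \<le> \<phi> x"
  shows "source_int l \<alpha> \<psi> \<le> source_int l \<alpha> \<phi>" "gradient_int l \<alpha> \<psi> \<le> gradient_int l \<alpha> \<phi>"
proof -
  have *: "(\<integral>\<^sup>+x. c x * ennreal (\<psi> x) \<partial>lborel) \<le> (\<integral>\<^sup>+x. c x * ennreal (\<phi> x) \<partial>lborel)" for c
    by (rule nn_integral_mono, rule mult_left_mono, rule ennreal_leI, rule assms) simp
  show "source_int l \<alpha> \<psi> \<le> source_int l \<alpha> \<phi>" "gradient_int l \<alpha> \<psi> \<le> gradient_int l \<alpha> \<phi>"
    unfolding source_int_def gradient_int_def by (rule *)+
qed

lemma source_gradient_shift_le:
  assumes "\<alpha> < 0" "0 \<le> l"
  shows "source_int l \<alpha> \<phi> \<le> source_int 0 \<alpha> \<phi>" "gradient_int l \<alpha> \<phi> \<le> gradient_int 0 \<alpha> \<phi>"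
proof -
  have *: "(\<integral>\<^sup>+x. c x * ennreal (u x + l) epowr s * d x \<partial>lborel) \<le> (\<integral>\<^sup>+x. c x * ennreal (u x + 0) epowr s * d x \<partial>lborel)"
    if "s < 0" for c d :: "real^'n \<Rightarrow> ennreal" and s
  proof (rule nn_integral_mono)
    fix x
    have "ennreal (u x + l) epowr s \<le> ennreal (u x + 0) epowr s"
      using that assms(2) by (intro epowr_antimono ennreal_leI) auto
    then show "c x * ennreal (u x + l) epowr s * d x \<le> c x * ennreal (u x + 0) epowr s * d x"
      by (intro mult_right_mono mult_left_mono) auto
  qed
  show "source_int l \<alpha> \<phi> \<le> source_int 0 \<alpha> \<phi>" "gradient_int l \<alpha> \<phi> \<le> gradient_int 0 \<alpha> \<phi>"
    unfolding source_int_def gradient_int_def by (rule *, use assms(1) in simp)+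
qed

text \<open>The quotient can be nonzero only where \<phi> > \<epsilon>^p, which bounds its
  denominator from below.\<close>

lemma cutoff_quotient_trunc_bounded:
  assumes \<phi>: "\<phi> \<in> nonneg_tests \<Omega>" and \<epsilon>: "\<epsilon> > 0"
  obtains b K where "compact K" "K \<subseteq> \<Omega>" "0 \<le> b" "\<And>x. cutoff_quotient (trunc \<epsilon> \<phi>) x \<le> b * indicator K x"
proof -
  obtain K B where K: "compact K" "K \<subseteq> \<Omega>" and z: "\<And>x. x \<notin> K \<Longrightarrow> \<phi> x = 0"
    and B: "\<And>x. norm (hgrad X \<phi> x) \<le> B" "0 \<le> B"
    by (rule test_facts[OF \<phi>]) (rule that)
  define b where "b = B powr p / (\<epsilon> powr p) powr (p - 1)"
  show ?thesis
  proof (rule that[OF K])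
    show "0 \<le> b" by (simp add: b_def)
    fix x
    show "cutoff_quotient (trunc \<epsilon> \<phi>) x \<le> b * indicator K x"
    proof (cases "\<phi> x > \<epsilon> powr p")
      case True
      have ep: "\<epsilon> powr p > 0" using \<epsilon> by simp
      then have xK: "x \<in> K" using True z[of x] by (metis less_asym)
      have "cutoff_quotient \<phi> x \<le> b" unfolding cutoff_quotient_def b_def
        using True ep B p by (intro frac_le powr_mono2) auto
      then show ?thesis using xK True by (simp add: trunc_test(2)[OF \<phi> \<epsilon>])
    qed (auto simp: trunc_test(2)[OF \<phi> \<epsilon>] b_def)
  qed
qed

text \<open>For 0 < s \<le> p and shifts at most 1, (u + l)^s is at most (u + 1)^p, which is
  integrable on the compact set carrying the bounded quotient. This gives dominated convergence and
  a finite limit.\<close>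

lemma weighted_int_trunc_tendsto:
  assumes \<phi>: "\<phi> \<in> nonneg_tests \<Omega>" and \<epsilon>: "\<epsilon> > 0" and s: "0 < s" "s \<le> p"
  shows "(\<lambda>n. weighted_int (sh n) s (trunc \<epsilon> \<phi>)) \<longlonglongrightarrow> weighted_int 0 s (trunc \<epsilon> \<phi>)" "weighted_int 0 s (trunc \<epsilon> \<phi>) < \<infinity>"
proof -
  obtain b K where K: "compact K" "K \<subseteq> \<Omega>" and b: "0 \<le> b" and Qb: "\<And>x. cutoff_quotient (trunc \<epsilon> \<phi>) x \<le> b * indicator K x"
    by (rule cutoff_quotient_trunc_bounded[OF \<phi> \<epsilon>]) (rule that)
  have [measurable]: "K \<in> sets borel" using K by (simp add: borel_compact)
  note [measurable] = test_meas[OF trunc_test(1)[OF \<phi> \<epsilon>]]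
  define W where "W x = ennreal (2 powr p * b) * ((ennreal (\<bar>u x\<bar> powr p) + 1) * indicator K x)" for x
  have W: "(\<integral>\<^sup>+x. W x \<partial>lborel) < \<infinity>"
  proof -
    have "(\<integral>\<^sup>+x. W x \<partial>lborel) = ennreal (2 powr p * b) * ((\<integral>\<^sup>+x. ennreal (\<bar>u x\<bar> powr p) * indicator K x \<partial>lborel) + emeasure lborel K)"
      unfolding W_def by (subst nn_integral_cmult, measurable) (simp add: distrib_right nn_integral_add)
    also have "\<dots> < \<infinity>" using u_Lp[OF K] emeasure_compact_finite[OF K(1)] by (simp add: ennreal_mult_less_top less_top)
    finally show ?thesis .
  qed
  have dom: "ennreal (u x + l) epowr s * ennreal (cutoff_quotient (trunc \<epsilon> \<phi>) x) \<le> W x" if l: "0 \<le> l" "l \<le> 1" for x l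
  proof -
    have "(u x + l) powr s \<le> (u x + 1) powr s" using l u_nonneg[of x] s by (intro powr_mono2) auto
    also have "\<dots> \<le> (u x + 1) powr p" using u_nonneg[of x] s by (intro powr_mono) auto
    also have "\<dots> \<le> 2 powr p * (u x powr p + 1 powr p)" using u_nonneg[of x] p by (intro powr_add_le) auto
    finally have 1: "(u x + l) powr s \<le> 2 powr p * (u x powr p + 1)" by simp
    have "ennreal (u x + l) epowr s = ennreal ((u x + l) powr s)"
      using l u_nonneg[of x] s by (intro epowr_ennreal_nonneg) auto
    also have "\<dots> * ennreal (cutoff_quotient (trunc \<epsilon> \<phi>) x) \<le> ennreal (2 powr p * (u x powr p + 1)) * ennreal (b * indicator K x)"
      by (intro mult_mono ennreal_leI 1 Qb) auto
    also have "ennreal (2 powr p * (u x powr p + 1)) * ennreal (b * indicator K x) = W x"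
    proof -
      have "ennreal (u x powr p + 1) = ennreal (u x powr p) + 1" by (subst ennreal_plus) auto
      then show ?thesis unfolding W_def using b u_nonneg[of x] by (auto simp: indicator_def ennreal_mult mult_ac)
    qed
    finally show ?thesis .
  qed
  show "(\<lambda>n. weighted_int (sh n) s (trunc \<epsilon> \<phi>)) \<longlonglongrightarrow> weighted_int 0 s (trunc \<epsilon> \<phi>)"
    unfolding weighted_int_def
  proof (rule nn_integral_dominated_convergence[where w=W])
    show "AE x in lborel. ennreal (u x + sh j) epowr s * ennreal (cutoff_quotient (trunc \<epsilon> \<phi>) x) \<le> W x" for j
      by (intro AE_I2 dom) (auto simp: field_simps)
    show "W \<in> borel_measurable lborel" unfolding W_def by measurable
    show "AE x in lborel. (\<lambda>n. ennreal (u x + sh n) epowr s * ennreal (cutoff_quotient (trunc \<epsilon> \<phi>) x)) \<longlonglongrightarrow> ennreal (u x + 0) epowr s * ennreal (cutoff_quotient (trunc \<epsilon> \<phi>) x)"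
    proof (rule AE_I2)
      fix x
      have "(\<lambda>n. (u x + sh n) powr s) \<longlonglongrightarrow> (u x + 0) powr s"
        using s u_nonneg[of x] by (intro tendsto_powr' tendsto_add tendsto_const LIMSEQ_inverse_real_of_nat) auto
      then have L: "(\<lambda>n. ennreal ((u x + sh n) powr s)) \<longlonglongrightarrow> ennreal ((u x + 0) powr s)" by (rule tendsto_ennrealI)
      have e: "ennreal (u x + r) epowr s = ennreal ((u x + r) powr s)" if "0 \<le> r" for r
        using u_nonneg[of x] s that by (intro epowr_ennreal_nonneg) auto
      have e': "ennreal (u x + sh n) epowr s = ennreal ((u x + sh n) powr s)" for n by (rule e) simp
      have "(\<lambda>n. ennreal (u x + sh n) epowr s) \<longlonglongrightarrow> ennreal (u x + 0) epowr s"
        unfolding e' e[OF order_refl] by (rule L)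
      from ennreal_tendsto_cmult[OF _ this, of "ennreal (cutoff_quotient (trunc \<epsilon> \<phi>) x)"]
      show "(\<lambda>n. ennreal (u x + sh n) epowr s * ennreal (cutoff_quotient (trunc \<epsilon> \<phi>) x)) \<longlonglongrightarrow> ennreal (u x + 0) epowr s * ennreal (cutoff_quotient (trunc \<epsilon> \<phi>) x)"
        by (simp add: mult.commute)
    qed
  qed (use W in measurable)
  have "weighted_int 0 s (trunc \<epsilon> \<phi>) \<le> (\<integral>\<^sup>+x. W x \<partial>lborel)" unfolding weighted_int_def by (intro nn_integral_mono dom) auto
  then show "weighted_int 0 s (trunc \<epsilon> \<phi>) < \<infinity>" using W by (rule le_less_trans)
qed

lemma weighted_int_trunc_le:
  assumes "\<phi> \<in> nonneg_tests \<Omega>" "\<epsilon> > 0"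
  shows "weighted_int l s (trunc \<epsilon> \<phi>) \<le> weighted_int l s \<phi>"
  unfolding weighted_int_def using assms by (intro nn_integral_mono mult_left_mono) (auto simp: trunc_test(2))

text \<open>The coefficients are general so that one passage to l = 0 serves both the inequality
  with the gradient on two sides and the absorbed one. On the right the gradient integral is bounded
  by its value at l = 0 beforehand, so only the weighted integral has to be followed.\<close>

lemma energy_limit:
  fixes a b c d :: ennreal
  assumes fin: "a < \<infinity>" "b < \<infinity>" "d < \<infinity>" and \<alpha>: "\<alpha> < 0" and \<phi>: "\<phi> \<in> nonneg_tests \<Omega>"
    and ineq: "\<And>l \<phi>. 0 < l \<Longrightarrow> \<phi> \<in> nonneg_tests \<Omega> \<Longrightarrow> a * source_int l \<alpha> \<phi> + b * gradient_int l \<alpha> \<phi> \<le> c * gradient_int l \<alpha> \<phi> + d * weighted_int l (\<alpha> - 1 + p) \<phi>"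
  shows "a * source_int 0 \<alpha> \<phi> + b * gradient_int 0 \<alpha> \<phi> \<le> c * gradient_int 0 \<alpha> \<phi> + d * weighted_int 0 (\<alpha> - 1 + p) \<phi>"
proof -
  have lim: "(\<lambda>n. a * source_int (sh n) \<alpha> \<phi> + b * gradient_int (sh n) \<alpha> \<phi>) \<longlonglongrightarrow> a * source_int 0 \<alpha> \<phi> + b * gradient_int 0 \<alpha> \<phi>" if "\<phi> \<in> nonneg_tests \<Omega>" for \<phi>
  proof -
    note [measurable] = test_meas[OF that]
    show ?thesis unfolding source_int_def gradient_int_def using fin \<alpha>
      by (intro tendsto_add ennreal_tendsto_cmult weighted_tendsto_shift) auto
  qed
  have le: "a * source_int (sh n) \<alpha> \<phi> + b * gradient_int (sh n) \<alpha> \<phi> \<le> c * gradient_int 0 \<alpha> \<phi> + d * weighted_int (sh n) (\<alpha> - 1 + p) \<phi>" if "\<phi> \<in> nonneg_tests \<Omega>" for \<phi> n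
    using order_trans[OF ineq[OF _ that] add_right_mono[OF mult_left_mono[OF source_gradient_shift_le(2)[OF \<alpha>]]]] by simp
  show ?thesis
  proof (cases "\<alpha> - 1 + p \<le> 0")
    case True
    \<comment> \<open>With a nonpositive exponent the weighted integral grows when the shift is
      removed, so it is bounded by its value at 0 and no limit is taken on the right.\<close>
    have "weighted_int (sh n) (\<alpha> - 1 + p) \<phi> \<le> weighted_int 0 (\<alpha> - 1 + p) \<phi>" for n
      unfolding weighted_int_def using True by (intro nn_integral_mono mult_right_mono epowr_antimono ennreal_leI) auto
    then have "a * source_int (sh n) \<alpha> \<phi> + b * gradient_int (sh n) \<alpha> \<phi> \<le> c * gradient_int 0 \<alpha> \<phi> + d * weighted_int 0 (\<alpha> - 1 + p) \<phi>" for n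
      using order_trans[OF le[OF \<phi>] add_left_mono[OF mult_left_mono]] by simp
    then show ?thesis by (intro LIMSEQ_le_const2[OF lim[OF \<phi>]]) auto
  next
    case False
    \<comment> \<open>With a positive exponent domination is available for the truncated test. Its
      quotient is at most the original one, and on the left the truncation is undone by monotone
      convergence.\<close>
    have tr: "a * source_int 0 \<alpha> (trunc (sh k) \<phi>) + b * gradient_int 0 \<alpha> (trunc (sh k) \<phi>) \<le> c * gradient_int 0 \<alpha> \<phi> + d * weighted_int 0 (\<alpha> - 1 + p) \<phi>" for k
    proof -
      have e: "sh k > 0" by simp
      note \<psi> = trunc_test(1)[OF \<phi> e]
      note pos = test_nonneg[OF \<phi>]
      have s: "0 < \<alpha> - 1 + p" "\<alpha> - 1 + p \<le> p" using False \<alpha> by auto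
      have "(\<lambda>n. c * gradient_int 0 \<alpha> (trunc (sh k) \<phi>) + d * weighted_int (sh n) (\<alpha> - 1 + p) (trunc (sh k) \<phi>)) \<longlonglongrightarrow> c * gradient_int 0 \<alpha> (trunc (sh k) \<phi>) + d * weighted_int 0 (\<alpha> - 1 + p) (trunc (sh k) \<phi>)"
        using fin by (intro tendsto_add tendsto_const ennreal_tendsto_cmult weighted_int_trunc_tendsto(1)[OF \<phi> e s]) auto
      from LIMSEQ_le[OF lim[OF \<psi>] this] le[OF \<psi>]
      have "a * source_int 0 \<alpha> (trunc (sh k) \<phi>) + b * gradient_int 0 \<alpha> (trunc (sh k) \<phi>) \<le> c * gradient_int 0 \<alpha> (trunc (sh k) \<phi>) + d * weighted_int 0 (\<alpha> - 1 + p) (trunc (sh k) \<phi>)"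
        by blast
      also have "\<dots> \<le> c * gradient_int 0 \<alpha> \<phi> + d * weighted_int 0 (\<alpha> - 1 + p) \<phi>"
        using e by (intro add_mono mult_left_mono source_gradient_mono(2) weighted_int_trunc_le[OF \<phi>] trunc_le pos) auto
      finally show ?thesis .
    qed
    have "(\<lambda>k. a * source_int 0 \<alpha> (trunc (sh k) \<phi>) + b * gradient_int 0 \<alpha> (trunc (sh k) \<phi>)) \<longlonglongrightarrow> a * source_int 0 \<alpha> \<phi> + b * gradient_int 0 \<alpha> \<phi>"
      unfolding source_int_def gradient_int_def using fin
      by (intro tendsto_add ennreal_tendsto_cmult weighted_tendsto_trunc[OF \<phi>]) auto
    then show ?thesis using tr by (intro LIMSEQ_le_const2) auto
  qed
qed

text \<open>Absorption is carried out for l > 0, where the gradient integral is finite and can be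
  cancelled. At l = 0 it might be infinite, so the absorbed inequality is passed to the limit itself
  instead of being deduced from the first one.\<close>

lemma energy:
  assumes \<phi>: "\<phi> \<in> nonneg_tests \<Omega>" and l: "l \<ge> 0" and \<alpha>: "\<alpha> < 0" and \<eta>: "0 < \<eta>" and q: "q = p / (p - 1)"
  shows "source_int l \<alpha> \<phi> + ennreal (- \<alpha>) * gradient_int l \<alpha> \<phi> \<le> ennreal (\<eta> powr q / q) * gradient_int l \<alpha> \<phi> + ennreal (\<eta> powr (- p) / p) * weighted_int l (\<alpha> - 1 + p) \<phi>"
    and "\<eta> powr q / q < - \<alpha> \<Longrightarrow> ennreal (- \<alpha> - \<eta> powr q / q) * gradient_int l \<alpha> \<phi> \<le> ennreal (\<eta> powr (- p) / p) * weighted_int l (\<alpha> - 1 + p) \<phi>"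
proof -
  have q0: "q > 0" using p by (simp add: q)
  show "source_int l \<alpha> \<phi> + ennreal (- \<alpha>) * gradient_int l \<alpha> \<phi> \<le> ennreal (\<eta> powr q / q) * gradient_int l \<alpha> \<phi> + ennreal (\<eta> powr (- p) / p) * weighted_int l (\<alpha> - 1 + p) \<phi>"
  proof (cases "l = 0")
    case True
    have "1 * source_int 0 \<alpha> \<phi> + ennreal (- \<alpha>) * gradient_int 0 \<alpha> \<phi> \<le> ennreal (\<eta> powr q / q) * gradient_int 0 \<alpha> \<phi> + ennreal (\<eta> powr (- p) / p) * weighted_int 0 (\<alpha> - 1 + p) \<phi>"
      by (rule energy_limit[OF _ _ _ \<alpha> \<phi>]) (use energy_young(1)[OF _ _ \<alpha> \<eta> q] in auto)
    then show ?thesis using True by simp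
  qed (use l in \<open>auto intro!: energy_young(1)[OF \<phi> _ \<alpha> \<eta> q]\<close>)
  assume small: "\<eta> powr q / q < - \<alpha>"
  have pos: "ennreal (- \<alpha> - \<eta> powr q / q) * gradient_int l \<alpha> \<phi> \<le> ennreal (\<eta> powr (- p) / p) * weighted_int l (\<alpha> - 1 + p) \<phi>"
    if l: "l > 0" and \<phi>: "\<phi> \<in> nonneg_tests \<Omega>" for l \<phi>
  proof -
    note E = energy_young[OF \<phi> l \<alpha> \<eta> q]
    then obtain D where D: "gradient_int l \<alpha> \<phi> = ennreal D" "D \<ge> 0" by (cases "gradient_int l \<alpha> \<phi>" rule: ennreal_cases) auto
    have "ennreal (- \<alpha> - \<eta> powr q / q) * gradient_int l \<alpha> \<phi> + ennreal (\<eta> powr q / q * D) = ennreal ((- \<alpha> - \<eta> powr q / q) * D + \<eta> powr q / q * D)"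
      using D small q0 by (subst ennreal_plus) (auto simp: ennreal_mult intro!: mult_nonneg_nonneg)
    also have "(- \<alpha> - \<eta> powr q / q) * D + \<eta> powr q / q * D = - \<alpha> * D" by (simp add: left_diff_distrib)
    also have "ennreal (- \<alpha> * D) = ennreal (- \<alpha>) * gradient_int l \<alpha> \<phi>"
      unfolding D(1) using \<alpha> D(2) by (intro ennreal_mult) auto
    also have "\<dots> \<le> source_int l \<alpha> \<phi> + ennreal (- \<alpha>) * gradient_int l \<alpha> \<phi>" by simp
    also have "\<dots> \<le> ennreal (\<eta> powr (- p) / p) * weighted_int l (\<alpha> - 1 + p) \<phi> + ennreal (\<eta> powr q / q) * gradient_int l \<alpha> \<phi>"
      using E(1) by (simp only: add.commute)
    also have "ennreal (\<eta> powr q / q) * gradient_int l \<alpha> \<phi> = ennreal (\<eta> powr q / q * D)"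
      unfolding D(1) using D(2) q0 by (intro ennreal_mult[symmetric]) auto
    finally show ?thesis by (subst (asm) ennreal_add_left_cancel_le[of "ennreal (\<eta> powr q / q * D)", unfolded add.commute[of "ennreal (\<eta> powr q / q * D)"]]) simp
  qed
  show "ennreal (- \<alpha> - \<eta> powr q / q) * gradient_int l \<alpha> \<phi> \<le> ennreal (\<eta> powr (- p) / p) * weighted_int l (\<alpha> - 1 + p) \<phi>"
  proof (cases "l = 0")
    case True
    \<comment> \<open>\<open>energy_limit\<close> with a = c = 0 and b = |\<alpha>| - \<eta>^q /
      q.\<close>
    have "0 * source_int 0 \<alpha> \<phi> + ennreal (- \<alpha> - \<eta> powr q / q) * gradient_int 0 \<alpha> \<phi> \<le> 0 * gradient_int 0 \<alpha> \<phi> + ennreal (\<eta> powr (- p) / p) * weighted_int 0 (\<alpha> - 1 + p) \<phi>"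
      by (rule energy_limit[OF _ _ _ \<alpha> \<phi>]) (use pos in auto)
    then show ?thesis using True by simp
  qed (use l in \<open>auto intro!: pos \<phi>\<close>)
qed

text \<open>For \<open>l = 0\<close> the factors in Hoelder's inequality degenerate on \<open>{u = 0}\<close>; the gradient vanishes there.\<close>

lemma w_zero_where_u_zero:
  assumes \<phi>: "\<phi> \<in> nonneg_tests \<Omega>"
  shows "AE x in lborel. u x = 0 \<longrightarrow> \<phi> x > 0 \<longrightarrow> w x = 0"
proof -
  define q where "q = p / (p - 1)"
  have q0: "q > 0" using p by (simp add: q_def)
  \<comment> \<open>Then \<alpha> - 1 + p = (p - 1) / 2 lies in (0, p], the range in which the
    truncated weighted integral is finite at shift 0.\<close>
  define \<alpha> where "\<alpha> = (1 - p) / 2"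
  have \<alpha>: "\<alpha> < 0" "0 < \<alpha> - 1 + p" "\<alpha> - 1 + p \<le> p" using p by (auto simp: \<alpha>_def field_simps)
  obtain \<eta> where \<eta>: "\<eta> > 0" "\<eta> powr q / q < - \<alpha>" by (rule small_parameter[OF q0 \<alpha>(1)])
  have "AE x in lborel. u x = 0 \<longrightarrow> trunc (sh n) \<phi> x > 0 \<longrightarrow> w x = 0" for n
  proof -
    have e: "sh n > 0" by simp
    note \<psi> = trunc_test(1)[OF \<phi> e]
    note [measurable] = test_meas[OF \<psi>]
    have "ennreal (- \<alpha> - \<eta> powr q / q) * gradient_int 0 \<alpha> (trunc (sh n) \<phi>) \<le> ennreal (\<eta> powr (- p) / p) * weighted_int 0 (\<alpha> - 1 + p) (trunc (sh n) \<phi>)"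
      by (rule energy(2)[OF \<psi> _ \<alpha>(1) \<eta>(1) q_def \<eta>(2)]) simp
    also have "\<dots> < \<infinity>" using weighted_int_trunc_tendsto(2)[OF \<phi> e \<alpha>(2,3)] by (simp add: ennreal_mult_less_top)
    finally have "gradient_int 0 \<alpha> (trunc (sh n) \<phi>) < \<infinity>" using \<eta>(2) by (auto simp: ennreal_mult_less_top ennreal_eq_0_iff)
    \<comment> \<open>An integrand with finite integral is finite almost everywhere. Where u = 0 the
      power with exponent \<alpha> - 1 < 0 is \<infinity>, so |w|^p must vanish wherever the
      truncated test is positive.\<close>
    then have "AE x in lborel. ennreal (norm (w x) powr p) * ennreal (u x + 0) epowr (\<alpha> - 1) * ennreal (trunc (sh n) \<phi> x) \<noteq> \<infinity>"
      unfolding gradient_int_def by (intro nn_integral_PInf_AE, measurable)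
    then show ?thesis
    proof eventually_elim
      case (elim x)
      show ?case
      proof (intro impI)
        assume "u x = 0" "trunc (sh n) \<phi> x > 0"
        then have "\<not> norm (w x) powr p > 0" using elim \<alpha> by (auto simp: epowr_def ennreal_mult_eq_top_iff)
        then show "w x = 0" by simp
      qed
    qed
  qed
  then have "AE x in lborel. \<forall>n. u x = 0 \<longrightarrow> trunc (sh n) \<phi> x > 0 \<longrightarrow> w x = 0" unfolding AE_all_countable by blast
  then show ?thesis
  proof eventually_elim
    case (elim x)
    show ?case
    proof (intro impI)
      assume u: "u x = 0" and f: "\<phi> x > 0"
      have "(\<lambda>n. ennreal (trunc (sh n) \<phi> x)) \<longlonglongrightarrow> ennreal (\<phi> x)" using f by (intro trunc_tendsto) simp
      then have "\<forall>\<^sub>F n in sequentially. ennreal (trunc (sh n) \<phi> x) > 0" using f by (intro order_tendstoD) auto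
      then obtain n where "trunc (sh n) \<phi> x > 0" by (auto simp: eventually_sequentially)
      then show "w x = 0" using elim u by blast
    qed
  qed
qed

text \<open>The weak inequality tested with \<phi>, and Cauchy-Schwarz for the flux. Should the flux
  integrand fail to be integrable, its Bochner integral is 0 and the bound is trivial.\<close>

lemma flux_estimate:
  assumes \<phi>: "\<phi> \<in> nonneg_tests \<Omega>"
  shows "(\<integral>\<^sup>+x. ennreal (h x) * ennreal (\<phi> x) \<partial>lborel) \<le> (\<integral>\<^sup>+x. ennreal (norm (w x) powr (p - 1) * norm (hgrad X \<phi> x)) \<partial>lborel)"
proof -
  obtain K B where K: "compact K" "K \<subseteq> \<Omega>" and z: "\<And>x. x \<notin> K \<Longrightarrow> \<phi> x = 0"
    and pos: "\<And>x. 0 \<le> \<phi> x" and B: "\<And>x. \<phi> x \<le> B" "\<And>x. norm (hgrad X \<phi> x) \<le> B"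
    and g0: "\<And>x. \<phi> x = 0 \<Longrightarrow> hgrad X \<phi> x = 0" and B0: "0 \<le> B"
    by (rule test_facts[OF \<phi>]) (rule that)
  have [measurable]: "K \<in> sets borel" using K by (simp add: borel_compact)
  note [measurable] = test_meas[OF \<phi>]
  have hi: "integrable lborel (\<lambda>x. h x * \<phi> x)"
  proof (rule Bochner_Integration.integrable_bound)
    show "integrable lborel (\<lambda>x. B * (h x * indicator K x))" using integrable_on_compact(3)[OF K] by simp
    have "\<bar>h x * \<phi> x\<bar> \<le> B * (h x * indicator K x)" for x
    proof (cases "x \<in> K")
      case True
      have "h x * \<phi> x \<le> h x * B" using h_nonneg[of x] B(1)[of x] by (intro mult_left_mono)
      then show ?thesis using True h_nonneg[of x] pos[of x] by (simp add: abs_mult mult.commute)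
    qed (simp add: z)
    then show "AE x in lborel. norm (h x * \<phi> x) \<le> norm (B * (h x * indicator K x))" 
      unfolding real_norm_def by (intro AE_I2) (rule order_trans[OF _ abs_ge_self])
  qed measurable
  have "(\<integral>\<^sup>+x. ennreal (h x) * ennreal (\<phi> x) \<partial>lborel) = ennreal (\<integral>x. h x * \<phi> x \<partial>lborel)"
    using hi h_nonneg pos by (subst nn_integral_eq_integral[symmetric]) (auto simp: ennreal_mult)
  also have "(\<lambda>x. h x * \<phi> x) = (\<lambda>x. indicator \<Omega> x * (h x * \<phi> x))" using z K by (auto simp: fun_eq_iff indicator_def)
  also have "ennreal (\<integral>x. indicator \<Omega> x * (h x * \<phi> x) \<partial>lborel) \<le> ennreal (\<integral>x. indicator \<Omega> x * (norm (w x) powr (p - 2) * (w x \<bullet> hgrad X \<phi> x)) \<partial>lborel)"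
    by (rule ennreal_leI[OF weak[OF \<phi>]])
  also have "\<dots> \<le> ennreal \<bar>\<integral>x. indicator \<Omega> x * (norm (w x) powr (p - 2) * (w x \<bullet> hgrad X \<phi> x)) \<partial>lborel\<bar>" by (rule ennreal_leI) simp
  also have "\<dots> \<le> (\<integral>\<^sup>+x. ennreal (norm (w x) powr (p - 1) * norm (hgrad X \<phi> x)) \<partial>lborel)"
  proof (cases "integrable lborel (\<lambda>x. indicator \<Omega> x * (norm (w x) powr (p - 2) * (w x \<bullet> hgrad X \<phi> x)))")
    case True
    have "ennreal \<bar>\<integral>x. indicator \<Omega> x * (norm (w x) powr (p - 2) * (w x \<bullet> hgrad X \<phi> x)) \<partial>lborel\<bar> \<le>
       (\<integral>\<^sup>+x. ennreal (norm (indicator \<Omega> x * (norm (w x) powr (p - 2) * (w x \<bullet> hgrad X \<phi> x)))) \<partial>lborel)"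
      using integral_norm_bound_ennreal[OF True] by simp
    also have "\<dots> \<le> (\<integral>\<^sup>+x. ennreal (norm (w x) powr (p - 1) * norm (hgrad X \<phi> x)) \<partial>lborel)"
    proof (intro nn_integral_mono ennreal_leI)
      fix x show "norm (indicator \<Omega> x * (norm (w x) powr (p - 2) * (w x \<bullet> hgrad X \<phi> x))) \<le> norm (w x) powr (p - 1) * norm (hgrad X \<phi> x)"
        using flux_bound[of x "hgrad X \<phi> x"] by (auto simp: indicator_def abs_mult)
    qed
    finally show ?thesis .
  qed (simp add: not_integrable_integral_eq)
  finally show ?thesis .
qed

text \<open>Hoelder with exponents q and p for |w|^(p-1) |\<nabla>\<phi>|, after inserting (u +
  l)^((\<alpha>-1)/q) \<phi>^(1/q) and its inverse. The q-th power of the first factor is the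
  gradient integrand; the p-th power of the second carries u + l to the exponent (1 - \<alpha>) p /
  q = (1 - \<alpha>) (p - 1). The absorbed energy inequality then bounds the gradient
  integral.\<close>

lemma holder_estimate:
  assumes \<phi>: "\<phi> \<in> nonneg_tests \<Omega>" and l: "l \<ge> 0" and \<alpha>: "\<alpha> < 0" and \<eta>: "0 < \<eta>" and q: "q = p / (p - 1)"
    and small: "\<eta> powr q / q < - \<alpha>"
  shows "(\<integral>\<^sup>+x. ennreal (h x) * ennreal (\<phi> x) \<partial>lborel) \<le>
    ennreal (((\<eta> powr (- p) / p) / (- \<alpha> - \<eta> powr q / q)) powr (1 / q)) * weighted_int l (\<alpha> - 1 + p) \<phi> epowr (1 / q) * weighted_int l ((1 - \<alpha>) * (p - 1)) \<phi> epowr (1 / p)"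
proof -
  have q1: "q > 1" "(p - 1) / p = 1 / q" "(p - 1) * q = p" "p / q = p - 1" using p by (auto simp: q field_simps)
  have pq: "p = q / (q - 1)" unfolding q using p by (simp add: field_simps)
  note [measurable] = test_meas[OF \<phi>]
  note pos = test_nonneg[OF \<phi>] and g0 = test_hgrad_zero[OF \<phi>]
  let ?f = "\<lambda>x. (ennreal (norm (w x) powr p) * ennreal (u x + l) epowr (\<alpha> - 1) * ennreal (\<phi> x)) epowr (1 / q)"
  let ?g = "\<lambda>x. (ennreal (u x + l) epowr ((1 - \<alpha>) * (p - 1)) * ennreal (cutoff_quotient \<phi> x)) epowr (1 / p)"
  have "(\<integral>\<^sup>+x. ennreal (h x) * ennreal (\<phi> x) \<partial>lborel) \<le> (\<integral>\<^sup>+x. ennreal (norm (w x) powr (p - 1) * norm (hgrad X \<phi> x)) \<partial>lborel)"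
    by (rule flux_estimate[OF \<phi>])
  also have "\<dots> \<le> (\<integral>\<^sup>+x. ?f x * ?g x \<partial>lborel)"
  proof (rule nn_integral_mono_AE)
    show "AE x in lborel. ennreal (norm (w x) powr (p - 1) * norm (hgrad X \<phi> x)) \<le> ?f x * ?g x"
      using w_zero_where_u_zero[OF \<phi>]
    proof eventually_elim
      case (elim x)
      \<comment> \<open>Where \<phi> = 0 its gradient vanishes, and where u + l = 0 the field w
        does; in the remaining case the inserted powers are finite and nonzero.\<close>
      consider "\<phi> x = 0" | "\<phi> x > 0" "u x + l = 0" | "\<phi> x > 0" "u x + l > 0"
      proof -
        have "\<phi> x = 0 \<or> \<phi> x > 0" "u x + l = 0 \<or> u x + l > 0"
          using pos[of x] u_nonneg[of x] l by linarith+
        then show ?thesis using that by blast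
      qed
      then show ?case
      proof cases
        case 1 then show ?thesis by (simp add: g0)
      next
        case 2 then have "w x = 0" using elim u_nonneg[of x] l by simp
        then show ?thesis by simp
      next
        case 3
        let ?t = "u x + l" and ?G = "norm (hgrad X \<phi> x)" and ?W = "norm (w x)"
        have "?f x * ?g x = ennreal ((?W powr p * ?t powr (\<alpha> - 1) * \<phi> x) powr (1 / q)) * ennreal ((?t powr ((1 - \<alpha>) * (p - 1)) * (?G powr p / \<phi> x powr (p - 1))) powr (1 / p))"
          using 3 p q1 unfolding cutoff_quotient_def by (simp add: epowr_ennreal ennreal_mult[symmetric] epowr_ennreal_nonneg)
        also have "\<dots> = ennreal ((?W powr p * ?t powr (\<alpha> - 1) * \<phi> x) powr (1 / q) * (?t powr ((1 - \<alpha>) * (p - 1)) * (?G powr p / \<phi> x powr (p - 1))) powr (1 / p))"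
          by (simp add: ennreal_mult)
        also have "(?W powr p * ?t powr (\<alpha> - 1) * \<phi> x) powr (1 / q) = ?W powr (p - 1) * ?t powr ((\<alpha> - 1) / q) * \<phi> x powr (1 / q)"
          using 3 q1 by (simp add: powr_mult powr_powr)
        also have "(?t powr ((1 - \<alpha>) * (p - 1)) * (?G powr p / \<phi> x powr (p - 1))) powr (1 / p) = ?t powr (- ((\<alpha> - 1) / q)) * (?G / \<phi> x powr (1 / q))"
        proof -
          have "(1 - \<alpha>) * (p - 1) * (1 / p) = - ((\<alpha> - 1) * ((p - 1) / p))" using p by (simp add: field_simps)
          then have "(1 - \<alpha>) * (p - 1) * (1 / p) = - ((\<alpha> - 1) / q)" unfolding q1(2) by simp
          moreover have "(p - 1) * (1 / p) = 1 / q" using q1(2) by simp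
          ultimately show ?thesis using 3 p by (simp only: powr_mult powr_divide powr_powr) simp
        qed
        also have "?W powr (p - 1) * ?t powr ((\<alpha> - 1) / q) * \<phi> x powr (1 / q) * (?t powr (- ((\<alpha> - 1) / q)) * (?G / \<phi> x powr (1 / q))) = ?W powr (p - 1) * ?G"
          using 3 by (simp add: powr_minus field_simps)
        finally show ?thesis by simp
      qed
    qed
  qed
  also have "\<dots> \<le> (\<integral>\<^sup>+x. ?f x epowr q \<partial>lborel) epowr (1 / q) * (\<integral>\<^sup>+x. ?g x epowr p \<partial>lborel) epowr (1 / p)"
    by (rule nn_integral_Hoelder[OF q1(1) pq]) (auto simp: weighted_int_def)
  also have "(\<integral>\<^sup>+x. ?f x epowr q \<partial>lborel) = gradient_int l \<alpha> \<phi>" unfolding gradient_int_def using q1 by (simp add: epowr_epowr)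
  also have "(\<integral>\<^sup>+x. ?g x epowr p \<partial>lborel) = weighted_int l ((1 - \<alpha>) * (p - 1)) \<phi>" unfolding weighted_int_def using p by (simp add: epowr_epowr)
  finally have main: "(\<integral>\<^sup>+x. ennreal (h x) * ennreal (\<phi> x) \<partial>lborel) \<le> gradient_int l \<alpha> \<phi> epowr (1 / q) * weighted_int l ((1 - \<alpha>) * (p - 1)) \<phi> epowr (1 / p)" .
  define c1 where "c1 = - \<alpha> - \<eta> powr q / q"
  define c2 where "c2 = \<eta> powr (- p) / p"
  have c: "c1 > 0" "c2 > 0" using small \<eta> p by (auto simp: c1_def c2_def)
  have "gradient_int l \<alpha> \<phi> = ennreal (1 / c1) * (ennreal c1 * gradient_int l \<alpha> \<phi>)"
    using c by (simp add: mult.assoc[symmetric] ennreal_mult[symmetric])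
  also have "\<dots> \<le> ennreal (1 / c1) * (ennreal c2 * weighted_int l (\<alpha> - 1 + p) \<phi>)"
    unfolding c1_def c2_def by (intro mult_left_mono energy(2)[OF \<phi> l \<alpha> \<eta> q small]) simp
  also have "\<dots> = ennreal (c2 / c1) * weighted_int l (\<alpha> - 1 + p) \<phi>"
    using c ennreal_mult[of "1 / c1" c2] by (simp add: mult.assoc)
  finally have "gradient_int l \<alpha> \<phi> epowr (1 / q) \<le> (ennreal (c2 / c1) * weighted_int l (\<alpha> - 1 + p) \<phi>) epowr (1 / q)"
    using q1 by (intro epowr_mono) auto
  also have "\<dots> = ennreal (c2 / c1) epowr (1 / q) * weighted_int l (\<alpha> - 1 + p) \<phi> epowr (1 / q)"
    using q1 by (intro epowr_mult) auto
  also have "ennreal (c2 / c1) epowr (1 / q) = ennreal ((c2 / c1) powr (1 / q))"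
    using c by (intro epowr_ennreal) auto
  finally have "gradient_int l \<alpha> \<phi> epowr (1 / q) \<le> ennreal ((c2 / c1) powr (1 / q)) * weighted_int l (\<alpha> - 1 + p) \<phi> epowr (1 / q)" .
  from order_trans[OF main mult_right_mono[OF this]] show ?thesis by (simp add: c1_def c2_def)
qed

end

section \<open>Borel representatives of a weak solution\<close>

text \<open>A left-invariant field is determined by its value at the origin, an axis vector for the
  first layer; so it is \<open>Y (axis i 1)\<close>, and layer 1 makes it homogeneous of degree one.
  The zero fields used as padding scale in the same way.\<close>

lemma carnot_group_locale:
  assumes "homogeneous_carnot_group r layer mul X"
  obtains mul' iv' where "homogeneous_lie_group mul (m_inv (group_of mul)) layer mul' iv'"
    "\<And>i. X i = homogeneous_lie_group.Y mul' (axis i 1) \<or> X i = (\<lambda>x. 0)"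
    "\<And>i x R. R > 0 \<Longrightarrow> dilation layer R (X i x) = R *\<^sub>R X i (dilation layer R x)"
    "\<And>i. continuous_on UNIV (X i)"
proof -
  let ?G = "group_of mul" and ?iv = "m_inv (group_of mul)"
  have G: "group ?G" and sm: "smooth_on UNIV (\<lambda>z. mul (fst z) (snd z))" and si: "smooth_on UNIV ?iv"
    and lay: "range layer = {1..r}" and dil: "\<And>R. R > 0 \<Longrightarrow> dilation layer R \<in> iso ?G ?G"
    and hf: "horizontal_frame mul layer X"
    using assms unfolding homogeneous_carnot_group_def lie_group_law_def by auto
  interpret G: group ?G by (rule G)
  have carr: "carrier ?G = UNIV" "monoid.mult ?G = mul" "monoid.one ?G = 0" by (auto simp: group_of_def)
  have "Ck_on 1 UNIV ?iv" by (rule spec[OF si[unfolded smooth_on_def]])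
  then obtain iv' where iv': "C1_deriv ?iv iv'" by (rule Ck_on_1_UNIV_iff[THEN iffD1, THEN exE])
  \<comment> \<open>Two derivatives of the group law are taken: one defines the left-invariant
    fields, the other makes them C^1.\<close>
  have "Ck_on (Suc 1) UNIV (\<lambda>z. mul (fst z) (snd z))" by (rule spec[OF sm[unfolded smooth_on_def]])
  then have C2: "Ck_on 1 UNIV (\<lambda>z. frechet_derivative (\<lambda>z. mul (fst z) (snd z)) (at z) d)" for d
    unfolding Ck_on.simps(2) by (rule spec[OF conjunct2])
  have "Ck_on 1 UNIV (\<lambda>z. mul (fst z) (snd z))" by (rule spec[OF sm[unfolded smooth_on_def]])
  then obtain mul' where mul': "C1_deriv (\<lambda>z. mul (fst z) (snd z)) mul'" by (rule Ck_on_1_UNIV_iff[THEN iffD1, THEN exE])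
  have loc: "homogeneous_lie_group mul ?iv layer mul' iv'"
  proof
    show "mul (mul x y) z = mul x (mul y z)" for x y z using G.m_assoc[of x y z] by (simp add: carr)
    show "mul 0 x = x" "mul x 0 = x" for x using G.l_one[of x] G.r_one[of x] by (simp_all add: carr)
    show "mul (?iv x) x = 0" "mul x (?iv x) = 0" for x using G.l_inv[of x] G.r_inv[of x] by (simp_all add: carr)
    show "1 \<le> layer i" for i using lay by (metis atLeastAtMost_iff rangeI)
    show "dilation layer R (mul x y) = mul (dilation layer R x) (dilation layer R y)" if "R > 0" for R x y
      using dil[OF that] by (auto simp: iso_def hom_def carr)
    show "C1_deriv (\<lambda>z. mul (fst z) (snd z)) mul'" "C1_deriv ?iv iv'" by fact+
    show "\<exists>D. C1_deriv (\<lambda>a. blinfun_apply (mul' (a, 0)) (0, v)) D" for v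
    proof -
      have "Ck_on 1 UNIV (\<lambda>z. blinfun_apply (mul' z) (0, v))"
        using C2[of "(0, v)"] unfolding C1_deriv_frechet[OF mul'] .
      then obtain E where E: "C1_deriv (\<lambda>z. blinfun_apply (mul' z) (0, v)) E"
        by (rule Ck_on_1_UNIV_iff[THEN iffD1, THEN exE])
      show ?thesis by (rule C1_deriv_section_fst[OF E, of 0]) (rule exI)
    qed
  qed
  interpret homogeneous_lie_group mul ?iv layer mul' iv' by (rule loc)
  have XY: "X i = Y (axis i 1)" if "layer i = 1" for i
  proof
    fix a
    have li: "left_invariant mul (X i)" "X i 0 = axis i 1" using hf that unfolding horizontal_frame_def by auto
    then have "frechet_derivative (mul a) (at 0) (X i 0) = X i (mul a 0)" unfolding left_invariant_def by blast
    moreover have "frechet_derivative (mul a) (at 0) = (\<lambda>v. Y v a)"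
      using frechet_derivative_at[OF mul_left_deriv_0] by simp
    ultimately show "X i a = Y (axis i 1) a" using li by simp
  qed
  have X0: "X i = (\<lambda>x. 0)" if "layer i \<noteq> 1" for i using hf that unfolding horizontal_frame_def by auto
  show ?thesis
  proof (rule that[OF loc])
    show "X i = Y (axis i 1) \<or> X i = (\<lambda>x. 0)" for i using XY X0 by blast
    show "dilation layer R (X i x) = R *\<^sub>R X i (dilation layer R x)" if "R > 0" for i x R
    proof (cases "layer i = 1")
      case True then show ?thesis using Y_axis_dilation[OF that, of i x] by (simp add: XY)
    next
      case False then show ?thesis by (simp add: X0 dilation_def vec_eq_iff)
    qed
    show "continuous_on UNIV (X i)" for i
    proof (cases "layer i = 1")
      case True
      obtain D where "C1_deriv (Y (axis i 1)) D" using Y_C1 .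
      then show ?thesis using C1_deriv_imp_continuous True by (simp add: XY)
    qed (simp add: X0)
  qed
qed

lemma lebesgue_on_borel_version:
  fixes f :: "real^'n \<Rightarrow> real"
  assumes \<Omega>: "open \<Omega>" and f: "f \<in> borel_measurable (lebesgue_on \<Omega>)"
  obtains g where "g \<in> borel_measurable borel" "AE x in lborel. x \<in> \<Omega> \<longrightarrow> f x = g x"
    "(\<lambda>x. indicator \<Omega> x * f x) \<in> borel_measurable lebesgue"
proof -
  have m: "(\<lambda>x. indicator \<Omega> x * f x) \<in> borel_measurable lebesgue"
    using f \<Omega> by (subst (asm) borel_measurable_restrict_space_iff) auto
  obtain g where g: "g \<in> borel_measurable lborel" "AE x in lborel. indicator \<Omega> x * f x = g x"
    using completion_ex_borel_measurable_real[OF m] by blast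
  have "AE x in lborel. x \<in> \<Omega> \<longrightarrow> f x = g x" using g(2) by eventually_elim (auto simp: indicator_def)
  then show ?thesis using g(1) m by (intro that[of g]) auto
qed

lemma AE_lebesgue_iff: "(AE x in lebesgue. P x) \<longleftrightarrow> (AE x in lborel. P x)"
  by (rule AE_completion_iff)

lemma integral_lebesgue_version:
  fixes f g :: "real^'n \<Rightarrow> real"
  assumes "f \<in> borel_measurable lebesgue" "g \<in> borel_measurable borel" "AE x in lborel. f x = g x"
  shows "(\<integral>x. f x \<partial>lebesgue) = (\<integral>x. g x \<partial>lborel)"
proof -
  have "g \<in> borel_measurable lborel" using assms(2) by simp
  then have g: "g \<in> borel_measurable lebesgue" by (rule measurable_completion)
  have "AE x in lebesgue. f x = g x" unfolding AE_lebesgue_iff by (rule assms(3))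
  then have "(\<integral>x. f x \<partial>lebesgue) = (\<integral>x. g x \<partial>lebesgue)" by (rule integral_cong_AE[OF assms(1) g])
  also have "\<dots> = (\<integral>x. g x \<partial>lborel)" using \<open>g \<in> borel_measurable lborel\<close> by (rule integral_completion)
  finally show ?thesis .
qed

text \<open>Changing values on a null set makes u and h Borel and nonnegative everywhere and w
  Borel, as convolution and Fubini over \<open>lborel\<close> require. The integrals in the weak
  formulation are unaffected, and the approximation property comes from mollifying the new
  representatives.\<close>

lemma supersolution_version:
  assumes carnot: "homogeneous_carnot_group r layer mul X" and \<Omega>: "open \<Omega>" and p: "1 < p"
    and uW: "u \<in> W1p_loc X p \<Omega>" and u0: "AE x in lebesgue. x \<in> \<Omega> \<longrightarrow> 0 \<le> u x"
    and h0: "AE x in lebesgue. x \<in> \<Omega> \<longrightarrow> 0 \<le> h x" and hL: "Lp_loc 1 \<Omega> h" and ss: "weak_supersolution X \<Omega> p h u"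
  obtains u' h' w' where "supersolution X \<Omega> p u' h' w'"
    "AE x in lborel. x \<in> \<Omega> \<longrightarrow> u x = u' x \<and> h x = h' x \<and> weak_hgrad X \<Omega> u x = w' x"
proof -
  define w where "w = weak_hgrad X \<Omega> u"
  have uL: "Lp_loc p \<Omega> u" and wL: "Lp_loc p \<Omega> w" and ww: "is_weak_hgrad X \<Omega> u w"
  proof -
    \<comment> \<open>\<open>weak_hgrad\<close> is a choice; existence turns the chosen function
      into a genuine weak gradient.\<close>
    have "\<exists>w. is_weak_hgrad X \<Omega> u w" using uW unfolding W1p_loc_def by blast
    then show "is_weak_hgrad X \<Omega> u w" unfolding w_def weak_hgrad_def by (rule someI_ex)
  qed (use uW in \<open>auto simp: W1p_loc_def w_def\<close>)
  obtain mul' iv' where loc: "homogeneous_lie_group mul (m_inv (group_of mul)) layer mul' iv'"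
    and XY: "\<And>i. X i = homogeneous_lie_group.Y mul' (axis i 1) \<or> X i = (\<lambda>x. 0)"
    and Xc: "\<And>i. continuous_on UNIV (X i)"
    by (rule carnot_group_locale[OF carnot]) (rule that)
  interpret homogeneous_lie_group mul "m_inv (group_of mul)" layer mul' iv' by (rule loc)
  have um: "u \<in> borel_measurable (lebesgue_on \<Omega>)" and wm: "w \<in> borel_measurable (lebesgue_on \<Omega>)" and hm: "h \<in> borel_measurable (lebesgue_on \<Omega>)"
    using uL wL hL by (auto simp: Lp_loc_def)
  have wim: "(\<lambda>x. w x $ i) \<in> borel_measurable (lebesgue_on \<Omega>)" for i
    using measurable_compose[OF wm borel_measurable_continuous_onI[OF continuous_on_component[of UNIV "\<lambda>x::real^'a. x" i]]] by simp
  obtain u1 where u1: "u1 \<in> borel_measurable borel" "AE x in lborel. x \<in> \<Omega> \<longrightarrow> u x = u1 x" "(\<lambda>x. indicator \<Omega> x * u x) \<in> borel_measurable lebesgue"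
    by (rule lebesgue_on_borel_version[OF \<Omega> um]) (rule that)
  obtain h1 where h1: "h1 \<in> borel_measurable borel" "AE x in lborel. x \<in> \<Omega> \<longrightarrow> h x = h1 x" "(\<lambda>x. indicator \<Omega> x * h x) \<in> borel_measurable lebesgue"
    by (rule lebesgue_on_borel_version[OF \<Omega> hm]) (rule that)
  have wex: "\<exists>g. g \<in> borel_measurable borel \<and> (AE x in lborel. x \<in> \<Omega> \<longrightarrow> w x $ i = g x) \<and> (\<lambda>x. indicator \<Omega> x * w x $ i) \<in> borel_measurable lebesgue" for i
  proof -
    obtain g where "g \<in> borel_measurable borel" "AE x in lborel. x \<in> \<Omega> \<longrightarrow> w x $ i = g x" "(\<lambda>x. indicator \<Omega> x * w x $ i) \<in> borel_measurable lebesgue"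
      by (rule lebesgue_on_borel_version[OF \<Omega> wim[of i]]) (rule that)
    then show ?thesis by (intro exI[of _ g] conjI)
  qed
  have "\<exists>w1. \<forall>i. w1 i \<in> borel_measurable borel \<and> (AE x in lborel. x \<in> \<Omega> \<longrightarrow> w x $ i = w1 i x) \<and> (\<lambda>x. indicator \<Omega> x * w x $ i) \<in> borel_measurable lebesgue"
    by (rule choice) (rule allI, rule wex)
  then obtain w1 where w1: "\<And>i. w1 i \<in> borel_measurable borel" "\<And>i. AE x in lborel. x \<in> \<Omega> \<longrightarrow> w x $ i = w1 i x"
    "\<And>i. (\<lambda>x. indicator \<Omega> x * w x $ i) \<in> borel_measurable lebesgue" by auto
  define u' where "u' x = max 0 (u1 x)" for x
  define h' where "h' x = max 0 (h1 x)" for x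
  define w' where "w' x = (\<chi> i. w1 i x)" for x
  have [measurable]: "u' \<in> borel_measurable borel" "h' \<in> borel_measurable borel"
    using u1 h1 unfolding u'_def h'_def by measurable
  have w'm[measurable]: "w' \<in> borel_measurable borel"
    unfolding w'_def by (subst borel_measurable_euclidean_space) (auto simp: Basis_vec_def inner_axis w1(1))
  have w'im[measurable]: "(\<lambda>x. w' x $ i) \<in> borel_measurable borel" for i using w1(1) by (simp add: w'_def)
  have eq: "AE x in lborel. x \<in> \<Omega> \<longrightarrow> u x = u' x \<and> h x = h' x \<and> w x = w' x"
  proof -
    have "AE x in lborel. \<forall>i. x \<in> \<Omega> \<longrightarrow> w x $ i = w1 i x" unfolding AE_all_countable by (intro allI w1(2))
    moreover have "AE x in lborel. x \<in> \<Omega> \<longrightarrow> 0 \<le> u x" "AE x in lborel. x \<in> \<Omega> \<longrightarrow> 0 \<le> h x"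
      using u0 h0 by (simp_all only: AE_lebesgue_iff)
    ultimately show ?thesis using u1(2) h1(2)
    proof eventually_elim
      case (elim x)
      then show ?case by (auto simp: u'_def h'_def w'_def vec_eq_iff)
    qed
  qed
  have LpK: "(\<integral>\<^sup>+x. ennreal (norm (f' x) powr s) * indicator K x \<partial>lborel) < \<infinity>"
    if "Lp_loc s \<Omega> f" "AE x in lborel. x \<in> \<Omega> \<longrightarrow> f x = f' x" "compact K" "K \<subseteq> \<Omega>" for f f' :: "real^'a \<Rightarrow> 'b::real_normed_vector" and s K
  proof -
    have "(\<integral>\<^sup>+x. ennreal (norm (f' x) powr s) * indicator K x \<partial>lborel) = (\<integral>\<^sup>+x. ennreal (norm (f x) powr s) * indicator K x \<partial>lborel)"
    proof (rule nn_integral_cong_AE)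
      show "AE x in lborel. ennreal (norm (f' x) powr s) * indicator K x = ennreal (norm (f x) powr s) * indicator K x"
        using that(2)
      proof eventually_elim
        case (elim x)
        then show ?case using subsetD[OF that(4), of x] by (cases "x \<in> K") auto
      qed
    qed
    also have "\<dots> < \<infinity>" using that(1,3,4) unfolding Lp_loc_def by (simp add: nn_integral_completion)
    finally show ?thesis .
  qed
  have equ: "AE x in lborel. x \<in> \<Omega> \<longrightarrow> u x = u' x" and eqh: "AE x in lborel. x \<in> \<Omega> \<longrightarrow> h x = h' x"
    and eqw: "AE x in lborel. x \<in> \<Omega> \<longrightarrow> w x = w' x" using eq by auto
  have u'K: "(\<integral>\<^sup>+x. ennreal (\<bar>u' x\<bar> powr p) * indicator K x \<partial>lborel) < \<infinity>" if "compact K" "K \<subseteq> \<Omega>" for K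
    using LpK[OF uL equ that] by simp
  have w'K: "(\<integral>\<^sup>+x. ennreal (norm (w' x) powr p) * indicator K x \<partial>lborel) < \<infinity>" if "compact K" "K \<subseteq> \<Omega>" for K
    using LpK[OF wL eqw that] .
  have h'K: "(\<integral>\<^sup>+x. ennreal (h' x) * indicator K x \<partial>lborel) < \<infinity>" if "compact K" "K \<subseteq> \<Omega>" for K
    using LpK[OF hL eqh that] by (simp add: h'_def)
  have [measurable]: "\<Omega> \<in> sets borel" using \<Omega> by simp
  have lint: "(LINT x:\<Omega>|lebesgue. f x) = (\<integral>x. indicator \<Omega> x * f x \<partial>lebesgue)" for f :: "real^'a \<Rightarrow> real"
    by (simp add: set_lebesgue_integral_def)
  have ml: "f \<in> borel_measurable lebesgue" if "f \<in> borel_measurable borel" for f :: "real^'a \<Rightarrow> real"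
    using measurable_completion[of f lborel borel] that by simp
  have weak_int: "(\<integral>x. indicator \<Omega> x * (u' x * formal_adjoint (X i) \<phi> x) \<partial>lborel) = (\<integral>x. indicator \<Omega> x * (w' x $ i * \<phi> x) \<partial>lborel)"
    if \<phi>: "\<phi> \<in> C1_0 \<Omega>" for i \<phi>
  proof -
    obtain \<phi>' where \<phi>': "C1_deriv \<phi> \<phi>'" by (rule C1_0_imp_C1_deriv[OF \<phi> \<Omega>]) (rule that)
    have "continuous_on UNIV (formal_adjoint (X i) \<phi>)"
    proof -
      have "continuous_on UNIV (\<lambda>x. - blinfun_apply (\<phi>' x) (X i x))"
        using C1_deriv_cont[OF \<phi>'] Xc by (intro continuous_intros)
      moreover have "formal_adjoint (X i) \<phi> = (\<lambda>x. - blinfun_apply (\<phi>' x) (X i x))"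
      proof (rule ext)
        fix x
        from XY[of i] show "formal_adjoint (X i) \<phi> x = - blinfun_apply (\<phi>' x) (X i x)"
        proof
          assume "X i = Y (axis i 1)"
          then show ?thesis by (simp only: formal_adjoint_Y[OF \<phi>'])
        next
          assume "X i = (\<lambda>x. 0)"
          then show ?thesis by (simp only: formal_adjoint_zero blinfun.zero_right minus_zero)
        qed
      qed
      ultimately show ?thesis by simp
    qed
    then have am[measurable]: "formal_adjoint (X i) \<phi> \<in> borel_measurable borel" by (rule borel_measurable_continuous_onI)
    have pm[measurable]: "\<phi> \<in> borel_measurable borel" using C1_deriv_imp_continuous[OF \<phi>'] by (rule borel_measurable_continuous_onI)
    have "(\<integral>x. indicator \<Omega> x * (u x * formal_adjoint (X i) \<phi> x) \<partial>lebesgue) = (\<integral>x. indicator \<Omega> x * (w x $ i * \<phi> x) \<partial>lebesgue)"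
      by (rule bspec[OF spec[OF conjunct2[OF ww[unfolded is_weak_hgrad_def lint]]] \<phi>])
    moreover have "(\<integral>x. indicator \<Omega> x * (u x * formal_adjoint (X i) \<phi> x) \<partial>lebesgue) = (\<integral>x. indicator \<Omega> x * (u' x * formal_adjoint (X i) \<phi> x) \<partial>lborel)"
    proof (rule integral_lebesgue_version)
      have "(\<lambda>x. (indicator \<Omega> x * u x) * formal_adjoint (X i) \<phi> x) \<in> borel_measurable lebesgue"
        by (rule borel_measurable_times[OF u1(3) ml[OF am]])
      then show "(\<lambda>x. indicator \<Omega> x * (u x * formal_adjoint (X i) \<phi> x)) \<in> borel_measurable lebesgue" by (simp add: mult.assoc)
      show "AE x in lborel. indicator \<Omega> x * (u x * formal_adjoint (X i) \<phi> x) = indicator \<Omega> x * (u' x * formal_adjoint (X i) \<phi> x)"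
        using equ
      proof eventually_elim
        case (elim x)
        then show ?case by (cases "x \<in> \<Omega>") simp_all
      qed
    qed measurable
    moreover have "(\<integral>x. indicator \<Omega> x * (w x $ i * \<phi> x) \<partial>lebesgue) = (\<integral>x. indicator \<Omega> x * (w' x $ i * \<phi> x) \<partial>lborel)"
    proof (rule integral_lebesgue_version)
      have "(\<lambda>x. (indicator \<Omega> x * w x $ i) * \<phi> x) \<in> borel_measurable lebesgue"
        by (rule borel_measurable_times[OF w1(3) ml[OF pm]])
      then show "(\<lambda>x. indicator \<Omega> x * (w x $ i * \<phi> x)) \<in> borel_measurable lebesgue" by (simp add: mult.assoc)
      show "AE x in lborel. indicator \<Omega> x * (w x $ i * \<phi> x) = indicator \<Omega> x * (w' x $ i * \<phi> x)"
        using eqw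
      proof eventually_elim
        case (elim x)
        then show ?case by (cases "x \<in> \<Omega>") simp_all
      qed
    qed measurable
    ultimately show ?thesis by (simp only:)
  qed
  have "supersolution X \<Omega> p u' h' w'"
  proof
    show "open \<Omega>" "1 < p" by fact+
    show "continuous_on UNIV (X i)" for i by (rule Xc)
    show "0 \<le> u' x" "0 \<le> h' x" for x by (auto simp: u'_def h'_def)
    show "u' \<in> borel_measurable borel" "h' \<in> borel_measurable borel" "w' \<in> borel_measurable borel" by measurable
    fix K :: "(real^'a) set" assume K: "compact K" "K \<subseteq> \<Omega>"
    show "(\<integral>\<^sup>+x. ennreal (\<bar>u' x\<bar> powr p) * indicator K x \<partial>lborel) < \<infinity>" by (rule u'K[OF K])
    show "(\<integral>\<^sup>+x. ennreal (norm (w' x) powr p) * indicator K x \<partial>lborel) < \<infinity>" by (rule w'K[OF K])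
    show "(\<integral>\<^sup>+x. ennreal (h' x) * indicator K x \<partial>lborel) < \<infinity>" by (rule h'K[OF K])
    have u'0: "0 \<le> u' x" for x by (simp add: u'_def)
    have u'm: "u' \<in> borel_measurable borel" by measurable
    show "\<exists>U. (\<forall>n. \<exists>D. C1_deriv (U n) D) \<and> (\<forall>n x. 0 \<le> U n x) \<and>
      (AE x in lborel. x \<in> K \<longrightarrow> (\<lambda>n. U n x) \<longlonglongrightarrow> u' x) \<and>
      (\<forall>i. (\<lambda>n::nat. \<integral>\<^sup>+x. ennreal (\<bar>hgrad X (U n) x $ i - w' x $ i\<bar> powr p) * indicator K x \<partial>lborel) \<longlonglongrightarrow> 0)"
    proof -
      obtain U where "\<And>n. \<exists>D. C1_deriv (U n) D" "\<And>n x. 0 \<le> U n x"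
        "AE x in lborel. x \<in> K \<longrightarrow> (\<lambda>n. U n x) \<longlonglongrightarrow> u' x"
        "\<And>i. (\<lambda>n::nat. \<integral>\<^sup>+x. ennreal (\<bar>hgrad X (U n) x $ i - w' x $ i\<bar> powr p) * indicator K x \<partial>lborel) \<longlonglongrightarrow> 0"
      proof (rule C1_approximation[OF \<Omega> K p u'm u'0 w'm])
        show "(\<integral>\<^sup>+x. ennreal (\<bar>u' x\<bar> powr p) * indicator K x \<partial>lborel) < \<infinity>" if "compact K" "K \<subseteq> \<Omega>" for K
          by (rule u'K[OF that])
        show "(\<integral>\<^sup>+x. ennreal (norm (w' x) powr p) * indicator K x \<partial>lborel) < \<infinity>" if "compact K" "K \<subseteq> \<Omega>" for K
          by (rule w'K[OF that])
        show "X i = Y (axis i 1) \<or> X i = (\<lambda>x. 0)" for i by (rule XY)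
        show "(\<integral>x. indicator \<Omega> x * (u' x * formal_adjoint (X i) \<phi> x) \<partial>lborel) = (\<integral>x. indicator \<Omega> x * (w' x $ i * \<phi> x) \<partial>lborel)"
          if "\<phi> \<in> C1_0 \<Omega>" for i \<phi> by (rule weak_int[OF that])
      qed (rule that)
      then show ?thesis by (intro exI[of _ U] conjI allI)
    qed
  next
    fix \<phi> assume \<phi>: "\<phi> \<in> nonneg_tests \<Omega>"
    then have "\<phi> \<in> C1_0 \<Omega>" by (simp add: nonneg_tests_def)
    then obtain \<phi>' where \<phi>': "C1_deriv \<phi> \<phi>'" by (rule C1_0_imp_C1_deriv[OF _ \<Omega>])
    have pm[measurable]: "\<phi> \<in> borel_measurable borel" using C1_deriv_imp_continuous[OF \<phi>'] by (rule borel_measurable_continuous_onI)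
    have gm[measurable]: "hgrad X \<phi> \<in> borel_measurable borel" by (rule borel_measurable_continuous_onI, rule continuous_hgrad[OF _ \<phi>'], rule Xc)
    have "(\<integral>x. indicator \<Omega> x * (h x * \<phi> x) \<partial>lebesgue) \<le> (\<integral>x. indicator \<Omega> x * (norm (w x) powr (p - 2) * (w x \<bullet> hgrad X \<phi> x)) \<partial>lebesgue)"
      by (rule bspec[OF ss[unfolded weak_supersolution_def lint w_def[symmetric]] \<phi>])
    moreover have "(\<integral>x. indicator \<Omega> x * (h x * \<phi> x) \<partial>lebesgue) = (\<integral>x. indicator \<Omega> x * (h' x * \<phi> x) \<partial>lborel)"
    proof (rule integral_lebesgue_version)
      have "(\<lambda>x. (indicator \<Omega> x * h x) * \<phi> x) \<in> borel_measurable lebesgue"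
        by (rule borel_measurable_times[OF h1(3) ml[OF pm]])
      then show "(\<lambda>x. indicator \<Omega> x * (h x * \<phi> x)) \<in> borel_measurable lebesgue" by (simp add: mult.assoc)
      show "AE x in lborel. indicator \<Omega> x * (h x * \<phi> x) = indicator \<Omega> x * (h' x * \<phi> x)"
        using eqh
      proof eventually_elim
        case (elim x)
        then show ?case by (cases "x \<in> \<Omega>") simp_all
      qed
    qed measurable
    moreover have "(\<integral>x. indicator \<Omega> x * (norm (w x) powr (p - 2) * (w x \<bullet> hgrad X \<phi> x)) \<partial>lebesgue) =
      (\<integral>x. indicator \<Omega> x * (norm (w' x) powr (p - 2) * (w' x \<bullet> hgrad X \<phi> x)) \<partial>lborel)"
    proof (rule integral_lebesgue_version)
      have wv[measurable]: "(\<lambda>x. indicator \<Omega> x *\<^sub>R w x) \<in> borel_measurable lebesgue"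
        using wm \<Omega> by (subst (asm) borel_measurable_restrict_space_iff) auto
      have gl[measurable]: "hgrad X \<phi> \<in> borel_measurable lebesgue" using measurable_completion[of "hgrad X \<phi>" lborel borel] gm by simp
      have "(\<lambda>x. norm (indicator \<Omega> x *\<^sub>R w x) powr (p - 2) * ((indicator \<Omega> x *\<^sub>R w x) \<bullet> hgrad X \<phi> x)) \<in> borel_measurable lebesgue"
        by measurable
      also have "(\<lambda>x. norm (indicator \<Omega> x *\<^sub>R w x) powr (p - 2) * ((indicator \<Omega> x *\<^sub>R w x) \<bullet> hgrad X \<phi> x)) =
         (\<lambda>x. indicator \<Omega> x * (norm (w x) powr (p - 2) * (w x \<bullet> hgrad X \<phi> x)))"
        by (auto simp: fun_eq_iff indicator_def)
      finally show "(\<lambda>x. indicator \<Omega> x * (norm (w x) powr (p - 2) * (w x \<bullet> hgrad X \<phi> x))) \<in> borel_measurable lebesgue" .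
      show "AE x in lborel. indicator \<Omega> x * (norm (w x) powr (p - 2) * (w x \<bullet> hgrad X \<phi> x)) = indicator \<Omega> x * (norm (w' x) powr (p - 2) * (w' x \<bullet> hgrad X \<phi> x))"
        using eqw
      proof eventually_elim
        case (elim x)
        then show ?case by (cases "x \<in> \<Omega>") simp_all
      qed
    qed measurable
    ultimately show "(\<integral>x. indicator \<Omega> x * (h' x * \<phi> x) \<partial>lborel) \<le>
      (\<integral>x. indicator \<Omega> x * (norm (w' x) powr (p - 2) * (w' x \<bullet> hgrad X \<phi> x)) \<partial>lborel)" by (simp only:)
  qed
  then show ?thesis by (rule that[OF _ eq[unfolded w_def]])
qed

section \<open>Averages over homogeneous balls\<close>

lemma dilation_dilation: "dilation layer a (dilation layer b x) = dilation layer (a * b) x"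
  by (simp add: dilation_def vec_eq_iff power_mult_distrib)

lemma dilation_1 [simp]: "dilation layer 1 x = x"
  by (simp add: dilation_def vec_eq_iff)

lemma dilation_cancel: "t > 0 \<Longrightarrow> dilation layer t (dilation layer (1 / t) x) = x" "t > 0 \<Longrightarrow> dilation layer (1 / t) (dilation layer t x) = x"
  by (simp_all add: dilation_dilation)

text \<open>A dilation is diagonal, so it scales Lebesgue measure by the product of the t^(layer i).
  One factor serves all Borel sets and therefore cancels in quotients of measures.\<close>

lemma emeasure_lborel_dilation:
  fixes layer :: "'n::finite \<Rightarrow> nat"
  assumes t: "t > 0"
  obtains c :: real where "c > 0" "\<And>A. A \<in> sets borel \<Longrightarrow> emeasure lborel A = ennreal c * emeasure lborel (dilation layer t -` A)"
proof -
  define k :: "real^'n \<Rightarrow> real" where "k j = t ^ layer (axis_index j)" for j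
  have k0: "k j \<noteq> 0" "k j > 0" for j using t by (auto simp: k_def)
  have T: "(\<lambda>x. 0 + (\<Sum>j\<in>Basis. (k j * (x \<bullet> j)) *\<^sub>R j)) = dilation layer t"
  proof (rule ext)
    fix x :: "real^'n"
    show "0 + (\<Sum>j\<in>Basis. (k j * (x \<bullet> j)) *\<^sub>R j) = dilation layer t x"
    proof (rule euclidean_eqI)
      fix b :: "real^'n" assume b: "b \<in> Basis"
      then obtain i where i: "b = axis i 1" by (auto simp: Basis_vec_def)
      have "(0 + (\<Sum>j\<in>Basis. (k j * (x \<bullet> j)) *\<^sub>R j)) \<bullet> b = k b * (x \<bullet> b)"
        using b by (simp add: inner_sum_left_Basis)
      also have "\<dots> = dilation layer t x \<bullet> b" using b by (simp add: k_def i inner_axis dilation_nth)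
      finally show "(0 + (\<Sum>j\<in>Basis. (k j * (x \<bullet> j)) *\<^sub>R j)) \<bullet> b = dilation layer t x \<bullet> b" .
    qed
  qed
  define c where "c = (\<Prod>j\<in>(Basis :: (real^'n) set). \<bar>k j\<bar>)"
  have c: "c > 0" unfolding c_def using k0 by (intro prod_pos) auto
  have L: "lborel = density (distr lborel borel (dilation layer t)) (\<lambda>_. (\<Prod>j\<in>(Basis :: (real^'n) set). \<bar>k j\<bar>))"
    using lborel_affine_euclidean[of k "0::real^'n"] k0 unfolding T by blast
  have m: "dilation layer t \<in> borel_measurable borel"
    using bounded_linear_dilation by (intro borel_measurable_continuous_onI linear_continuous_on)
  have "emeasure lborel A = ennreal c * emeasure lborel (dilation layer t -` A)" if A: "A \<in> sets borel" for A
  proof -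
    have "emeasure lborel A = emeasure (density (distr lborel borel (dilation layer t)) (\<lambda>_. ennreal c)) A"
      using L unfolding c_def by (rule arg_cong[where f="\<lambda>M. emeasure M A"])
    also have "\<dots> = ennreal c * emeasure (distr lborel borel (dilation layer t)) A"
      using A by (simp add: emeasure_density_const)
    also have "emeasure (distr lborel borel (dilation layer t)) A = emeasure lborel (dilation layer t -` A)"
      using A m by (subst emeasure_distr) auto
    finally show ?thesis .
  qed
  then show ?thesis using c by (intro that[of c])
qed

context
  fixes layer :: "'n::finite \<Rightarrow> nat" and S :: "real^'n \<Rightarrow> real"
  assumes S_dilation: "\<And>R x. R > 0 \<Longrightarrow> S (dilation layer R x) = R * S x"
begin

lemma hball_dilation:
  assumes "t > 0"
  shows "dilation layer t -` hball S (t * r) = hball S r" "dilation layer t ` hball S r = hball S (t * r)"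
proof -
  show v: "dilation layer t -` hball S (t * r) = hball S r" using assms by (auto simp: hball_def S_dilation)
  show "dilation layer t ` hball S r = hball S (t * r)"
  proof (intro equalityI subsetI)
    fix x assume "x \<in> hball S (t * r)"
    then have "dilation layer (1 / t) x \<in> hball S r" using assms by (simp add: v[symmetric] dilation_cancel)
    then show "x \<in> dilation layer t ` hball S r" using dilation_cancel(1)[OF assms, of layer x] by (metis imageI)
  qed (use v in blast)
qed

text \<open>Dilations are injective linear maps in finite dimension and so commute with the closure
  that the annulus removes.\<close>

lemma annulus_dilation:
  assumes "t > 0"
  shows "dilation layer t -` annulus S (t * r) = annulus S r"
proof -
  have inj: "inj (dilation layer t)" using dilation_cancel(2)[OF assms] by (metis injI)
  have lin: "linear (dilation layer t)" using bounded_linear_dilation bounded_linear.linear by blast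
  have "closure (hball S (t * r)) = dilation layer t ` closure (hball S r)"
    using closure_injective_linear_image[OF lin inj, of "hball S r"] by (simp add: hball_dilation(2)[OF assms])
  then have "dilation layer t -` closure (hball S (t * r)) = closure (hball S r)"
    using inj by (simp add: inj_vimage_image_eq)
  moreover have "dilation layer t -` hball S (2 * (t * r)) = hball S (2 * r)"
    using hball_dilation(1)[OF assms, of "2 * r"] by (simp add: mult_ac)
  ultimately show ?thesis unfolding annulus_def by (simp add: vimage_Diff)
qed

lemma bounded_hball_scale:
  assumes "bounded (hball S r)" "t > 0"
  shows "bounded (hball S (t * r))"
  using bounded_linear_image[OF assms(1) bounded_linear_dilation] hball_dilation(2)[OF assms(2), of r] by metis

end

section \<open>Cutoff functions adapted to homogeneous balls\<close>

context homogeneous_lie_group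
begin

text \<open>S is continuous but composing a profile with it need not give a C^1 function, so the
  indicator of \<open>{x. S x \<le> 3 / 2}\<close> is mollified. The mollifier is so narrow that S
  changes by at most 1/4: S x < 1 forces S y \<le> 5/4 on the support of the kernel, and S y \<le>
  3/2 forces S x \<le> 7/4.\<close>

lemma unit_cutoff:
  fixes S :: "real^'n \<Rightarrow> real"
  assumes S: "continuous_on UNIV S" and b: "bounded (hball S 2)"
  obtains \<phi> \<phi>' where "C1_deriv \<phi> \<phi>'" "\<And>x. 0 \<le> \<phi> x" "\<And>x. S x < 1 \<longrightarrow> \<phi> x = 1" "\<And>x. S x \<ge> 2 \<longrightarrow> \<phi> x = (0::real)"
proof -
  have cl: "closed {x. S x \<le> c}" for c using S by (intro closed_Collect_le continuous_intros)
  have comp: "compact {x. S x \<le> c}" if "c < 2" for c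
    unfolding compact_eq_bounded_closed using cl b that by (auto intro: bounded_subset simp: hball_def)
  let ?K = "{x. S x \<le> 3 / 2}"
  have K: "compact ?K" by (rule comp) simp
  have "continuous_on UNIV (\<lambda>(a :: real^'n, x :: real^'n). S (mul (iv a) x))" unfolding case_prod_unfold
    by (intro continuous_on_compose2[OF S] continuous_intros) auto
  then obtain d1 where d1: "d1 > 0" "\<And>a x. dist a 0 < d1 \<Longrightarrow> S x \<le> 1 \<Longrightarrow> dist (S (mul (iv a) x)) (S (mul (iv 0) x)) \<le> 1 / 4"
    using uniform_near_on_compact[of "\<lambda>a x. S (mul (iv a) x)" "{x. S x \<le> 1}" "1 / 4" 0] comp[of 1] by auto
  have "continuous_on UNIV (\<lambda>(a :: real^'n, x :: real^'n). S (mul a x))" unfolding case_prod_unfold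
    by (intro continuous_on_compose2[OF S] continuous_intros) auto
  then obtain d2 where d2: "d2 > 0" "\<And>a x. dist a 0 < d2 \<Longrightarrow> S x \<le> 3 / 2 \<Longrightarrow> dist (S (mul a x)) (S (mul 0 x)) \<le> 1 / 4"
    using uniform_near_on_compact[of "\<lambda>a x. S (mul a x)" ?K "1 / 4" 0] K by auto
  obtain \<rho> where \<rho>: "mollifier (min d1 d2) \<rho>" by (rule mollifier_exists[of "min d1 d2"]) (use d1 d2 in auto)
  define \<phi> where "\<phi> = moll \<rho> (indicator ?K)"
  have ii: "integrable lborel (indicator ?K :: real^'n \<Rightarrow> real)" by (rule integrable_indicator_compact[OF K])
  obtain \<phi>' where "C1_deriv (moll \<rho> (indicator ?K)) \<phi>'"
    by (rule moll_C1[OF \<rho> K ii]) (simp, rule that)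
  then have \<phi>': "C1_deriv \<phi> \<phi>'" unfolding \<phi>_def .
  show ?thesis
  proof (rule that[OF \<phi>'])
    fix x
    show "0 \<le> \<phi> x" unfolding \<phi>_def moll_def using mollifierD(1)[OF \<rho>] by (intro Bochner_Integration.integral_nonneg) simp
    have near: "norm (mul x (iv y)) < d1" "norm (mul x (iv y)) < d2" if "\<rho> (mul x (iv y)) \<noteq> 0" for y
      using mollifierD(2)[OF \<rho> that] by auto
    show "S x < 1 \<longrightarrow> \<phi> x = 1"
    proof
      assume x: "S x < 1"
      have "\<phi> x = (\<integral>y. \<rho> (mul x (iv y)) \<partial>lborel)" unfolding \<phi>_def moll_def
      proof (intro Bochner_Integration.integral_cong refl)
        fix y
        show "\<rho> (mul x (iv y)) * indicator ?K y = \<rho> (mul x (iv y))"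
        proof (cases "\<rho> (mul x (iv y)) = 0")
          case False
          have "mul (iv (mul x (iv y))) x = y" by (simp add: iv_mul assoc)
          then have "dist (S y) (S x) \<le> 1 / 4" using d1(2)[of "mul x (iv y)" x] near(1)[OF False] x by simp
          then have "S y \<le> 3 / 2" using x unfolding dist_real_def by linarith
          then show ?thesis by simp
        qed simp
      qed
      then show "\<phi> x = 1" by (simp add: mollifierD(3)[OF \<rho>])
    qed
    show "S x \<ge> 2 \<longrightarrow> \<phi> x = 0"
    proof
      assume x: "S x \<ge> 2"
      have "\<phi> x = (\<integral>y. 0 \<partial>(lborel :: (real^'n) measure))" unfolding \<phi>_def moll_def
      proof (intro Bochner_Integration.integral_cong refl)
        fix y
        show "\<rho> (mul x (iv y)) * indicator ?K y = 0"
        proof (cases "\<rho> (mul x (iv y)) = 0 \<or> y \<notin> ?K")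
          case False
          have "mul (mul x (iv y)) y = x" by (simp add: assoc)
          then have "dist (S x) (S y) \<le> 1 / 4" using d2(2)[of "mul x (iv y)" y] near(2)[of y] False by simp
          moreover have "S y \<le> 3 / 2" using False by simp
          ultimately have False using x unfolding dist_real_def by linarith
          then show ?thesis ..
        qed auto
      qed
      then show "\<phi> x = 0" by simp
    qed
  qed
qed

text \<open>For the p-th power \<psi>1 = \<phi>^p the quotient |\<nabla>\<psi>1|^p / \<psi>1^(p-1)
  equals p^p |\<nabla>\<phi>|^p and is bounded. The fields are homogeneous of degree one, so
  composing with the dilation by 1/R multiplies it by R^(-p); the constant depends neither on R nor
  on \<open>\<Omega>\<close>.\<close>

lemma scaled_cutoff:
  fixes S :: "real^'n \<Rightarrow> real" and X :: "'n \<Rightarrow> real^'n \<Rightarrow> real^'n"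
  assumes S: "continuous_on UNIV S" and S_dilation: "\<And>R x. R > 0 \<Longrightarrow> S (dilation layer R x) = R * S x"
    and b: "bounded (hball S 2)" and p: "1 < p"
    and X: "\<And>i x R. R > 0 \<Longrightarrow> dilation layer R (X i x) = R *\<^sub>R X i (dilation layer R x)"
    and Xc: "\<And>i. continuous_on UNIV (X i)"
  obtains c where "0 \<le> c" "\<And>R \<Omega>. R > 0 \<Longrightarrow> compactly_inside (hball S (2 * R)) \<Omega> \<Longrightarrow>
    \<exists>\<psi>\<in>nonneg_tests \<Omega>. (\<forall>x\<in>hball S R. \<psi> x = 1) \<and>
      (\<forall>x. norm (hgrad X \<psi> x) powr p / \<psi> x powr (p - 1) \<le> c * R powr (- p) * indicator (annulus S R) x)"
proof -
  obtain \<phi> \<phi>' where \<phi>: "C1_deriv \<phi> \<phi>'" and \<phi>0: "\<And>x. 0 \<le> \<phi> x" and "\<And>x. S x < 1 \<longrightarrow> \<phi> x = 1"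
    and "\<And>x. S x \<ge> 2 \<longrightarrow> \<phi> x = (0::real)"
    by (rule unit_cutoff[OF S b]) (rule that)
  then have \<phi>1: "\<And>x. S x < 1 \<Longrightarrow> \<phi> x = 1" and \<phi>2: "\<And>x. S x \<ge> 2 \<Longrightarrow> \<phi> x = 0" by simp_all
  let ?K = "closure (hball S 2)"
  have K: "compact ?K" using b by (simp add: compact_closure)
  have zK: "\<phi> x = 0" if "x \<notin> ?K" for x
  proof (rule \<phi>2, rule ccontr)
    assume "\<not> 2 \<le> S x"
    then have "x \<in> hball S 2" by (simp add: hball_def)
    then show False using that closure_subset by blast
  qed
  have "bounded (hgrad X \<phi> ` ?K)"
    using continuous_on_subset[OF continuous_hgrad[of X, OF Xc \<phi>] subset_UNIV] K
    by (blast intro: compact_imp_bounded compact_continuous_image)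
  then obtain B where B: "\<And>x. x \<in> ?K \<Longrightarrow> norm (hgrad X \<phi> x) \<le> B" by (auto simp: bounded_iff)
  have gB: "norm (hgrad X \<phi> x) \<le> \<bar>B\<bar>" for x
  proof (cases "x \<in> ?K")
    case False
    have "hgrad X \<phi> x = 0" using C1_deriv_zero_off_compact[OF \<phi> K zK False] by (simp add: vec_eq_iff hgrad_nth_C1[OF \<phi>])
    then show ?thesis by simp
  qed (use B in \<open>force intro: order_trans\<close>)
  define \<psi>1 where "\<psi>1 x = max 0 (\<phi> x) powr p" for x
  obtain \<psi>1' where \<psi>1': "C1_deriv \<psi>1 \<psi>1'" and \<psi>1'eq: "\<And>x. \<psi>1' x = (p * max 0 (\<phi> x) powr (p - 1)) *\<^sub>R \<phi>' x"
    using C1_deriv_pos_part_powr[OF p \<phi>] unfolding \<psi>1_def[abs_def] by blast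
  define c where "c = (p * \<bar>B\<bar>) powr p"
  have Q1: "norm (hgrad X \<psi>1 x) powr p / \<psi>1 x powr (p - 1) \<le> c" for x
  proof (cases "\<phi> x = 0")
    case True then show ?thesis using p by (simp add: \<psi>1_def c_def)
  next
    case False
    then have f: "\<phi> x > 0" using \<phi>0[of x] by simp
    have g: "hgrad X \<psi>1 x = (p * \<phi> x powr (p - 1)) *\<^sub>R hgrad X \<phi> x"
      using f by (simp add: vec_eq_iff hgrad_nth_C1[OF \<psi>1'] hgrad_nth_C1[OF \<phi>] \<psi>1'eq scaleR_blinfun.rep_eq)
    have "norm (hgrad X \<psi>1 x) powr p / \<psi>1 x powr (p - 1) = (\<phi> x powr (p - 1) * (p * norm (hgrad X \<phi> x))) powr p / (\<phi> x powr p) powr (p - 1)"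
      unfolding g using f p by (simp add: \<psi>1_def abs_mult mult_ac)
    also have "\<dots> = (p * norm (hgrad X \<phi> x)) powr p"
      using f p by (simp add: powr_mult[of "\<phi> x powr (p - 1)"] powr_powr mult.commute)
    also have "\<dots> \<le> c" unfolding c_def using p gB[of x] by (intro powr_mono2 mult_left_mono) auto
    finally show ?thesis .
  qed
  show ?thesis
  proof (rule that)
    show "0 \<le> c" by (simp add: c_def)
    fix R :: real and \<Omega> assume R: "R > 0" and ci: "compactly_inside (hball S (2 * R)) \<Omega>"
    let ?d = "dilation layer (1 / R)"
    define \<psi> where "\<psi> x = \<psi>1 (?d x)" for x
    have R1: "1 / R > 0" using R by simp
    have Sd: "S (?d x) = S x / R" for x using S_dilation[OF R1, of x] by simp
    note C = C1_deriv_compose[OF \<psi>1' C1_deriv_linear[OF bounded_linear_dilation[of layer "1 / R"]]]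
    have \<psi>': "C1_deriv \<psi> (\<lambda>x. \<psi>1' (?d x) o\<^sub>L Blinfun ?d)" using C unfolding \<psi>_def[abs_def] .
    have \<psi>0: "0 \<le> \<psi> x" for x by (simp add: \<psi>_def \<psi>1_def)
    have \<psi>z: "\<psi> x = 0" if "x \<notin> hball S (2 * R)" for x
    proof -
      have "S (?d x) \<ge> 2" using that R by (simp add: Sd hball_def field_simps)
      then show ?thesis using p by (simp add: \<psi>_def \<psi>1_def \<phi>2)
    qed
    have cK: "compact (closure (hball S (2 * R)))" "closure (hball S (2 * R)) \<subseteq> \<Omega>" using ci by (auto simp: compactly_inside_def)
    have "\<psi> x = 0" if "x \<notin> closure (hball S (2 * R))" for x using \<psi>z that closure_subset by blast
    then have "\<psi> \<in> C1_0 \<Omega>" by (rule C1_deriv_imp_C1_0[OF \<psi>' cK])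
    then have test: "\<psi> \<in> nonneg_tests \<Omega>" using \<psi>0 by (simp add: nonneg_tests_def)
    have one: "\<psi> x = 1" if "x \<in> hball S R" for x
      using that R by (simp add: \<psi>_def \<psi>1_def hball_def \<phi>1 Sd)
    have grad: "hgrad X \<psi> x = (1 / R) *\<^sub>R hgrad X \<psi>1 (?d x)" for x
      by (subst vec_eq_iff) (simp add: hgrad_nth_C1[OF \<psi>'] hgrad_nth_C1[OF \<psi>1'] blinfun_compose.rep_eq
          bounded_linear_Blinfun_apply[OF bounded_linear_dilation] blinfun.scaleR_right X[OF R1])
    \<comment> \<open>Outside B_2R the cutoff is at its minimum 0. On B_R it is constant, and by
      continuity its gradient vanishes on the closure too; so the quotient lives on the
      annulus.\<close>
    have g0: "hgrad X \<psi> x = 0" if x: "x \<notin> annulus S R" for x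
    proof -
      consider "x \<notin> hball S (2 * R)" | "x \<in> closure (hball S R)" using x unfolding annulus_def by blast
      then show ?thesis
      proof cases
        case 1
        have "(\<psi>1' (?d x) o\<^sub>L Blinfun ?d) = 0" by (rule C1_deriv_zero_at_min[OF \<psi>' \<psi>0 \<psi>z[OF 1]])
        then show ?thesis by (simp only: vec_eq_iff hgrad_nth_C1[OF \<psi>']) simp
      next
        case 2
        have op: "open (hball S R)" unfolding hball_def using S by (intro open_Collect_less continuous_intros)
        have "hgrad X \<psi> y = 0" if y: "y \<in> hball S R" for y
        proof -
          have "(\<psi> has_derivative (\<lambda>h. 0)) (at y)"
            by (rule has_derivative_transform_within_open[OF has_derivative_const[of 1] op y]) (simp add: one)
          then have "frechet_derivative \<psi> (at y) = (\<lambda>h. 0)" using frechet_derivative_at by metis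
          then show ?thesis by (simp add: hgrad_def vec_eq_iff)
        qed
        then have "hball S R \<subseteq> {y. hgrad X \<psi> y = 0}" by blast
        moreover have "closed {y. hgrad X \<psi> y = 0}"
          by (intro closed_Collect_eq continuous_hgrad[of X, OF Xc \<psi>'] continuous_on_const)
        ultimately have "closure (hball S R) \<subseteq> {y. hgrad X \<psi> y = 0}" by (rule closure_minimal)
        then show ?thesis using 2 by blast
      qed
    qed
    have "norm (hgrad X \<psi> x) powr p / \<psi> x powr (p - 1) \<le> c * R powr (- p) * indicator (annulus S R) x" for x
    proof (cases "x \<in> annulus S R")
      case True
      have "norm (hgrad X \<psi> x) powr p / \<psi> x powr (p - 1) = (1 / R) powr p * (norm (hgrad X \<psi>1 (?d x)) powr p / \<psi>1 (?d x) powr (p - 1))"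
        unfolding grad using R by (simp add: \<psi>_def powr_mult powr_divide)
      also have "\<dots> \<le> (1 / R) powr p * c" by (intro mult_left_mono Q1) simp
      also have "(1 / R) powr p = R powr (- p)" using R by (simp add: powr_minus_divide powr_divide)
      finally show ?thesis using True by (simp add: mult.commute)
    next
      case False
      then show ?thesis using p by (simp add: g0[OF False])
    qed
    then show "\<exists>\<psi>\<in>nonneg_tests \<Omega>. (\<forall>x\<in>hball S R. \<psi> x = 1) \<and>
      (\<forall>x. norm (hgrad X \<psi> x) powr p / \<psi> x powr (p - 1) \<le> c * R powr (- p) * indicator (annulus S R) x)"
      using test one by blast
  qed
qed

end

section \<open>Averages and power means\<close>

lemma divide_ennreal_real: "0 < a \<Longrightarrow> x / ennreal a = x * ennreal (1 / a)"
  by (simp add: divide_ennreal_def inverse_ennreal inverse_eq_divide)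

lemma ennreal_avg_cancel: "0 < a \<Longrightarrow> ennreal a * (x / ennreal a) = x"
proof -
  assume a: "0 < a"
  have "ennreal a * (x / ennreal a) = x * (ennreal a * ennreal (1 / a))"
    by (simp only: divide_ennreal_real[OF a] mult_ac)
  also have "ennreal a * ennreal (1 / a) = 1" using a by (simp add: ennreal_mult[symmetric])
  finally show ?thesis by simp
qed

lemma avg_lborel:
  assumes E: "E \<in> sets borel"
  shows "avg E h = (\<integral>\<^sup>+x. h x * indicator E x \<partial>lborel) / emeasure lborel E"
proof -
  have E': "E \<in> sets lborel" "E \<in> sets lebesgue" using E by auto
  have "emeasure lebesgue E = (\<integral>\<^sup>+x. indicator E x \<partial>lebesgue)" using nn_integral_indicator[OF E'(2)] by simp
  also have "\<dots> = emeasure lborel E" unfolding nn_integral_completion using nn_integral_indicator[OF E'(1)] by simp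
  finally show ?thesis unfolding avg_def nn_integral_completion by simp
qed

lemma avg_cong_AE:
  assumes E: "E \<in> sets borel" and eq: "AE x in lborel. x \<in> E \<longrightarrow> f x = g x"
  shows "avg E f = avg E g"
proof -
  have "(\<integral>\<^sup>+x. f x * indicator E x \<partial>lborel) = (\<integral>\<^sup>+x. g x * indicator E x \<partial>lborel)"
  proof (rule nn_integral_cong_AE)
    show "AE x in lborel. f x * indicator E x = g x * indicator E x" using eq
    proof eventually_elim
      case (elim x) then show ?case by (cases "x \<in> E") simp_all
    qed
  qed
  then show ?thesis by (simp only: avg_lborel[OF E])
qed

text \<open>Since 1/q + 1/p = 1, pulling the measure a out of both powers leaves exactly one factor
  a.\<close>

lemma avg_rescale:
  assumes p: "1 < p" and q: "q = p / (p - 1)" and a: "0 < a" and b: "0 < b" and D: "0 \<le> D"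
    and J: "J \<le> ennreal D * I1 epowr (1 / q) * I2 epowr (1 / p)"
  shows "J / ennreal b \<le> ennreal (D * a / b) * (I1 / ennreal a) epowr (1 / q) * (I2 / ennreal a) epowr (1 / p)"
proof -
  have q1: "q > 0" "1 / q + 1 / p = 1" using p by (auto simp: q field_simps)
  have "J \<le> ennreal D * (ennreal a * (I1 / ennreal a)) epowr (1 / q) * (ennreal a * (I2 / ennreal a)) epowr (1 / p)"
    using J by (simp only: ennreal_avg_cancel[OF a])
  also have "\<dots> = ennreal D * (ennreal a epowr (1 / q) * ennreal a epowr (1 / p)) * (I1 / ennreal a) epowr (1 / q) * (I2 / ennreal a) epowr (1 / p)"
    using p q1(1) epowr_mult[of "1 / q" "ennreal a" "I1 / ennreal a"] epowr_mult[of "1 / p" "ennreal a" "I2 / ennreal a"]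
    by (simp add: mult_ac)
  also have "ennreal a epowr (1 / q) * ennreal a epowr (1 / p) = ennreal a"
    using p q1 epowr_add[of "1 / q" "1 / p" "ennreal a"] by simp
  finally have "J * ennreal (1 / b) \<le> ennreal D * ennreal a * (I1 / ennreal a) epowr (1 / q) * (I2 / ennreal a) epowr (1 / p) * ennreal (1 / b)"
    by (rule mult_right_mono) simp
  also have "\<dots> = (ennreal D * ennreal a * ennreal (1 / b)) * (I1 / ennreal a) epowr (1 / q) * (I2 / ennreal a) epowr (1 / p)"
    by (simp only: mult_ac)
  also have "ennreal D * ennreal a * ennreal (1 / b) = ennreal (D * a / b)"
    using D a b by (simp add: ennreal_mult[symmetric])
  finally show ?thesis by (simp only: divide_ennreal_real[OF b])
qed

text \<open>Jensen's inequality, as Hoelder with exponent t / s against the indicator of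
  \<open>E\<close>. It is stated in [0,\<infinity>], so both averages may be infinite.\<close>

lemma power_mean:
  assumes s: "0 < s" "s \<le> t" and [measurable]: "f \<in> borel_measurable M" "E \<in> sets M" and a: "0 < a" "emeasure M E = ennreal a"
  shows "(\<integral>\<^sup>+x. f x epowr s * indicator E x \<partial>M) / ennreal a \<le> ((\<integral>\<^sup>+x. f x epowr t * indicator E x \<partial>M) / ennreal a) epowr (s / t)"
proof (cases "s = t")
  case True then show ?thesis using s by simp
next
  case False
  define P where "P = t / s"
  define Q where "Q = P / (P - 1)"
  have P: "1 < P" using s False by (simp add: P_def)
  have Q: "Q > 0" "1 / P + 1 / Q = 1" "1 / P = s / t" "s * P = t" using P s by (auto simp: Q_def P_def field_simps)
  define I where "I = (\<integral>\<^sup>+x. f x epowr t * indicator E x \<partial>M)"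
  have "(\<integral>\<^sup>+x. f x epowr s * indicator E x \<partial>M) = (\<integral>\<^sup>+x. (f x epowr s * indicator E x) * indicator E x \<partial>M)"
    by (intro nn_integral_cong) (simp add: indicator_def)
  also have "\<dots> \<le> (\<integral>\<^sup>+x. (f x epowr s * indicator E x) epowr P \<partial>M) epowr (1 / P) * (\<integral>\<^sup>+x. indicator E x epowr Q \<partial>M) epowr (1 / Q)"
    by (rule nn_integral_Hoelder[OF P Q_def]) measurable
  also have "(\<integral>\<^sup>+x. (f x epowr s * indicator E x) epowr P \<partial>M) = I"
    unfolding I_def using P s Q by (intro nn_integral_cong) (auto simp: indicator_def epowr_epowr zero_epowr)
  also have "(\<integral>\<^sup>+x. indicator E x epowr Q \<partial>M) = (\<integral>\<^sup>+x. indicator E x \<partial>M)"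
    using Q(1) epowr_ennreal[of 1 Q] by (intro nn_integral_cong) (auto simp: indicator_def zero_epowr)
  also have "\<dots> = ennreal a" using a by simp
  finally have 1: "(\<integral>\<^sup>+x. f x epowr s * indicator E x \<partial>M) \<le> I epowr (1 / P) * ennreal a epowr (1 / Q)" .
  have "I epowr (1 / P) = ennreal a epowr (1 / P) * (I / ennreal a) epowr (1 / P)"
    using P epowr_mult[of "1 / P" "ennreal a" "I / ennreal a"] ennreal_avg_cancel[OF a(1), of I] by simp
  then have "I epowr (1 / P) * ennreal a epowr (1 / Q) = (ennreal a epowr (1 / P) * ennreal a epowr (1 / Q)) * (I / ennreal a) epowr (1 / P)"
    by (simp only: mult_ac)
  also have "ennreal a epowr (1 / P) * ennreal a epowr (1 / Q) = ennreal a"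
  proof -
    have "ennreal a epowr (1 / P) * ennreal a epowr (1 / Q) = ennreal a epowr (1 / P + 1 / Q)"
      using P Q(1) by (intro epowr_add[symmetric]) auto
    then show ?thesis by (simp only: Q(2) epowr_1)
  qed
  finally have "(\<integral>\<^sup>+x. f x epowr s * indicator E x \<partial>M) * ennreal (1 / a) \<le> ennreal a * (I / ennreal a) epowr (1 / P) * ennreal (1 / a)"
    using 1 by (intro mult_right_mono) auto
  also have "\<dots> = (I / ennreal a) epowr (1 / P) * (ennreal a * ennreal (1 / a))" by (simp only: mult_ac)
  also have "ennreal a * ennreal (1 / a) = 1" using a by (simp add: ennreal_mult[symmetric])
  finally show ?thesis unfolding I_def using Q(3) by (simp add: divide_ennreal_real[OF a(1)])
qed

text \<open>a - e may be negative, so the subtraction takes place in the extended reals. If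
  \<open>G = \<infinity>\<close> the right side is \<infinity>; otherwise \<open>D\<close>, and with
  it \<open>F\<close>, is finite and the claim concerns real numbers.\<close>

lemma ereal_energy:
  assumes le: "F + ennreal a * D \<le> ennreal e * D + ennreal c * G" and c: "0 < c" and ae: "0 \<le> a" "0 \<le> e"
    and fin: "G < \<infinity> \<Longrightarrow> D < \<infinity>"
  shows "enn2ereal F + ereal (a - e) * enn2ereal D \<le> ereal c * enn2ereal G"
proof (cases "G = \<infinity>")
  case True
  then show ?thesis using c by simp
next
  case False
  then obtain g where g: "G = ennreal g" "g \<ge> 0" by (cases G rule: ennreal_cases) auto
  have "D < \<infinity>" using fin False by (simp add: less_top)
  then obtain d where d: "D = ennreal d" "d \<ge> 0" by (cases D rule: ennreal_cases) auto
  have r: "ennreal e * D + ennreal c * G = ennreal (e * d + c * g)"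
    unfolding g(1) d(1) using g(2) d(2) ae c by (simp add: ennreal_mult)
  have "F \<le> F + ennreal a * D" by simp
  then have "F < \<infinity>" using le r by (metis ennreal_less_top infinity_ennreal_def order_trans le_less_trans)
  then obtain f where f: "F = ennreal f" "f \<ge> 0" by (cases F rule: ennreal_cases) auto
  have "F + ennreal a * D = ennreal (f + a * d)"
    unfolding f(1) d(1) using f(2) d(2) ae by (simp add: ennreal_mult)
  then have "ennreal (f + a * d) \<le> ennreal (e * d + c * g)" using le r by simp
  then have "f + a * d \<le> e * d + c * g" using ae c g(2) d(2) by (subst (asm) ennreal_le_iff) auto
  then show ?thesis using f d g by (simp add: enn2ereal_ennreal left_diff_distrib)
qed

section \<open>Ball estimates for a single inequation\<close>

context supersolution
begin

text \<open>\<open>C\<close> is fixed before the test, the bound k and the sets, which later makes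
  the constants independent of R. The bound k enters both Hoelder factors with exponents 1/q and
  1/p, hence to the first power.\<close>

lemma ball_estimate:
  assumes \<alpha>: "\<alpha> < 0" and q: "q = p / (p - 1)"
  obtains C where "C > 0" "\<forall>\<psi>\<in>nonneg_tests \<Omega>. \<forall>k\<ge>0. \<forall>A\<in>sets borel. \<forall>B. (\<forall>x\<in>B. \<psi> x = 1) \<longrightarrow> (\<forall>x. cutoff_quotient \<psi> x \<le> k * indicator A x) \<longrightarrow>
    (\<integral>\<^sup>+x. ennreal (h x) * indicator B x \<partial>lborel) \<le> ennreal (C * k) *
      (\<integral>\<^sup>+x. ennreal (u x) epowr (\<alpha> - 1 + p) * indicator A x \<partial>lborel) epowr (1 / q) *
      (\<integral>\<^sup>+x. ennreal (u x) epowr ((1 - \<alpha>) * (p - 1)) * indicator A x \<partial>lborel) epowr (1 / p)"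
proof -
  have q1: "q > 0" "1 / q + 1 / p = 1" using p by (auto simp: q field_simps)
  obtain \<eta> where \<eta>: "\<eta> > 0" "\<eta> powr q / q < - \<alpha>" by (rule small_parameter[OF q1(1) \<alpha>])
  define C where "C = ((\<eta> powr (- p) / p) / (- \<alpha> - \<eta> powr q / q)) powr (1 / q)"
  have C: "C > 0" using \<eta> p by (simp add: C_def)
  show ?thesis
  proof (rule that[OF C], intro ballI allI impI)
    fix \<psi> k A B
    assume \<psi>: "\<psi> \<in> nonneg_tests \<Omega>" and k: "0 \<le> (k::real)" and A[measurable]: "A \<in> sets borel"
      and B: "\<forall>x\<in>B. \<psi> x = 1" and Q: "\<forall>x. cutoff_quotient \<psi> x \<le> k * indicator A x"
    let ?I = "\<lambda>s. \<integral>\<^sup>+x. ennreal (u x) epowr s * indicator A x \<partial>lborel"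
    have G: "weighted_int 0 s \<psi> \<le> ennreal k * ?I s" for s
    proof -
      have "weighted_int 0 s \<psi> \<le> (\<integral>\<^sup>+x. ennreal k * (ennreal (u x) epowr s * indicator A x) \<partial>lborel)"
        unfolding weighted_int_def
      proof (rule nn_integral_mono)
        fix x
        have "ennreal (cutoff_quotient \<psi> x) \<le> ennreal (k * indicator A x)" using Q by (intro ennreal_leI) simp
        also have "\<dots> = ennreal k * indicator A x" by (simp add: indicator_def)
        finally have "ennreal (u x + 0) epowr s * ennreal (cutoff_quotient \<psi> x) \<le> ennreal (u x + 0) epowr s * (ennreal k * indicator A x)"
          by (rule mult_left_mono) simp
        then show "ennreal (u x + 0) epowr s * ennreal (cutoff_quotient \<psi> x) \<le> ennreal k * (ennreal (u x) epowr s * indicator A x)"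
          by (simp add: mult_ac)
      qed
      also have "\<dots> = ennreal k * ?I s" by (rule nn_integral_cmult) measurable
      finally show ?thesis .
    qed
    have "(\<integral>\<^sup>+x. ennreal (h x) * indicator B x \<partial>lborel) \<le> (\<integral>\<^sup>+x. ennreal (h x) * ennreal (\<psi> x) \<partial>lborel)"
      using B by (intro nn_integral_mono mult_left_mono) (auto simp: indicator_def)
    also have "\<dots> \<le> ennreal C * weighted_int 0 (\<alpha> - 1 + p) \<psi> epowr (1 / q) * weighted_int 0 ((1 - \<alpha>) * (p - 1)) \<psi> epowr (1 / p)"
      unfolding C_def by (rule holder_estimate[OF \<psi> order_refl \<alpha> \<eta>(1) q \<eta>(2)])
    also have "\<dots> \<le> ennreal C * (ennreal k * ?I (\<alpha> - 1 + p)) epowr (1 / q) * (ennreal k * ?I ((1 - \<alpha>) * (p - 1))) epowr (1 / p)"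
      using q1 p by (intro mult_mono order_refl epowr_mono G) auto
    also have "\<dots> = ennreal C * (ennreal k epowr (1 / q) * ennreal k epowr (1 / p)) * ?I (\<alpha> - 1 + p) epowr (1 / q) * ?I ((1 - \<alpha>) * (p - 1)) epowr (1 / p)"
      using p q1(1) by (simp add: epowr_mult mult_ac)
    also have "ennreal k epowr (1 / q) * ennreal k epowr (1 / p) = ennreal k"
      using p q1 epowr_add[of "1 / q" "1 / p" "ennreal k"] by simp
    also have "ennreal C * ennreal k = ennreal (C * k)" using C k by (simp add: ennreal_mult)
    finally show "(\<integral>\<^sup>+x. ennreal (h x) * indicator B x \<partial>lborel) \<le> ennreal (C * k) * ?I (\<alpha> - 1 + p) epowr (1 / q) * ?I ((1 - \<alpha>) * (p - 1)) epowr (1 / p)" .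
  qed
qed

end

text \<open>One inequation of the system, with the coupling hidden in the source term h. It is
  instantiated once for u and once for v.\<close>

locale supersolution_on_carnot =
  fixes r :: nat and layer :: "'n::finite \<Rightarrow> nat" and mul :: "real^'n \<Rightarrow> real^'n \<Rightarrow> real^'n"
    and X :: "'n \<Rightarrow> real^'n \<Rightarrow> real^'n" and S :: "real^'n \<Rightarrow> real" and \<Omega> :: "(real^'n) set" and p :: real
    and u h :: "real^'n \<Rightarrow> real"
  assumes carnot: "homogeneous_carnot_group r layer mul X" and S_norm: "homogeneous_norm layer mul S"
    and open_domain: "open \<Omega>" and p: "1 < p" and u_W: "u \<in> W1p_loc X p \<Omega>"
    and u_nonneg: "AE x in lebesgue. x \<in> \<Omega> \<longrightarrow> 0 \<le> u x" and h_nonneg: "AE x in lebesgue. x \<in> \<Omega> \<longrightarrow> 0 \<le> h x"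
    and h_L1: "Lp_loc 1 \<Omega> h" and weak: "weak_supersolution X \<Omega> p h u"
begin

lemma S_cont: "continuous_on UNIV S" and S_dilation: "R > 0 \<Longrightarrow> S (dilation layer R x) = R * S x" and S_zero: "S x = 0 \<longleftrightarrow> x = 0" and S_nonneg: "0 \<le> S x"
  using S_norm unfolding homogeneous_norm_def by blast+

lemma hball_open: "open (hball S R)"
  unfolding hball_def using S_cont by (intro open_Collect_less continuous_intros)

lemma hball_borel [measurable]: "hball S R \<in> sets borel" and annulus_borel [measurable]: "annulus S R \<in> sets borel"
  unfolding annulus_def using hball_open by auto

lemma inside_subset:
  assumes "R > 0" "compactly_inside (hball S (2 * R)) \<Omega>"
  shows "hball S R \<subseteq> \<Omega>" "annulus S R \<subseteq> \<Omega>" "hball S (2 * R) \<subseteq> \<Omega>"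
proof -
  show *: "hball S (2 * R) \<subseteq> \<Omega>" using assms(2) closure_subset[of "hball S (2 * R)"] unfolding compactly_inside_def by blast
  show "hball S R \<subseteq> \<Omega>" "annulus S R \<subseteq> \<Omega>" using * assms(1) by (force simp: hball_def annulus_def)+
qed

lemma versions:
  obtains u' h' w' where "supersolution X \<Omega> p u' h' w'"
    "AE x in lborel. x \<in> \<Omega> \<longrightarrow> u x = u' x \<and> h x = h' x \<and> weak_hgrad X \<Omega> u x = w' x"
  by (rule supersolution_version[OF carnot open_domain p u_W u_nonneg h_nonneg h_L1 weak]) (rule that)

lemma energy_functionals:
  assumes ss: "supersolution X \<Omega> p u' h' w'"
    and eq: "AE x in lborel. x \<in> \<Omega> \<longrightarrow> u x = u' x \<and> h x = h' x \<and> weak_hgrad X \<Omega> u x = w' x"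
    and \<phi>: "\<phi> \<in> nonneg_tests \<Omega>"
  shows "(\<integral>\<^sup>+x\<in>\<Omega>. ennreal (h x) * ennreal (u x + l) epowr \<alpha> * ennreal (\<phi> x) \<partial>lebesgue) = supersolution.source_int u' h' l \<alpha> \<phi>"
    and "(\<integral>\<^sup>+x\<in>\<Omega>. ennreal (norm (weak_hgrad X \<Omega> u x) powr p) * ennreal (u x + l) epowr (\<alpha> - 1) * ennreal (\<phi> x) \<partial>lebesgue) = supersolution.gradient_int p u' w' l \<alpha> \<phi>"
    and "(\<integral>\<^sup>+x\<in>\<Omega>. ennreal (u x + l) epowr s * ennreal (norm (hgrad X \<phi> x) powr p / \<phi> x powr (p - 1)) \<partial>lebesgue) = supersolution.weighted_int X p u' l s \<phi>"
    and "(\<integral>\<^sup>+x\<in>\<Omega>. ennreal (h x) * ennreal (\<phi> x) \<partial>lebesgue) = (\<integral>\<^sup>+x. ennreal (h' x) * ennreal (\<phi> x) \<partial>lborel)"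
proof -
  interpret supersolution X \<Omega> p u' h' w' by (rule ss)
  have z: "\<phi> x = 0" if "x \<notin> \<Omega>" for x using \<phi> that unfolding nonneg_tests_def C1_0_def by blast
  have zg: "hgrad X \<phi> x = 0" if "x \<notin> \<Omega>" for x by (rule test_hgrad_zero[OF \<phi> z[OF that]])
  note c = nn_integral_cong_AE[OF AE_mp[OF eq AE_I2]]
  show "(\<integral>\<^sup>+x\<in>\<Omega>. ennreal (h x) * ennreal (u x + l) epowr \<alpha> * ennreal (\<phi> x) \<partial>lebesgue) = source_int l \<alpha> \<phi>"
    unfolding nn_integral_completion source_int_def by (rule c) (auto simp: indicator_def z)
  show "(\<integral>\<^sup>+x\<in>\<Omega>. ennreal (norm (weak_hgrad X \<Omega> u x) powr p) * ennreal (u x + l) epowr (\<alpha> - 1) * ennreal (\<phi> x) \<partial>lebesgue) = gradient_int l \<alpha> \<phi>"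
    unfolding nn_integral_completion gradient_int_def by (rule c) (auto simp: indicator_def z)
  show "(\<integral>\<^sup>+x\<in>\<Omega>. ennreal (u x + l) epowr s * ennreal (norm (hgrad X \<phi> x) powr p / \<phi> x powr (p - 1)) \<partial>lebesgue) = weighted_int l s \<phi>"
    unfolding nn_integral_completion weighted_int_def cutoff_quotient_def by (rule c) (use p in \<open>auto simp: indicator_def zg\<close>)
  show "(\<integral>\<^sup>+x\<in>\<Omega>. ennreal (h x) * ennreal (\<phi> x) \<partial>lebesgue) = (\<integral>\<^sup>+x. ennreal (h' x) * ennreal (\<phi> x) \<partial>lborel)"
    unfolding nn_integral_completion by (rule c) (auto simp: indicator_def z)
qed

lemma energy_inequality:
  assumes q: "q = p / (p - 1)" and \<phi>: "\<phi> \<in> nonneg_tests \<Omega>" and l: "0 \<le> l" and \<alpha>: "\<alpha> < 0" and \<eta>: "0 < \<eta>"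
  shows "enn2ereal (\<integral>\<^sup>+x\<in>\<Omega>. ennreal (h x) * ennreal (u x + l) epowr \<alpha> * ennreal (\<phi> x) \<partial>lebesgue)
      + ereal (\<bar>\<alpha>\<bar> - \<eta> powr q / q) * enn2ereal (\<integral>\<^sup>+x\<in>\<Omega>. ennreal (norm (weak_hgrad X \<Omega> u x) powr p) * ennreal (u x + l) epowr (\<alpha> - 1) * ennreal (\<phi> x) \<partial>lebesgue)
      \<le> ereal (\<eta> powr (- p) / p) * enn2ereal (\<integral>\<^sup>+x\<in>\<Omega>. ennreal (u x + l) epowr (\<alpha> - 1 + p) * ennreal (norm (hgrad X \<phi> x) powr p / \<phi> x powr (p - 1)) \<partial>lebesgue)"
proof -
  obtain u' h' w' where ss: "supersolution X \<Omega> p u' h' w'"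
    and eq: "AE x in lborel. x \<in> \<Omega> \<longrightarrow> u x = u' x \<and> h x = h' x \<and> weak_hgrad X \<Omega> u x = w' x"
    by (rule versions)
  interpret ss: supersolution X \<Omega> p u' h' w' by (rule ss)
  have q0: "q > 0" using p by (simp add: q)
  have a: "\<bar>\<alpha>\<bar> = - \<alpha>" using \<alpha> by simp
  show ?thesis
    unfolding energy_functionals[OF ss eq \<phi>] a
  proof (rule ereal_energy[OF ss.energy(1)[OF \<phi> l \<alpha> \<eta> q]])
    show "0 < \<eta> powr (- p) / p" "0 \<le> - \<alpha>" "0 \<le> \<eta> powr q / q" using \<eta> p \<alpha> q0 by auto
    assume G: "ss.weighted_int l (\<alpha> - 1 + p) \<phi> < \<infinity>"
    \<comment> \<open>The given \<eta> may make |\<alpha>| - \<eta>^q / q nonpositive and then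
      permits no absorption. A separate small parameter shows that a finite weighted integral forces
      a finite gradient integral.\<close>
    obtain \<theta> where \<theta>: "\<theta> > 0" "\<theta> powr q / q < - \<alpha>" by (rule small_parameter[OF q0 \<alpha>])
    have "ennreal (- \<alpha> - \<theta> powr q / q) * ss.gradient_int l \<alpha> \<phi> \<le> ennreal (\<theta> powr (- p) / p) * ss.weighted_int l (\<alpha> - 1 + p) \<phi>"
      by (rule ss.energy(2)[OF \<phi> l \<alpha> \<theta>(1) q \<theta>(2)])
    also have "\<dots> < \<infinity>" using G by (simp add: ennreal_mult_less_top)
    finally show "ss.gradient_int l \<alpha> \<phi> < \<infinity>" using \<theta>(2) by (auto simp: ennreal_mult_less_top ennreal_eq_0_iff)
  qed
qed

lemma source_estimate:
  assumes q: "q = p / (p - 1)" and \<phi>: "\<phi> \<in> nonneg_tests \<Omega>" and l: "0 \<le> l" and \<alpha>: "\<alpha> < 0" and \<eta>: "0 < \<eta>"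
    and small: "\<bar>\<alpha>\<bar> - \<eta> powr q / q > 0"
  shows "(\<integral>\<^sup>+x\<in>\<Omega>. ennreal (h x) * ennreal (\<phi> x) \<partial>lebesgue)
    \<le> ennreal ((\<eta> powr (- p) / p / (\<bar>\<alpha>\<bar> - \<eta> powr q / q)) powr (1 / q))
      * (\<integral>\<^sup>+x\<in>\<Omega>. ennreal (u x + l) epowr (\<alpha> - 1 + p) * ennreal (norm (hgrad X \<phi> x) powr p / \<phi> x powr (p - 1)) \<partial>lebesgue) epowr (1 / q)
      * (\<integral>\<^sup>+x\<in>\<Omega>. ennreal (u x + l) epowr ((1 - \<alpha>) * (p - 1)) * ennreal (norm (hgrad X \<phi> x) powr p / \<phi> x powr (p - 1)) \<partial>lebesgue) epowr (1 / p)"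
proof -
  obtain u' h' w' where ss: "supersolution X \<Omega> p u' h' w'"
    and eq: "AE x in lborel. x \<in> \<Omega> \<longrightarrow> u x = u' x \<and> h x = h' x \<and> weak_hgrad X \<Omega> u x = w' x"
    by (rule versions)
  interpret ss: supersolution X \<Omega> p u' h' w' by (rule ss)
  have a: "\<bar>\<alpha>\<bar> = - \<alpha>" using \<alpha> by simp
  show ?thesis
    unfolding energy_functionals(3,4)[OF ss eq \<phi>] a
    by (rule ss.holder_estimate[OF \<phi> l \<alpha> \<eta> q]) (use small a in simp)
qed

text \<open>A dilation scales the three measures by one common factor c, so their ratios do not
  depend on R. At unit scale the sets are open and nonempty, hence of positive measure, and bounded,
  hence of finite measure.\<close>

lemma ball_measures:
  assumes b: "bounded (hball S 2)"
  obtains b1 a1 m1 where "0 < b1" "0 < a1" "0 < m1"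
    "\<forall>R>0. \<exists>c>0. emeasure lborel (hball S R) = ennreal (c * b1) \<and> emeasure lborel (annulus S R) = ennreal (c * a1) \<and>
      emeasure lborel (hball S (2 * R)) = ennreal (c * m1)"
proof -
  have pos: "0 < emeasure lborel E" if "open E" "x \<in> E" for E :: "(real^'n) set" and x
  proof (rule ccontr)
    assume "\<not> 0 < emeasure lborel E"
    then have "E \<in> null_sets lborel" using that(1) by (simp add: null_sets_def)
    then have "negligible E" unfolding negligible_iff_null_sets by (rule null_sets_completionI)
    then show False using open_not_negligible[OF that(1)] that(2) by blast
  qed
  have fin: "emeasure lborel E < \<infinity>" if "E \<subseteq> hball S 2" for E
    by (rule emeasure_bounded_finite) (rule bounded_subset[OF b that])
  have S0: "S 0 = 0" by (simp add: S_zero)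
  have "(axis undefined 1 :: real^'n) \<noteq> 0" by (simp add: axis_eq_0_iff)
  then have sp: "0 < S (axis undefined 1)" using S_nonneg S_zero by (metis less_eq_real_def)
  \<comment> \<open>A point with S y = 3/2, obtained by dilating an axis vector; it shows that the
    unit annulus is not empty.\<close>
  define y where "y = dilation layer (3 / 2 / S (axis undefined 1)) (axis undefined 1 :: real^'n)"
  have "S y = 3 / 2" unfolding y_def using sp by (subst S_dilation) auto
  moreover have cl: "closure (hball S 1) \<subseteq> {x. S x \<le> 1}"
    by (rule closure_minimal) (use S_cont in \<open>auto simp: hball_def intro!: closed_Collect_le continuous_intros\<close>)
  ultimately have ya: "y \<in> annulus S 1" by (auto simp: annulus_def hball_def)
  have "open (annulus S 1)" unfolding annulus_def using hball_open by (intro open_Diff) auto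
  from pos[OF this ya] fin[of "annulus S 1"] obtain a1 where a1: "0 < a1" "emeasure lborel (annulus S 1) = ennreal a1"
    by (cases "emeasure lborel (annulus S 1)" rule: ennreal_cases) (auto simp: annulus_def)
  have "hball S 1 \<subseteq> hball S 2" by (auto simp: hball_def)
  with pos[OF hball_open, of 0 1] fin[of "hball S 1"] obtain b1 where b1: "0 < b1" "emeasure lborel (hball S 1) = ennreal b1"
    by (cases "emeasure lborel (hball S 1)" rule: ennreal_cases) (auto simp: hball_def S0)
  from pos[OF hball_open, of 0 2] fin[of "hball S 2"] obtain m1 where m1: "0 < m1" "emeasure lborel (hball S 2) = ennreal m1"
    by (cases "emeasure lborel (hball S 2)" rule: ennreal_cases) (auto simp: hball_def S0)
  show ?thesis
  proof (rule that[OF b1(1) a1(1) m1(1)], intro allI impI)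
    fix R :: real assume R: "R > 0"
    obtain c where c: "c > 0" "\<And>A. A \<in> sets borel \<Longrightarrow> emeasure lborel A = ennreal c * emeasure lborel (dilation layer R -` A)"
      using emeasure_lborel_dilation[OF R, of layer] by blast
    have "emeasure lborel (hball S R) = ennreal (c * b1)"
      using c(2)[of "hball S R"] hball_dilation(1)[of S layer, OF S_dilation R, of 1] c(1) b1 by (simp add: ennreal_mult)
    moreover have "emeasure lborel (annulus S R) = ennreal (c * a1)"
      using c(2)[of "annulus S R"] annulus_dilation[of S layer, OF S_dilation R, of 1] c(1) a1 by (simp add: ennreal_mult)
    moreover have "emeasure lborel (hball S (2 * R)) = ennreal (c * m1)"
      using c(2)[of "hball S (2 * R)"] hball_dilation(1)[of S layer, OF S_dilation R, of 2] c(1) m1 by (simp add: ennreal_mult mult.commute)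
    ultimately show "\<exists>c>0. emeasure lborel (hball S R) = ennreal (c * b1) \<and> emeasure lborel (annulus S R) = ennreal (c * a1) \<and>
      emeasure lborel (hball S (2 * R)) = ennreal (c * m1)" using c(1) by blast
  qed
qed

lemma inside_bounded:
  assumes "R > 0" "compactly_inside (hball S (2 * R)) \<Omega>"
  shows "bounded (hball S 2)"
proof -
  have "bounded (hball S (2 * R))"
    using assms(2) closure_subset unfolding compactly_inside_def by (meson bounded_subset compact_imp_bounded)
  then have "bounded (hball S ((1 / R) * (2 * R)))"
    using assms(1) by (intro bounded_hball_scale[where layer=layer and S=S and r="2 * R" and t="1 / R"]) (auto simp: S_dilation)
  then show ?thesis using assms(1) by simp
qed

text \<open>The dilated cutoff bounds the quotient by k R^(-p) times the indicator of the annulus.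
  Dividing by the measures leaves their ratio a1 / b1, which does not depend on R.\<close>

lemma ball_average_estimate:
  assumes q: "q = p / (p - 1)" and \<alpha>: "\<alpha> < 0"
  shows "\<exists>c>0. \<forall>R>0. compactly_inside (hball S (2 * R)) \<Omega> \<longrightarrow>
    avg (hball S R) (\<lambda>x. ennreal (h x)) \<le> ennreal (c * R powr (- p))
      * avg (annulus S R) (\<lambda>x. ennreal (u x) epowr (\<alpha> - 1 + p)) epowr (1 / q)
      * avg (annulus S R) (\<lambda>x. ennreal (u x) epowr ((1 - \<alpha>) * (p - 1))) epowr (1 / p)"
proof (cases "bounded (hball S 2)")
  \<comment> \<open>If B_2 is unbounded, no B_2R is compactly inside \<open>\<Omega>\<close> and the
    claim is vacuous.\<close>
  case False
  then show ?thesis using inside_bounded by (intro exI[of _ 1]) auto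
next
  case b: True
  obtain u' h' w' where ss: "supersolution X \<Omega> p u' h' w'"
    and eq: "AE x in lborel. x \<in> \<Omega> \<longrightarrow> u x = u' x \<and> h x = h' x \<and> weak_hgrad X \<Omega> u x = w' x"
    by (rule versions)
  interpret ss: supersolution X \<Omega> p u' h' w' by (rule ss)
  obtain C where C: "C > 0" and est: "\<forall>\<psi>\<in>nonneg_tests \<Omega>. \<forall>k\<ge>0. \<forall>A\<in>sets borel. \<forall>B. (\<forall>x\<in>B. \<psi> x = 1) \<longrightarrow> (\<forall>x. ss.cutoff_quotient \<psi> x \<le> k * indicator A x) \<longrightarrow>
    (\<integral>\<^sup>+x. ennreal (h' x) * indicator B x \<partial>lborel) \<le> ennreal (C * k) *
      (\<integral>\<^sup>+x. ennreal (u' x) epowr (\<alpha> - 1 + p) * indicator A x \<partial>lborel) epowr (1 / q) *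
      (\<integral>\<^sup>+x. ennreal (u' x) epowr ((1 - \<alpha>) * (p - 1)) * indicator A x \<partial>lborel) epowr (1 / p)"
    by (rule ss.ball_estimate[OF \<alpha> q])
  obtain mul' iv' where loc: "homogeneous_lie_group mul (m_inv (group_of mul)) layer mul' iv'"
    and Xd: "\<And>i x R. R > 0 \<Longrightarrow> dilation layer R (X i x) = R *\<^sub>R X i (dilation layer R x)"
    by (rule carnot_group_locale[OF carnot]) blast
  interpret G: homogeneous_lie_group mul "m_inv (group_of mul)" layer mul' iv' by (rule loc)
  obtain k where k: "0 \<le> k" and cut: "\<And>R \<Omega>. R > 0 \<Longrightarrow> compactly_inside (hball S (2 * R)) \<Omega> \<Longrightarrow>
    \<exists>\<psi>\<in>nonneg_tests \<Omega>. (\<forall>x\<in>hball S R. \<psi> x = 1) \<and>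
      (\<forall>x. norm (hgrad X \<psi> x) powr p / \<psi> x powr (p - 1) \<le> k * R powr (- p) * indicator (annulus S R) x)"
    using G.scaled_cutoff[of S p X, OF S_cont S_dilation b p Xd ss.X_cont] by blast
  obtain b1 a1 m1 where m: "0 < b1" "0 < a1" "0 < m1" and meas: "\<forall>R>0. \<exists>c>0. emeasure lborel (hball S R) = ennreal (c * b1) \<and>
      emeasure lborel (annulus S R) = ennreal (c * a1) \<and> emeasure lborel (hball S (2 * R)) = ennreal (c * m1)"
    by (rule ball_measures[OF b])
  \<comment> \<open>\<open>k + 1\<close> keeps the constant positive when k = 0.\<close>
  define c where "c = C * (k + 1) * a1 / b1"
  have c: "c > 0" using C k m by (simp add: c_def)
  show ?thesis
  proof (rule exI[of _ c], intro conjI c allI impI)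
    fix R :: real assume R: "R > 0" and ci: "compactly_inside (hball S (2 * R)) \<Omega>"
    obtain t where t: "t > 0" "emeasure lborel (hball S R) = ennreal (t * b1)" "emeasure lborel (annulus S R) = ennreal (t * a1)"
      using meas R by blast
    obtain \<psi> where \<psi>: "\<psi> \<in> nonneg_tests \<Omega>" "\<forall>x\<in>hball S R. \<psi> x = 1"
      "\<forall>x. norm (hgrad X \<psi> x) powr p / \<psi> x powr (p - 1) \<le> k * R powr (- p) * indicator (annulus S R) x"
      using cut[OF R ci] by blast
    let ?D = "C * (k * R powr (- p))"
    let ?I = "\<lambda>s. \<integral>\<^sup>+x. ennreal (u' x) epowr s * indicator (annulus S R) x \<partial>lborel"
    have "(\<integral>\<^sup>+x. ennreal (h' x) * indicator (hball S R) x \<partial>lborel) \<le> ennreal ?D * ?I (\<alpha> - 1 + p) epowr (1 / q) * ?I ((1 - \<alpha>) * (p - 1)) epowr (1 / p)"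
      using est[rule_format, OF \<psi>(1), of "k * R powr (- p)" "annulus S R" "hball S R"] \<psi>(2,3) k by (simp add: ss.cutoff_quotient_def)
    then have "(\<integral>\<^sup>+x. ennreal (h' x) * indicator (hball S R) x \<partial>lborel) / ennreal (t * b1) \<le> ennreal (?D * (t * a1) / (t * b1))
        * (?I (\<alpha> - 1 + p) / ennreal (t * a1)) epowr (1 / q) * (?I ((1 - \<alpha>) * (p - 1)) / ennreal (t * a1)) epowr (1 / p)"
      using t m C k by (intro avg_rescale[OF p q]) auto
    moreover have "avg (hball S R) (\<lambda>x. ennreal (h x)) = (\<integral>\<^sup>+x. ennreal (h' x) * indicator (hball S R) x \<partial>lborel) / ennreal (t * b1)"
    proof -
      have "avg (hball S R) (\<lambda>x. ennreal (h x)) = avg (hball S R) (\<lambda>x. ennreal (h' x))"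
        by (rule avg_cong_AE[OF hball_borel AE_mp[OF eq AE_I2]]) (use inside_subset(1)[OF R ci] in auto)
      then show ?thesis by (simp only: avg_lborel[OF hball_borel] t)
    qed
    moreover have "avg (annulus S R) (\<lambda>x. ennreal (u x) epowr s) = ?I s / ennreal (t * a1)" for s
    proof -
      have "avg (annulus S R) (\<lambda>x. ennreal (u x) epowr s) = avg (annulus S R) (\<lambda>x. ennreal (u' x) epowr s)"
        by (rule avg_cong_AE[OF annulus_borel AE_mp[OF eq AE_I2]]) (use inside_subset(2)[OF R ci] in auto)
      then show ?thesis by (simp only: avg_lborel[OF annulus_borel] t)
    qed
    ultimately have "avg (hball S R) (\<lambda>x. ennreal (h x)) \<le> ennreal (?D * (t * a1) / (t * b1))
      * avg (annulus S R) (\<lambda>x. ennreal (u x) epowr (\<alpha> - 1 + p)) epowr (1 / q)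
      * avg (annulus S R) (\<lambda>x. ennreal (u x) epowr ((1 - \<alpha>) * (p - 1))) epowr (1 / p)"
      by (simp only:)
    also have "\<dots> \<le> ennreal (c * R powr (- p))
      * avg (annulus S R) (\<lambda>x. ennreal (u x) epowr (\<alpha> - 1 + p)) epowr (1 / q)
      * avg (annulus S R) (\<lambda>x. ennreal (u x) epowr ((1 - \<alpha>) * (p - 1))) epowr (1 / p)"
    proof (intro mult_right_mono ennreal_leI)
      have "?D * (t * a1) / (t * b1) = (C * a1 / b1 * R powr (- p)) * k" using t m by (simp add: field_simps)
      also have "\<dots> \<le> (C * a1 / b1 * R powr (- p)) * (k + 1)" using C m by (intro mult_left_mono) auto
      also have "\<dots> = c * R powr (- p)" by (simp add: c_def mult_ac)
      finally show "?D * (t * a1) / (t * b1) \<le> c * R powr (- p)" .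
    qed auto
    finally show "avg (hball S R) (\<lambda>x. ennreal (h x)) \<le> ennreal (c * R powr (- p))
      * avg (annulus S R) (\<lambda>x. ennreal (u x) epowr (\<alpha> - 1 + p)) epowr (1 / q)
      * avg (annulus S R) (\<lambda>x. ennreal (u x) epowr ((1 - \<alpha>) * (p - 1))) epowr (1 / p)" .
  qed
qed

lemma annulus_power_mean:
  assumes R: "R > 0" and ci: "compactly_inside (hball S (2 * R)) \<Omega>" and s: "0 < s" "s \<le> \<sigma>"
  shows "avg (annulus S R) (\<lambda>x. ennreal (u x) epowr s) \<le> avg (annulus S R) (\<lambda>x. ennreal (u x) epowr \<sigma>) epowr (s / \<sigma>)"
proof -
  obtain u' h' w' where ss: "supersolution X \<Omega> p u' h' w'"
    and eq: "AE x in lborel. x \<in> \<Omega> \<longrightarrow> u x = u' x \<and> h x = h' x \<and> weak_hgrad X \<Omega> u x = w' x"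
    by (rule versions)
  interpret ss: supersolution X \<Omega> p u' h' w' by (rule ss)
  obtain b1 a1 m1 where m: "0 < b1" "0 < a1" "0 < m1" and meas: "\<forall>R>0. \<exists>c>0. emeasure lborel (hball S R) = ennreal (c * b1) \<and>
      emeasure lborel (annulus S R) = ennreal (c * a1) \<and> emeasure lborel (hball S (2 * R)) = ennreal (c * m1)"
    by (rule ball_measures[OF inside_bounded[OF R ci]])
  obtain t where t: "t > 0" "emeasure lborel (annulus S R) = ennreal (t * a1)" using meas R by blast
  have av: "avg (annulus S R) (\<lambda>x. ennreal (u x) epowr s) = (\<integral>\<^sup>+x. ennreal (u' x) epowr s * indicator (annulus S R) x \<partial>lborel) / ennreal (t * a1)" for s
  proof -
    have "avg (annulus S R) (\<lambda>x. ennreal (u x) epowr s) = avg (annulus S R) (\<lambda>x. ennreal (u' x) epowr s)"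
      by (rule avg_cong_AE[OF annulus_borel AE_mp[OF eq AE_I2]]) (use inside_subset(2)[OF R ci] in auto)
    then show ?thesis by (simp only: avg_lborel[OF annulus_borel] t)
  qed
  show ?thesis unfolding av
    by (rule power_mean[OF s]) (use t m in auto)
qed

text \<open>For a suitable \<alpha> both exponents of the two-factor estimate lie in (0, \<sigma>],
  so power means bound both averages by that of u^\<sigma>. The resulting exponents add up to
  ((\<alpha> - 1 + p) + (1 - \<alpha>)) (p - 1) / (\<sigma> p) = (p - 1) / \<sigma>.\<close>

lemma ball_average_power:
  assumes \<sigma>: "p - 1 < \<sigma>"
  shows "\<exists>c>0. \<forall>R>0. compactly_inside (hball S (2 * R)) \<Omega> \<longrightarrow>
    avg (hball S R) (\<lambda>x. ennreal (h x)) \<le> ennreal (c * R powr (- p)) * avg (annulus S R) (\<lambda>x. ennreal (u x) epowr \<sigma>) epowr ((p - 1) / \<sigma>)"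
proof -
  define q where "q = p / (p - 1)"
  \<comment> \<open>The first bound makes \<alpha> - 1 + p positive, the second makes (1 - \<alpha>)
    (p - 1) at most \<sigma>; \<sigma> > p - 1 keeps the maximum negative.\<close>
  define \<alpha> where "\<alpha> = max ((1 - p) / 2) (1 - \<sigma> / (p - 1))"
  have \<sigma>1: "\<sigma> / (p - 1) > 1" using \<sigma> p by simp
  have \<alpha>: "\<alpha> < 0" "(1 - p) / 2 \<le> \<alpha>" "1 - \<sigma> / (p - 1) \<le> \<alpha>" using p \<sigma>1 by (auto simp: \<alpha>_def)
  define s1 where "s1 = \<alpha> - 1 + p"
  define s2 where "s2 = (1 - \<alpha>) * (p - 1)"
  have s1: "0 < s1" "s1 \<le> \<sigma>" using \<alpha> p \<sigma> by (auto simp: s1_def field_simps)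
  have "(1 - \<alpha>) * (p - 1) \<le> (\<sigma> / (p - 1)) * (p - 1)" using \<alpha>(3) p by (intro mult_right_mono) auto
  then have s2: "0 < s2" "s2 \<le> \<sigma>" using \<alpha>(1) p by (auto simp: s2_def)
  have q1: "q > 0" "1 / q = (p - 1) / p" using p by (auto simp: q_def)
  have sum: "s1 / \<sigma> * (1 / q) + s2 / \<sigma> * (1 / p) = (p - 1) / \<sigma>"
  proof -
    have "s1 / \<sigma> * (1 / q) + s2 / \<sigma> * (1 / p) = (s1 + (1 - \<alpha>)) * (p - 1) / (\<sigma> * p)"
      unfolding q1(2) s2_def using p \<sigma> by (simp add: field_simps)
    also have "s1 + (1 - \<alpha>) = p" by (simp add: s1_def)
    finally show ?thesis using p by simp
  qed
  obtain c where c: "c > 0" and est: "\<forall>R>0. compactly_inside (hball S (2 * R)) \<Omega> \<longrightarrow>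
    avg (hball S R) (\<lambda>x. ennreal (h x)) \<le> ennreal (c * R powr (- p))
      * avg (annulus S R) (\<lambda>x. ennreal (u x) epowr s1) epowr (1 / q)
      * avg (annulus S R) (\<lambda>x. ennreal (u x) epowr s2) epowr (1 / p)"
    using ball_average_estimate[OF q_def \<alpha>(1)] unfolding s1_def s2_def by blast
  show ?thesis
  proof (rule exI[of _ c], intro conjI c allI impI)
    fix R :: real assume R: "R > 0" and ci: "compactly_inside (hball S (2 * R)) \<Omega>"
    let ?A = "avg (annulus S R) (\<lambda>x. ennreal (u x) epowr \<sigma>)"
    have \<sigma>0: "\<sigma> > 0" using \<sigma> p by simp
    have "avg (hball S R) (\<lambda>x. ennreal (h x)) \<le> ennreal (c * R powr (- p))
      * avg (annulus S R) (\<lambda>x. ennreal (u x) epowr s1) epowr (1 / q)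
      * avg (annulus S R) (\<lambda>x. ennreal (u x) epowr s2) epowr (1 / p)" using est R ci by blast
    also have "\<dots> \<le> ennreal (c * R powr (- p)) * (?A epowr (s1 / \<sigma>)) epowr (1 / q) * (?A epowr (s2 / \<sigma>)) epowr (1 / p)"
      using q1(1) p by (intro mult_mono order_refl epowr_mono annulus_power_mean[OF R ci] s1 s2) auto
    also have "\<dots> = ennreal (c * R powr (- p)) * (?A epowr (s1 / \<sigma> * (1 / q)) * ?A epowr (s2 / \<sigma> * (1 / p)))"
      using s1(1) s2(1) \<sigma>0 q1(1) p by (simp add: epowr_epowr mult.assoc)
    also have "?A epowr (s1 / \<sigma> * (1 / q)) * ?A epowr (s2 / \<sigma> * (1 / p)) = ?A epowr (s1 / \<sigma> * (1 / q) + s2 / \<sigma> * (1 / p))"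
      using s1(1) s2(1) \<sigma>0 q1(1) p by (intro epowr_add[symmetric]) auto
    finally show "avg (hball S R) (\<lambda>x. ennreal (h x)) \<le> ennreal (c * R powr (- p)) * ?A epowr ((p - 1) / \<sigma>)"
      unfolding sum .
  qed
qed

lemma annulus_avg_le_ball_avg:
  assumes b: "bounded (hball S 2)"
  obtains k where "0 < k" "\<forall>R>0. avg (annulus S R) f \<le> ennreal k * avg (hball S (2 * R)) f"
proof -
  obtain b1 a1 m1 where m: "0 < b1" "0 < a1" "0 < m1" and meas: "\<forall>R>0. \<exists>c>0. emeasure lborel (hball S R) = ennreal (c * b1) \<and>
      emeasure lborel (annulus S R) = ennreal (c * a1) \<and> emeasure lborel (hball S (2 * R)) = ennreal (c * m1)"
    by (rule ball_measures[OF b])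
  show ?thesis
  proof (rule that[of "m1 / a1"], use m in simp, intro allI impI)
    fix R :: real assume R: "R > 0"
    obtain t where t: "t > 0" "emeasure lborel (annulus S R) = ennreal (t * a1)" "emeasure lborel (hball S (2 * R)) = ennreal (t * m1)"
      using meas R by blast
    have tp: "0 < t * a1" "0 < t * m1" using t m by auto
    let ?J = "\<integral>\<^sup>+x. f x * indicator (hball S (2 * R)) x \<partial>lborel"
    have "avg (annulus S R) f = (\<integral>\<^sup>+x. f x * indicator (annulus S R) x \<partial>lborel) * ennreal (1 / (t * a1))"
      by (simp only: avg_lborel[OF annulus_borel] t divide_ennreal_real[OF tp(1)])
    also have "\<dots> \<le> ?J * ennreal (1 / (t * a1))"
      by (intro mult_right_mono nn_integral_mono) (auto simp: annulus_def indicator_def)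
    also have "1 / (t * a1) = (m1 / a1) * (1 / (t * m1))" using t m by (simp add: field_simps)
    also have "ennreal \<dots> = ennreal (m1 / a1) * ennreal (1 / (t * m1))" using t m by (intro ennreal_mult) auto
    also have "?J * (ennreal (m1 / a1) * ennreal (1 / (t * m1))) = ennreal (m1 / a1) * (?J * ennreal (1 / (t * m1)))" by (simp only: mult_ac)
    also have "?J * ennreal (1 / (t * m1)) = avg (hball S (2 * R)) f"
      by (simp only: avg_lborel[OF hball_borel] t divide_ennreal_real[OF tp(2)])
    finally show "avg (annulus S R) f \<le> ennreal (m1 / a1) * avg (hball S (2 * R)) f" .
  qed
qed

text \<open>The annulus lies in B_2R, so its average is at most a constant multiple of the average
  over B_2R. The weak Harnack inequality on B_2R bounds the latter by the essential infimum over the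
  half ball, which is B_R.\<close>

lemma ball_average_harnack:
  assumes \<sigma>: "p - 1 < \<sigma>" and wh: "weak_harnack S \<Omega> \<sigma> u"
  shows "\<exists>c>0. \<forall>R>0. compactly_inside (hball S (2 * R)) \<Omega> \<longrightarrow>
    avg (hball S R) (\<lambda>x. ennreal (h x)) \<le> ennreal (c * R powr (- p)) * ess_inf (hball S R) (\<lambda>x. ennreal (u x)) epowr (p - 1)"
proof (cases "bounded (hball S 2)")
  case False
  then show ?thesis using inside_bounded by (intro exI[of _ 1]) auto
next
  case b: True
  let ?f = "\<lambda>x. ennreal (u x) epowr \<sigma>"
  have \<sigma>0: "\<sigma> > 0" using \<sigma> p by simp
  obtain c where c: "c > 0" and est: "\<forall>R>0. compactly_inside (hball S (2 * R)) \<Omega> \<longrightarrow>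
    avg (hball S R) (\<lambda>x. ennreal (h x)) \<le> ennreal (c * R powr (- p)) * avg (annulus S R) ?f epowr ((p - 1) / \<sigma>)"
    using ball_average_power[OF \<sigma>] by blast
  obtain k where k: "0 < k" and ak: "\<forall>R>0. avg (annulus S R) ?f \<le> ennreal k * avg (hball S (2 * R)) ?f"
    by (rule annulus_avg_le_ball_avg[OF b])
  obtain d where d: "d > 0" and H: "\<forall>R>0. compactly_inside (hball S R) \<Omega> \<longrightarrow>
      avg (hball S R) ?f epowr (1 / \<sigma>) \<le> ennreal d * ess_inf (hball S (R / 2)) (\<lambda>x. ennreal (u x))"
    using wh unfolding weak_harnack_def by blast
  define C where "C = c * (k powr ((p - 1) / \<sigma>) * d powr (p - 1))"
  have C: "C > 0" using c k d by (simp add: C_def)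
  show ?thesis
  proof (rule exI[of _ C], intro conjI C allI impI)
    fix R :: real assume R: "R > 0" and ci: "compactly_inside (hball S (2 * R)) \<Omega>"
    let ?e = "ess_inf (hball S R) (\<lambda>x. ennreal (u x))" and ?M = "avg (hball S (2 * R)) ?f"
    have M: "?M epowr (1 / \<sigma>) \<le> ennreal d * ?e" using H[rule_format, of "2 * R"] R ci by simp
    have "avg (annulus S R) ?f epowr ((p - 1) / \<sigma>) \<le> (ennreal k * ?M) epowr ((p - 1) / \<sigma>)"
      using ak R \<sigma>0 p by (intro epowr_mono) auto
    also have "\<dots> = ennreal k epowr ((p - 1) / \<sigma>) * ?M epowr ((p - 1) / \<sigma>)" using \<sigma>0 p by (intro epowr_mult) auto
    also have "ennreal k epowr ((p - 1) / \<sigma>) = ennreal (k powr ((p - 1) / \<sigma>))" using k by (rule epowr_ennreal)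
    also have "?M epowr ((p - 1) / \<sigma>) = (?M epowr (1 / \<sigma>)) epowr (p - 1)" using \<sigma>0 p by (subst epowr_epowr) auto
    finally have 1: "avg (annulus S R) ?f epowr ((p - 1) / \<sigma>) \<le> ennreal (k powr ((p - 1) / \<sigma>)) * (?M epowr (1 / \<sigma>)) epowr (p - 1)" .
    have "(?M epowr (1 / \<sigma>)) epowr (p - 1) \<le> (ennreal d * ?e) epowr (p - 1)" using p by (intro epowr_mono M) auto
    also have "\<dots> = ennreal (d powr (p - 1)) * ?e epowr (p - 1)" using p d by (simp add: epowr_mult epowr_ennreal)
    finally have 2: "(?M epowr (1 / \<sigma>)) epowr (p - 1) \<le> ennreal (d powr (p - 1)) * ?e epowr (p - 1)" .
    have "avg (hball S R) (\<lambda>x. ennreal (h x)) \<le> ennreal (c * R powr (- p)) * avg (annulus S R) ?f epowr ((p - 1) / \<sigma>)"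
      using est R ci by blast
    also have "\<dots> \<le> ennreal (c * R powr (- p)) * (ennreal (k powr ((p - 1) / \<sigma>)) * (ennreal (d powr (p - 1)) * ?e epowr (p - 1)))"
      by (intro mult_left_mono order_trans[OF 1] 2) auto
    also have "\<dots> = (ennreal (c * R powr (- p)) * ennreal (k powr ((p - 1) / \<sigma>)) * ennreal (d powr (p - 1))) * ?e epowr (p - 1)"
      by (simp only: mult.assoc)
    also have "ennreal (c * R powr (- p)) * ennreal (k powr ((p - 1) / \<sigma>)) * ennreal (d powr (p - 1)) = ennreal (C * R powr (- p))"
      using c by (simp add: ennreal_mult[symmetric] C_def mult_ac)
    finally show "avg (hball S R) (\<lambda>x. ennreal (h x)) \<le> ennreal (C * R powr (- p)) * ?e epowr (p - 1)" .
  qed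
qed

end

text \<open>The constants of the two components are found separately, each before R.
  \<open>K'\<close> may add further conditions on R, such as the local integrability assumed on the
  annulus.\<close>

lemma two_constants:
  fixes P Q :: "real \<Rightarrow> real \<Rightarrow> bool"
  assumes "\<exists>c>0. \<forall>R>0. K R \<longrightarrow> P c R" and "\<exists>d>0. \<forall>R>0. K R \<longrightarrow> Q d R" and "\<And>R. K' R \<Longrightarrow> K R"
  shows "\<exists>c>0. \<exists>d>0. \<forall>R>0. K' R \<longrightarrow> P c R \<and> Q d R"
  using assms by meson

theorem theorem3p1:
  fixes mul :: "real^'n \<Rightarrow> real^'n \<Rightarrow> real^'n"
    and layer :: "'n \<Rightarrow> nat"
    and r :: nat
    and X :: "'n \<Rightarrow> real^'n \<Rightarrow> real^'n"
    and S :: "real^'n \<Rightarrow> real"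
    and \<Omega> :: "(real^'n) set"
    and p q :: real
    and f g :: "real^'n \<Rightarrow> real \<Rightarrow> real \<Rightarrow> real"
    and u v :: "real^'n \<Rightarrow> real"
  assumes "homogeneous_carnot_group r layer mul X"
    and "homogeneous_norm layer mul S"
    and "p > 1" and "q > 1" and "open \<Omega>"
    and "caratheodory \<Omega> f" and "caratheodory \<Omega> g"
    and "\<And>x s t. x \<in> \<Omega> \<Longrightarrow> s \<ge> 0 \<Longrightarrow> t \<ge> 0 \<Longrightarrow> f x s t \<ge> 0"
    and "\<And>x s t. x \<in> \<Omega> \<Longrightarrow> s \<ge> 0 \<Longrightarrow> t \<ge> 0 \<Longrightarrow> g x s t \<ge> 0"
    and "weak_solution X \<Omega> p q f g u v"
  shows "let p' = p / (p - 1); q' = q / (q - 1); Du = weak_hgrad X \<Omega> u; Dv = weak_hgrad X \<Omega> v in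
    (\<forall>\<phi>1\<in>nonneg_tests \<Omega>. \<forall>\<phi>2\<in>nonneg_tests \<Omega>. \<forall>l\<ge>0. \<forall>\<alpha><0. \<forall>\<beta><0. \<forall>\<eta>>0. \<forall>\<mu>>0.
       let c1 = \<bar>\<alpha>\<bar> - \<eta> powr p' / p'; c2 = \<eta> powr (- p) / p;
           d1 = \<bar>\<beta>\<bar> - \<mu> powr q' / q'; d2 = \<mu> powr (- q) / q
       in
         enn2ereal (\<integral>\<^sup>+x\<in>\<Omega>. ennreal (f x (u x) (v x)) * ennreal (u x + l) epowr \<alpha> * ennreal (\<phi>1 x) \<partial>lebesgue)
         + ereal c1 * enn2ereal (\<integral>\<^sup>+x\<in>\<Omega>. ennreal (norm (Du x) powr p) * ennreal (u x + l) epowr (\<alpha> - 1) * ennreal (\<phi>1 x) \<partial>lebesgue)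
         \<le> ereal c2 * enn2ereal (\<integral>\<^sup>+x\<in>\<Omega>. ennreal (u x + l) epowr (\<alpha> - 1 + p) * ennreal (norm (hgrad X \<phi>1 x) powr p / \<phi>1 x powr (p - 1)) \<partial>lebesgue)
       \<and>
         enn2ereal (\<integral>\<^sup>+x\<in>\<Omega>. ennreal (g x (u x) (v x)) * ennreal (v x + l) epowr \<beta> * ennreal (\<phi>2 x) \<partial>lebesgue)
         + ereal d1 * enn2ereal (\<integral>\<^sup>+x\<in>\<Omega>. ennreal (norm (Dv x) powr q) * ennreal (v x + l) epowr (\<beta> - 1) * ennreal (\<phi>2 x) \<partial>lebesgue)
         \<le> ereal d2 * enn2ereal (\<integral>\<^sup>+x\<in>\<Omega>. ennreal (v x + l) epowr (\<beta> - 1 + q) * ennreal (norm (hgrad X \<phi>2 x) powr q / \<phi>2 x powr (q - 1)) \<partial>lebesgue)) \<and>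

    (\<forall>\<alpha><0. \<forall>\<beta><0. \<forall>\<eta>>0. \<forall>\<mu>>0.
       let c1 = \<bar>\<alpha>\<bar> - \<eta> powr p' / p'; c2 = \<eta> powr (- p) / p;
           d1 = \<bar>\<beta>\<bar> - \<mu> powr q' / q'; d2 = \<mu> powr (- q) / q;
           c3 = (c2 / c1) powr (1 / p'); d3 = (d2 / d1) powr (1 / q')
       in c1 > 0 \<and> d1 > 0 \<longrightarrow>
         (\<forall>l\<ge>0. \<forall>\<phi>1\<in>nonneg_tests \<Omega>. \<forall>\<phi>2\<in>nonneg_tests \<Omega>.
           (\<integral>\<^sup>+x\<in>\<Omega>. ennreal (f x (u x) (v x)) * ennreal (\<phi>1 x) \<partial>lebesgue)
           \<le> ennreal c3
             * (\<integral>\<^sup>+x\<in>\<Omega>. ennreal (u x + l) epowr (\<alpha> - 1 + p) * ennreal (norm (hgrad X \<phi>1 x) powr p / \<phi>1 x powr (p - 1)) \<partial>lebesgue) epowr (1 / p')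
             * (\<integral>\<^sup>+x\<in>\<Omega>. ennreal (u x + l) epowr ((1 - \<alpha>) * (p - 1)) * ennreal (norm (hgrad X \<phi>1 x) powr p / \<phi>1 x powr (p - 1)) \<partial>lebesgue) epowr (1 / p)
         \<and>
           (\<integral>\<^sup>+x\<in>\<Omega>. ennreal (g x (u x) (v x)) * ennreal (\<phi>2 x) \<partial>lebesgue)
           \<le> ennreal d3
             * (\<integral>\<^sup>+x\<in>\<Omega>. ennreal (v x + l) epowr (\<beta> - 1 + q) * ennreal (norm (hgrad X \<phi>2 x) powr q / \<phi>2 x powr (q - 1)) \<partial>lebesgue) epowr (1 / q')
             * (\<integral>\<^sup>+x\<in>\<Omega>. ennreal (v x + l) epowr ((1 - \<beta>) * (q - 1)) * ennreal (norm (hgrad X \<phi>2 x) powr q / \<phi>2 x powr (q - 1)) \<partial>lebesgue) epowr (1 / q))) \<and>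

    (\<forall>\<alpha><0. \<forall>\<beta><0. \<exists>c4>0. \<exists>d4>0. \<forall>R>0.
       compactly_inside (hball S (2 * R)) \<Omega> \<and>
       nn_L1_loc (annulus S R) (\<lambda>x. ennreal (u x) epowr (\<alpha> - 1 + p)) \<and>
       nn_L1_loc (annulus S R) (\<lambda>x. ennreal (u x) epowr ((1 - \<alpha>) * (p - 1))) \<and>
       nn_L1_loc (annulus S R) (\<lambda>x. ennreal (v x) epowr (\<beta> - 1 + q)) \<and>
       nn_L1_loc (annulus S R) (\<lambda>x. ennreal (v x) epowr ((1 - \<beta>) * (q - 1))) \<longrightarrow>
         avg (hball S R) (\<lambda>x. ennreal (f x (u x) (v x)))
         \<le> ennreal (c4 * R powr (- p))
           * avg (annulus S R) (\<lambda>x. ennreal (u x) epowr (\<alpha> - 1 + p)) epowr (1 / p')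
           * avg (annulus S R) (\<lambda>x. ennreal (u x) epowr ((1 - \<alpha>) * (p - 1))) epowr (1 / p)
       \<and>
         avg (hball S R) (\<lambda>x. ennreal (g x (u x) (v x)))
         \<le> ennreal (d4 * R powr (- q))
           * avg (annulus S R) (\<lambda>x. ennreal (v x) epowr (\<beta> - 1 + q)) epowr (1 / q')
           * avg (annulus S R) (\<lambda>x. ennreal (v x) epowr ((1 - \<beta>) * (q - 1))) epowr (1 / q)) \<and>

    (\<forall>\<sigma>>p - 1. \<forall>\<delta>>q - 1.
       nn_L1_loc \<Omega> (\<lambda>x. ennreal (u x) epowr \<sigma>) \<and>
       nn_L1_loc \<Omega> (\<lambda>x. ennreal (v x) epowr \<delta>) \<longrightarrow>
         (\<exists>c4>0. \<exists>d4>0. \<forall>R>0. compactly_inside (hball S (2 * R)) \<Omega> \<longrightarrow>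
           avg (hball S R) (\<lambda>x. ennreal (f x (u x) (v x)))
           \<le> ennreal (c4 * R powr (- p))
             * avg (annulus S R) (\<lambda>x. ennreal (u x) epowr \<sigma>) epowr ((p - 1) / \<sigma>)
         \<and>
           avg (hball S R) (\<lambda>x. ennreal (g x (u x) (v x)))
           \<le> ennreal (d4 * R powr (- q))
             * avg (annulus S R) (\<lambda>x. ennreal (v x) epowr \<delta>) epowr ((q - 1) / \<delta>))) \<and>

    (\<forall>\<sigma>>p - 1. \<forall>\<delta>>q - 1.
       nn_L1_loc \<Omega> (\<lambda>x. ennreal (u x) epowr \<sigma>) \<and>
       nn_L1_loc \<Omega> (\<lambda>x. ennreal (v x) epowr \<delta>) \<and>
       weak_harnack S \<Omega> \<sigma> u \<and> weak_harnack S \<Omega> \<delta> v \<longrightarrow>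
         (\<exists>c5>0. \<exists>d5>0. \<forall>R>0. compactly_inside (hball S (2 * R)) \<Omega> \<longrightarrow>
           avg (hball S R) (\<lambda>x. ennreal (f x (u x) (v x)))
           \<le> ennreal (c5 * R powr (- p)) * ess_inf (hball S R) (\<lambda>x. ennreal (u x)) epowr (p - 1)
         \<and>
           avg (hball S R) (\<lambda>x. ennreal (g x (u x) (v x)))
           \<le> ennreal (d5 * R powr (- q)) * ess_inf (hball S R) (\<lambda>x. ennreal (v x)) epowr (q - 1)))"
proof -
  have sol: "u \<in> W1p_loc X p \<Omega>" "v \<in> W1p_loc X q \<Omega>" "AE x in lebesgue. x \<in> \<Omega> \<longrightarrow> 0 \<le> u x \<and> 0 \<le> v x"
    "Lp_loc 1 \<Omega> (\<lambda>x. f x (u x) (v x))" "Lp_loc 1 \<Omega> (\<lambda>x. g x (u x) (v x))"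
    "weak_supersolution X \<Omega> p (\<lambda>x. f x (u x) (v x)) u" "weak_supersolution X \<Omega> q (\<lambda>x. g x (u x) (v x)) v"
    using assms(10) unfolding weak_solution_def by blast+
  \<comment> \<open>f and g are nonnegative at nonnegative arguments, and u, v \<ge> 0 holds almost
    everywhere, so the source terms are nonnegative almost everywhere.\<close>
  have nonneg: "AE x in lebesgue. x \<in> \<Omega> \<longrightarrow> 0 \<le> u x" "AE x in lebesgue. x \<in> \<Omega> \<longrightarrow> 0 \<le> v x"
    "AE x in lebesgue. x \<in> \<Omega> \<longrightarrow> 0 \<le> f x (u x) (v x)" "AE x in lebesgue. x \<in> \<Omega> \<longrightarrow> 0 \<le> g x (u x) (v x)"
    by (rule AE_mp[OF sol(3) AE_I2]; use assms(8,9) in blast)+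
  interpret U: supersolution_on_carnot r layer mul X S \<Omega> p u "\<lambda>x. f x (u x) (v x)"
    by (rule supersolution_on_carnot.intro[OF assms(1,2,5,3) sol(1) nonneg(1,3) sol(4,6)])
  interpret V: supersolution_on_carnot r layer mul X S \<Omega> q v "\<lambda>x. g x (u x) (v x)"
    by (rule supersolution_on_carnot.intro[OF assms(1,2,5,4) sol(2) nonneg(2,4) sol(5,7)])
  show ?thesis
    unfolding Let_def
    apply (rule conjI)
    subgoal
      by (intro ballI allI impI conjI; (rule U.energy_inequality[OF refl] V.energy_inequality[OF refl]; assumption))
    apply (rule conjI)
    subgoal
      by (intro ballI allI impI conjI; (elim conjE)?; (rule U.source_estimate[OF refl] V.source_estimate[OF refl]; assumption))
    apply (rule conjI)
    subgoal
      by (intro allI impI) (rule two_constants[OF U.ball_average_estimate[OF refl] V.ball_average_estimate[OF refl]]; (assumption | elim conjE))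
    apply (rule conjI)
    subgoal
      by (intro allI impI) (rule two_constants[OF U.ball_average_power V.ball_average_power]; (assumption | elim conjE))
    by (intro allI impI) (elim conjE, rule two_constants[OF U.ball_average_harnack V.ball_average_harnack]; (assumption | elim conjE))
qed

end
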